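(* For $k>4$, every simple topological graph on $n\ge 2$ vertices with no $(k,1)$-crossing family has $O(n\log^{2k+2}n)$ edges. For $k\in\{2,3,4\}$, every simple topological graph on $n\ge 2$ vertices with no $(k,1)$-crossing family has $O(n\log^{6}n)$ edges.
   Context: A topological graph is a graph drawn in the plane with vertices as points and edges as non-self-intersecting arcs joining their endpoints, not passing through other vertices, with no tangencies; no parallel edges or loops. It is simple if every pair of edges has at most one point in common. Two edges cross if their interiors share a point; they are disjoint if they share no point (including endpoints). A $(k,1)$-crossing family consists of $k$ pairwise crossing edges together with one further edge disjoint from each of these $k$ edges. The implicit constants may depend on $k$. *)

theory Defs
  imports "HOL-Analysis.Analysis"
begin

text \<open>A topological graph: vertices are points of the plane (complex numbers), edges are
  2-element sets of vertices (so no loops, no parallel edges), and each edge e is drawn as an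
  arc (injective continuous path on [0,1]) curve e joining its two endpoints.\<close>

definition edge_interior :: "(complex set \<Rightarrow> real \<Rightarrow> complex) \<Rightarrow> complex set \<Rightarrow> complex set" where
  "edge_interior curve e = path_image (curve e) - e"

definition proper_crossing_at :: "complex set \<Rightarrow> complex set \<Rightarrow> complex \<Rightarrow> bool" where
  "proper_crossing_at A B p \<longleftrightarrow>
     (\<exists>U h h'. open U \<and> p \<in> U \<and> homeomorphism U (ball 0 1) h h' \<and> h p = 0 \<and>
        h ` (A \<inter> U) = {z \<in> ball 0 1. Im z = 0} \<and>
        h ` (B \<inter> U) = {z \<in> ball 0 1. Re z = 0})"

definition topological_graph :: "complex set \<Rightarrow> complex set set \<Rightarrow> (complex set \<Rightarrow> real \<Rightarrow> complex) \<Rightarrow> bool" where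
  "topological_graph V E curve \<longleftrightarrow>
     finite V \<and>
     (\<forall>e\<in>E. e \<subseteq> V \<and> card e = 2 \<and> arc (curve e) \<and>
        {pathstart (curve e), pathfinish (curve e)} = e \<and>
        path_image (curve e) \<inter> V = e) \<and>
     (\<forall>e\<in>E. \<forall>f\<in>E. e \<noteq> f \<longrightarrow>
        (\<forall>p \<in> edge_interior curve e \<inter> edge_interior curve f.
           proper_crossing_at (path_image (curve e)) (path_image (curve f)) p))"

definition simple_topological_graph :: "complex set \<Rightarrow> complex set set \<Rightarrow> (complex set \<Rightarrow> real \<Rightarrow> complex) \<Rightarrow> bool" where
  "simple_topological_graph V E curve \<longleftrightarrow>
     topological_graph V E curve \<and>
     (\<forall>e\<in>E. \<forall>f\<in>E. e \<noteq> f \<longrightarrow>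
        (\<forall>x y. x \<in> path_image (curve e) \<inter> path_image (curve f) \<longrightarrow>
               y \<in> path_image (curve e) \<inter> path_image (curve f) \<longrightarrow> x = y))"

definition edges_cross :: "(complex set \<Rightarrow> real \<Rightarrow> complex) \<Rightarrow> complex set \<Rightarrow> complex set \<Rightarrow> bool" where
  "edges_cross curve e f \<longleftrightarrow> edge_interior curve e \<inter> edge_interior curve f \<noteq> {}"

definition edges_disjoint :: "(complex set \<Rightarrow> real \<Rightarrow> complex) \<Rightarrow> complex set \<Rightarrow> complex set \<Rightarrow> bool" where
  "edges_disjoint curve e f \<longleftrightarrow> path_image (curve e) \<inter> path_image (curve f) = {}"

definition has_k1_crossing_family :: "nat \<Rightarrow> complex set set \<Rightarrow> (complex set \<Rightarrow> real \<Rightarrow> complex) \<Rightarrow> bool" where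
  "has_k1_crossing_family k E curve \<longleftrightarrow>
     (\<exists>F g. F \<subseteq> E \<and> card F = k \<and>
        (\<forall>e\<in>F. \<forall>f\<in>F. e \<noteq> f \<longrightarrow> edges_cross curve e f) \<and>
        g \<in> E \<and> (\<forall>e\<in>F. edges_disjoint curve e g))"

end

theory Submission
  imports Defs "HOL-Complex_Analysis.Complex_Analysis" "HOL-Probability.Probability"
begin

text \<open>
  Write \<open>\<lambda>(n) = 1 + ln n\<close>. The bound obtained is \<open>O(n \<lambda>(n)^(k + 2))\<close> for every \<open>k \<ge> 2\<close>.

  A graph without \<open>k\<close> pairwise crossing edges has \<open>O(n \<lambda>(n)^(k - 2))\<close> edges, by induction on \<open>k\<close>: on a shortest path
  of the crossing graph, the neighbours of every fourth vertex span no \<open>k - 1\<close> pairwise crossing edges, so shortest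
  paths are cheap barriers in the plane and yield balanced separators of the crossing graph, while the vertex counts of
  mutually non-crossing connected pieces add up to \<open>O(n)\<close> because they form a plane structure without large complete
  minors. Hence, without a \<open>(k,1)\<close>-crossing family, every edge is disjoint from at most \<open>\<zeta> = O(n \<lambda>(n)^(k - 2))\<close> others.

  A subgraph of a bipartite half that maximises \<open>m / (n \<lambda>(n)^(k + 2))\<close> expands: the flow out of a set of stationary
  measure \<open>\<pi> \<le> 1/2\<close> is at least a constant times \<open>\<pi> (1 + ln (1/\<pi>)) / \<lambda>\<close>. Therefore the lazy random walk mixes in
  \<open>O(\<lambda>\<^sup>2)\<close> steps, and random walks of that length joining three random vertices on one side to three on the other
  have, on average, fewer than one incident or disjoint-edge pair among nonadjacent walks once
  \<open>m\<close> exceeds a constant times \<open>\<lambda>\<^sup>4 (n + \<zeta>)\<close>. A drawing of \<open>K\<^sub>3\<^sub>,\<^sub>3\<close> whose nonadjacent walks are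
  vertex-disjoint, and all of whose edges from nonadjacent walks cross, contradicts a parity identity for winding numbers.
\<close>

section \<open>Crossing parity of arcs via winding numbers\<close>

text \<open>The contradiction is a count modulo 2. If all edges of two nonadjacent walks cross, the
  pair of walks has an odd number of crossings, because bipartiteness makes the number of edges of
  each walk odd. There are 18 such pairs, so the total is even, while the winding number identity
  makes it odd. The identity passes from edges to walks because the crossing parity of two edges is
  a sum of terms attached to endpoints, and such sums telescope along a walk. Walks with a common
  end may meet freely.

  The logarithm in the expansion keeps the mixing time at \<open>O(\<lambda>\<^sup>2)\<close>:
  expansion of order \<open>1 / \<lambda>\<close> alone would need a further logarithm to flatten a
  point mass, whereas sets of small measure expand better and the early phase becomes as short as
  the late one. One factor \<lambda> of the maximised density supplies this. The exponent
  \<open>k + 2\<close> itself is 4, from the square of the number of steps, plus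
  \<open>k - 2\<close>, from \<zeta>; with the same power in the density, the bound for the core
  carries over to the whole graph.\<close>

lemma winding_number_eq_log_change:
  assumes cont: "continuous_on {0..1} l" and g: "\<And>t. t \<in> {0..1} \<Longrightarrow> g t = w + exp (l t)"
  shows "l 1 - l 0 = 2 * of_real pi * \<i> * winding_number g w"
proof -
  have "continuous_on {0..1} (\<lambda>t. w + exp (l t))"
    by (intro continuous_intros cont)
  then have "path g"
    unfolding path_def by (rule continuous_on_eq) (simp add: g)
  have "w \<notin> path_image g"
    using g by (auto simp: path_image_def)
  obtain q where q: "path q" "pathfinish q - pathstart q = 2 * of_real pi * \<i> * winding_number g w"
      "\<And>t. t \<in> {0..1} \<Longrightarrow> g t = w + exp (q t)"
    using winding_number_as_continuous_log[OF \<open>path g\<close> \<open>w \<notin> path_image g\<close>] by metis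
  have eq: "exp (q t - l t) = 1" if "t \<in> {0..1}" for t
    using q(3)[OF that] g[OF that] by (simp add: exp_diff)
  \<comment> \<open>Two logarithms of the same path differ by a continuous function with values in a
    lattice of spacing \<open>2 * pi\<close>, hence by a constant; so any continuous logarithm
    computes the winding number.\<close>
  have "(\<lambda>t. q t - l t) constant_on {0..1}"
  proof (rule continuous_discrete_range_constant)
    show "connected {0..1::real}" by simp
    show "continuous_on {0..1} (\<lambda>t. q t - l t)"
      using q(1) cont by (intro continuous_intros) (auto simp: path_def)
    show "\<exists>e>0. \<forall>y. y \<in> {0..1} \<and> q y - l y \<noteq> q x - l x \<longrightarrow> e \<le> cmod ((q y - l y) - (q x - l x))"
      if "x \<in> {0..1}" for x
    proof (intro exI[of _ "2*pi"] conjI allI impI)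
      fix y assume y: "y \<in> {0..1} \<and> q y - l y \<noteq> q x - l x"
      define d where "d = (q y - l y) - (q x - l x)"
      have "exp d = 1" using eq[of x] eq[of y] y that by (simp add: d_def exp_diff)
      then obtain n :: int where n: "d = of_int (2 * n) * pi * \<i>"
        by (metis complex_eq_iff exp_eq_1 Im_complex_of_real Re_complex_of_real mult.commute
              Complex_eq_0 complex_exp_exists exp_eq exp_zero add_0)
      have "d \<noteq> 0" using y by (simp add: d_def)
      then have "n \<noteq> 0" using n by auto
      then have "1 \<le> \<bar>real_of_int n\<bar>" by linarith
      then have "2 * pi \<le> 2 * pi * \<bar>real_of_int n\<bar>" using pi_gt_zero by simp
      also have "\<dots> = cmod d" unfolding n by (simp add: norm_mult)
      finally show "2 * pi \<le> cmod ((q y - l y) - (q x - l x))" by (simp add: d_def)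
    qed simp
  qed
  then obtain c where c: "\<And>t. t \<in> {0..1} \<Longrightarrow> q t - l t = c"
    by (auto simp: constant_on_def)
  have "q 1 - l 1 = q 0 - l 0" using c[of 0] c[of 1] by simp
  then show ?thesis using q(2) by (simp add: pathfinish_def pathstart_def algebra_simps)
qed

text \<open>The degree over the square of \<open>(s, t) \<mapsto> g s - h t\<close>, computed along the boundary.\<close>

definition pair_index :: "(real \<Rightarrow> complex) \<Rightarrow> (real \<Rightarrow> complex) \<Rightarrow> complex" where
  "pair_index g h = winding_number g (pathstart h) - winding_number g (pathfinish h)
     + winding_number h (pathfinish g) - winding_number h (pathstart g)"

text \<open>The four logarithms live on the four sides of the parameter square. Along the sides
  where \<open>h\<close> moves, the winding number refers to \<open>h t - g 0\<close> and
  \<open>h t - g 1\<close>, the negatives of the given functions; the correction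
  \<open>of_real pi * \<i>\<close> to the logarithm drops out of the differences.\<close>

lemma pair_index_eq_log_change:
  assumes "continuous_on {0..1} l0" "continuous_on {0..1} l1" "continuous_on {0..1} r0" "continuous_on {0..1} r1"
    and "\<And>s. s \<in> {0..1} \<Longrightarrow> g s - h 0 = exp (l0 s)" "\<And>s. s \<in> {0..1} \<Longrightarrow> g s - h 1 = exp (l1 s)"
    and "\<And>t. t \<in> {0..1} \<Longrightarrow> g 0 - h t = exp (r0 t)" "\<And>t. t \<in> {0..1} \<Longrightarrow> g 1 - h t = exp (r1 t)"
  shows "2 * of_real pi * \<i> * pair_index g h = (l0 1 - l0 0) - (l1 1 - l1 0) + (r1 1 - r1 0) - (r0 1 - r0 0)"
proof -
  have 1: "l0 1 - l0 0 = 2 * of_real pi * \<i> * winding_number g (h 0)"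
    by (rule winding_number_eq_log_change) (use assms in \<open>auto simp: algebra_simps\<close>)
  have 2: "l1 1 - l1 0 = 2 * of_real pi * \<i> * winding_number g (h 1)"
    by (rule winding_number_eq_log_change) (use assms in \<open>auto simp: algebra_simps\<close>)
  have e: "h t = g x + exp (y + of_real pi * \<i>)" if "g x - h t = exp y" for x y t
    using that by (simp add: exp_add algebra_simps)
  have 3: "(r1 1 + of_real pi * \<i>) - (r1 0 + of_real pi * \<i>) = 2 * of_real pi * \<i> * winding_number h (g 1)"
    by (rule winding_number_eq_log_change[of "\<lambda>t. r1 t + of_real pi * \<i>"])
       (use assms e in \<open>auto intro!: continuous_intros\<close>)
  have 4: "(r0 1 + of_real pi * \<i>) - (r0 0 + of_real pi * \<i>) = 2 * of_real pi * \<i> * winding_number h (g 0)"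
    by (rule winding_number_eq_log_change[of "\<lambda>t. r0 t + of_real pi * \<i>"])
       (use assms e in \<open>auto intro!: continuous_intros\<close>)
  show ?thesis
    using 1 2 3 4 by (simp add: pair_index_def pathstart_def pathfinish_def algebra_simps)
qed

text \<open>For disjoint images the difference \<open>g s - h t\<close> never vanishes, so it has
  one logarithm on the whole square, and the changes of that logarithm around the boundary add up to
  zero.\<close>

lemma pair_index_disjoint:
  assumes "path g" "path h" "path_image g \<inter> path_image h = {}"
  shows "pair_index g h = 0"
proof -
  let ?S = "{0..1::real} \<times> {0..1::real}"
  let ?F = "\<lambda>x. g (fst x) - h (snd x)"
  have contF: "continuous_on ?S ?F"
  proof (intro continuous_intros)
    show "continuous_on ?S (\<lambda>x. g (fst x))"
      using assms(1) unfolding path_def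
      by (rule continuous_on_compose2[OF _ continuous_on_fst[OF continuous_on_id]]) auto
    show "continuous_on ?S (\<lambda>x. h (snd x))"
      using assms(2) unfolding path_def
      by (rule continuous_on_compose2[OF _ continuous_on_snd[OF continuous_on_id]]) auto
  qed
  have nz: "?F x \<noteq> 0" if "x \<in> ?S" for x
    using that assms(3) by (auto simp: path_image_def)
  have "convex ?S" by (simp add: convex_Times)
  then have "contractible ?S" by (rule convex_imp_contractible)
  then obtain l where l: "continuous_on ?S l" "\<And>x. x \<in> ?S \<Longrightarrow> ?F x = exp (l x)"
    using continuous_logarithm_on_contractible[OF contF _ nz] by metis
  have c: "continuous_on {0..1} (\<lambda>s. l (s, t))" "continuous_on {0..1} (\<lambda>s. l (t, s))" if "t \<in> {0..1}" for t
    by (rule continuous_on_compose2[OF l(1)]; use that in \<open>auto intro!: continuous_intros\<close>)+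
  have "2 * of_real pi * \<i> * pair_index g h = (l (1,0) - l (0,0)) - (l (1,1) - l (0,1))
      + (l (1,1) - l (1,0)) - (l (0,1) - l (0,0))"
    by (rule pair_index_eq_log_change[of "\<lambda>s. l (s,0)" "\<lambda>s. l (s,1)" "\<lambda>t. l (0,t)" "\<lambda>t. l (1,t)"])
       (use c l(2) in \<open>auto\<close>)
  then show ?thesis by simp
qed

text \<open>The index is additive under cutting the first path, and the two end pieces contribute
  nothing because they miss \<open>h\<close>. This localises a crossing in a chart; the second path
  is treated the same way after exchanging the arguments, which flips the sign.\<close>

lemma pair_index_subpath_left:
  assumes "path g" "path h" "s \<in> {0..1}" "s' \<in> {0..1}" "s \<le> s'"
    and "pathstart h \<notin> path_image g" "pathfinish h \<notin> path_image g"
    and "path_image (subpath 0 s g) \<inter> path_image h = {}" "path_image (subpath s' 1 g) \<inter> path_image h = {}"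
  shows "pair_index g h = pair_index (subpath s s' g) h"
proof -
  have sub: "winding_number (subpath 0 s g) z + winding_number (subpath s s' g) z + winding_number (subpath s' 1 g) z
      = winding_number g z" if "z \<notin> path_image g" for z
  proof -
    have "winding_number (subpath 0 s g) z + winding_number (subpath s s' g) z = winding_number (subpath 0 s' g) z"
      by (rule winding_number_subpath_combine) (use assms that in auto)
    moreover have "winding_number (subpath 0 s' g) z + winding_number (subpath s' 1 g) z = winding_number (subpath 0 1 g) z"
      by (rule winding_number_subpath_combine) (use assms that in auto)
    ultimately show ?thesis by simp
  qed
  have 1: "pair_index (subpath 0 s g) h = 0" "pair_index (subpath s' 1 g) h = 0"
    using assms by (auto intro!: pair_index_disjoint path_subpath)
  have "pair_index g h = pair_index (subpath 0 s g) h + pair_index (subpath s s' g) h + pair_index (subpath s' 1 g) h"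
    using sub[OF assms(6)] sub[OF assms(7)]
    unfolding pair_index_def by (simp add: pathstart_def pathfinish_def subpath_def algebra_simps)
  then show ?thesis using 1 by simp
qed

lemma pair_index_swap: "pair_index h g = - pair_index g h"
  by (simp add: pair_index_def)

lemma pair_index_reverse_left:
  assumes "path g" "path h" "pathstart h \<notin> path_image g" "pathfinish h \<notin> path_image g"
  shows "pair_index (reversepath g) h = - pair_index g h"
  using assms by (simp add: pair_index_def winding_number_reversepath)

text \<open>The four half-plane conditions on \<open>z - w\<close> cut out convex sets of pairs, on which \<open>k z - k w\<close>
  has a logarithm; exchanging \<open>z\<close> and \<open>w\<close> maps opposite sets to each other and negates \<open>k z - k w\<close>,
  which forces the total change of argument to be an odd multiple of \<open>2\<pi>\<close>.\<close>

lemma pair_index_local_odd: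
  fixes k :: "complex \<Rightarrow> complex" and \<alpha> \<beta> :: "real \<Rightarrow> real"
  assumes k: "continuous_on (ball 0 1) k" "inj_on k (ball 0 1)"
    and \<alpha>: "continuous_on {0..1} \<alpha>" "\<alpha> 0 < 0" "0 < \<alpha> 1" "\<And>s. s \<in> {0..1} \<Longrightarrow> \<bar>\<alpha> s\<bar> < 1"
    and \<beta>: "continuous_on {0..1} \<beta>" "\<beta> 0 < 0" "0 < \<beta> 1" "\<And>s. s \<in> {0..1} \<Longrightarrow> \<bar>\<beta> s\<bar> < 1"
    and g: "\<And>s. s \<in> {0..1} \<Longrightarrow> g s = k (of_real (\<alpha> s))" and h: "\<And>t. t \<in> {0..1} \<Longrightarrow> h t = k (\<i> * of_real (\<beta> t))"
  shows "\<exists>n::int. pair_index g h = of_int (2 * n + 1)"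
proof -
  define B where "B = (ball 0 1 :: complex set)"
  \<comment> \<open>Logarithms are taken on these two sets only: pairs whose difference points down
    or left are carried into them by exchanging the two points, at the price of a summand
    \<open>of_real pi * \<i>\<close>.\<close>
  define U where "U = {x \<in> B \<times> B. Im (fst x - snd x) > 0}"
  define R where "R = {x \<in> B \<times> B. Re (fst x - snd x) > 0}"
  have lin: "linear (\<lambda>x::complex\<times>complex. fst x - snd x)"
    by (auto intro!: linearI simp: algebra_simps)
  have cvx: "convex {x::complex\<times>complex. Im (fst x - snd x) > 0}" "convex {x::complex\<times>complex. Re (fst x - snd x) > 0}"
            "convex {x::complex\<times>complex. Im (fst x - snd x) < 0}"
    using convex_linear_vimage[OF lin convex_halfspace_Im_gt[of 0]] convex_linear_vimage[OF lin convex_halfspace_Re_gt[of 0]]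
      convex_linear_vimage[OF lin convex_halfspace_Im_lt[of 0]] by (simp_all add: vimage_def)
  have cB: "convex (B \<times> B)" by (simp add: B_def convex_Times)
  have cU: "convex U" using convex_Int[OF cB cvx(1)] by (simp add: U_def Int_def)
  have cR: "convex R" using convex_Int[OF cB cvx(2)] by (simp add: R_def Int_def)
  have cUR: "convex (U \<inter> R)" using cU cR by (rule convex_Int)
  have cRD: "convex (R \<inter> {x. Im (fst x - snd x) < 0})" using cR cvx(3) by (rule convex_Int)
  let ?F = "\<lambda>x. k (fst x) - k (snd x)"
  have contF: "continuous_on (B \<times> B) ?F"
  proof (intro continuous_intros)
    show "continuous_on (B \<times> B) (\<lambda>x. k (fst x))"
      using k(1) by (rule continuous_on_compose2[OF _ continuous_on_fst[OF continuous_on_id]]) (auto simp: B_def)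
    show "continuous_on (B \<times> B) (\<lambda>x. k (snd x))"
      using k(1) by (rule continuous_on_compose2[OF _ continuous_on_snd[OF continuous_on_id]]) (auto simp: B_def)
  qed
  have nz: "?F x \<noteq> 0" if "x \<in> B \<times> B" "fst x \<noteq> snd x" for x
    using that inj_onD[OF k(2), of "fst x" "snd x"] by (auto simp: B_def mem_Times_iff)
  have nzU: "?F x \<noteq> 0" if "x \<in> U" for x using that by (intro nz) (auto simp: U_def)
  have nzR: "?F x \<noteq> 0" if "x \<in> R" for x using that by (intro nz) (auto simp: R_def)
  have cFU: "continuous_on U ?F" by (rule continuous_on_subset[OF contF]) (auto simp: U_def)
  have cFR: "continuous_on R ?F" by (rule continuous_on_subset[OF contF]) (auto simp: R_def)
  obtain lu where lu: "continuous_on U lu" "\<And>x. x \<in> U \<Longrightarrow> ?F x = exp (lu x)"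
    using continuous_logarithm_on_contractible[OF cFU convex_imp_contractible[OF cU] nzU] by metis
  obtain lr where lr: "continuous_on R lr" "\<And>x. x \<in> R \<Longrightarrow> ?F x = exp (lr x)"
    using continuous_logarithm_on_contractible[OF cFR convex_imp_contractible[OF cR] nzR] by metis
  \<comment> \<open>To be applied to the difference of two logarithms of one function: on a convex
    set it is a fixed integer multiple of a full turn.\<close>
  have const: "\<exists>n::int. \<forall>x\<in>S. d x = 2 * of_int n * of_real pi * \<i>"
    if S: "convex S" and d: "continuous_on S d" and e: "\<And>x. x \<in> S \<Longrightarrow> exp (d x) = 1"
    for S :: "(complex\<times>complex) set" and d :: "complex \<times> complex \<Rightarrow> complex"
  proof -
    have int: "\<exists>n::int. d x = 2 * of_int n * of_real pi * \<i>" if "x \<in> S" for x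
      using e[OF that] by (metis exp_eq exp_zero add_0 of_int_mult of_int_numeral of_real_mult of_real_of_int_eq mult.assoc)
    have "d constant_on S"
    proof (rule continuous_discrete_range_constant)
      show "connected S" using S by (rule convex_connected)
      show "\<exists>e>0. \<forall>y. y \<in> S \<and> d y \<noteq> d x \<longrightarrow> e \<le> cmod (d y - d x)" if x: "x \<in> S" for x
      proof (intro exI[of _ "2*pi"] conjI allI impI)
        fix y assume y: "y \<in> S \<and> d y \<noteq> d x"
        obtain n m :: int where nm: "d x = 2 * of_int n * of_real pi * \<i>" "d y = 2 * of_int m * of_real pi * \<i>"
          using int x y by metis
        then have "n \<noteq> m" using y by auto
        then have "1 \<le> \<bar>real_of_int (m - n)\<bar>" by linarith
        then have "2 * pi \<le> 2 * pi * \<bar>real_of_int (m - n)\<bar>" using pi_gt_zero by simp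
        also have "\<dots> = cmod (2 * of_int (m - n) * of_real pi * \<i>)" by (simp add: norm_mult del: of_int_diff)
        also have "2 * of_int (m - n) * of_real pi * \<i> = d y - d x" by (simp add: nm algebra_simps)
        finally show "2 * pi \<le> cmod (d y - d x)" .
      qed simp
    qed (rule d)
    then obtain c where c: "\<And>x. x \<in> S \<Longrightarrow> d x = c" by (auto simp: constant_on_def)
    show ?thesis
    proof (cases "S = {}")
      case False
      then obtain x0 where "x0 \<in> S" by blast
      then show ?thesis using c int[of x0] by auto
    qed auto
  qed
  obtain n1 :: int where n1: "\<And>x. x \<in> U \<inter> R \<Longrightarrow> lu x - lr x = 2 * of_int n1 * of_real pi * \<i>"
  proof -
    have "\<exists>n::int. \<forall>x\<in>U \<inter> R. lu x - lr x = 2 * of_int n * of_real pi * \<i>"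
    proof (rule const[OF cUR])
      show "continuous_on (U \<inter> R) (\<lambda>x. lu x - lr x)"
        by (intro continuous_intros continuous_on_subset[OF lu(1)] continuous_on_subset[OF lr(1)]) auto
      show "exp (lu x - lr x) = 1" if "x \<in> U \<inter> R" for x
        using lu(2)[of x] lr(2)[of x] that by (simp add: exp_diff)
    qed
    then show thesis using that by blast
  qed
  have swap: "prod.swap x \<in> U" if "x \<in> R \<inter> {x. Im (fst x - snd x) < 0}" for x
    using that by (auto simp: R_def U_def)
  obtain n2 :: int where n2: "\<And>x. x \<in> R \<inter> {x. Im (fst x - snd x) < 0} \<Longrightarrow>
      lr x - (lu (prod.swap x) + of_real pi * \<i>) = 2 * of_int n2 * of_real pi * \<i>"
  proof -
    have "\<exists>n::int. \<forall>x\<in>R \<inter> {x. Im (fst x - snd x) < 0}.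
        lr x - (lu (prod.swap x) + of_real pi * \<i>) = 2 * of_int n * of_real pi * \<i>"
    proof (rule const[OF cRD])
      show "continuous_on (R \<inter> {x. Im (fst x - snd x) < 0}) (\<lambda>x. lr x - (lu (prod.swap x) + of_real pi * \<i>))"
        by (intro continuous_intros continuous_on_subset[OF lr(1)] continuous_on_compose2[OF lu(1)])
           (use swap in \<open>auto simp: prod.swap_def intro!: continuous_intros\<close>)
      show "exp (lr x - (lu (prod.swap x) + of_real pi * \<i>)) = 1" if x: "x \<in> R \<inter> {x. Im (fst x - snd x) < 0}" for x
      proof -
        have "?F x = exp (lr x)" using lr(2) x by blast
        moreover have "?F (prod.swap x) = exp (lu (prod.swap x))" using lu(2)[OF swap[OF x]] .
        ultimately have "exp (lr x) = - exp (lu (prod.swap x))" by (metis fst_swap snd_swap minus_diff_eq)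
        then show ?thesis by (simp add: exp_diff exp_add)
      qed
    qed
    then show thesis using that by blast
  qed
  have in\<alpha>: "of_real (\<alpha> s) \<in> B" if "s \<in> {0..1}" for s using \<alpha>(4)[OF that] by (simp add: B_def)
  have in\<beta>: "\<i> * of_real (\<beta> s) \<in> B" if "s \<in> {0..1}" for s using \<beta>(4)[OF that] by (simp add: B_def norm_mult)
  have memU: "(of_real (\<alpha> s), \<i> * of_real (\<beta> 0)) \<in> U" if "s \<in> {0..1}" for s
    using in\<alpha>[OF that] in\<beta>[of 0] \<beta> by (auto simp: U_def)
  have memD: "(\<i> * of_real (\<beta> 1), of_real (\<alpha> s)) \<in> U" if "s \<in> {0..1}" for s
    using in\<alpha>[OF that] in\<beta>[of 1] \<beta> by (auto simp: U_def)
  have memR: "(of_real (\<alpha> 1), \<i> * of_real (\<beta> s)) \<in> R" if "s \<in> {0..1}" for s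
    using in\<beta>[OF that] in\<alpha>[of 1] \<alpha> by (auto simp: R_def)
  have memL: "(\<i> * of_real (\<beta> s), of_real (\<alpha> 0)) \<in> R" if "s \<in> {0..1}" for s
    using in\<beta>[OF that] in\<alpha>[of 0] \<alpha> by (auto simp: R_def)
  have idx: "2 * of_real pi * \<i> * pair_index g h =
     (lu (of_real (\<alpha> 1), \<i> * of_real (\<beta> 0)) - lu (of_real (\<alpha> 0), \<i> * of_real (\<beta> 0)))
   - ((lu (\<i> * of_real (\<beta> 1), of_real (\<alpha> 1)) + of_real pi * \<i>) - (lu (\<i> * of_real (\<beta> 1), of_real (\<alpha> 0)) + of_real pi * \<i>))
   + (lr (of_real (\<alpha> 1), \<i> * of_real (\<beta> 1)) - lr (of_real (\<alpha> 1), \<i> * of_real (\<beta> 0)))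
   - ((lr (\<i> * of_real (\<beta> 1), of_real (\<alpha> 0)) + of_real pi * \<i>) - (lr (\<i> * of_real (\<beta> 0), of_real (\<alpha> 0)) + of_real pi * \<i>))"
  proof (rule pair_index_eq_log_change[of "\<lambda>s. lu (of_real (\<alpha> s), \<i> * of_real (\<beta> 0))" "\<lambda>s. lu (\<i> * of_real (\<beta> 1), of_real (\<alpha> s)) + of_real pi * \<i>"
      "\<lambda>t. lr (\<i> * of_real (\<beta> t), of_real (\<alpha> 0)) + of_real pi * \<i>" "\<lambda>t. lr (of_real (\<alpha> 1), \<i> * of_real (\<beta> t))"])
    show "continuous_on {0..1} (\<lambda>s. lu (of_real (\<alpha> s), \<i> * of_real (\<beta> 0)))"
      by (rule continuous_on_compose2[OF lu(1)]) (use memU in \<open>auto intro!: continuous_intros \<alpha>\<close>)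
    show "continuous_on {0..1} (\<lambda>s. lu (\<i> * of_real (\<beta> 1), of_real (\<alpha> s)) + of_real pi * \<i>)"
      by (intro continuous_intros, rule continuous_on_compose2[OF lu(1)]) (use memD in \<open>auto intro!: continuous_intros \<alpha>\<close>)
    show "continuous_on {0..1} (\<lambda>t. lr (\<i> * of_real (\<beta> t), of_real (\<alpha> 0)) + of_real pi * \<i>)"
      by (intro continuous_intros, rule continuous_on_compose2[OF lr(1)]) (use memL in \<open>auto intro!: continuous_intros \<beta>\<close>)
    show "continuous_on {0..1} (\<lambda>t. lr (of_real (\<alpha> 1), \<i> * of_real (\<beta> t)))"
      by (rule continuous_on_compose2[OF lr(1)]) (use memR in \<open>auto intro!: continuous_intros \<beta>\<close>)
  next
    fix s :: real assume s: "s \<in> {0..1}"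
    show "g s - h 0 = exp (lu (of_real (\<alpha> s), \<i> * of_real (\<beta> 0)))"
      using lu(2)[OF memU[OF s]] s by (simp add: g h)
    show "g s - h 1 = exp (lu (\<i> * of_real (\<beta> 1), of_real (\<alpha> s)) + of_real pi * \<i>)"
      using lu(2)[OF memD[OF s]] s by (simp add: g h exp_add) (metis minus_diff_eq)
    show "g 0 - h s = exp (lr (\<i> * of_real (\<beta> s), of_real (\<alpha> 0)) + of_real pi * \<i>)"
      using lr(2)[OF memL[OF s]] s by (simp add: g h exp_add) (metis minus_diff_eq)
    show "g 1 - h s = exp (lr (of_real (\<alpha> 1), \<i> * of_real (\<beta> s)))"
      using lr(2)[OF memR[OF s]] s by (simp add: g h)
  qed
  have c1: "lu (of_real (\<alpha> 1), \<i> * of_real (\<beta> 0)) - lr (of_real (\<alpha> 1), \<i> * of_real (\<beta> 0)) = 2 * of_int n1 * of_real pi * \<i>"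
    by (rule n1) (use memU[of 1] memR[of 0] in auto)
  have c2: "lu (\<i> * of_real (\<beta> 1), of_real (\<alpha> 0)) - lr (\<i> * of_real (\<beta> 1), of_real (\<alpha> 0)) = 2 * of_int n1 * of_real pi * \<i>"
    by (rule n1) (use memD[of 0] memL[of 1] in auto)
  have c3: "lr (of_real (\<alpha> 1), \<i> * of_real (\<beta> 1)) - (lu (\<i> * of_real (\<beta> 1), of_real (\<alpha> 1)) + of_real pi * \<i>) = 2 * of_int n2 * of_real pi * \<i>"
    using n2[of "(of_real (\<alpha> 1), \<i> * of_real (\<beta> 1))"] memR[of 1] \<beta>(3) by (auto simp: prod.swap_def)
  have c4: "lr (\<i> * of_real (\<beta> 0), of_real (\<alpha> 0)) - (lu (of_real (\<alpha> 0), \<i> * of_real (\<beta> 0)) + of_real pi * \<i>) = 2 * of_int n2 * of_real pi * \<i>"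
    using n2[of "(\<i> * of_real (\<beta> 0), of_real (\<alpha> 0))"] memL[of 0] \<beta>(2) by (auto simp: prod.swap_def)
  \<comment> \<open>Regrouped by the corners of the square. After the exchange, opposite corners lie
    in the same overlap, so their jumps are the same integer \<open>n1\<close> or \<open>n2\<close>
    and contribute an even total; the shifts by \<open>of_real pi * \<i>\<close> leave one full turn
    over.\<close>
  have idx2: "2 * of_real pi * \<i> * pair_index g h =
     (lu (of_real (\<alpha> 1), \<i> * of_real (\<beta> 0)) - lr (of_real (\<alpha> 1), \<i> * of_real (\<beta> 0)))
   + (lu (\<i> * of_real (\<beta> 1), of_real (\<alpha> 0)) - lr (\<i> * of_real (\<beta> 1), of_real (\<alpha> 0)))
   + (lr (of_real (\<alpha> 1), \<i> * of_real (\<beta> 1)) - (lu (\<i> * of_real (\<beta> 1), of_real (\<alpha> 1)) + of_real pi * \<i>))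
   + (lr (\<i> * of_real (\<beta> 0), of_real (\<alpha> 0)) - (lu (of_real (\<alpha> 0), \<i> * of_real (\<beta> 0)) + of_real pi * \<i>))
   + 2 * of_real pi * \<i>"
    unfolding idx by simp
  have "2 * of_real pi * \<i> * pair_index g h = 2 * of_real pi * \<i> * of_int (2 * (n1 + n2) + 1)"
    unfolding idx2 c1 c2 c3 c4 by (simp add: algebra_simps)
  then show ?thesis by (intro exI[of _ "n1 + n2"]) simp
qed

text \<open>Both arcs are cut down to pieces inside the chart at \<open>p\<close>, where one becomes
  real and the other imaginary; the pieces carry the whole index, since beyond them the arcs do not
  meet. Reversing a piece changes only the sign, which leaves the parity alone, so each may be taken
  to run from the negative to the positive half of its axis.\<close>

lemma pair_index_crossing:
  assumes g: "arc g" and h: "arc h" and int: "path_image g \<inter> path_image h = {p}"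
    and p: "p \<notin> {pathstart g, pathfinish g}" "p \<notin> {pathstart h, pathfinish h}"
    and cross: "proper_crossing_at (path_image g) (path_image h) p"
  shows "\<exists>n::int. pair_index g h = of_int (2 * n + 1)"
proof -
  obtain U k k' where U: "open U" "p \<in> U" "homeomorphism U (ball 0 1) k k'" "k p = 0"
     "k ` (path_image g \<inter> U) = {z \<in> ball 0 1. Im z = 0}" "k ` (path_image h \<inter> U) = {z \<in> ball 0 1. Re z = 0}"
    using cross unfolding proper_crossing_at_def by blast
  have kk': "k' (k z) = z" if "z \<in> U" for z using U(3) that by (auto simp: homeomorphism_def)
  have kU: "k z \<in> ball 0 1" if "z \<in> U" for z using U(3) that by (auto simp: homeomorphism_def)
  have ck: "continuous_on U k" "continuous_on (ball 0 1) k'" using U(3) by (auto simp: homeomorphism_def)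
  have injk: "inj_on k U" using kk' by (metis inj_on_def)
  have injk': "inj_on k' (ball 0 1)" using U(3) by (intro inj_on_inverseI[of _ k]) (auto simp: homeomorphism_def)
  have piece: "\<exists>s s'. s \<in> {0..1} \<and> s' \<in> {0..1} \<and> s < s' \<and> path_image (subpath s s' q) \<subseteq> U
        \<and> p \<notin> path_image (subpath 0 s q) \<and> p \<notin> path_image (subpath s' 1 q) \<and> p \<in> q ` {s<..<s'}"
    if q: "arc q" "p \<in> path_image q" "p \<notin> {pathstart q, pathfinish q}" for q
  proof -
    obtain s0 where s0: "s0 \<in> {0..1}" "q s0 = p" using q(2) by (auto simp: path_image_def)
    have "s0 \<noteq> 0" "s0 \<noteq> 1" using q(3) s0 by (auto simp: pathstart_def pathfinish_def)
    then have s0': "0 < s0" "s0 < 1" using s0 by auto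
    have "continuous_on {0..1} q" using q(1) by (simp add: arc_def path_def)
    then have cont: "\<forall>x\<in>{0..1}. \<forall>e>0. \<exists>d>0. \<forall>x'\<in>{0..1}. dist x' x < d \<longrightarrow> dist (q x') (q x) < e"
      by (simp add: continuous_on_iff)
    obtain r where r: "r > 0" "ball p r \<subseteq> U" using U(1,2) openE by blast
    obtain e where e: "e > 0" "\<And>s. s \<in> {0..1} \<Longrightarrow> dist s s0 < e \<Longrightarrow> dist (q s) p < r"
      using cont[rule_format, OF s0(1) r(1)] s0(2) by auto
    have e: "e > 0" "\<And>s. s \<in> {0..1} \<Longrightarrow> dist s s0 < e \<Longrightarrow> q s \<in> U"
      using e r(2) by (auto simp: dist_commute subset_iff)
    \<comment> \<open>Keeps \<open>s0 - d\<close> and \<open>s0 + d\<close> inside the parameter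
      interval and inside the radius on which the arc stays in \<open>U\<close>; a cut may fall on
      an end of the arc.\<close>
    define d where "d = Min {e/2, s0, 1 - s0}"
    have d: "d > 0" "d < e" "d \<le> s0" "d \<le> 1 - s0" using e(1) s0' by (auto simp: d_def)
    have inj: "inj_on q {0..1}" using q(1) by (simp add: arc_def)
    have "p \<notin> q ` {0..s0-d}" "p \<notin> q ` {s0+d..1}"
      using inj_onD[OF inj] s0 d by fastforce+
    moreover have "q ` {s0-d..s0+d} \<subseteq> U"
      using e(2) d s0 by (auto simp: dist_real_def)
    ultimately show ?thesis
      using d s0 by (intro exI[of _ "s0-d"] exI[of _ "s0+d"]) (auto simp: path_image_subpath)
  qed
  have pg: "p \<in> path_image g" and ph: "p \<in> path_image h" using int by auto
  obtain s s' where s: "s \<in> {0..1}" "s' \<in> {0..1}" "s < s'" "path_image (subpath s s' g) \<subseteq> U"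
      "p \<notin> path_image (subpath 0 s g)" "p \<notin> path_image (subpath s' 1 g)" "p \<in> g ` {s<..<s'}"
    using piece[OF g pg p(1)] by blast
  obtain t t' where t: "t \<in> {0..1}" "t' \<in> {0..1}" "t < t'" "path_image (subpath t t' h) \<subseteq> U"
      "p \<notin> path_image (subpath 0 t h)" "p \<notin> path_image (subpath t' 1 h)" "p \<in> h ` {t<..<t'}"
    using piece[OF h ph p(2)] by blast
  define G where "G = subpath s s' g"
  define H where "H = subpath t t' h"
  have pathg: "path g" "path h" using g h by (auto simp: arc_def)
  have sub: "path_image (subpath a b q) \<subseteq> path_image q" if "a \<in> {0..1}" "b \<in> {0..1}" for a b and q :: "real \<Rightarrow> complex"
    using that by (rule path_image_subpath_subset)
  have off: "x \<notin> path_image g" if "x \<in> path_image h" "x \<noteq> p" for x using that int by blast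
  have off': "x \<notin> path_image h" if "x \<in> path_image g" "x \<noteq> p" for x using that int by blast
  have ends: "pathstart h \<notin> path_image g" "pathfinish h \<notin> path_image g" "pathstart g \<notin> path_image h" "pathfinish g \<notin> path_image h"
    using off off' p by auto
  have 1: "pair_index g h = pair_index G h"
  proof -
    have "x \<noteq> p" "x \<in> path_image g" if "x \<in> path_image (subpath 0 s g) \<or> x \<in> path_image (subpath s' 1 g)" for x
      using sub[of 0 s g] sub[of s' 1 g] s(1,2,5,6) that by auto
    then have "path_image (subpath 0 s g) \<inter> path_image h = {}" "path_image (subpath s' 1 g) \<inter> path_image h = {}"
      using off by blast+
    then show ?thesis unfolding G_def using s pathg ends by (intro pair_index_subpath_left) auto
  qed
  have arcG: "arc G" "arc H" unfolding G_def H_def using s t g h by (auto intro: arc_subpath_arc)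
  have pathG: "path G" "path H" using arcG by (auto simp: arc_def)
  have Gh: "path_image G \<subseteq> path_image g" "path_image H \<subseteq> path_image h" using sub s t by (auto simp: G_def H_def)
  have injg: "inj_on g {0..1}" "inj_on h {0..1}" using g h by (auto simp: arc_def)
  have "g s \<noteq> p" "g s' \<noteq> p" "h t \<noteq> p" "h t' \<noteq> p"
  proof -
    have "g s \<in> path_image (subpath 0 s g)" "g s' \<in> path_image (subpath s' 1 g)"
      "h t \<in> path_image (subpath 0 t h)" "h t' \<in> path_image (subpath t' 1 h)"
      using s(1,2) t(1,2) by (auto simp: path_image_subpath)
    then show "g s \<noteq> p" "g s' \<noteq> p" "h t \<noteq> p" "h t' \<noteq> p" using s(5,6) t(5,6) by auto
  qed
  then have Gends: "pathstart G \<noteq> p" "pathfinish G \<noteq> p" "pathstart H \<noteq> p" "pathfinish H \<noteq> p"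
    by (auto simp: G_def H_def pathstart_def pathfinish_def subpath_def)
  then have Gends': "pathstart G \<notin> path_image h" "pathfinish G \<notin> path_image h"
      "pathstart H \<notin> path_image g" "pathfinish H \<notin> path_image g"
    using Gh off off' pathstart_in_path_image[of G] pathfinish_in_path_image[of G]
      pathstart_in_path_image[of H] pathfinish_in_path_image[of H] by auto
  have 2: "pair_index h G = pair_index H G"
  proof -
    have "x \<noteq> p" "x \<in> path_image h" if "x \<in> path_image (subpath 0 t h) \<or> x \<in> path_image (subpath t' 1 h)" for x
      using sub[of 0 t h] sub[of t' 1 h] t(1,2,5,6) that by auto
    then have "path_image (subpath 0 t h) \<inter> path_image G = {}" "path_image (subpath t' 1 h) \<inter> path_image G = {}"
      using off Gh(1) by blast+
    then show ?thesis unfolding H_def using t pathg pathG Gends' by (intro pair_index_subpath_left) auto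
  qed
  have pG: "\<exists>x\<in>{0<..<1}. G x = p" "\<exists>x\<in>{0<..<1}. H x = p"
  proof -
    obtain y where y: "y \<in> {s<..<s'}" "g y = p" using s(7) by auto
    show "\<exists>x\<in>{0<..<1}. G x = p"
      using y s(3) by (intro bexI[of _ "(y - s)/(s'-s)"]) (auto simp: G_def subpath_def)
    obtain y where y: "y \<in> {t<..<t'}" "h y = p" using t(7) by auto
    show "\<exists>x\<in>{0<..<1}. H x = p"
      using y t(3) by (intro bexI[of _ "(y - t)/(t'-t)"]) (auto simp: H_def subpath_def)
  qed
  have GU: "G x \<in> path_image g \<inter> U" "H x \<in> path_image h \<inter> U" if "x \<in> {0..1}" for x
    using that s(4) t(4) Gh unfolding G_def H_def path_image_def by blast+
  have ImG: "Im (k (G x)) = 0" "Re (k (H x)) = 0" if "x \<in> {0..1}" for x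
    using GU[OF that] U(5,6) by blast+
  have "\<exists>G'. (pair_index G' H = pair_index G H \<or> pair_index G' H = - pair_index G H) \<and> Re (k (G' 0)) < 0 \<and> 0 < Re (k (G' 1))
       \<and> path G' \<and> path_image G' = path_image G"
  proof -
    obtain x where x: "x \<in> {0<..<1}" "G x = p" using pG(1) by blast
    have cont: "continuous_on {0..1} (\<lambda>x. Re (k (G x)))"
      by (intro continuous_intros continuous_on_compose2[OF ck(1)]) (use pathG GU in \<open>auto simp: path_def\<close>)
    have inj: "inj_on (\<lambda>x. Re (k (G x))) {0..1}"
    proof (rule inj_onI)
      fix a b :: real assume ab: "a \<in> {0..1}" "b \<in> {0..1}" "Re (k (G a)) = Re (k (G b))"
      then have "k (G a) = k (G b)" using ImG by (simp add: complex_eq_iff)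
      then have "G a = G b" using injk GU ab by (metis IntE inj_onD)
      then show "a = b" using arcG(1) ab by (auto simp: arc_def inj_on_def)
    qed
    \<comment> \<open>A continuous injective real function is strictly monotone, and this one
      vanishes at the interior parameter of \<open>p\<close>, so its end values have opposite
      signs.\<close>
    have sgn: "(Re (k (G 0)) < 0 \<and> 0 < Re (k (G 1))) \<or> (Re (k (G 1)) < 0 \<and> 0 < Re (k (G 0)))"
      using continuous_inj_imp_mono[OF _ _ cont inj, of x] x U(4) by auto
    show ?thesis
    proof (cases "Re (k (G 0)) < 0 \<and> 0 < Re (k (G 1))")
      case True
      then show ?thesis using pathG by (intro exI[of _ G]) auto
    next
      case False
      have "pair_index (reversepath G) H = - pair_index G H"
        using pathG Gends' Gh by (intro pair_index_reverse_left) auto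
      moreover have "reversepath G 0 = G 1" "reversepath G 1 = G 0" by (simp_all add: reversepath_def)
      ultimately show ?thesis using sgn False pathG by (intro exI[of _ "reversepath G"]) auto
    qed
  qed
  then obtain G' where G': "pair_index G' H = pair_index G H \<or> pair_index G' H = - pair_index G H"
     "Re (k (G' 0)) < 0" "0 < Re (k (G' 1))" "path G'" "path_image G' = path_image G" by blast
  have GU': "G' x \<in> path_image g \<inter> U" if "x \<in> {0..1}" for x
  proof -
    have "G' x \<in> path_image G" using that G'(5) by (auto simp: path_image_def)
    then show ?thesis using GU(1) by (auto simp: path_image_def)
  qed
  have "\<exists>H'. (pair_index G' H' = pair_index G' H \<or> pair_index G' H' = - pair_index G' H) \<and> Im (k (H' 0)) < 0 \<and> 0 < Im (k (H' 1))
       \<and> path H' \<and> path_image H' = path_image H"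
  proof -
    obtain x where x: "x \<in> {0<..<1}" "H x = p" using pG(2) by blast
    have cont: "continuous_on {0..1} (\<lambda>x. Im (k (H x)))"
      by (intro continuous_intros continuous_on_compose2[OF ck(1)]) (use pathG GU in \<open>auto simp: path_def\<close>)
    have inj: "inj_on (\<lambda>x. Im (k (H x))) {0..1}"
    proof (rule inj_onI)
      fix a b :: real assume ab: "a \<in> {0..1}" "b \<in> {0..1}" "Im (k (H a)) = Im (k (H b))"
      then have "k (H a) = k (H b)" using ImG by (simp add: complex_eq_iff)
      then have "H a = H b" using injk GU ab by (metis IntE inj_onD)
      then show "a = b" using arcG(2) ab by (auto simp: arc_def inj_on_def)
    qed
    have sgn: "(Im (k (H 0)) < 0 \<and> 0 < Im (k (H 1))) \<or> (Im (k (H 1)) < 0 \<and> 0 < Im (k (H 0)))"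
      using continuous_inj_imp_mono[OF _ _ cont inj, of x] x U(4) by auto
    show ?thesis
    proof (cases "Im (k (H 0)) < 0 \<and> 0 < Im (k (H 1))")
      case True
      then show ?thesis using pathG by (intro exI[of _ H]) auto
    next
      case False
      have e: "pathstart G' \<in> path_image G'" "pathfinish G' \<in> path_image G'" by auto
      have "pathstart G' \<notin> path_image H" "pathfinish G' \<notin> path_image H"
      proof -
        have "pathstart G' \<noteq> p" "pathfinish G' \<noteq> p" using G'(2,3) U(4) by (auto simp: pathstart_def pathfinish_def)
        then show "pathstart G' \<notin> path_image H" "pathfinish G' \<notin> path_image H" using e G'(5) Gh int by blast+
      qed
      then have "pair_index (reversepath H) G' = - pair_index H G'"
        using pathG G' by (intro pair_index_reverse_left) auto
      then have "pair_index G' (reversepath H) = - pair_index G' H"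
        by (metis pair_index_swap)
      moreover have "reversepath H 0 = H 1" "reversepath H 1 = H 0" by (simp_all add: reversepath_def)
      ultimately show ?thesis using sgn False pathG by (intro exI[of _ "reversepath H"]) auto
    qed
  qed
  then obtain H' where H': "pair_index G' H' = pair_index G' H \<or> pair_index G' H' = - pair_index G' H"
     "Im (k (H' 0)) < 0" "0 < Im (k (H' 1))" "path H'" "path_image H' = path_image H" by blast
  have HU': "H' x \<in> path_image h \<inter> U" if "x \<in> {0..1}" for x
  proof -
    have "H' x \<in> path_image H" using that H'(5) by (auto simp: path_image_def)
    then show ?thesis using GU(2) by (auto simp: path_image_def)
  qed
  have ImG': "Im (k (G' x)) = 0" "Re (k (H' x)) = 0" if "x \<in> {0..1}" for x
    using GU'[OF that] HU'[OF that] U(5,6) by blast+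
  have "\<exists>n::int. pair_index G' H' = of_int (2 * n + 1)"
  proof (rule pair_index_local_odd[of k' "\<lambda>x. Re (k (G' x))" "\<lambda>x. Im (k (H' x))"])
    show "continuous_on {0..1} (\<lambda>x. Re (k (G' x)))" "continuous_on {0..1} (\<lambda>x. Im (k (H' x)))"
      by (intro continuous_intros continuous_on_compose2[OF ck(1)]; use G' H' GU' HU' in \<open>auto simp: path_def\<close>)+
    fix x :: real assume x: "x \<in> {0..1}"
    have "cmod (k (G' x)) < 1" "cmod (k (H' x)) < 1" using kU GU'[OF x] HU'[OF x] by auto
    then show "\<bar>Re (k (G' x))\<bar> < 1" "\<bar>Im (k (H' x))\<bar> < 1"
      using abs_Re_le_cmod abs_Im_le_cmod by (meson le_less_trans)+
    have "of_real (Re (k (G' x))) = k (G' x)" "\<i> * of_real (Im (k (H' x))) = k (H' x)"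
      using ImG'[OF x] by (auto simp: complex_eq_iff)
    then show "G' x = k' (of_real (Re (k (G' x))))" "H' x = k' (\<i> * of_real (Im (k (H' x))))"
      using kk' GU'[OF x] HU'[OF x] by auto
  qed (use injk' ck G' H' in auto)
  then obtain n :: int where n: "pair_index G' H' = of_int (2 * n + 1)" by blast
  have "pair_index g h = - pair_index h G" unfolding 1 by (rule pair_index_swap)
  also have "\<dots> = - pair_index H G" by (simp only: 2)
  also have "\<dots> = pair_index G H" by (simp only: pair_index_swap[of H G] minus_minus)
  finally have "pair_index g h = pair_index G H" .
  moreover have "x = c \<or> x = - c" if "y = c" "z = x \<or> z = - x" "y = z \<or> y = - z" for x y z c :: complex
    using that by auto
  ultimately have "pair_index g h = of_int (2 * n + 1) \<or> pair_index g h = - of_int (2 * n + 1)"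
    using n G'(1) H'(1) by metis
  moreover have "- of_int (2 * n + 1) = (of_int (2 * (- n - 1) + 1) :: complex)" by simp
  ultimately show ?thesis by (elim disjE) (metis, metis)
qed

text \<open>The winding number of an open path is an integer up to a term determined by its
  endpoints and the principal logarithm. This is that integer; it depends on one curve and one
  point.\<close>

definition turn_number :: "(real \<Rightarrow> complex) \<Rightarrow> complex \<Rightarrow> int" where
  "turn_number g w = (SOME n. winding_number g w =
     (Ln (pathfinish g - w) - Ln (pathstart g - w)) / (2 * of_real pi * \<i>) + of_int n)"

lemma winding_number_turn_number:
  assumes "path g" "w \<notin> path_image g"
  shows "winding_number g w = (Ln (pathfinish g - w) - Ln (pathstart g - w)) / (2 * of_real pi * \<i>) + of_int (turn_number g w)"
proof -
  have nz: "pathstart g - w \<noteq> 0" "pathfinish g - w \<noteq> 0" using assms by auto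
  have "exp (2 * of_real pi * \<i> * winding_number g w) = exp (Ln (pathfinish g - w) - Ln (pathstart g - w))"
    using winding_number_exp_2pi[OF assms] nz by (simp add: exp_diff field_simps)
  then obtain n :: int where "2 * of_real pi * \<i> * winding_number g w
      = Ln (pathfinish g - w) - Ln (pathstart g - w) + (of_int (2 * n) * pi) * \<i>"
    by (metis exp_eq)
  then have "winding_number g w = (Ln (pathfinish g - w) - Ln (pathstart g - w)) / (2 * of_real pi * \<i>) + of_int n"
    by (simp add: field_simps)
  then show ?thesis unfolding turn_number_def by (rule someI)
qed

text \<open>Chosen to match the branch cut of \<open>Ln\<close>: the tie at equal imaginary parts is
  resolved so that \<open>Ln (p - q) - Ln (q - p)\<close> is \<open>of_real pi * \<i>\<close> or its
  negative according to the value 1 or 0.\<close>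

definition above :: "complex \<Rightarrow> complex \<Rightarrow> int" where
  "above p q = (if Im (p - q) > 0 \<or> (Im (p - q) = 0 \<and> Re (p - q) < 0) then 1 else 0)"

lemma above_add: "p \<noteq> q \<Longrightarrow> above p q + above q p = 1"
  by (auto simp: above_def complex_eq_iff)

lemma Ln_diff_above:
  assumes "p \<noteq> q"
  shows "Ln (p - q) - Ln (q - p) = of_real pi * \<i> * (2 * of_int (above p q) - 1)"
  using Ln_minus[of "p - q"] assms by (auto simp: above_def algebra_simps)

text \<open>The logarithmic parts of the four winding numbers combine to logarithms of opposite
  differences, which \<open>above\<close> evaluates. What remains is a sum of integers, each
  depending on one curve and one end of the other, or on two ends; modulo 2 these can be regrouped
  over a whole drawing.\<close>

lemma pair_index_formula:
  assumes "path g" "path h" "pathstart h \<notin> path_image g" "pathfinish h \<notin> path_image g"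
    "pathstart g \<notin> path_image h" "pathfinish g \<notin> path_image h"
  shows "pair_index g h = of_int (turn_number g (pathstart h) - turn_number g (pathfinish h)
      + turn_number h (pathfinish g) - turn_number h (pathstart g)
      + above (pathfinish g) (pathstart h) - above (pathstart g) (pathstart h)
      - above (pathfinish g) (pathfinish h) + above (pathstart g) (pathfinish h))"
proof -
  let ?u = "pathstart g" and ?v = "pathfinish g" and ?w = "pathstart h" and ?w' = "pathfinish h"
  have ne: "?u \<noteq> ?w" "?u \<noteq> ?w'" "?v \<noteq> ?w" "?v \<noteq> ?w'" using assms by auto
  have "pair_index g h = ((Ln (?v - ?w) - Ln (?w - ?v)) - (Ln (?u - ?w) - Ln (?w - ?u)) - (Ln (?v - ?w') - Ln (?w' - ?v))
       + (Ln (?u - ?w') - Ln (?w' - ?u))) / (2 * of_real pi * \<i>)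
     + of_int (turn_number g ?w - turn_number g ?w' + turn_number h ?v - turn_number h ?u)"
    using assms by (simp add: pair_index_def winding_number_turn_number diff_divide_distrib add_divide_distrib)
  also have "((Ln (?v - ?w) - Ln (?w - ?v)) - (Ln (?u - ?w) - Ln (?w - ?u)) - (Ln (?v - ?w') - Ln (?w' - ?v))
       + (Ln (?u - ?w') - Ln (?w' - ?u))) / (2 * of_real pi * \<i>)
     = of_int (above ?v ?w - above ?u ?w - above ?v ?w' + above ?u ?w')"
    using ne by (simp add: Ln_diff_above field_simps)
  finally show ?thesis by simp
qed

section \<open>The parity obstruction for \<open>K\<^sub>3\<^sub>,\<^sub>3\<close>\<close>

lemma sum_list_parity_cong:
  assumes "\<And>e. e \<in> set xs \<Longrightarrow> even (f e - g e :: int)"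
  shows "even (sum_list (map f xs) - sum_list (map g xs))"
  using assms
proof (induction xs)
  case (Cons x xs)
  have "sum_list (map f (x # xs)) - sum_list (map g (x # xs)) = (f x - g x) + (sum_list (map f xs) - sum_list (map g xs))"
    by simp
  then show ?case using Cons by (metis dvd_add list.set_intros(1) list.set_intros(2))
qed simp

text \<open>\<open>P i j k\<close> and \<open>Q i j l\<close> collect the turning numbers of the walk \<open>a i \<rightarrow> b j\<close> around \<open>a k\<close> and \<open>b l\<close>.\<close>

lemma K33_parity:
  fixes T :: "nat \<Rightarrow> nat \<Rightarrow> nat \<Rightarrow> nat \<Rightarrow> int" and P Q :: "nat \<Rightarrow> nat \<Rightarrow> nat \<Rightarrow> int" and aa ab ba bb :: "nat \<Rightarrow> nat \<Rightarrow> int"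
  assumes T: "\<And>i j k l. \<lbrakk>i < 3; j < 3; k < 3; l < 3; i \<noteq> k; j \<noteq> l\<rbrakk> \<Longrightarrow>
      even (T i j k l - (P i j k + Q i j l + P k l i + Q k l j + aa i k + ab i l + ba j k + bb j l))"
    and ba: "\<And>i j. \<lbrakk>i < 3; j < 3\<rbrakk> \<Longrightarrow> ba j i = 1 - ab i j"
    and bb: "\<And>j l. \<lbrakk>j < l; l < 3\<rbrakk> \<Longrightarrow> bb l j = 1 - bb j l"
  shows "odd (\<Sum>(i,k)\<leftarrow>[(0,1),(0,2),(1,2)]. \<Sum>(j,l)\<leftarrow>[(0,1),(0,2),(1,0),(1,2),(2,0),(2,1)]. T i j k l)"
proof -
  \<comment> \<open>Increasing \<open>(i, k)\<close> against ordered \<open>(j, l)\<close>: the 18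
    unordered pairs of nonadjacent edges of \<open>K\<^sub>3\<^sub>,\<^sub>3\<close>, each listed
    once.\<close>
  let ?I = "[(0,1),(0,2),(1,2)] :: (nat \<times> nat) list"
  let ?J = "[(0,1),(0,2),(1,0),(1,2),(2,0),(2,1)] :: (nat \<times> nat) list"
  let ?R = "\<lambda>i j k l. P i j k + Q i j l + P k l i + Q k l j + aa i k + ab i l + ba j k + bb j l"
  have A: "even ((\<Sum>(i,k)\<leftarrow>?I. \<Sum>(j,l)\<leftarrow>?J. T i j k l) - (\<Sum>(i,k)\<leftarrow>?I. \<Sum>(j,l)\<leftarrow>?J. ?R i j k l))"
    unfolding case_prod_beta
  proof (intro sum_list_parity_cong)
    fix x y assume "x \<in> set ?I" "y \<in> set ?J"
    then have "fst x < 3 \<and> fst y < 3 \<and> snd x < 3 \<and> snd y < 3 \<and> fst x \<noteq> snd x \<and> fst y \<noteq> snd y" by auto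
    then show "even (T (fst x) (fst y) (snd x) (snd y) - ?R (fst x) (fst y) (snd x) (snd y))"
      by (intro T) auto
  qed
  have B: "odd (\<Sum>(i,k)\<leftarrow>?I. \<Sum>(j,l)\<leftarrow>?J. ?R i j k l)"
  proof -
    \<comment> \<open>Each \<open>P\<close> and \<open>Q\<close> term occurs twice. The odd
      remainder 9 comes from \<open>bb j l + bb l j = 1\<close>, once for each of the three pairs
      \<open>{j, l}\<close> and each of the three pairs \<open>{i, k}\<close>; the \<open>ba\<close>
      terms contribute the even number 18 and, modulo 2, cancel against the \<open>ab\<close>
      terms.\<close>
    have eq: "(\<Sum>(i,k)\<leftarrow>?I. \<Sum>(j,l)\<leftarrow>?J. ?R i j k l) = 2 * (
        (\<Sum>i\<leftarrow>[0,1,2]. \<Sum>j\<leftarrow>[0,1,2]. \<Sum>k\<leftarrow>[0,1,2]. (if k \<noteq> i then P i j k else 0) + (if k \<noteq> j then Q i j k else 0))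
         + 3 * (aa 0 1 + aa 0 2 + aa 1 2) + 2 * (ab 0 0 + ab 0 1 + ab 0 2)  + 9 - 2 * (ab 2 0 + ab 2 1 + ab 2 2)) + 9"
      by (simp add: ba bb)
    have "odd (2 * K + 9)" for K :: int by simp
    then show ?thesis unfolding eq .
  qed
  have "odd x" if "even (x - y)" "odd y" for x y :: int using that by presburger
  from this[OF A B] show ?thesis .
qed

text \<open>Planarity in a weak form: the paths may intersect themselves, and those with a common
  end may overlap. Disjoint nonadjacent paths have index zero, so all 18 terms vanish, against the
  odd total; disjointness also separates the endpoints, as the antisymmetry of \<open>above\<close>
  requires.\<close>

theorem no_K33_paths:
  fixes g :: "nat \<Rightarrow> nat \<Rightarrow> real \<Rightarrow> complex"
  assumes g: "\<And>i j. \<lbrakk>i < 3; j < 3\<rbrakk> \<Longrightarrow> path (g i j) \<and> pathstart (g i j) = a i \<and> pathfinish (g i j) = b j"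
    and disj: "\<And>i j k l. \<lbrakk>i < 3; j < 3; k < 3; l < 3; i \<noteq> k; j \<noteq> l\<rbrakk> \<Longrightarrow> path_image (g i j) \<inter> path_image (g k l) = {}"
  shows False
proof -
  have mem: "a i \<in> path_image (g i j)" "b j \<in> path_image (g i j)" if "i < 3" "j < 3" for i j
    using g[OF that] pathstart_in_path_image pathfinish_in_path_image by metis+
  have ne: "a i \<noteq> b j" if "i < 3" "j < 3" for i j
  proof -
    obtain k l :: nat where kl: "k < 3" "k \<noteq> i" "l < 3" "l \<noteq> j"
      by (metis One_nat_def Suc_lessI zero_neq_one numeral_3_eq_3 zero_less_Suc less_Suc_eq)
    have "path_image (g i l) \<inter> path_image (g k j) = {}" using disj that kl by auto
    moreover have "a i \<in> path_image (g i l)" "b j \<in> path_image (g k j)" using mem that kl by auto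
    ultimately show ?thesis by (metis disjoint_iff)
  qed
  have neb: "b j \<noteq> b l" if "j < 3" "l < 3" "j \<noteq> l" for j l
  proof -
    have "path_image (g 0 j) \<inter> path_image (g 1 l) = {}" using disj that by auto
    moreover have "b j \<in> path_image (g 0 j)" "b l \<in> path_image (g 1 l)" using mem that by auto
    ultimately show ?thesis by (metis disjoint_iff)
  qed
  have "odd (\<Sum>(i,k)\<leftarrow>[(0::nat,1::nat),(0,2),(1,2)]. \<Sum>(j,l)\<leftarrow>[(0::nat,1::nat),(0,2),(1,0),(1,2),(2,0),(2,1)]. (0::int))"
  proof (rule K33_parity[where P = "\<lambda>i j k. turn_number (g i j) (a k)" and Q = "\<lambda>i j l. turn_number (g i j) (b l)"
        and aa = "\<lambda>i k. above (a i) (a k)" and ab = "\<lambda>i l. above (a i) (b l)" and ba = "\<lambda>j k. above (b j) (a k)"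
        and bb = "\<lambda>j l. above (b j) (b l)" and T = "\<lambda>_ _ _ _. 0"])
    fix i j k l :: nat assume ijkl: "i < 3" "j < 3" "k < 3" "l < 3" "i \<noteq> k" "j \<noteq> l"
    have d: "path_image (g i j) \<inter> path_image (g k l) = {}" using disj ijkl by auto
    have m: "a i \<in> path_image (g i j)" "b j \<in> path_image (g i j)" "a k \<in> path_image (g k l)" "b l \<in> path_image (g k l)"
      using mem ijkl by auto
    have "pair_index (g i j) (g k l) = 0"
      using g ijkl d by (intro pair_index_disjoint) auto
    moreover have "pair_index (g i j) (g k l) = of_int (turn_number (g i j) (a k) - turn_number (g i j) (b l)
      + turn_number (g k l) (b j) - turn_number (g k l) (a i)
      + above (b j) (a k) - above (a i) (a k) - above (b j) (b l) + above (a i) (b l))"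
      using pair_index_formula[of "g i j" "g k l"] g ijkl d m by auto
    ultimately have "of_int (turn_number (g i j) (a k) - turn_number (g i j) (b l)
      + turn_number (g k l) (b j) - turn_number (g k l) (a i)
      + above (b j) (a k) - above (a i) (a k) - above (b j) (b l) + above (a i) (b l)) = (of_int 0 :: complex)"
      by (simp only: of_int_0)
    then have "turn_number (g i j) (a k) - turn_number (g i j) (b l)
      + turn_number (g k l) (b j) - turn_number (g k l) (a i)
      + above (b j) (a k) - above (a i) (a k) - above (b j) (b l) + above (a i) (b l) = 0"
      by (simp only: of_int_eq_iff)
    moreover have "even (0 - (t1 + t2 + t4 + t3 + t6 + t8 + t5 + t7))" if "t1 - t2 + t3 - t4 + t5 - t6 - t7 + t8 = 0"
      for t1 t2 t3 t4 t5 t6 t7 t8 :: int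
    proof -
      have "0 - (t1 + t2 + t4 + t3 + t6 + t8 + t5 + t7) = 2 * - (t2 + t4 + t6 + t7)" using that by (simp add: algebra_simps)
      then show ?thesis by (metis dvd_triv_left)
    qed
    ultimately show "even (0 - (turn_number (g i j) (a k) + turn_number (g i j) (b l) + turn_number (g k l) (a i) + turn_number (g k l) (b j)
        + above (a i) (a k) + above (a i) (b l) + above (b j) (a k) + above (b j) (b l)))"
      by blast
  next
    show "above (b j) (a i) = 1 - above (a i) (b j)" if "i < 3" "j < 3" for i j
      using above_add[OF ne[OF that]] by linarith
    show "above (b l) (b j) = 1 - above (b j) (b l)" if "j < l" "l < 3" for j l
      using above_add[of "b j" "b l"] neb[of j l] that by linarith
  qed
  then show False by simp
qed

section \<open>Sums over the edges of a walk modulo 2\<close>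

fun walk_edges :: "'a list \<Rightarrow> 'a set list" where
  "walk_edges (x # y # xs) = {x, y} # walk_edges (y # xs)"
| "walk_edges _ = []"

lemma length_walk_edges: "length (walk_edges xs) = length xs - 1"
  by (induction xs rule: walk_edges.induct) auto

lemma walk_edges_subset: "e \<in> set (walk_edges xs) \<Longrightarrow> e \<subseteq> set xs"
  by (induction xs rule: walk_edges.induct) auto

text \<open>Every inner vertex ends two consecutive edges, so modulo 2 only the first and the last
  vertex survive. The condition \<open>card e = 2\<close> excludes immediate repetitions, for which
  the sum over the set would count one end only.\<close>

lemma walk_edges_telescope:
  fixes \<psi> :: "'a \<Rightarrow> int"
  assumes "xs \<noteq> []" "\<And>e. e \<in> set (walk_edges xs) \<Longrightarrow> card e = 2"
  shows "even ((\<Sum>e\<leftarrow>walk_edges xs. \<Sum>p\<in>e. \<psi> p) - (\<psi> (hd xs) + \<psi> (last xs)))"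
  using assms
proof (induction xs rule: walk_edges.induct)
  case (1 x y xs)
  have "x \<noteq> y" using 1(3)[of "{x,y}"] by auto
  moreover have "even ((\<Sum>e\<leftarrow>walk_edges (y # xs). \<Sum>p\<in>e. \<psi> p) - (\<psi> y + \<psi> (last (y # xs))))"
    using 1 by auto
  moreover have "(\<Sum>e\<leftarrow>walk_edges (x # y # xs). \<Sum>p\<in>e. \<psi> p) - (\<psi> (hd (x # y # xs)) + \<psi> (last (x # y # xs)))
     = ((\<Sum>e\<leftarrow>walk_edges (y # xs). \<Sum>p\<in>e. \<psi> p) - (\<psi> y + \<psi> (last (y # xs)))) + 2 * \<psi> y"
    using \<open>x \<noteq> y\<close> by simp
  ultimately show ?case by (metis dvd_add dvd_triv_left)
qed auto

text \<open>The crossing parity of two edges is a sum of terms at their endpoints, and telescoping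
  in each walk separately leaves the expression for a single pair of edges with the ends of the
  walks, the sums of \<open>\<phi>\<close> over the walks taking the place of its turning
  numbers.\<close>

lemma walk_pair_parity:
  fixes x :: "'a set \<Rightarrow> 'a set \<Rightarrow> int" and \<phi> :: "'a set \<Rightarrow> 'a \<Rightarrow> int" and ord :: "'a \<Rightarrow> 'a \<Rightarrow> int"
  assumes x: "\<And>e f. \<lbrakk>e \<in> E; f \<in> E; e \<inter> f = {}\<rbrakk> \<Longrightarrow>
       even (x e f - ((\<Sum>q\<in>f. \<phi> e q) + (\<Sum>p\<in>e. \<phi> f p) + (\<Sum>p\<in>e. \<Sum>q\<in>f. ord p q)))"
    and E: "\<And>e. e \<in> E \<Longrightarrow> card e = 2"
    and w: "w \<noteq> []" "w' \<noteq> []" "set (walk_edges w) \<subseteq> E" "set (walk_edges w') \<subseteq> E" "set w \<inter> set w' = {}"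
  shows "even ((\<Sum>e\<leftarrow>walk_edges w. \<Sum>f\<leftarrow>walk_edges w'. x e f)
     - ((\<Sum>e\<leftarrow>walk_edges w. \<phi> e (hd w')) + (\<Sum>e\<leftarrow>walk_edges w. \<phi> e (last w'))
      + (\<Sum>f\<leftarrow>walk_edges w'. \<phi> f (hd w)) + (\<Sum>f\<leftarrow>walk_edges w'. \<phi> f (last w))
      + ord (hd w) (hd w') + ord (hd w) (last w') + ord (last w) (hd w') + ord (last w) (last w')))"
proof -
  let ?es = "walk_edges w" and ?fs = "walk_edges w'"
  have card: "card e = 2" if "e \<in> set ?es \<or> e \<in> set ?fs" for e using that w E by auto
  have disj: "e \<inter> f = {}" if "e \<in> set ?es" "f \<in> set ?fs" for e f
    using walk_edges_subset[OF that(1)] walk_edges_subset[OF that(2)] w(5) by auto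
  have A: "even ((\<Sum>e\<leftarrow>?es. \<Sum>f\<leftarrow>?fs. x e f)
       - (\<Sum>e\<leftarrow>?es. \<Sum>f\<leftarrow>?fs. (\<Sum>q\<in>f. \<phi> e q) + (\<Sum>p\<in>e. \<phi> f p) + (\<Sum>p\<in>e. \<Sum>q\<in>f. ord p q)))"
    using x w disj by (intro sum_list_parity_cong) blast
  have B: "(\<Sum>e\<leftarrow>?es. \<Sum>f\<leftarrow>?fs. (\<Sum>q\<in>f. \<phi> e q) + (\<Sum>p\<in>e. \<phi> f p) + (\<Sum>p\<in>e. \<Sum>q\<in>f. ord p q))
      = (\<Sum>e\<leftarrow>?es. \<Sum>f\<leftarrow>?fs. \<Sum>q\<in>f. \<phi> e q) + (\<Sum>e\<leftarrow>?es. \<Sum>f\<leftarrow>?fs. \<Sum>p\<in>e. \<phi> f p)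
       + (\<Sum>e\<leftarrow>?es. \<Sum>f\<leftarrow>?fs. \<Sum>p\<in>e. \<Sum>q\<in>f. ord p q)"
    by (simp add: sum_list_addf)
  have C: "even ((\<Sum>e\<leftarrow>?es. \<Sum>f\<leftarrow>?fs. \<Sum>q\<in>f. \<phi> e q) - (\<Sum>e\<leftarrow>?es. \<phi> e (hd w') + \<phi> e (last w')))"
    by (intro sum_list_parity_cong walk_edges_telescope) (use w card in auto)
  have D: "even ((\<Sum>e\<leftarrow>?es. \<Sum>f\<leftarrow>?fs. \<Sum>p\<in>e. \<phi> f p) - (\<Sum>f\<leftarrow>?fs. \<phi> f (hd w) + \<phi> f (last w)))"
  proof -
    have sw: "(\<Sum>e\<leftarrow>es. \<Sum>f\<leftarrow>fs. h e f) = (\<Sum>f\<leftarrow>fs. \<Sum>e\<leftarrow>es. h e f :: int)" for es fs :: "'a set list" and h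
      by (induction es) (auto simp: sum_list_addf)
    show ?thesis unfolding sw[of _ ?fs]
      by (intro sum_list_parity_cong walk_edges_telescope) (use w card in auto)
  qed
  have F: "even ((\<Sum>e\<leftarrow>?es. \<Sum>f\<leftarrow>?fs. \<Sum>p\<in>e. \<Sum>q\<in>f. ord p q)
       - (ord (hd w) (hd w') + ord (hd w) (last w') + ord (last w) (hd w') + ord (last w) (last w')))"
  proof -
    have sw: "(\<Sum>f\<leftarrow>fs. \<Sum>p\<in>A. h p f) = (\<Sum>p\<in>A. \<Sum>f\<leftarrow>fs. h p f :: int)" for fs :: "'a set list" and A :: "'a set" and h
      by (induction fs) (auto simp: sum.distrib)
    have 1: "even ((\<Sum>e\<leftarrow>?es. \<Sum>p\<in>e. \<Sum>f\<leftarrow>?fs. \<Sum>q\<in>f. ord p q) - ((\<Sum>f\<leftarrow>?fs. \<Sum>q\<in>f. ord (hd w) q) + (\<Sum>f\<leftarrow>?fs. \<Sum>q\<in>f. ord (last w) q)))"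
      by (rule walk_edges_telescope[where \<psi> = "\<lambda>p. \<Sum>f\<leftarrow>?fs. \<Sum>q\<in>f. ord p q"]) (use w card in auto)
    have 2: "even ((\<Sum>f\<leftarrow>?fs. \<Sum>q\<in>f. ord p q) - (ord p (hd w') + ord p (last w')))" for p
      by (rule walk_edges_telescope) (use w card in auto)
    have 3: "even (A - (p + q + r' + s'))" if "even (A - (B + C))" "even (B - (p + q))" "even (C - (r' + s'))"
      for A B C p q r' s' :: int
    proof -
      have "A - (p + q + r' + s') = (A - (B + C)) + (B - (p + q)) + (C - (r' + s'))" by simp
      then show ?thesis using that by (metis dvd_add)
    qed
    show ?thesis unfolding sw by (rule 3[OF 1 2 2])
  qed
  have G: "even (X - (p + q + r' + s' + t + u + v + z))"
    if "even (X - Y)" "Y = A + B + C" "even (A - (p + q))" "even (B - (r' + s'))" "even (C - (t + u + v + z))"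
    for X Y A B C p q r' s' t u v z :: int
  proof -
    have "X - (p + q + r' + s' + t + u + v + z) = (X - Y) + (A - (p + q)) + (B - (r' + s')) + (C - (t + u + v + z))"
      using that(2) by simp
    then show ?thesis using that by (metis dvd_add)
  qed
  show ?thesis
    by (rule G[OF A B C[unfolded sum_list_addf] D[unfolded sum_list_addf] F])
qed

section \<open>Crossing parity in simple topological graphs\<close>

locale simple_tg =
  fixes V :: "complex set" and E :: "complex set set" and curve :: "complex set \<Rightarrow> real \<Rightarrow> complex"
  assumes stg: "simple_topological_graph V E curve"
begin

abbreviation img :: "complex set \<Rightarrow> complex set" where "img e \<equiv> path_image (curve e)"
abbreviation crossing :: "complex set \<Rightarrow> complex set \<Rightarrow> bool" where "crossing \<equiv> edges_cross curve"

lemma finite_V: "finite V"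
  using stg by (simp add: simple_topological_graph_def topological_graph_def)

lemma edgeD:
  assumes "e \<in> E"
  shows "e \<subseteq> V" "card e = 2" "arc (curve e)" "{pathstart (curve e), pathfinish (curve e)} = e" "img e \<inter> V = e"
  using stg assms by (auto simp: simple_topological_graph_def topological_graph_def)

lemma finite_E: "finite E"
  using finite_V edgeD(1) by (meson Pow_iff finite_Pow_iff finite_subset subsetI)

lemma finite_edge: "e \<in> E \<Longrightarrow> finite e"
  using edgeD(1) finite_V by (meson finite_subset)

lemma img_unique:
  assumes "e \<in> E" "f \<in> E" "e \<noteq> f" "x \<in> img e" "x \<in> img f" "y \<in> img e" "y \<in> img f"
  shows "x = y"
  using stg assms by (auto simp: simple_topological_graph_def)

lemma crossing_iff:
  "e \<in> E \<Longrightarrow> f \<in> E \<Longrightarrow> crossing e f \<longleftrightarrow> (\<exists>p. p \<in> img e \<and> p \<in> img f \<and> p \<notin> V)"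
  using edgeD(5)[of e] edgeD(5)[of f] unfolding edges_cross_def edge_interior_def by auto

lemma crossing_sym: "crossing e f \<longleftrightarrow> crossing f e"
  by (auto simp: edges_cross_def)

text \<open>Simplicity makes two crossing edges meet in exactly one point, so their index is odd by
  the local computation; noncrossing edges without a common end are disjoint and have index
  0.\<close>

lemma crossing_parity:
  assumes e: "e \<in> E" and f: "f \<in> E" and ef: "e \<inter> f = {}"
  shows "even ((if crossing e f then 1 else 0) - ((\<Sum>q\<in>f. turn_number (curve e) q) + (\<Sum>p\<in>e. turn_number (curve f) p)
      + (\<Sum>p\<in>e. \<Sum>q\<in>f. above p q)))"
proof -
  let ?g = "curve e" and ?h = "curve f"
  have ne: "e \<noteq> f" using ef edgeD(2)[OF e] by auto
  have arc: "arc ?g" "arc ?h" using edgeD e f by auto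
  have path: "path ?g" "path ?h" using arc by (auto simp: arc_def)
  have ends: "e = {pathstart ?g, pathfinish ?g}" "f = {pathstart ?h, pathfinish ?h}" using edgeD(4) e f by auto
  have d: "pathstart ?g \<noteq> pathfinish ?g" "pathstart ?h \<noteq> pathfinish ?h" using arc arc_distinct_ends by metis+
  have off: "q \<notin> img e" if "q \<in> f" for q using that edgeD(1)[OF f] edgeD(5)[OF e] ef by auto
  have off': "q \<notin> img f" if "q \<in> e" for q using that edgeD(1)[OF e] edgeD(5)[OF f] ef by auto
  have idx: "pair_index ?g ?h = of_int (turn_number ?g (pathstart ?h) - turn_number ?g (pathfinish ?h)
      + turn_number ?h (pathfinish ?g) - turn_number ?h (pathstart ?g)
      + above (pathfinish ?g) (pathstart ?h) - above (pathstart ?g) (pathstart ?h)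
      - above (pathfinish ?g) (pathfinish ?h) + above (pathstart ?g) (pathfinish ?h))" (is "_ = of_int ?N")
    using path off off' ends by (intro pair_index_formula) blast+
  have 0: "even ((if crossing e f then 1 else 0) - ?N)"
  proof (cases "crossing e f")
    case False
    have "img e \<inter> img f = {}"
    proof (rule ccontr)
      assume "img e \<inter> img f \<noteq> {}"
      then obtain p where p: "p \<in> img e" "p \<in> img f" by blast
      then have "p \<in> V" using False crossing_iff e f by blast
      then show False using p edgeD(5)[OF e] edgeD(5)[OF f] ef by blast
    qed
    then have "pair_index ?g ?h = 0" using path by (intro pair_index_disjoint)
    then have "of_int ?N = (of_int 0 :: complex)" unfolding idx by (simp only: of_int_0)
    then have "?N = 0" by (simp only: of_int_eq_iff)
    then show ?thesis using False by simp
  next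
    case True
    then obtain p where p: "p \<in> img e" "p \<in> img f" "p \<notin> V" using crossing_iff e f by blast
    have "img e \<inter> img f = {p}" using p img_unique[OF e f ne] by blast
    moreover have "proper_crossing_at (img e) (img f) p"
    proof -
      have "\<forall>e\<in>E. \<forall>f\<in>E. e \<noteq> f \<longrightarrow> (\<forall>p\<in>edge_interior curve e \<inter> edge_interior curve f. proper_crossing_at (img e) (img f) p)"
        using stg by (simp add: simple_topological_graph_def topological_graph_def)
      moreover have "p \<in> edge_interior curve e \<inter> edge_interior curve f"
        using p edgeD(1)[OF e] edgeD(1)[OF f] by (auto simp: edge_interior_def)
      ultimately show ?thesis using e f ne by metis
    qed
    moreover have "p \<notin> {pathstart ?g, pathfinish ?g}" "p \<notin> {pathstart ?h, pathfinish ?h}"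
      using p ends edgeD(1)[OF e] edgeD(1)[OF f] by auto
    ultimately obtain n :: int where "pair_index ?g ?h = of_int (2 * n + 1)"
      using pair_index_crossing arc by blast
    then have "?N = 2 * n + 1" unfolding idx by (simp only: of_int_eq_iff)
    then show ?thesis using True by simp
  qed
  have 1: "(\<Sum>q\<in>f. turn_number ?g q) = turn_number ?g (pathstart ?h) + turn_number ?g (pathfinish ?h)"
    using d by (subst ends(2)) simp
  have 2: "(\<Sum>p\<in>e. turn_number ?h p) = turn_number ?h (pathstart ?g) + turn_number ?h (pathfinish ?g)"
    using d by (subst ends(1)) simp
  have 3: "(\<Sum>p\<in>e. \<Sum>q\<in>f. above p q) = above (pathstart ?g) (pathstart ?h) + above (pathstart ?g) (pathfinish ?h)
     + above (pathfinish ?g) (pathstart ?h) + above (pathfinish ?g) (pathfinish ?h)"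
    using d by (subst ends(1), subst ends(2)) simp
  have 4: "even (X - (S1 + S2 + S3))"
    if "even (X - (t1 - t2 + t3 - t4 + t5 - t6 - t7 + t8))" "S1 = t1 + t2" "S2 = t4 + t3" "S3 = t6 + t8 + t5 + t7"
    for X S1 S2 S3 t1 t2 t3 t4 t5 t6 t7 t8 :: int
  proof -
    have "X - (S1 + S2 + S3) = (X - (t1 - t2 + t3 - t4 + t5 - t6 - t7 + t8)) + 2 * - (t2 + t4 + t6 + t7)"
      using that(2-) by (simp add: algebra_simps)
    then show ?thesis using that(1) by (metis dvd_add dvd_triv_left)
  qed
  show ?thesis by (rule 4[OF 0 1 2 3])
qed

text \<open>If no two edges from nonadjacent walks were disjoint, all of them would cross, as
  vertex-disjoint walks leave no shared end. Each of the 18 pairs of walks would then have odd times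
  odd many crossings, an even total, contrary to the parity identity.\<close>

theorem K33_walks_disjoint_pair:
  fixes w :: "nat \<Rightarrow> nat \<Rightarrow> complex list"
  assumes w: "\<And>i j. \<lbrakk>i < 3; j < 3\<rbrakk> \<Longrightarrow> w i j \<noteq> [] \<and> hd (w i j) = a i \<and> last (w i j) = b j
        \<and> even (length (w i j)) \<and> set (walk_edges (w i j)) \<subseteq> E"
    and disj: "\<And>i j k l. \<lbrakk>i < 3; j < 3; k < 3; l < 3; i \<noteq> k; j \<noteq> l\<rbrakk> \<Longrightarrow> set (w i j) \<inter> set (w k l) = {}"
  shows "\<exists>i j k l e f. i < 3 \<and> j < 3 \<and> k < 3 \<and> l < 3 \<and> i \<noteq> k \<and> j \<noteq> l \<and> e \<in> set (walk_edges (w i j))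
       \<and> f \<in> set (walk_edges (w k l)) \<and> edges_disjoint curve e f"
proof (rule ccontr)
  assume none: "\<not> ?thesis"
  let ?x = "\<lambda>e f. if crossing e f then 1 else 0 :: int"
  let ?T = "\<lambda>i j k l. \<Sum>e\<leftarrow>walk_edges (w i j). \<Sum>f\<leftarrow>walk_edges (w k l). ?x e f"
  have mem: "a i \<in> set (w i j)" "b j \<in> set (w i j)" if "i < 3" "j < 3" for i j
    using w[OF that] hd_in_set last_in_set by metis+
  have ne: "a i \<noteq> b j" if "i < 3" "j < 3" for i j
  proof -
    obtain k l :: nat where kl: "k < 3" "k \<noteq> i" "l < 3" "l \<noteq> j"
      by (metis One_nat_def Suc_lessI zero_neq_one numeral_3_eq_3 zero_less_Suc less_Suc_eq)
    have "set (w i l) \<inter> set (w k j) = {}" using disj that kl by auto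
    moreover have "a i \<in> set (w i l)" "b j \<in> set (w k j)" using mem that kl by auto
    ultimately show ?thesis by (metis disjoint_iff)
  qed
  have neb: "b j \<noteq> b l" if "j < 3" "l < 3" "j \<noteq> l" for j l
  proof -
    have "set (w 0 j) \<inter> set (w 1 l) = {}" using disj that by auto
    moreover have "b j \<in> set (w 0 j)" "b l \<in> set (w 1 l)" using mem that by auto
    ultimately show ?thesis by (metis disjoint_iff)
  qed
  have "odd (\<Sum>(i,k)\<leftarrow>[(0::nat,1::nat),(0,2),(1,2)]. \<Sum>(j,l)\<leftarrow>[(0::nat,1::nat),(0,2),(1,0),(1,2),(2,0),(2,1)]. ?T i j k l)"
  proof (rule K33_parity[where P = "\<lambda>i j k. \<Sum>e\<leftarrow>walk_edges (w i j). turn_number (curve e) (a k)"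
        and Q = "\<lambda>i j l. \<Sum>e\<leftarrow>walk_edges (w i j). turn_number (curve e) (b l)"
        and aa = "\<lambda>i k. above (a i) (a k)" and ab = "\<lambda>i l. above (a i) (b l)" and ba = "\<lambda>j k. above (b j) (a k)"
        and bb = "\<lambda>j l. above (b j) (b l)" and T = ?T])
    fix i j k l :: nat assume ijkl: "i < 3" "j < 3" "k < 3" "l < 3" "i \<noteq> k" "j \<noteq> l"
    show "even (?T i j k l - ((\<Sum>e\<leftarrow>walk_edges (w i j). turn_number (curve e) (a k)) + (\<Sum>e\<leftarrow>walk_edges (w i j). turn_number (curve e) (b l))
       + (\<Sum>e\<leftarrow>walk_edges (w k l). turn_number (curve e) (a i)) + (\<Sum>e\<leftarrow>walk_edges (w k l). turn_number (curve e) (b j))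
        + above (a i) (a k) + above (a i) (b l) + above (b j) (a k) + above (b j) (b l)))"
      using walk_pair_parity[where E = E and x = ?x and \<phi> = "\<lambda>e. turn_number (curve e)" and ord = above
          and w = "w i j" and w' = "w k l"] crossing_parity edgeD(2) w ijkl disj by simp
  next
    show "above (b j) (a i) = 1 - above (a i) (b j)" if "i < 3" "j < 3" for i j
      using above_add[OF ne[OF that]] by linarith
    show "above (b l) (b j) = 1 - above (b j) (b l)" if "j < l" "l < 3" for j l
      using above_add[of "b j" "b l"] neb[of j l] that by linarith
  qed
  moreover have "odd (?T i j k l)" if ijkl: "i < 3" "j < 3" "k < 3" "l < 3" "i \<noteq> k" "j \<noteq> l" for i j k l
  proof -
    have "?x e f = 1" if e: "e \<in> set (walk_edges (w i j))" and f: "f \<in> set (walk_edges (w k l))" for e f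
    proof -
      have E: "e \<in> E" "f \<in> E" using e f w ijkl by blast+
      have "\<not> edges_disjoint curve e f" using none e f ijkl by blast
      then obtain p where p: "p \<in> img e" "p \<in> img f" by (auto simp: edges_disjoint_def)
      have "e \<inter> f = {}" using walk_edges_subset[OF e] walk_edges_subset[OF f] disj ijkl by blast
      then have "p \<notin> V" using p edgeD(5)[OF E(1)] edgeD(5)[OF E(2)] by blast
      then show ?thesis using p crossing_iff E by auto
    qed
    then have "?T i j k l = (\<Sum>e\<leftarrow>walk_edges (w i j). \<Sum>f\<leftarrow>walk_edges (w k l). 1)"
      by (intro arg_cong[where f = sum_list] map_cong refl) auto
    also have "\<dots> = int (length (walk_edges (w i j))) * int (length (walk_edges (w k l)))"
      by (simp add: sum_list_triv)
    finally have "?T i j k l = int (length (walk_edges (w i j))) * int (length (walk_edges (w k l)))" .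
    moreover have "odd (length (walk_edges (w i j)))" "odd (length (walk_edges (w k l)))"
      using w[OF ijkl(1,2)] w[OF ijkl(3,4)] by (auto simp: length_walk_edges)
    ultimately show ?thesis by simp
  qed
  ultimately show False by simp
qed

end

section \<open>Complete minors and plane graphs\<close>

definition r_connected :: "('a \<Rightarrow> 'a \<Rightarrow> bool) \<Rightarrow> 'a set \<Rightarrow> bool" where
  "r_connected r S \<longleftrightarrow> S \<noteq> {} \<and> (\<forall>x\<in>S. \<forall>y\<in>S. (x, y) \<in> {(u, v). u \<in> S \<and> v \<in> S \<and> r u v}\<^sup>*)"

definition touching :: "('a \<Rightarrow> 'a \<Rightarrow> bool) \<Rightarrow> 'a set \<Rightarrow> 'a set \<Rightarrow> bool" where
  "touching r A B \<longleftrightarrow> (\<exists>x\<in>A. \<exists>y\<in>B. r x y)"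

definition bags :: "('a \<Rightarrow> 'a \<Rightarrow> bool) \<Rightarrow> 'a set set \<Rightarrow> bool" where
  "bags r \<B> \<longleftrightarrow> finite \<B> \<and> (\<forall>A\<in>\<B>. \<forall>B\<in>\<B>. A \<noteq> B \<longrightarrow> A \<inter> B = {}) \<and> (\<forall>B\<in>\<B>. r_connected r B)"

text \<open>Ordered pairs, so that the quotient by the number of bags is the average degree of the
  contracted graph.\<close>

definition bag_pairs :: "('a \<Rightarrow> 'a \<Rightarrow> bool) \<Rightarrow> 'a set set \<Rightarrow> ('a set \<times> 'a set) set" where
  "bag_pairs r \<B> = {(A, B). A \<in> \<B> \<and> B \<in> \<B> \<and> A \<noteq> B \<and> touching r A B}"

lemma r_connected_Un:
  assumes A: "r_connected r A" and B: "r_connected r B" and t: "touching r A B" "touching r B A"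
  shows "r_connected r (A \<union> B)"
proof -
  let ?R = "\<lambda>S. {(u, v). u \<in> S \<and> v \<in> S \<and> r u v}"
  have mono: "(x, y) \<in> (?R (A \<union> B))\<^sup>*" if "(x, y) \<in> (?R A)\<^sup>* \<or> (x, y) \<in> (?R B)\<^sup>*" for x y
    using that rtrancl_mono[of "?R A" "?R (A \<union> B)"] rtrancl_mono[of "?R B" "?R (A \<union> B)"] by blast
  have cr: "(x, y) \<in> (?R (C \<union> D))\<^sup>*"
    if C: "r_connected r C" and D: "r_connected r D" and t: "touching r C D" and xy: "x \<in> C" "y \<in> D"
      and CD: "C \<union> D = A \<union> B" for C D x y
  proof -
    obtain u v where uv: "u \<in> C" "v \<in> D" "r u v" using t by (auto simp: touching_def)
    have "(x, u) \<in> (?R (C \<union> D))\<^sup>*" using C xy uv rtrancl_mono[of "?R C" "?R (C \<union> D)"] by (auto simp: r_connected_def)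
    also have "(u, v) \<in> ?R (C \<union> D)" using uv by auto
    also have "(v, y) \<in> (?R (C \<union> D))\<^sup>*" using D xy uv rtrancl_mono[of "?R D" "?R (C \<union> D)"] by (auto simp: r_connected_def)
    finally show ?thesis .
  qed
  have "(x, y) \<in> (?R (A \<union> B))\<^sup>*" if "x \<in> A \<union> B" "y \<in> A \<union> B" for x y
    using that cr[OF A B t(1), of x y] cr[OF B A t(2), of x y] mono[of x y] A B
    by (auto simp: r_connected_def Un_commute)
  then show ?thesis using A by (auto simp: r_connected_def)
qed

text \<open>Average degree at least \<open>2 ^ t\<close> forces a complete minor with
  \<open>t + 1\<close> bags. In a contraction with as few bags as possible that keeps the density,
  merging two touching bags must lose many pairs, so the two have many common neighbours; the
  neighbourhood of one bag is then dense enough for the induction hypothesis, and that bag completes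
  the minor.\<close>

lemma complete_minor:
  assumes sym: "symp r" and "bags r \<B>" "\<B> \<noteq> {}" "2 ^ t * card \<B> \<le> card (bag_pairs r \<B>)"
  shows "\<exists>\<M>. bags r \<M> \<and> card \<M> = Suc t \<and> (\<forall>A\<in>\<M>. \<forall>B\<in>\<M>. A \<noteq> B \<longrightarrow> touching r A B)
     \<and> (\<forall>M\<in>\<M>. M \<subseteq> \<Union>\<B> \<and> (\<exists>B\<in>\<B>. B \<subseteq> M))"
  using assms(2-)
proof (induction t arbitrary: \<B>)
  case 0
  then obtain B where B: "B \<in> \<B>" by blast
  then show ?case using 0 by (intro exI[of _ "{B}"]) (auto simp: bags_def)
next
  case (Suc t)
  have tsym: "touching r A B \<longleftrightarrow> touching r B A" for A B
    using sym by (auto simp: touching_def symp_def)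
  have tsymD: "touching r A B \<Longrightarrow> touching r B A" for A B using tsym by blast
  \<comment> \<open>The inclusion clauses confine the minor to the given bags and put a given bag
    into each of its bags; applied to the neighbours of \<open>B\<close> below, they make every new
    bag disjoint from \<open>B\<close> and touching it.\<close>
  define Good where "Good \<C> \<longleftrightarrow> bags r \<C> \<and> \<C> \<noteq> {} \<and> (\<forall>M\<in>\<C>. M \<subseteq> \<Union>\<B> \<and> (\<exists>B\<in>\<B>. B \<subseteq> M))
       \<and> 2 ^ Suc t * card \<C> \<le> card (bag_pairs r \<C>)" for \<C>
  have "Good \<B>" using Suc by (auto simp: Good_def)
  then obtain \<C> where C: "Good \<C>" and min: "\<And>\<D>. Good \<D> \<Longrightarrow> card \<C> \<le> card \<D>"
    using ex_has_least_nat[of Good \<B> card] by blast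
  have bC: "bags r \<C>" and neC: "\<C> \<noteq> {}" and subC: "\<And>M. M \<in> \<C> \<Longrightarrow> M \<subseteq> \<Union>\<B> \<and> (\<exists>B\<in>\<B>. B \<subseteq> M)"
    and cC: "2 ^ Suc t * card \<C> \<le> card (bag_pairs r \<C>)" using C by (auto simp: Good_def)
  have finC: "finite \<C>" and disjC: "\<And>A B. A \<in> \<C> \<Longrightarrow> B \<in> \<C> \<Longrightarrow> A \<noteq> B \<Longrightarrow> A \<inter> B = {}"
    and conC: "\<And>B. B \<in> \<C> \<Longrightarrow> r_connected r B" using bC by (auto simp: bags_def)
  have neB: "B \<noteq> {}" if "B \<in> \<C>" for B using conC[OF that] by (auto simp: r_connected_def)
  have fp: "finite (bag_pairs r \<A>)" if "finite \<A>" for \<A>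
    by (rule finite_subset[of _ "\<A> \<times> \<A>"]) (use that in \<open>auto simp: bag_pairs_def\<close>)
  define N where "N B = {D \<in> \<C>. D \<noteq> B \<and> touching r D B}" for B
  have common: "2 ^ t \<le> card (N A \<inter> N B)" if AB: "A \<in> \<C>" "B \<in> \<C>" "A \<noteq> B" "touching r A B" for A B
  proof -
    define \<R> where "\<R> = \<C> - {A, B}"
    define NA where "NA = {D \<in> \<R>. touching r D A}"
    define NB where "NB = {D \<in> \<R>. touching r D B}"
    define \<D> where "\<D> = insert (A \<union> B) \<R>"
    have finR: "finite \<R>" "finite NA" "finite NB" using finC by (auto simp: \<R>_def NA_def NB_def)
    have notin: "A \<union> B \<notin> \<C>"
      using disjC[of "A \<union> B" A] disjC[of "A \<union> B" B] neB AB by blast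
    have cardD: "card \<D> = card \<C> - 1"
    proof -
      have "card \<R> = card \<C> - 2" using AB finC by (simp add: \<R>_def card_Diff_subset)
      moreover have "card \<C> \<ge> 2" using AB finC card_mono[of \<C> "{A,B}"] by auto
      moreover have "card \<D> = Suc (card \<R>)" using notin finR by (simp add: \<D>_def \<R>_def)
      ultimately show ?thesis by simp
    qed
    have bD: "bags r \<D>"
      unfolding bags_def
    proof (intro conjI ballI impI)
      show "finite \<D>" using finR by (simp add: \<D>_def)
      show "X \<inter> Y = {}" if XY: "X \<in> \<D>" "Y \<in> \<D>" "X \<noteq> Y" for X Y
      proof -
        have R: "Z \<inter> (A \<union> B) = {}" if "Z \<in> \<R>" for Z
          using that disjC[of Z A] disjC[of Z B] AB(1,2) by (auto simp: \<R>_def)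
        have "X \<inter> Y = {}" if "X \<in> \<R>" "Y \<in> \<R>" using that disjC XY(3) by (auto simp: \<R>_def)
        then show ?thesis using XY R[of X] R[of Y] by (auto simp: \<D>_def)
      qed
      show "r_connected r X" if "X \<in> \<D>" for X
      proof (cases "X = A \<union> B")
        case True
        then show ?thesis using r_connected_Un[OF conC[OF AB(1)] conC[OF AB(2)] AB(4)] AB(4) tsym by simp
      next
        case False
        then show ?thesis using that conC by (auto simp: \<D>_def \<R>_def)
      qed
    qed
    have "\<not> 2 ^ Suc t * card \<D> \<le> card (bag_pairs r \<D>)"
    proof
      assume "2 ^ Suc t * card \<D> \<le> card (bag_pairs r \<D>)"
      moreover have "M \<subseteq> \<Union>\<B> \<and> (\<exists>B\<in>\<B>. B \<subseteq> M)" if "M \<in> \<D>" for M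
      proof (cases "M = A \<union> B")
        case True
        then show ?thesis using subC[OF AB(1)] subC[OF AB(2)] by blast
      next
        case False
        then show ?thesis using that subC by (auto simp: \<D>_def \<R>_def)
      qed
      ultimately have "Good \<D>" using bD by (auto simp: Good_def \<D>_def)
      then have "card \<C> \<le> card \<D>" by (rule min)
      moreover have "card \<C> > 0" using neC finC by (simp add: card_gt_0_iff)
      ultimately show False using cardD by simp
    qed
    then have lt: "card (bag_pairs r \<D>) < 2 ^ Suc t * (card \<C> - 1)" by (simp add: cardD)
    \<comment> \<open>Merging \<open>A\<close> and \<open>B\<close> loses the pair itself in both
      orders and, for each common neighbour, one of its two adjacencies, again in both
      orders.\<close>
    have "bag_pairs r \<C> \<subseteq> bag_pairs r \<R> \<union> ({A} \<times> NA \<union> NA \<times> {A}) \<union> ({B} \<times> NB \<union> NB \<times> {B}) \<union> {(A,B),(B,A)}"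
    proof
      fix p assume p: "p \<in> bag_pairs r \<C>"
      obtain X Y where XY: "p = (X, Y)" by (cases p)
      show "p \<in> bag_pairs r \<R> \<union> ({A} \<times> NA \<union> NA \<times> {A}) \<union> ({B} \<times> NB \<union> NB \<times> {B}) \<union> {(A,B),(B,A)}"
        using p tsymD[of X Y] unfolding XY bag_pairs_def NA_def NB_def \<R>_def by auto
    qed
    then have "card (bag_pairs r \<C>) \<le> card (bag_pairs r \<R> \<union> ({A} \<times> NA \<union> NA \<times> {A}) \<union> ({B} \<times> NB \<union> NB \<times> {B}) \<union> {(A,B),(B,A)})"
      by (intro card_mono) (use fp finR in auto)
    also have "\<dots> \<le> card (bag_pairs r \<R>) + (card ({A} \<times> NA) + card (NA \<times> {A})) + (card ({B} \<times> NB) + card (NB \<times> {B})) + card {(A,B),(B,A)}"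
      by (intro order_trans[OF card_Un_le] add_mono order_refl)
    also have "\<dots> \<le> card (bag_pairs r \<R>) + 2 * card NA + 2 * card NB + 2"
    proof -
      have "card {(A,B),(B,A)} = 2" using AB(3) by simp
      then show ?thesis by (simp only: card_cartesian_product card.empty card.insert finite.intros empty_iff) simp
    qed
    also have "\<dots> = card (bag_pairs r \<R>) + 2 * card (NA \<union> NB) + 2 * card (NA \<inter> NB) + 2"
      using card_Un_Int[OF finR(2,3)] by simp
    also have "card (bag_pairs r \<R>) + 2 * card (NA \<union> NB) \<le> card (bag_pairs r \<D>)"
    proof -
      let ?X = "{A \<union> B} \<times> (NA \<union> NB)" and ?Y = "(NA \<union> NB) \<times> {A \<union> B}"
      have nR: "A \<union> B \<notin> \<R>" using notin by (auto simp: \<R>_def)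
      have "card (bag_pairs r \<R> \<union> (?X \<union> ?Y)) = card (bag_pairs r \<R>) + (card ?X + card ?Y)"
      proof -
        have "card (?X \<union> ?Y) = card ?X + card ?Y"
          by (rule card_Un_disjoint) (use finR nR in \<open>auto simp: NA_def NB_def\<close>)
        moreover have "card (bag_pairs r \<R> \<union> (?X \<union> ?Y)) = card (bag_pairs r \<R>) + card (?X \<union> ?Y)"
          by (rule card_Un_disjoint) (use finR fp nR in \<open>auto simp: bag_pairs_def\<close>)
        ultimately show ?thesis by simp
      qed
      moreover have "bag_pairs r \<R> \<union> (?X \<union> ?Y) \<subseteq> bag_pairs r \<D>"
      proof -
        have "touching r D (A \<union> B) \<and> touching r (A \<union> B) D" if "D \<in> NA \<union> NB" for D
        proof -
          have "touching r D (A \<union> B)" using that by (auto simp: NA_def NB_def touching_def)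
          then show ?thesis using tsymD by blast
        qed
        then show ?thesis using nR by (auto simp: bag_pairs_def \<D>_def NA_def NB_def)
      qed
      then have "card (bag_pairs r \<R> \<union> (?X \<union> ?Y)) \<le> card (bag_pairs r \<D>)"
        by (intro card_mono fp) (use finR in \<open>auto simp: \<D>_def\<close>)
      ultimately show ?thesis by (simp add: card_cartesian_product)
    qed
    finally have "card (bag_pairs r \<C>) \<le> card (bag_pairs r \<D>) + 2 * card (NA \<inter> NB) + 2" by simp
    with cC lt have "2 ^ Suc t * card \<C> < 2 ^ Suc t * (card \<C> - 1) + 2 * card (NA \<inter> NB) + 2" by linarith
    moreover have "card \<C> > 0" using neC finC by (simp add: card_gt_0_iff)
    then have "2 ^ Suc t * card \<C> = 2 ^ Suc t * (card \<C> - 1) + 2 ^ Suc t"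
      by (metis add.commute mult_Suc_right Suc_diff_1)
    ultimately have "2 ^ t \<le> card (NA \<inter> NB)" by simp
    moreover have "NA \<inter> NB = N A \<inter> N B" by (auto simp: NA_def NB_def N_def \<R>_def)
    ultimately show ?thesis by simp
  qed
  have "card (bag_pairs r \<C>) > 0"
    using cC neC finC by (metis card_gt_0_iff le_zero_eq mult_is_0 not_gr_zero power_not_zero zero_neq_numeral)
  then obtain B B' where BB': "(B, B') \<in> bag_pairs r \<C>" by (metis card.empty ex_in_conv less_irrefl surj_pair)
  then have B: "B \<in> \<C>" "B' \<in> \<C>" "B \<noteq> B'" "touching r B B'" by (auto simp: bag_pairs_def)
  have NB: "bags r (N B)" "N B \<noteq> {}" "finite (N B)" "N B \<subseteq> \<C>"
    using bC finC B tsymD[OF B(4)] by (auto simp: N_def bags_def)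
  have "2 ^ t \<le> card (N B \<inter> N D)" if "D \<in> N B" for D
    using common[of B D] that tsymD[of D B] B(1) by (auto simp: N_def)
  then have "2 ^ t * card (N B) \<le> (\<Sum>D\<in>N B. card (N B \<inter> N D))"
    using sum_bounded_below[of "N B" "2 ^ t" "\<lambda>D. card (N B \<inter> N D)"] by (simp add: mult.commute)
  also have "\<dots> = card (SIGMA D:N B. N B \<inter> N D)"
    using NB by (simp add: card_SigmaI)
  also have "\<dots> \<le> card (bag_pairs r (N B))"
    using fp[OF NB(3)] by (intro card_mono) (auto simp: bag_pairs_def N_def intro: tsymD)
  finally have le: "2 ^ t * card (N B) \<le> card (bag_pairs r (N B))" .
  from Suc.IH[OF NB(1,2) le] obtain \<M> where M0: "bags r \<M>" "card \<M> = Suc t"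
      "\<forall>A\<in>\<M>. \<forall>B\<in>\<M>. A \<noteq> B \<longrightarrow> touching r A B" "\<forall>M\<in>\<M>. M \<subseteq> \<Union>(N B) \<and> (\<exists>D\<in>N B. D \<subseteq> M)"
    by (elim exE conjE)
  note M = M0(1,2) M0(3)[rule_format] M0(4)[rule_format]
  have dB: "M \<inter> B = {}" if M': "M \<in> \<M>" for M
  proof -
    have "D \<inter> B = {}" if "D \<in> N B" for D using that disjC[of D B] B(1) by (auto simp: N_def)
    then show ?thesis using M(4)[OF M'] by blast
  qed
  have tB: "touching r M B" if M': "M \<in> \<M>" for M
  proof -
    obtain D where "D \<in> N B" "D \<subseteq> M" using M(4)[OF M'] by blast
    then show ?thesis by (auto simp: N_def touching_def)
  qed
  have "B \<notin> \<M>" using dB[of B] neB[OF B(1)] by auto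
  show ?case
  proof (intro exI[of _ "insert B \<M>"] conjI)
    show "bags r (insert B \<M>)" using M(1) dB conC[OF B(1)] unfolding bags_def by (simp add: Int_commute)
    show "card (insert B \<M>) = Suc (Suc t)" using M \<open>B \<notin> \<M>\<close> by (simp add: bags_def)
    show "\<forall>A\<in>insert B \<M>. \<forall>B\<in>insert B \<M>. A \<noteq> B \<longrightarrow> touching r A B" using M(3) tB tsymD by auto
    show "\<forall>M\<in>insert B \<M>. M \<subseteq> \<Union>\<B> \<and> (\<exists>B\<in>\<B>. B \<subseteq> M)"
    proof
      fix M assume "M \<in> insert B \<M>"
      then consider "M = B" | "M \<in> \<M>" by blast
      then show "M \<subseteq> \<Union>\<B> \<and> (\<exists>B\<in>\<B>. B \<subseteq> M)"
      proof cases
        case 1 then show ?thesis using subC B by auto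
      next
        case 2
        then obtain D where D: "D \<in> N B" "D \<subseteq> M" "M \<subseteq> \<Union>(N B)" using M(4) by blast
        have "\<Union>(N B) \<subseteq> \<Union>\<B>" using subC NB(4) by (meson Union_least subsetD)
        then have 1: "M \<subseteq> \<Union>\<B>" using D(3) by (rule order_trans[rotated])
        have "D \<in> \<C>" using D(1) NB(4) by (rule subsetD[rotated])
        then obtain B0 where B0: "B0 \<in> \<B>" "B0 \<subseteq> D" using subC by metis
        have "B0 \<subseteq> M" using B0(2) D(2) by (rule order_trans)
        then show ?thesis using 1 B0(1) by (intro conjI bexI[of _ B0])
      qed
    qed
  qed
qed

text \<open>Regions \<open>R x\<close> are glued along links \<open>J x y\<close>. This serves the
  bags of a minor as well as the connected pieces of the crossing graph, the latter with empty
  links.\<close>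

lemma path_connected_r_connected:
  fixes R :: "'a \<Rightarrow> complex set"
  assumes S: "r_connected r S" and R: "\<And>x. x \<in> S \<Longrightarrow> path_connected (R x) \<and> R x \<noteq> {}"
    and J: "\<And>x y. \<lbrakk>x \<in> S; y \<in> S; r x y\<rbrakk> \<Longrightarrow> path_connected (R x \<union> J x y \<union> R y)"
  shows "path_connected ((\<Union>x\<in>S. R x) \<union> (\<Union>x\<in>S. \<Union>y\<in>{y\<in>S. r x y}. J x y))" (is "path_connected ?T")
proof -
  have sub: "path_component ?T p q" if "A \<subseteq> ?T" "path_connected A" "p \<in> A" "q \<in> A" for A p q
    using that by (meson path_component_of_subset path_connected_component)
  have edge: "path_component ?T p q" if "x \<in> S" "y \<in> S" "r x y" "p \<in> R x \<union> J x y \<union> R y" "q \<in> R x \<union> J x y \<union> R y" for x y p q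
    using that J[OF that(1-3)] by (intro sub[of "R x \<union> J x y \<union> R y"]) auto
  have chain: "path_component ?T p q" if "(x, y) \<in> {(u, v). u \<in> S \<and> v \<in> S \<and> r u v}\<^sup>*" "x \<in> S" "p \<in> R x" "q \<in> R y" for x y p q
    using that
  proof (induction arbitrary: q)
    case base
    then show ?case using R by (intro sub[of "R x"]) auto
  next
    case (step y z)
    have yz: "y \<in> S" "z \<in> S" "r y z" using step.hyps(2) by auto
    obtain q' where q': "q' \<in> R y" using R yz by blast
    have "path_component ?T p q'" using step.IH step.prems q' by blast
    moreover have "path_component ?T q' q" using yz q' step.prems by (intro edge[of y z]) auto
    ultimately show ?case by (rule path_component_trans)
  qed
  have anchor: "\<exists>x\<in>S. \<exists>p'\<in>R x. path_component ?T p p'" if pT: "p \<in> ?T" for p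
  proof -
    consider x where "x \<in> S" "p \<in> R x" | x y where "x \<in> S" "y \<in> S" "r x y" "p \<in> J x y" using pT by blast
    then show ?thesis
    proof cases
      case 1 then show ?thesis using sub[of "R x" p p] R by blast
    next
      case 2
      obtain p' where "p' \<in> R x" using R 2 by blast
      then show ?thesis using edge[of x y p p'] 2 by blast
    qed
  qed
  show ?thesis
    unfolding path_connected_component
  proof (intro ballI)
    fix p q assume "p \<in> ?T" "q \<in> ?T"
    obtain x p' where 1: "x \<in> S" "p' \<in> R x" "path_component ?T p p'" using anchor[OF \<open>p \<in> ?T\<close>] by (elim bexE)
    obtain y q' where 2: "y \<in> S" "q' \<in> R y" "path_component ?T q q'" using anchor[OF \<open>q \<in> ?T\<close>] by (elim bexE)
    have "path_component ?T p' q'" using chain[of x y p' q'] 1 2 S by (simp add: r_connected_def)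
    then show "path_component ?T p q"
      by (rule path_component_trans[OF 1(3) path_component_trans[OF _ path_component_sym[OF 2(3)]]])
  qed
qed

text \<open>The factor is \<open>2 ^ 5\<close>: a denser structure contains a complete minor with
  six bags, and three of them against the other three, joined through links, draw
  \<open>K\<^sub>3\<^sub>,\<^sub>3\<close> with disjoint nonadjacent paths. A link may be empty when
  the two regions have a path-connected union already.\<close>

lemma plane_realization_sparse:
  fixes R :: "'a \<Rightarrow> complex set"
  assumes fin: "finite W" and sym: "symp r" and rW: "\<And>x y. r x y \<Longrightarrow> x \<in> W \<and> y \<in> W \<and> x \<noteq> y"
    and R: "\<And>x. x \<in> W \<Longrightarrow> path_connected (R x) \<and> R x \<noteq> {}"
    and RR: "\<And>x y. \<lbrakk>x \<in> W; y \<in> W; x \<noteq> y\<rbrakk> \<Longrightarrow> R x \<inter> R y = {}"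
    and J: "\<And>x y. r x y \<Longrightarrow> path_connected (R x \<union> J x y \<union> R y)"
    and JR: "\<And>x y z. \<lbrakk>r x y; z \<in> W\<rbrakk> \<Longrightarrow> J x y \<inter> R z = {}"
    and JJ: "\<And>x y x' y'. \<lbrakk>r x y; r x' y'; {x, y} \<noteq> {x', y'}\<rbrakk> \<Longrightarrow> J x y \<inter> J x' y' = {}"
  shows "card {(x, y). r x y} \<le> 32 * card W"
proof (cases "W = {}")
  case True
  then have "{(x, y). r x y} = {}" using rW by auto
  then show ?thesis by simp
next
  case neW: False
  show ?thesis
  proof (rule ccontr)
    assume "\<not> ?thesis"
    then have many: "2 ^ 5 * card W \<le> card {(x, y). r x y}" by simp
    let ?B = "(\<lambda>x. {x}) ` W"
    have b: "bags r ?B" using fin by (auto simp: bags_def r_connected_def)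
    have "bag_pairs r ?B = (\<lambda>(x, y). ({x}, {y})) ` {(x, y). r x y}"
      using rW by (auto simp: bag_pairs_def touching_def)
    moreover have "inj_on (\<lambda>(x, y). ({x}, {y})) {(x, y). r x y}" by (auto simp: inj_on_def)
    ultimately have "card (bag_pairs r ?B) = card {(x, y). r x y}" by (metis card_image)
    moreover have "card ?B = card W" by (intro card_image) (auto simp: inj_on_def)
    ultimately have "2 ^ 5 * card ?B \<le> card (bag_pairs r ?B)" using many by simp
    then have "\<exists>\<M>. bags r \<M> \<and> card \<M> = Suc 5 \<and> (\<forall>A\<in>\<M>. \<forall>B\<in>\<M>. A \<noteq> B \<longrightarrow> touching r A B)
     \<and> (\<forall>M\<in>\<M>. M \<subseteq> \<Union>?B \<and> (\<exists>B\<in>?B. B \<subseteq> M))"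
      using neW by (intro complete_minor[OF sym b]) auto
    then obtain \<M> where M: "bags r \<M>" "card \<M> = 6" "\<forall>A\<in>\<M>. \<forall>B\<in>\<M>. A \<noteq> B \<longrightarrow> touching r A B"
       "\<forall>M\<in>\<M>. M \<subseteq> \<Union>?B \<and> (\<exists>B\<in>?B. B \<subseteq> M)" by (elim exE conjE) simp
    have MW: "M \<subseteq> W" if "M \<in> \<M>" for M using M(4) that by auto
    obtain f where f: "bij_betw f {0..<6::nat} \<M>"
      using ex_bij_betw_nat_finite[of \<M>] M(1,2) by (auto simp: bags_def)
    define S where "S B = (\<Union>x\<in>B. R x) \<union> (\<Union>x\<in>B. \<Union>y\<in>{y\<in>B. r x y}. J x y)" for B
    have fM: "f i \<in> \<M>" if "i < 6" for i using f that by (auto simp: bij_betw_def)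
    have fd: "f i \<inter> f j = {}" "touching r (f i) (f j)" if "i < 6" "j < 6" "i \<noteq> j" for i j
    proof -
      have "f i \<noteq> f j" using f that by (auto simp: bij_betw_def inj_on_def)
      then show "f i \<inter> f j = {}" "touching r (f i) (f j)" using fM M(1,3) that by (auto simp: bags_def)
    qed
    have pcS: "path_connected (S (f i))" "S (f i) \<noteq> {}" if "i < 6" for i
    proof -
      have c: "r_connected r (f i)" using M(1) fM that by (auto simp: bags_def)
      show "path_connected (S (f i))" unfolding S_def
        by (rule path_connected_r_connected[OF c]) (use R J MW[OF fM[OF that]] in auto)
      obtain x where "x \<in> f i" using c by (auto simp: r_connected_def)
      then show "S (f i) \<noteq> {}" using R MW[OF fM[OF that]] by (fastforce simp: S_def)
    qed
    have d1: "S B \<inter> S B' = {}" if "B \<subseteq> W" "B' \<subseteq> W" "B \<inter> B' = {}" for B B'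
    proof -
      have "R x \<inter> R y = {}" if "x \<in> B" "y \<in> B'" for x y using that RR \<open>B \<subseteq> W\<close> \<open>B' \<subseteq> W\<close> \<open>B \<inter> B' = {}\<close> by blast
      moreover have "J x y \<inter> R z = {}" if "r x y" "z \<in> B \<union> B'" for x y z using that JR \<open>B \<subseteq> W\<close> \<open>B' \<subseteq> W\<close> by blast
      moreover have "J x y \<inter> J x' y' = {}" if "x \<in> B" "r x y" "x' \<in> B'" "y' \<in> B'" "r x' y'" for x y x' y'
        using that \<open>B \<inter> B' = {}\<close> by (intro JJ) auto
      ultimately show ?thesis unfolding S_def by blast
    qed
    have d2: "J x y \<inter> S B = {}" if "r x y" "x \<notin> B \<or> y \<notin> B" "B \<subseteq> W" for x y B
    proof -
      have "J x y \<inter> R z = {}" if "z \<in> B" for z using that JR \<open>r x y\<close> \<open>B \<subseteq> W\<close> by blast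
      moreover have "J x y \<inter> J x' y' = {}" if "x' \<in> B" "y' \<in> B" "r x' y'" for x' y'
        using that \<open>r x y\<close> \<open>x \<notin> B \<or> y \<notin> B\<close> by (intro JJ) auto
      ultimately show ?thesis unfolding S_def by blast
    qed
    \<comment> \<open>A touching pair of elements between bag \<open>i\<close> and bag
      \<open>3 + j\<close>; its link carries the edge of \<open>K\<^sub>3\<^sub>,\<^sub>3\<close>
      from \<open>i\<close> to \<open>j\<close>.\<close>
    define X where "X i j = (SOME p. fst p \<in> f i \<and> snd p \<in> f (3 + j) \<and> r (fst p) (snd p))" for i j
    have X: "fst (X i j) \<in> f i" "snd (X i j) \<in> f (3 + j)" "r (fst (X i j)) (snd (X i j))" if "i < 3" "j < 3" for i j
    proof -
      have "\<exists>p. fst p \<in> f i \<and> snd p \<in> f (3 + j) \<and> r (fst p) (snd p)"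
        using fd(2)[of i "3 + j"] that by (auto simp: touching_def)
      then have "fst (X i j) \<in> f i \<and> snd (X i j) \<in> f (3 + j) \<and> r (fst (X i j)) (snd (X i j))"
        unfolding X_def by (rule someI_ex)
      then show "fst (X i j) \<in> f i" "snd (X i j) \<in> f (3 + j)" "r (fst (X i j)) (snd (X i j))" by auto
    qed
    define Y where "Y i j = J (fst (X i j)) (snd (X i j))" for i j
    define Z where "Z i j = S (f i) \<union> Y i j \<union> S (f (3 + j))" for i j
    have pcZ: "path_connected (Z i j)" if ij: "i < 3" "j < 3" for i j
    proof -
      let ?x = "fst (X i j)" and ?y = "snd (X i j)"
      have x: "?x \<in> W" "?y \<in> W" using X(3)[OF ij] rW by auto
      have "R ?x \<subseteq> S (f i)" "R ?y \<subseteq> S (f (3 + j))" using X[OF ij] by (auto simp: S_def)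
      moreover have "R ?x \<noteq> {}" "R ?y \<noteq> {}" using R x by auto
      moreover have "path_connected (S (f i) \<union> (R ?x \<union> J ?x ?y \<union> R ?y))"
        using calculation pcS(1)[of i] J[OF X(3)[OF ij]] ij by (intro path_connected_Un[of "S (f i)" "R ?x \<union> J ?x ?y \<union> R ?y"]) auto
      moreover have "path_connected ((S (f i) \<union> (R ?x \<union> J ?x ?y \<union> R ?y)) \<union> S (f (3 + j)))"
        using calculation pcS(1)[of "3 + j"] ij by (intro path_connected_Un[of "S (f i) \<union> (R ?x \<union> J ?x ?y \<union> R ?y)"]) auto
      moreover have "(S (f i) \<union> (R ?x \<union> J ?x ?y \<union> R ?y)) \<union> S (f (3 + j)) = Z i j"
        using calculation(1,2) by (auto simp: Z_def Y_def)
      ultimately show ?thesis by simp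
    qed
    have dZ: "Z i j \<inter> Z k l = {}" if ij: "i < 3" "j < 3" "k < 3" "l < 3" "i \<noteq> k" "j \<noteq> l" for i j k l
    proof -
      have f4: "f i \<inter> f k = {}" "f i \<inter> f (3 + l) = {}" "f (3 + j) \<inter> f k = {}" "f (3 + j) \<inter> f (3 + l) = {}" "f i \<inter> f (3 + j) = {}" "f k \<inter> f (3 + l) = {}"
        using fd(1) ij by auto
      have W4: "f i \<subseteq> W" "f k \<subseteq> W" "f (3 + j) \<subseteq> W" "f (3 + l) \<subseteq> W" using MW fM ij by auto
      have "S (f i) \<inter> S (f k) = {}" "S (f i) \<inter> S (f (3 + l)) = {}" "S (f (3 + j)) \<inter> S (f k) = {}" "S (f (3 + j)) \<inter> S (f (3 + l)) = {}"
        using d1 W4 f4 by auto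
      moreover have n: "fst (X i j) \<notin> f k" "fst (X i j) \<notin> f (3 + l)" "fst (X k l) \<notin> f i" "fst (X k l) \<notin> f (3 + j)"
        using X(1)[OF ij(1,2)] X(1)[OF ij(3,4)] f4 by blast+
      moreover have "Y i j \<inter> S (f k) = {}" "Y i j \<inter> S (f (3 + l)) = {}"
        unfolding Y_def using n W4 d2[OF X(3)[OF ij(1,2)]] by simp_all
      moreover have "Y k l \<inter> S (f i) = {}" "Y k l \<inter> S (f (3 + j)) = {}"
        unfolding Y_def using n W4 d2[OF X(3)[OF ij(3,4)]] by simp_all
      moreover have "Y i j \<inter> Y k l = {}"
        unfolding Y_def using X[OF ij(1,2)] X[OF ij(3,4)] f4 by (intro JJ) (auto simp: doubleton_eq_iff)
      ultimately show ?thesis unfolding Z_def Int_Un_distrib Int_Un_distrib2 by (simp add: Int_commute)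
    qed
    define a where "a i = (SOME p. p \<in> S (f i))" for i
    have a: "a i \<in> S (f i)" if "i < 6" for i unfolding a_def using pcS(2)[OF that] by (simp add: some_in_eq)
    define g where "g i j = (SOME g. path g \<and> path_image g \<subseteq> Z i j \<and> pathstart g = a i \<and> pathfinish g = a (3 + j))" for i j
    have g: "path (g i j) \<and> path_image (g i j) \<subseteq> Z i j \<and> pathstart (g i j) = a i \<and> pathfinish (g i j) = a (3 + j)" if ij: "i < 3" "j < 3" for i j
    proof -
      have "a i \<in> Z i j" "a (3 + j) \<in> Z i j" using a[of i] a[of "3 + j"] ij by (auto simp: Z_def)
      then have "\<exists>g. path g \<and> path_image g \<subseteq> Z i j \<and> pathstart g = a i \<and> pathfinish g = a (3 + j)"
        using pcZ[OF ij] by (auto simp: path_connected_def)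
      then show ?thesis unfolding g_def by (rule someI_ex)
    qed
    show False
    proof (rule no_K33_paths[of g a "\<lambda>j. a (3 + j)"])
      show "path (g i j) \<and> pathstart (g i j) = a i \<and> pathfinish (g i j) = a (3 + j)" if "i < 3" "j < 3" for i j
        using g[OF that] by simp
      show "path_image (g i j) \<inter> path_image (g k l) = {}" if "i < 3" "j < 3" "k < 3" "l < 3" "i \<noteq> k" "j \<noteq> l" for i j k l
      proof -
        have "path_image (g i j) \<subseteq> Z i j" "path_image (g k l) \<subseteq> Z k l" using g that by simp_all
        then have "path_image (g i j) \<inter> path_image (g k l) \<subseteq> Z i j \<inter> Z k l" by (rule Int_mono)
        then show ?thesis unfolding dZ[OF that] by (simp only: subset_empty)
      qed
    qed
  qed
qed

section \<open>Noncrossing edges and connected pieces as plane structures\<close>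

context simple_tg
begin

lemma subgraph: "F \<subseteq> E \<Longrightarrow> simple_tg (\<Union>F) F curve"
proof
  assume F: "F \<subseteq> E"
  have "img e \<inter> \<Union>F = e" if "e \<in> F" for e
  proof -
    have "\<Union>F \<subseteq> V" using F edgeD(1) by blast
    then show ?thesis using edgeD(5)[of e] that F by blast
  qed
  moreover have "finite (\<Union>F)" using F finite_E finite_edge by (meson finite_Union finite_subset subsetD)
  moreover have "\<forall>e\<in>E. \<forall>f\<in>E. e \<noteq> f \<longrightarrow> (\<forall>p\<in>edge_interior curve e \<inter> edge_interior curve f. proper_crossing_at (img e) (img f) p)"
    using stg by (simp add: simple_topological_graph_def topological_graph_def)
  moreover have "\<forall>e\<in>F. e \<subseteq> \<Union>F \<and> card e = 2 \<and> arc (curve e) \<and> {pathstart (curve e), pathfinish (curve e)} = e"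
    using edgeD F by (metis Union_upper subsetD)
  moreover have "\<forall>e\<in>F. \<forall>f\<in>F. e \<noteq> f \<longrightarrow> (\<forall>x y. x \<in> img e \<inter> img f \<longrightarrow> y \<in> img e \<inter> img f \<longrightarrow> x = y)"
    using img_unique F by (metis IntE subsetD)
  moreover have "e \<in> E" if "e \<in> F" for e using that F by (rule subsetD[rotated])
  ultimately show "simple_topological_graph (\<Union>F) F curve"
    unfolding simple_topological_graph_def topological_graph_def by simp
qed

text \<open>All of \<open>V\<close> is removed, which for an edge of the graph takes away just its
  two ends. Crossing then means that interior arcs intersect, while edges that only share a vertex
  have disjoint ones.\<close>

definition interior_arc :: "complex set \<Rightarrow> complex set" where
  "interior_arc e = img e - V"

lemma interior_arc:
  assumes "e \<in> E"
  shows "path_connected (interior_arc e)" "interior_arc e \<noteq> {}" "\<And>v. v \<in> e \<Longrightarrow> path_connected (insert v (interior_arc e))"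
proof -
  let ?g = "curve e"
  have arc: "arc ?g" using edgeD assms by auto
  have inj: "inj_on ?g {0..1}" and cont: "continuous_on {0..1} ?g" using arc by (auto simp: arc_def path_def)
  have e: "{?g 0, ?g 1} = e" using edgeD(4)[OF assms] by (simp add: pathstart_def pathfinish_def)
  have int: "interior_arc e = img e - {?g 0, ?g 1}" unfolding e using edgeD(1,5)[OF assms] by (auto simp: interior_arc_def)
  have eq: "interior_arc e = ?g ` {0<..<1}"
  proof -
    have ends: "?g t \<noteq> ?g 0" "?g t \<noteq> ?g 1" if "t \<in> {0<..<1}" for t
      using inj_on_eq_iff[OF inj, of t 0] inj_on_eq_iff[OF inj, of t 1] that by auto
    show ?thesis
    proof (rule set_eqI, rule iffI)
      fix x assume "x \<in> interior_arc e"
      then obtain t where t: "t \<in> {0..1}" "x = ?g t" "x \<noteq> ?g 0" "x \<noteq> ?g 1"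
        unfolding int path_image_def by (elim DiffE imageE) simp
      then have "t \<noteq> 0" "t \<noteq> 1" by auto
      then show "x \<in> ?g ` {0<..<1}" using t by (intro image_eqI[of _ _ t]) auto
    next
      fix x assume "x \<in> ?g ` {0<..<1}"
      then obtain t where "t \<in> {0<..<1}" "x = ?g t" by (elim imageE)
      then show "x \<in> interior_arc e" using ends[of t] unfolding int path_image_def by simp
    qed
  qed
  have pc: "path_connected (?g ` T)" if "convex T" "T \<subseteq> {0..1}" for T
    using that by (intro path_connected_continuous_image continuous_on_subset[OF cont] convex_imp_path_connected)
  show "path_connected (interior_arc e)" unfolding eq by (rule pc) auto
  show "interior_arc e \<noteq> {}" unfolding eq by auto
  have ins: "insert (?g 0) (?g ` {0<..<1}) = ?g ` {0..<1}" "insert (?g 1) (?g ` {0<..<1}) = ?g ` {0<..1}"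
    by (auto simp: image_iff) (metis atLeastLessThan_iff greaterThanLessThan_iff less_eq_real_def
        greaterThanAtMost_iff zero_less_one)+
  show "path_connected (insert v (interior_arc e))" if "v \<in> e" for v
  proof -
    have "v = ?g 0 \<or> v = ?g 1" using that e by (metis empty_iff insert_iff)
    moreover have "path_connected (?g ` {0..<1})" "path_connected (?g ` {0<..1})" by (rule pc; force)+
    ultimately show ?thesis using ins unfolding eq by auto
  qed
qed

lemma interior_arc_disjoint: "\<lbrakk>e \<in> E; f \<in> E; \<not> crossing e f\<rbrakk> \<Longrightarrow> interior_arc e \<inter> interior_arc f = {}"
  by (auto simp: interior_arc_def crossing_iff)

lemma crossing_refl: "e \<in> E \<Longrightarrow> crossing e e"
  using interior_arc(2) by (auto simp: interior_arc_def crossing_iff)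

text \<open>The regions are the vertices as points and the links are the interior arcs; ordered
  adjacent pairs count every edge twice, which halves the factor 32.\<close>

lemma noncrossing_card_le:
  assumes F: "F \<subseteq> E" and nc: "\<And>e f. \<lbrakk>e \<in> F; f \<in> F; e \<noteq> f\<rbrakk> \<Longrightarrow> \<not> crossing e f"
  shows "card F \<le> 16 * card V"
proof -
  let ?r = "\<lambda>x y. {x, y} \<in> F"
  have ne: "x \<noteq> y" if "{x, y} \<in> F" for x y using edgeD(2)[of "{x,y}"] that F by auto
  have "card {(x, y). ?r x y} \<le> 32 * card V"
  proof (rule plane_realization_sparse[where R = "\<lambda>x. {x}" and J = "\<lambda>x y. interior_arc {x, y}"])
    show "symp ?r" by (auto simp: symp_def insert_commute)
    show "x \<in> V \<and> y \<in> V \<and> x \<noteq> y" if "{x, y} \<in> F" for x y using edgeD(1)[of "{x,y}"] ne that F by auto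
    show "path_connected ({x} \<union> interior_arc {x, y} \<union> {y})" if "{x, y} \<in> F" for x y
    proof -
      have i: "path_connected (insert x (interior_arc {x, y}))" "path_connected (insert y (interior_arc {x, y}))" "interior_arc {x, y} \<noteq> {}"
        using interior_arc that F by auto
      then have "path_connected (insert x (interior_arc {x, y}) \<union> insert y (interior_arc {x, y}))"
        by (intro path_connected_Un) auto
      moreover have "insert x (interior_arc {x, y}) \<union> insert y (interior_arc {x, y}) = {x} \<union> interior_arc {x, y} \<union> {y}" by auto
      ultimately show ?thesis by simp
    qed
    show "interior_arc {x, y} \<inter> interior_arc {x', y'} = {}" if "{x, y} \<in> F" "{x', y'} \<in> F" "{x, y} \<noteq> {x', y'}" for x y x' y'
      using that nc F by (intro interior_arc_disjoint) auto
  qed (use finite_V in \<open>auto simp: interior_arc_def\<close>)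
  moreover have "card {(x, y). ?r x y} = 2 * card F"
  proof -
    have finF: "finite F" using F finite_E finite_subset by blast
    have "{(x, y). ?r x y} = (\<Union>e\<in>F. {(x, y). {x, y} = e})" by auto
    moreover have "card (\<Union>e\<in>F. {(x, y). {x, y} = e}) = (\<Sum>e\<in>F. card {(x, y). {x, y} = e})"
    proof (rule card_UN_disjoint)
      show "\<forall>e\<in>F. finite {(x, y). {x, y} = e}"
      proof
        fix e assume "e \<in> F"
        then have "finite e" using finite_edge F by auto
        then show "finite {(x, y). {x, y} = e}" by (rule_tac finite_subset[of _ "e \<times> e"]) auto
      qed
    qed (use finF in auto)
    moreover have "card {(x, y). {x, y} = e} = 2" if eF: "e \<in> F" for e
    proof -
      have "card e = 2" using edgeD(2)[of e] eF F by auto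
      then obtain u v where uv: "e = {u, v}" "u \<noteq> v" by (auto simp: card_2_iff)
      have "{(x, y). {x, y} = e} = {(u, v), (v, u)}" using uv by (auto simp: doubleton_eq_iff)
      then show ?thesis using uv by simp
    qed
    ultimately show ?thesis by simp
  qed
  ultimately show ?thesis by simp
qed

text \<open>Incidences between vertices and pieces form a plane bipartite structure whose regions
  are points and unions of interior arcs. Representatives of the pieces do not cross, so there are
  at most \<open>16 * card V\<close> pieces and \<open>17 * card V\<close> regions; 32 times that
  bounds the incidences counted in both orders, and half of it is 272.\<close>

lemma pieces_vertex_sum:
  assumes fin: "finite \<P>" and sub: "\<And>P. P \<in> \<P> \<Longrightarrow> P \<subseteq> E" and con: "\<And>P. P \<in> \<P> \<Longrightarrow> r_connected crossing P"
    and nc: "\<And>P Q e f. \<lbrakk>P \<in> \<P>; Q \<in> \<P>; P \<noteq> Q; e \<in> P; f \<in> Q\<rbrakk> \<Longrightarrow> \<not> crossing e f"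
  shows "(\<Sum>P\<in>\<P>. card (\<Union>P)) \<le> 272 * card V"
proof -
  have ne: "P \<noteq> {}" if "P \<in> \<P>" for P using con[OF that] by (auto simp: r_connected_def)
  define pick where "pick P = (SOME e. e \<in> P)" for P :: "complex set set"
  have pick: "pick P \<in> P" if "P \<in> \<P>" for P unfolding pick_def using ne[OF that] by (simp add: some_in_eq)
  \<comment> \<open>Edges of distinct pieces never cross, whereas every edge crosses itself, so
    distinct pieces have distinct representatives.\<close>
  have "inj_on pick \<P>"
  proof (rule inj_onI, rule ccontr)
    fix P Q assume PQ: "P \<in> \<P>" "Q \<in> \<P>" "pick P = pick Q" "P \<noteq> Q"
    have "\<not> crossing (pick P) (pick Q)" using nc[OF PQ(1,2,4) pick[OF PQ(1)] pick[OF PQ(2)]] .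
    moreover have "pick P \<in> E" using pick[OF PQ(1)] sub[OF PQ(1)] by auto
    ultimately show False using crossing_refl[of "pick P"] PQ(3) by simp
  qed
  moreover have "card (pick ` \<P>) \<le> 16 * card V"
  proof (rule noncrossing_card_le)
    show "pick ` \<P> \<subseteq> E" using pick sub by (meson image_subsetI subsetD)
    fix e f assume ef: "e \<in> pick ` \<P>" "f \<in> pick ` \<P>" "e \<noteq> f"
    then obtain P Q where PQ: "P \<in> \<P>" "Q \<in> \<P>" "e = pick P" "f = pick Q" by (elim imageE)
    then have "P \<noteq> Q" using ef(3) by auto
    then show "\<not> crossing e f" using nc[OF PQ(1,2)] pick[OF PQ(1)] pick[OF PQ(2)] PQ(3,4) by metis
  qed
  ultimately have cP: "card \<P> \<le> 16 * card V" by (simp add: card_image)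
  define r :: "complex + complex set set \<Rightarrow> complex + complex set set \<Rightarrow> bool" where
    "r x y = (case (x, y) of (Inl v, Inr P) \<Rightarrow> P \<in> \<P> \<and> v \<in> \<Union>P | (Inr P, Inl v) \<Rightarrow> P \<in> \<P> \<and> v \<in> \<Union>P | _ \<Rightarrow> False)" for x y
  define R :: "complex + complex set set \<Rightarrow> complex set" where
    "R x = (case x of Inl v \<Rightarrow> {v} | Inr P \<Rightarrow> (\<Union>e\<in>P. interior_arc e))" for x
  have pcP: "path_connected (\<Union>e\<in>P. interior_arc e)" if P: "P \<in> \<P>" for P
  proof -
    have "path_connected ((\<Union>e\<in>P. interior_arc e) \<union> (\<Union>e\<in>P. \<Union>f\<in>{f\<in>P. crossing e f}. {}))"
    proof (rule path_connected_r_connected[OF con[OF P]])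
      show "path_connected (interior_arc e) \<and> interior_arc e \<noteq> {}" if "e \<in> P" for e using interior_arc sub P that by blast
      show "path_connected (interior_arc e \<union> {} \<union> interior_arc f)" if "e \<in> P" "f \<in> P" "crossing e f" for e f
      proof -
        have ef: "e \<in> E" "f \<in> E" using sub P that by auto
        have "interior_arc e \<inter> interior_arc f \<noteq> {}" using crossing_iff[OF ef] that by (auto simp: interior_arc_def)
        then show ?thesis using interior_arc(1)[OF ef(1)] interior_arc(1)[OF ef(2)] path_connected_Un by auto
      qed
    qed
    then show ?thesis by simp
  qed
  have pcv: "path_connected ({v} \<union> (\<Union>e\<in>P. interior_arc e))" if Pv: "P \<in> \<P>" "v \<in> \<Union>P" for P v
  proof -
    obtain e where e: "e \<in> P" "v \<in> e" using Pv(2) by blast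
    then have eE: "e \<in> E" using sub[OF Pv(1)] by auto
    have "path_connected (insert v (interior_arc e) \<union> (\<Union>e\<in>P. interior_arc e))"
      using interior_arc[OF eE] e pcP[OF Pv(1)] by (intro path_connected_Un) auto
    moreover have "insert v (interior_arc e) \<union> (\<Union>e\<in>P. interior_arc e) = {v} \<union> (\<Union>e\<in>P. interior_arc e)" using e by auto
    ultimately show ?thesis by simp
  qed
  let ?W = "Inl ` V \<union> Inr ` \<P>"
  have rW: "x \<in> ?W \<and> y \<in> ?W \<and> x \<noteq> y" if "r x y" for x y
  proof -
    have "\<Union>P \<subseteq> V" if "P \<in> \<P>" for P using sub[OF that] edgeD(1) by blast
    then show ?thesis using that by (fastforce simp: r_def split: sum.splits)
  qed
  have "card {(x, y). r x y} \<le> 32 * card ?W"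
  proof (rule plane_realization_sparse[where R = R and J = "\<lambda>_ _. {}"])
    show "finite ?W" using fin finite_V by simp
    show "symp r" by (auto simp: symp_def r_def split: sum.splits)
    show "x \<in> ?W \<and> y \<in> ?W \<and> x \<noteq> y" if "r x y" for x y using rW[OF that] .
    show "path_connected (R x) \<and> R x \<noteq> {}" if "x \<in> ?W" for x
    proof -
      have "(\<Union>e\<in>P. interior_arc e) \<noteq> {}" if "P \<in> \<P>" for P
        using pick[OF that] sub[OF that] interior_arc(2) by blast
      then have "path_connected (R (Inr P)) \<and> R (Inr P) \<noteq> {}" if "P \<in> \<P>" for P
        using pcP[OF that] that unfolding R_def sum.case by (intro conjI)
      moreover have "path_connected (R (Inl v)) \<and> R (Inl v) \<noteq> {}" for v by (simp add: R_def)
      ultimately show ?thesis using that by (elim UnE imageE) simp_all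
    qed
    show "R x \<inter> R y = {}" if "x \<in> ?W" "y \<in> ?W" "x \<noteq> y" for x y
    proof -
      have "interior_arc e \<inter> interior_arc f = {}" if "P \<in> \<P>" "Q \<in> \<P>" "P \<noteq> Q" "e \<in> P" "f \<in> Q" for P Q e f
        using that nc sub by (intro interior_arc_disjoint) blast+
      moreover have "interior_arc e \<inter> V = {}" for e by (auto simp: interior_arc_def)
      ultimately show ?thesis using that unfolding R_def by (auto split: sum.splits; blast)
    qed
    show "path_connected (R x \<union> {} \<union> R y)" if "r x y" for x y
      using that pcv by (auto simp: r_def R_def Un_commute split: sum.splits)
  qed auto
  also have "card ?W \<le> 17 * card V"
    using card_Un_le[of "Inl ` V :: (complex + complex set set) set" "Inr ` \<P>"] cP
      card_image_le[OF finite_V, of "Inl :: complex \<Rightarrow> complex + complex set set"]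
      card_image_le[OF fin, of "Inr :: complex set set \<Rightarrow> complex + complex set set"] by linarith
  finally have le: "card {(x, y). r x y} \<le> 544 * card V" by simp
  let ?A = "(\<lambda>(P, v). (Inr P, Inl v)) ` (SIGMA P:\<P>. \<Union>P) :: ((complex + complex set set) \<times> (complex + complex set set)) set"
    and ?A' = "(\<lambda>(P, v). (Inl v, Inr P)) ` (SIGMA P:\<P>. \<Union>P) :: ((complex + complex set set) \<times> (complex + complex set set)) set"
  have finU: "finite (\<Union>P)" if "P \<in> \<P>" for P
    using sub[OF that] edgeD(1) finite_V by (meson Union_least finite_subset subsetD)
  have "?A \<union> ?A' \<subseteq> {(x, y). r x y}" by (auto simp: r_def)
  moreover have "finite {(x, y). r x y}"
    by (rule finite_subset[of _ "?W \<times> ?W"]) (use fin finite_V rW in auto)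
  ultimately have "card (?A \<union> ?A') \<le> card {(x, y). r x y}" by (intro card_mono)
  moreover have "card (?A \<union> ?A') = card ?A + card ?A'"
    by (rule card_Un_disjoint) (use fin finU in auto)
  moreover have "card ?A = (\<Sum>P\<in>\<P>. card (\<Union>P))" "card ?A' = (\<Sum>P\<in>\<P>. card (\<Union>P))"
    using fin finU by (subst card_image; auto simp: inj_on_def card_SigmaI)+
  ultimately show ?thesis using le by simp
qed

end

section \<open>Balanced separators made of geodesics in the crossing graph\<close>

lemma winding_number_linepath_subdivide:
  fixes a d :: complex
  assumes "y \<notin> closed_segment a (a + of_nat n * d)"
  shows "(\<Sum>i<n. winding_number (linepath (a + of_nat i * d) (a + of_nat (Suc i) * d)) y)
     = winding_number (linepath a (a + of_nat n * d)) y"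
  using assms
proof (induction n)
  case 0
  then have "winding_number (linepath a a) y = 0" by (intro winding_number_trivial) auto
  then show ?case by (simp only: lessThan_0 sum.empty of_nat_0 mult_zero_left add_0_right)
next
  case (Suc n)
  have mem: "a + of_nat n * d \<in> closed_segment a (a + of_nat (Suc n) * d)"
  proof -
    have "a + of_nat n * d = (1 - real n / real (Suc n)) *\<^sub>R a + (real n / real (Suc n)) *\<^sub>R (a + of_nat (Suc n) * d)"
      by (simp add: scaleR_conv_of_real field_simps del: of_nat_Suc)
    then show ?thesis unfolding in_segment by (intro exI[of _ "real n / real (Suc n)"]) auto
  qed
  then have "closed_segment a (a + of_nat n * d) \<subseteq> closed_segment a (a + of_nat (Suc n) * d)"
    by (simp add: subset_closed_segment)
  then have "y \<notin> closed_segment a (a + of_nat n * d)" using Suc.prems by blast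
  then have "(\<Sum>i<n. winding_number (linepath (a + of_nat i * d) (a + of_nat (Suc i) * d)) y)
     = winding_number (linepath a (a + of_nat n * d)) y" by (rule Suc.IH)
  then show ?case
    using winding_number_split_linepath[OF mem Suc.prems] by (simp del: of_nat_Suc)
qed

text \<open>A discrete Stokes argument. The value attached to a grid edge is the winding number, around the members of
  \<open>\<F>\<close> that avoid it, of the loop through \<open>\<rho>\<close> closed up by that edge; it vanishes around every cell, but adds up to
  \<open>1\<close> along the boundary of the grid.\<close>

lemma no_grid_haven:
  fixes p :: "nat \<Rightarrow> nat \<Rightarrow> real \<Rightarrow> complex" and \<F> :: "complex set set" and z0 \<rho> :: complex and h \<epsilon> :: real
  defines "G \<equiv> \<lambda>i j. z0 + of_nat i * of_real h + of_nat j * (\<i> * of_real h)"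
  defines "A \<equiv> \<lambda>i j. path_image (p i j) \<union> cball (G i j) \<epsilon>"
  assumes h: "0 < h" "2 * h \<le> \<epsilon>" and N: "0 < N"
    and p: "\<And>i j. i \<le> N \<Longrightarrow> j \<le> N \<Longrightarrow> path (p i j) \<and> pathstart (p i j) = G i j \<and> pathfinish (p i j) = \<rho>"
    and con: "\<And>Y. Y \<in> \<F> \<Longrightarrow> connected Y" and meet: "\<And>Y Y'. Y \<in> \<F> \<Longrightarrow> Y' \<in> \<F> \<Longrightarrow> Y \<inter> Y' \<noteq> {}"
    and sq: "\<And>i j. i < N \<Longrightarrow> j < N \<Longrightarrow> \<exists>Y\<in>\<F>. Y \<inter> (A i j \<union> A (Suc i) j \<union> A i (Suc j) \<union> A (Suc i) (Suc j)) = {}"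
    and bd: "\<exists>Y\<in>\<F>. \<exists>y\<in>Y. y \<in> box z0 (G N N) \<and> (\<forall>i\<le>N. \<forall>j\<le>N. i = 0 \<or> i = N \<or> j = 0 \<or> j = N \<longrightarrow> Y \<inter> A i j = {})"
  shows False
proof -
  \<comment> \<open>The loop runs along the grid edge, on to \<rho> and back. Written as a sum, its
    \<open>p\<close> terms cancel around a cell and around the boundary of the grid.\<close>
  define w where "w i j i' j' y = winding_number (linepath (G i j) (G i' j')) y + winding_number (p i' j') y - winding_number (p i j) y" for i j i' j' y
  define step where "step i j i' j' \<longleftrightarrow> i \<le> N \<and> j \<le> N \<and> i' \<le> N \<and> j' \<le> N \<and> dist (G i j) (G i' j') \<le> \<epsilon>" for i j i' j'
  have seg: "closed_segment (G i j) (G i' j') \<subseteq> cball (G i j) \<epsilon>" if "step i j i' j'" for i j i' j'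
    using that h by (intro closed_segment_subset) (auto simp: step_def)
  \<comment> \<open>Members of \<F> meet pairwise, so two of them form a connected set; when it
    misses the loop, the winding number is the same at all its points. The choice made in
    \<open>s\<close> below is therefore immaterial.\<close>
  have const: "w i j i' j' y = w i j i' j' y'"
    if st: "step i j i' j'" and Y: "Y \<in> \<F>" "Y \<inter> (A i j \<union> A i' j') = {}" "Y' \<in> \<F>" "Y' \<inter> (A i j \<union> A i' j') = {}"
      and y: "y \<in> Y" "y' \<in> Y'" for i j i' j' y y' Y Y'
  proof -
    let ?L = "linepath (G i j) (G i' j') +++ p i' j' +++ reversepath (p i j)"
    have pp: "path (p i j)" "path (p i' j')" "pathstart (p i j) = G i j" "pathstart (p i' j') = G i' j'"
        "pathfinish (p i j) = \<rho>" "pathfinish (p i' j') = \<rho>"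
      using p st by (auto simp: step_def)
    have L: "path ?L" "pathfinish ?L = pathstart ?L" using pp by auto
    have im: "path_image ?L \<subseteq> A i j \<union> A i' j'"
      using pp seg[OF st] by (auto simp: path_image_join A_def)
    have conY: "connected (Y \<union> Y')" using con meet Y by (intro connected_Un) auto
    have "(Y \<union> Y') \<inter> path_image ?L = {}" using im Y(2,4) by blast
    then have "winding_number ?L constant_on (Y \<union> Y')"
      by (intro winding_number_constant L conY)
    then have "winding_number ?L y = winding_number ?L y'" using y by (auto simp: constant_on_def)
    moreover have "winding_number ?L z = w i j i' j' z" if z: "z \<in> Y \<union> Y'" for z
    proof -
      have z': "z \<notin> A i j" "z \<notin> A i' j'" using z Y(2,4) by blast+
      have 1: "z \<notin> path_image (p i j)" "z \<notin> path_image (p i' j')" "z \<notin> closed_segment (G i j) (G i' j')"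
        using z' seg[OF st] by (auto simp: A_def)
      have "winding_number ?L z = winding_number (linepath (G i j) (G i' j')) z + winding_number (p i' j' +++ reversepath (p i j)) z"
        using 1 pp by (intro winding_number_join) (auto simp: path_image_join)
      also have "winding_number (p i' j' +++ reversepath (p i j)) z = winding_number (p i' j') z + winding_number (reversepath (p i j)) z"
        using 1 pp by (intro winding_number_join) auto
      also have "winding_number (reversepath (p i j)) z = - winding_number (p i j) z"
        using 1 pp by (intro winding_number_reversepath)
      finally show ?thesis by (simp add: w_def)
    qed
    ultimately show ?thesis using y by simp
  qed
  have dist1: "dist (G i j) (G (Suc i) j) = h" "dist (G i j) (G i (Suc j)) = h" for i j
    using h by (auto simp: G_def dist_norm norm_mult algebra_simps)
  define good where "good i j i' j' y \<longleftrightarrow> (\<exists>Y\<in>\<F>. y \<in> Y \<and> Y \<inter> (A i j \<union> A i' j') = {})" for i j i' j' y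
  define s where "s i j i' j' = w i j i' j' (SOME y. good i j i' j' y)" for i j i' j'
  have s_eq: "s i j i' j' = w i j i' j' y" if sg: "step i j i' j'" "good i j i' j' y" for i j i' j' y
  proof -
    have "good i j i' j' (SOME y. good i j i' j' y)" using sg(2) by (rule someI)
    then obtain Y where Y: "Y \<in> \<F>" "(SOME y. good i j i' j' y) \<in> Y" "Y \<inter> (A i j \<union> A i' j') = {}"
      unfolding good_def by (elim bexE conjE)
    obtain Y' where Y': "Y' \<in> \<F>" "y \<in> Y'" "Y' \<inter> (A i j \<union> A i' j') = {}"
      using sg(2) unfolding good_def by (elim bexE conjE)
    show ?thesis unfolding s_def by (rule const[OF sg(1) Y(1,3) Y'(1,3) Y(2) Y'(2)])
  qed
  have stepH: "step i j (Suc i) j" if "i < N" "j \<le> N" for i j using that h dist1 by (auto simp: step_def)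
  have stepV: "step i j i (Suc j)" if "i \<le> N" "j < N" for i j using that h dist1 by (auto simp: step_def)
  \<comment> \<open>One member avoids the sets of all four corners, so a single point serves the
    four edges: the path terms cancel, and the contour of the cell lies in a disc that misses the
    point. The opposite corner is in this disc because
    \<open>2 * h \<le> \<epsilon>\<close>.\<close>
  have cell: "s i j (Suc i) j + s (Suc i) j (Suc i) (Suc j) - s i (Suc j) (Suc i) (Suc j) - s i j i (Suc j) = 0"
    if ij: "i < N" "j < N" for i j
  proof -
    obtain Y where Y: "Y \<in> \<F>" "Y \<inter> (A i j \<union> A (Suc i) j \<union> A i (Suc j) \<union> A (Suc i) (Suc j)) = {}"
      using sq[OF ij] by (elim bexE)
    have "Y \<inter> Y \<noteq> {}" using meet Y(1) by blast
    then obtain y where y: "y \<in> Y" by blast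
    have g: "good i j (Suc i) j y" "good (Suc i) j (Suc i) (Suc j) y" "good i (Suc j) (Suc i) (Suc j) y" "good i j i (Suc j) y"
      unfolding good_def using Y y by blast+
    let ?a = "G i j" and ?b = "G (Suc i) j" and ?c = "G (Suc i) (Suc j)" and ?d = "G i (Suc j)"
    have eq: "s i j (Suc i) j + s (Suc i) j (Suc i) (Suc j) - s i (Suc j) (Suc i) (Suc j) - s i j i (Suc j)
      = winding_number (linepath ?a ?b) y + winding_number (linepath ?b ?c) y - winding_number (linepath ?d ?c) y - winding_number (linepath ?a ?d) y"
      using g ij by (simp add: s_eq stepH stepV w_def)
    have yb: "y \<notin> cball ?a \<epsilon>" using Y(2) y by (auto simp: A_def)
    have in_ball: "?a \<in> cball ?a \<epsilon>" "?b \<in> cball ?a \<epsilon>" "?d \<in> cball ?a \<epsilon>" "?c \<in> cball ?a \<epsilon>"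
    proof -
      have "dist ?a ?c \<le> dist ?a ?b + dist ?b ?c" by (rule dist_triangle)
      then show "?a \<in> cball ?a \<epsilon>" "?b \<in> cball ?a \<epsilon>" "?d \<in> cball ?a \<epsilon>" "?c \<in> cball ?a \<epsilon>" using dist1 h by auto
    qed
    have segs: "closed_segment u v \<subseteq> cball ?a \<epsilon>" if "u \<in> {?a, ?b, ?c, ?d}" "v \<in> {?a, ?b, ?c, ?d}" for u v
      using that in_ball by (intro closed_segment_subset) auto
    have ys: "y \<notin> closed_segment u v" if "u \<in> {?a, ?b, ?c, ?d}" "v \<in> {?a, ?b, ?c, ?d}" for u v
      using segs[OF that] yb by blast
    let ?q = "linepath ?a ?b +++ linepath ?b ?c +++ linepath ?c ?d +++ linepath ?d ?a"
    have "winding_number ?q y = 0"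
    proof (rule winding_number_zero_outside[of _ "cball ?a \<epsilon>"])
      show "path_image ?q \<subseteq> cball ?a \<epsilon>" using segs by (auto simp: path_image_join)
    qed (use yb in auto)
    moreover have "winding_number ?q y = winding_number (linepath ?a ?b) y + (winding_number (linepath ?b ?c) y
        + (winding_number (linepath ?c ?d) y + winding_number (linepath ?d ?a) y))"
      using ys by (simp add: winding_number_join path_image_join)
    moreover have "winding_number (linepath ?c ?d) y = - winding_number (linepath ?d ?c) y"
        "winding_number (linepath ?d ?a) y = - winding_number (linepath ?a ?d) y"
      using winding_number_reversepath[of "linepath ?d ?c" y] winding_number_reversepath[of "linepath ?a ?d" y] ys by auto
    moreover have "a + b - c - d = 0" if "q = 0" "q = a + (b + (e + f))" "e = - c" "f = - d" for a b c d e f q :: complex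
    proof -
      have "a + b - c - d = a + (b + (- c + - d))" by simp
      also have "\<dots> = q" unfolding that(2-4) ..
      finally show ?thesis using that(1) by simp
    qed
    ultimately show ?thesis unfolding eq by metis
  qed
  have "(\<Sum>j<N. \<Sum>i<N. s i j (Suc i) j + s (Suc i) j (Suc i) (Suc j) - s i (Suc j) (Suc i) (Suc j) - s i j i (Suc j)) = 0"
    using cell by (intro sum.neutral ballI) auto
  moreover have "(\<Sum>j<N. \<Sum>i<N. s i j (Suc i) j + s (Suc i) j (Suc i) (Suc j) - s i (Suc j) (Suc i) (Suc j) - s i j i (Suc j))
     = (\<Sum>i<N. s i 0 (Suc i) 0) - (\<Sum>i<N. s i N (Suc i) N) + (\<Sum>j<N. s N j N (Suc j)) - (\<Sum>j<N. s 0 j 0 (Suc j))"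
  proof -
    define R where "R j = (\<Sum>i<N. s i j (Suc i) j)" for j
    have row: "(\<Sum>i<N. s i j (Suc i) j + s (Suc i) j (Suc i) (Suc j) - s i (Suc j) (Suc i) (Suc j) - s i j i (Suc j))
       = (R j - R (Suc j)) + (s N j N (Suc j) - s 0 j 0 (Suc j))" for j
      using sum_lessThan_telescope[of "\<lambda>i. s i j i (Suc j)" N] by (simp add: R_def sum.distrib sum_subtractf algebra_simps)
    have "(\<Sum>j<N. (R j - R (Suc j)) + (s N j N (Suc j) - s 0 j 0 (Suc j)))
        = (R 0 - R N) + ((\<Sum>j<N. s N j N (Suc j)) - (\<Sum>j<N. s 0 j 0 (Suc j)))"
      unfolding sum.distrib sum_lessThan_telescope' sum_subtractf[of "\<lambda>j. s N j N (Suc j)"] ..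
    then show ?thesis unfolding row by (simp add: R_def)
  qed
  ultimately have total: "(\<Sum>i<N. s i 0 (Suc i) 0) - (\<Sum>i<N. s i N (Suc i) N) + (\<Sum>j<N. s N j N (Suc j)) - (\<Sum>j<N. s 0 j 0 (Suc j)) = 0"
    by simp
  \<comment> \<open>One member misses the sets of all boundary grid points, so every boundary value
    can be read off at the same point inside the rectangle, around which its contour winds
    once.\<close>
  obtain Y y where Y: "Y \<in> \<F>" "y \<in> Y" "y \<in> box z0 (G N N)"
      "\<forall>i\<le>N. \<forall>j\<le>N. i = 0 \<or> i = N \<or> j = 0 \<or> j = N \<longrightarrow> Y \<inter> A i j = {}"
    using bd by (elim bexE conjE)
  have gb: "good i j i' j' y" if "i \<le> N" "j \<le> N" "i' \<le> N" "j' \<le> N" "i = 0 \<or> i = N \<or> j = 0 \<or> j = N" "i' = 0 \<or> i' = N \<or> j' = 0 \<or> j' = N" for i j i' j'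
    using Y that unfolding good_def by blast
  have "s i 0 (Suc i) 0 = w i 0 (Suc i) 0 y" "s i N (Suc i) N = w i N (Suc i) N y" "s N i N (Suc i) = w N i N (Suc i) y"
     "s 0 i 0 (Suc i) = w 0 i 0 (Suc i) y" if "i < N" for i
    using that by (auto intro!: s_eq gb stepH stepV)
  then have "(\<Sum>i<N. w i 0 (Suc i) 0 y) - (\<Sum>i<N. w i N (Suc i) N y) + (\<Sum>j<N. w N j N (Suc j) y) - (\<Sum>j<N. w 0 j 0 (Suc j) y) = 0"
    using total by simp
  moreover have "(\<Sum>i<N. w i 0 (Suc i) 0 y) = (\<Sum>i<N. winding_number (linepath (G i 0) (G (Suc i) 0)) y) + (winding_number (p N 0) y - winding_number (p 0 0) y)"
    using sum_lessThan_telescope[of "\<lambda>i. winding_number (p i 0) y" N] by (simp add: w_def sum.distrib sum_subtractf algebra_simps)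
  moreover have "(\<Sum>i<N. w i N (Suc i) N y) = (\<Sum>i<N. winding_number (linepath (G i N) (G (Suc i) N)) y) + (winding_number (p N N) y - winding_number (p 0 N) y)"
    using sum_lessThan_telescope[of "\<lambda>i. winding_number (p i N) y" N] by (simp add: w_def sum.distrib sum_subtractf algebra_simps)
  moreover have "(\<Sum>j<N. w N j N (Suc j) y) = (\<Sum>j<N. winding_number (linepath (G N j) (G N (Suc j))) y) + (winding_number (p N N) y - winding_number (p N 0) y)"
    using sum_lessThan_telescope[of "\<lambda>i. winding_number (p N i) y" N] by (simp add: w_def sum.distrib sum_subtractf algebra_simps)
  moreover have "(\<Sum>j<N. w 0 j 0 (Suc j) y) = (\<Sum>j<N. winding_number (linepath (G 0 j) (G 0 (Suc j))) y) + (winding_number (p 0 N) y - winding_number (p 0 0) y)"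
    using sum_lessThan_telescope[of "\<lambda>i. winding_number (p 0 i) y" N] by (simp add: w_def sum.distrib sum_subtractf algebra_simps)
  ultimately have sides: "(\<Sum>i<N. winding_number (linepath (G i 0) (G (Suc i) 0)) y) - (\<Sum>i<N. winding_number (linepath (G i N) (G (Suc i) N)) y)
     + (\<Sum>j<N. winding_number (linepath (G N j) (G N (Suc j))) y) - (\<Sum>j<N. winding_number (linepath (G 0 j) (G 0 (Suc j))) y) = 0"
    by (simp add: algebra_simps)
  let ?z1 = "G N N"
  have z1: "Re ?z1 = Re z0 + real N * h" "Im ?z1 = Im z0 + real N * h" by (simp_all add: G_def)
  have corners: "G 0 0 = z0" "G N 0 = Complex (Re ?z1) (Im z0)" "G 0 N = Complex (Re z0) (Im ?z1)"
    by (simp_all add: G_def complex_eq_iff)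
  have lt: "Re z0 < Re ?z1" "Im z0 < Im ?z1" using z1 h N by auto
  have "y \<notin> path_image (rectpath z0 ?z1)"
    using Y(3) path_image_rectpath_cbox_minus_box[of z0 ?z1] lt by auto
  then have ysides: "y \<notin> closed_segment (G 0 0) (G N 0)" "y \<notin> closed_segment (G N 0) (G N N)" "y \<notin> closed_segment (G N N) (G 0 N)" "y \<notin> closed_segment (G 0 N) (G 0 0)"
    unfolding corners by (auto simp: rectpath_def Let_def path_image_join closed_segment_commute)
  have sub1: "(\<Sum>i<N. winding_number (linepath (G i 0) (G (Suc i) 0)) y) = winding_number (linepath (G 0 0) (G N 0)) y"
    using winding_number_linepath_subdivide[of y "G 0 0" N "of_real h"] ysides(1) by (simp add: G_def add_ac)
  have sub2: "(\<Sum>i<N. winding_number (linepath (G i N) (G (Suc i) N)) y) = winding_number (linepath (G 0 N) (G N N)) y"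
    using winding_number_linepath_subdivide[of y "G 0 N" N "of_real h"] ysides(3) by (simp add: G_def add_ac closed_segment_commute)
  have sub3: "(\<Sum>j<N. winding_number (linepath (G N j) (G N (Suc j))) y) = winding_number (linepath (G N 0) (G N N)) y"
    using winding_number_linepath_subdivide[of y "G N 0" N "\<i> * of_real h"] ysides(2) by (simp add: G_def add_ac)
  have sub4: "(\<Sum>j<N. winding_number (linepath (G 0 j) (G 0 (Suc j))) y) = winding_number (linepath (G 0 0) (G 0 N)) y"
    using winding_number_linepath_subdivide[of y "G 0 0" N "\<i> * of_real h"] ysides(4) by (simp add: G_def add_ac closed_segment_commute)
  have rev: "winding_number (linepath (G N N) (G 0 N)) y = - winding_number (linepath (G 0 N) (G N N)) y"
     "winding_number (linepath (G 0 N) (G 0 0)) y = - winding_number (linepath (G 0 0) (G 0 N)) y"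
    using winding_number_reversepath[of "linepath (G 0 N) (G N N)" y] winding_number_reversepath[of "linepath (G 0 0) (G 0 N)" y] ysides
    by (auto simp: closed_segment_commute)
  have "rectpath z0 ?z1 = linepath (G 0 0) (G N 0) +++ linepath (G N 0) (G N N) +++ linepath (G N N) (G 0 N) +++ linepath (G 0 N) (G 0 0)"
    unfolding corners by (simp add: rectpath_def Let_def)
  then have "winding_number (rectpath z0 ?z1) y = winding_number (linepath (G 0 0) (G N 0)) y + (winding_number (linepath (G N 0) (G N N)) y
     + (winding_number (linepath (G N N) (G 0 N)) y + winding_number (linepath (G 0 N) (G 0 0)) y))"
    using ysides by (simp add: winding_number_join path_image_join)
  moreover have "q = 0" if "a - b + c - d = 0" "a = a'" "b = b'" "c = c'" "d = d'" "e = - b'" "f = - d'" "q = a' + (c' + (e + f))"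
    for a b c d a' b' c' d' e f q :: complex
  proof -
    have "q = a' - b' + c' - d'" unfolding that(6-8) by simp
    then show ?thesis using that(1-5) by simp
  qed
  ultimately have "winding_number (rectpath z0 ?z1) y = 0" using sides sub1 sub2 sub3 sub4 rev by metis
  moreover have "winding_number (rectpath z0 ?z1) y = 1" using Y(3) by (rule winding_number_rectpath)
  ultimately show False by simp
qed

text \<open>For a subfamily without a common point, the sum of the distances to its members has a
  positive minimum on one of them, and a disc small against it cannot meet all members; finitely
  many subfamilies leave one scale. In this way the number of edges near a grid point is bounded by
  the number through a single point.\<close>

lemma compact_common_point_scale:
  fixes K :: "'i \<Rightarrow> complex set"
  assumes fin: "finite S" and cpt: "\<And>e. e \<in> S \<Longrightarrow> compact (K e)" and ne: "\<And>e. e \<in> S \<Longrightarrow> K e \<noteq> {}"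
  shows "\<exists>\<epsilon>>0. \<forall>z. \<forall>F\<subseteq>S. F \<noteq> {} \<longrightarrow> (\<forall>e\<in>F. K e \<inter> cball z \<epsilon> \<noteq> {}) \<longrightarrow> (\<exists>x. \<forall>e\<in>F. x \<in> K e)"
proof -
  have ex: "\<exists>\<epsilon>>0. \<forall>z. (\<forall>e\<in>F. K e \<inter> cball z \<epsilon> \<noteq> {}) \<longrightarrow> (\<exists>x. \<forall>e\<in>F. x \<in> K e)" if F: "F \<subseteq> S" "F \<noteq> {}" for F
  proof (cases "\<exists>x. \<forall>e\<in>F. x \<in> K e")
    case True
    then show ?thesis by (intro exI[of _ 1]) auto
  next
    case False
    obtain e0 where e0: "e0 \<in> F" using F by blast
    have finF: "finite F" using F fin finite_subset by blast
    let ?h = "\<lambda>w. \<Sum>e\<in>F. infdist w (K e)"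
    have "continuous_on (K e0) ?h" by (intro continuous_intros)
    then obtain w0 where w0: "w0 \<in> K e0" "\<And>w. w \<in> K e0 \<Longrightarrow> ?h w0 \<le> ?h w"
      using continuous_attains_inf[of "K e0" ?h] cpt ne e0 F by blast
    have "?h w0 \<noteq> 0"
    proof
      assume "?h w0 = 0"
      then have "\<forall>e\<in>F. infdist w0 (K e) = 0" using finF by (simp add: sum_nonneg_eq_0_iff infdist_nonneg)
      then have "\<forall>e\<in>F. w0 \<in> K e"
        using in_closed_iff_infdist_zero cpt ne F by (metis compact_imp_closed subsetD)
      then show False using False by blast
    qed
    then have pos: "?h w0 > 0" using sum_nonneg[of F "\<lambda>e. infdist w0 (K e)"] by (simp add: infdist_nonneg less_le)
    have cF: "card F > 0" using finF F by (simp add: card_gt_0_iff)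
    \<comment> \<open>Two points of the disc are at most \<open>2 * \<epsilon>\<close> apart, so a
      disc meeting all members would make the sum at most half of its minimum.\<close>
    define \<epsilon> where "\<epsilon> = ?h w0 / (4 * card F)"
    have \<epsilon>: "\<epsilon> > 0" using pos cF by (simp add: \<epsilon>_def)
    have "\<not> (\<forall>e\<in>F. K e \<inter> cball z \<epsilon> \<noteq> {})" for z
    proof
      assume near: "\<forall>e\<in>F. K e \<inter> cball z \<epsilon> \<noteq> {}"
      then obtain w where "w \<in> K e0 \<inter> cball z \<epsilon>" using e0 by blast
      then have w: "w \<in> K e0" "dist z w \<le> \<epsilon>" by auto
      have "infdist w (K e) \<le> 2 * \<epsilon>" if "e \<in> F" for e
      proof -
        have "K e \<inter> cball z \<epsilon> \<noteq> {}" using near that by blast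
        then obtain x where "x \<in> K e \<inter> cball z \<epsilon>" by blast
        then have x: "x \<in> K e" "dist z x \<le> \<epsilon>" by auto
        have "infdist w (K e) \<le> dist w x" using x by (rule_tac infdist_le)
        also have "\<dots> \<le> dist z w + dist z x" by (metis dist_commute dist_triangle)
        finally show ?thesis using w x by simp
      qed
      then have "?h w \<le> card F * (2 * \<epsilon>)" using sum_bounded_above[of F "\<lambda>e. infdist w (K e)" "2 * \<epsilon>"] by simp
      also have "\<dots> < ?h w0" using pos cF by (simp add: \<epsilon>_def field_simps)
      also have "\<dots> \<le> ?h w" using w0 w by blast
      finally show False by simp
    qed
    then show ?thesis using \<epsilon> by blast
  qed
  define eps where "eps F = (SOME \<epsilon>. \<epsilon> > 0 \<and> (\<forall>z. (\<forall>e\<in>F. K e \<inter> cball z \<epsilon> \<noteq> {}) \<longrightarrow> (\<exists>x. \<forall>e\<in>F. x \<in> K e)))" for F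
  have eps: "eps F > 0 \<and> (\<forall>z. (\<forall>e\<in>F. K e \<inter> cball z (eps F) \<noteq> {}) \<longrightarrow> (\<exists>x. \<forall>e\<in>F. x \<in> K e))" if "F \<in> Pow S - {{}}" for F
    unfolding eps_def by (rule someI_ex) (use ex that in auto)
  define \<epsilon> where "\<epsilon> = Min (insert 1 (eps ` (Pow S - {{}})))"
  have "\<epsilon> > 0" unfolding \<epsilon>_def using fin eps by (subst Min_gr_iff) auto
  moreover have "\<exists>x. \<forall>e\<in>F. x \<in> K e" if F: "F \<subseteq> S" "F \<noteq> {}" "\<forall>e\<in>F. K e \<inter> cball z \<epsilon> \<noteq> {}" for F z
  proof -
    have "\<epsilon> \<le> eps F" unfolding \<epsilon>_def using fin F by (intro Min_le) auto
    then have "\<forall>e\<in>F. K e \<inter> cball z (eps F) \<noteq> {}" using F(3) by fastforce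
    then show ?thesis using eps[of F] F by blast
  qed
  ultimately show ?thesis by blast
qed

section \<open>Barriers and separators in a drawing\<close>

context simple_tg
begin

definition no_clique :: "nat \<Rightarrow> complex set set \<Rightarrow> bool" where
  "no_clique k F \<longleftrightarrow> \<not> (\<exists>C\<subseteq>F. card C = k \<and> (\<forall>e\<in>C. \<forall>f\<in>C. e \<noteq> f \<longrightarrow> crossing e f))"

text \<open>At a vertex the edges are determined by their other ends; the edges through any other
  point cross pairwise, so there are fewer than \<open>k\<close> of them.\<close>

lemma card_through_point:
  assumes S: "S \<subseteq> E" "no_clique k S"
  shows "card {e \<in> S. z \<in> img e} \<le> card V + k"
proof (cases "z \<in> V")
  case True
  have "{e \<in> S. z \<in> img e} \<subseteq> (\<lambda>u. {z, u}) ` V"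
  proof
    fix e assume "e \<in> {e \<in> S. z \<in> img e}"
    then have e: "e \<in> E" "z \<in> e" using S(1) True edgeD(5)[of e] by auto
    obtain a b where ab: "e = {a, b}" using edgeD(2)[OF e(1)] by (auto simp: card_2_iff)
    then show "e \<in> (\<lambda>u. {z, u}) ` V" using e(2) edgeD(1)[OF e(1)] by (auto simp: insert_commute)
  qed
  then have "card {e \<in> S. z \<in> img e} \<le> card V"
    using finite_V by (meson card_image_le card_mono finite_imageI le_trans)
  then show ?thesis by simp
next
  case False
  let ?C = "{e \<in> S. z \<in> img e}"
  have cr: "crossing e f" if "e \<in> ?C" "f \<in> ?C" for e f using that False S(1) crossing_iff[of e f] by auto
  have fin: "finite ?C" using S(1) finite_E finite_subset by fastforce
  have "card ?C < k"
  proof (rule ccontr)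
    assume "\<not> card ?C < k"
    then obtain C where "C \<subseteq> ?C" "card C = k" using fin by (meson not_less obtain_subset_with_card_n)
    then show False using S(2) cr unfolding no_clique_def by blast
  qed
  then show ?thesis by simp
qed

text \<open>On a shortest chain the neighbourhoods of members whose indices are congruent modulo 4 do not cross each other, so a
  clique in their union lies in one neighbourhood and extends by its centre.\<close>

lemma geodesic_chain:
  assumes S: "S \<subseteq> E" "r_connected crossing S" and cr: "c \<in> S" "r \<in> S" and k: "2 \<le> k" "no_clique k S"
    and F: "\<And>T. \<lbrakk>T \<subseteq> S; no_clique (k - 1) T\<rbrakk> \<Longrightarrow> card T \<le> F"
  shows "\<exists>B\<subseteq>S. c \<in> B \<and> r \<in> B \<and> r_connected crossing B \<and> card {x \<in> S. \<exists>y\<in>B. crossing x y} \<le> 4 * F + 1"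
proof -
  have finS: "finite S" using S finite_E finite_subset by blast
  define ch where "ch xs \<longleftrightarrow> xs \<noteq> [] \<and> set xs \<subseteq> S \<and> (\<forall>i. Suc i < length xs \<longrightarrow> crossing (xs ! i) (xs ! Suc i))" for xs
  have "\<exists>xs. ch xs \<and> hd xs = c \<and> last xs = r"
  proof -
    have "(c, r) \<in> {(u, v). u \<in> S \<and> v \<in> S \<and> crossing u v}\<^sup>*" using S cr by (auto simp: r_connected_def)
    then show ?thesis
    proof (induction rule: rtrancl_induct)
      case base
      then show ?case using cr by (intro exI[of _ "[c]"]) (auto simp: ch_def)
    next
      case (step y z)
      then obtain xs where xs: "ch xs" "hd xs = c" "last xs = y" by blast
      have "crossing ((xs @ [z]) ! i) ((xs @ [z]) ! Suc i)" if "Suc i < length (xs @ [z])" for i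
      proof (cases "Suc i < length xs")
        case True
        then show ?thesis using xs(1) by (auto simp: ch_def nth_append)
      next
        case False
        then have "Suc i = length xs" using that by simp
        then have "xs ! i = y" using xs by (metis ch_def diff_Suc_1 last_conv_nth)
        then show ?thesis using step(2) \<open>Suc i = length xs\<close> by (auto simp: nth_append)
      qed
      then show ?case using xs step(2) by (intro exI[of _ "xs @ [z]"]) (auto simp: ch_def)
    qed
  qed
  then obtain xs where xs: "ch xs \<and> hd xs = c \<and> last xs = r"
    and min: "\<And>ys. ch ys \<and> hd ys = c \<and> last ys = r \<Longrightarrow> length xs \<le> length ys"
    using ex_has_least_nat[of "\<lambda>xs. ch xs \<and> hd xs = c \<and> last xs = r" _ length] by blast
  let ?n = "length xs"
  have n: "?n > 0" "set xs \<subseteq> S" "\<And>i. Suc i < ?n \<Longrightarrow> crossing (xs ! i) (xs ! Suc i)" using xs by (auto simp: ch_def)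
  have xsne: "xs \<noteq> []" using n(1) by auto
  have inS: "xs ! i \<in> S" if "i < ?n" for i using n(2) that by auto
  \<comment> \<open>Minimality in a usable form: a detour through \<open>ys\<close> is at least as
    long as the stretch from position \<open>i\<close> to position \<open>j\<close> that it
    replaces.\<close>
  have short: "j \<le> i + Suc (length ys)"
    if ij: "i < j" "j < ?n" and ys: "ch (xs ! i # ys @ [xs ! j])" for i j ys
  proof -
    let ?zs = "take i xs @ (xs ! i # ys @ [xs ! j]) @ drop (Suc j) xs"
    have "ch ?zs"
      unfolding ch_def
    proof (intro conjI allI impI)
      show "?zs \<noteq> []" by simp
      show "set ?zs \<subseteq> S" using n(2) ys set_take_subset[of i xs] set_drop_subset[of "Suc j" xs] by (auto simp: ch_def)
      fix l assume l: "Suc l < length ?zs"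
      let ?m = "xs ! i # ys @ [xs ! j]"
      have mid: "crossing (?m ! a) (?m ! Suc a)" if "Suc a < length ?m" for a using ys that by (auto simp: ch_def)
      have li: "length (take i xs) = i" using ij by simp
      consider "Suc l < i" | "Suc l = i" | "i \<le> l" "Suc l < i + length ?m" | "Suc l = i + length ?m" | "i + length ?m \<le> l" by linarith
      then show "crossing (?zs ! l) (?zs ! Suc l)"
      proof cases
        case 1 then show ?thesis using n(3)[of l] ij li by (simp add: nth_append)
      next
        case 2 then show ?thesis using n(3)[of l] ij li by (simp add: nth_append)
      next
        case 3
        then have "?zs ! l = ?m ! (l - i)" "?zs ! Suc l = ?m ! Suc (l - i)"
          using li by (auto simp: nth_append Suc_diff_le simp del: append_Cons)
        then show ?thesis using mid[of "l - i"] 3 by auto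
      next
        case 4
        then have "?zs ! l = last ?m" "?zs ! Suc l = drop (Suc j) xs ! 0" "Suc j < ?n"
          using li l by (auto simp: nth_append last_conv_nth)
        then show ?thesis using n(3)[of j] by simp
      next
        case 5
        let ?pre = "take i xs @ ?m"
        have zs: "?zs = ?pre @ drop (Suc j) xs" by simp
        have lp: "length ?pre = i + length ?m" using li by simp
        have "\<not> l < length ?pre" "\<not> Suc l < length ?pre" "Suc l - length ?pre = Suc (l - length ?pre)"
          unfolding lp using 5 by (simp_all add: Suc_diff_le)
        then have "?zs ! l = drop (Suc j) xs ! (l - (i + length ?m))" "?zs ! Suc l = drop (Suc j) xs ! Suc (l - (i + length ?m))"
          unfolding zs nth_append lp by simp_all
        moreover have "Suc (Suc j + (l - (i + length ?m))) < ?n" using l 5 li ij by auto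
        ultimately show ?thesis using n(3)[of "Suc j + (l - (i + length ?m))"] by simp
      qed
    qed
    moreover have "hd ?zs = c"
    proof (cases "i = 0")
      case True then show ?thesis using xs n by (simp add: hd_conv_nth)
    next
      case False then show ?thesis using xs n ij by (simp add: hd_append)
    qed
    moreover have "last ?zs = r"
    proof (cases "Suc j < ?n")
      case True then show ?thesis using xs by (simp add: last_drop)
    next
      case False
      then have "xs ! j = last xs" using ij n by (metis Suc_lessI diff_Suc_1 last_conv_nth length_greater_0_conv)
      then show ?thesis using False xs ij by simp
    qed
    ultimately have "?n \<le> length ?zs" using min by blast
    then show ?thesis using ij by simp
  qed
  define Nb where "Nb i = {x \<in> S. crossing x (xs ! i) \<and> x \<noteq> xs ! i}" for i
  \<comment> \<open>A crossing between a neighbour of \<open>xs ! i\<close> and one of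
    \<open>xs ! j\<close> gives a detour with two inner members, hence positions at most 3
    apart.\<close>
  have far: "j \<le> i + 3" if ij: "i < ?n" "j < ?n" and x: "x \<in> Nb i" "y \<in> Nb j" "crossing x y" for i j x y
  proof (rule ccontr)
    assume "\<not> ?thesis"
    then have "i + 3 < j" by simp
    moreover have "ch (xs ! i # [x, y] @ [xs ! j])"
      using x inS ij crossing_sym unfolding ch_def Nb_def by (auto simp: less_Suc_eq nth_Cons')
    ultimately show False using short[of i j "[x, y]"] ij by auto
  qed
  \<comment> \<open>Every edge crosses itself, so an immediate repetition is a legal step of a
    chain; minimality rules it out.\<close>
  have distinct: "xs ! i \<noteq> xs ! Suc i" if "Suc i < ?n" for i
  proof
    assume eq: "xs ! i = xs ! Suc i"
    show False
    proof (cases "Suc (Suc i) < ?n")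
      case True
      have "ch (xs ! i # [] @ [xs ! Suc (Suc i)])"
        using n(3)[OF True] eq inS[of i] inS[OF True] that by (auto simp: ch_def less_Suc_eq)
      then show False using short[of i "Suc (Suc i)" "[]"] True by simp
    next
      case False
      then have n2: "?n = Suc (Suc i)" using that by simp
      have "last xs = xs ! Suc i" using n2 by (simp add: last_conv_nth[OF xsne])
      have bl: "length (butlast xs) = Suc i" using n2 by simp
      have bne: "butlast xs \<noteq> []"
      proof
        assume "butlast xs = []"
        then show False using bl arg_cong[of "butlast xs" "[]" length] by (simp only: list.size)
      qed
      have "ch (butlast xs)"
        unfolding ch_def using bne n bl by (auto simp: nth_butlast dest: in_set_butlastD)
      moreover have "hd (butlast xs) = c"
        using bne xs bl nth_butlast[of 0 xs] by (simp add: hd_conv_nth xsne)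
      moreover have "last (butlast xs) = r"
      proof -
        have "last (butlast xs) = xs ! i" using bne bl nth_butlast[of i xs] by (simp add: last_conv_nth)
        then show ?thesis using xs eq \<open>last xs = xs ! Suc i\<close> by simp
      qed
      ultimately have "?n \<le> length (butlast xs)" using min by blast
      then show False using n2 bl by simp
    qed
  qed
  define T where "T q = (\<Union>i\<in>{i. i < ?n \<and> i mod 4 = q}. Nb i)" for q
  have Tc: "card (T q) \<le> F" for q
  proof (rule F)
    show "T q \<subseteq> S" by (auto simp: T_def Nb_def)
    show "no_clique (k - 1) (T q)"
      unfolding no_clique_def
    proof (rule notI, elim exE conjE)
      fix C assume C: "C \<subseteq> T q" "card C = k - 1" "\<forall>e\<in>C. \<forall>f\<in>C. e \<noteq> f \<longrightarrow> crossing e f"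
      then have "C \<noteq> {}" using k by auto
      then obtain x where x: "x \<in> C" by blast
      then obtain i where i: "i < ?n" "i mod 4 = q" "x \<in> Nb i" using C(1) by (auto simp: T_def)
      have all: "y \<in> Nb i" if y: "y \<in> C" for y
      proof -
        obtain j where j: "j < ?n" "j mod 4 = q" "y \<in> Nb j" using C(1) y by (auto simp: T_def)
        have "x \<in> E" using i S by (auto simp: Nb_def)
        then have "crossing x y" using C(3) x y crossing_refl by (cases "x = y") auto
        then have "j \<le> i + 3" "i \<le> j + 3" using far[OF i(1) j(1) i(3) j(3)] far[OF j(1) i(1) j(3) i(3)] crossing_sym by metis+
        moreover have "4 * (i div 4) + q = i" "4 * (j div 4) + q = j" using i(2) j(2) mult_div_mod_eq[of 4 i] mult_div_mod_eq[of 4 j] by simp_all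
        ultimately have "i div 4 = j div 4" by linarith
        then have "i = j" using \<open>4 * (i div 4) + q = i\<close> \<open>4 * (j div 4) + q = j\<close> by metis
        then show ?thesis using j by simp
      qed
      have "card (insert (xs ! i) C) = k"
      proof -
        have "xs ! i \<notin> C" using all by (auto simp: Nb_def)
        moreover have "C \<subseteq> S" using all by (auto simp: Nb_def)
        then have "finite C" using finS by (rule finite_subset)
        ultimately show ?thesis using C(2) k by simp
      qed
      moreover have "insert (xs ! i) C \<subseteq> S" using all inS i by (auto simp: Nb_def)
      moreover have "\<forall>e\<in>insert (xs ! i) C. \<forall>f\<in>insert (xs ! i) C. e \<noteq> f \<longrightarrow> crossing e f"
        using all C(3) crossing_sym by (auto simp: Nb_def)
      ultimately show False using k(2) unfolding no_clique_def by blast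
    qed
  qed
  \<comment> \<open>\<open>Nb i\<close> omits its own centre. A chain member with a successor lies
    in the neighbourhood of that successor, so only the last member \<open>r\<close> has to be
    added, which is the 1 in \<open>4 * F + 1\<close>.\<close>
  have "{x \<in> S. \<exists>y\<in>set xs. crossing x y} \<subseteq> insert r (T 0 \<union> T 1 \<union> T 2 \<union> T 3)"
  proof
    fix x assume "x \<in> {x \<in> S. \<exists>y\<in>set xs. crossing x y}"
    then obtain i where i: "x \<in> S" "i < ?n" "crossing x (xs ! i)" by (auto simp: in_set_conv_nth)
    have inT: "y \<in> T 0 \<union> T 1 \<union> T 2 \<union> T 3" if "y \<in> Nb j" "j < ?n" for y j
    proof -
      have "j mod 4 = 0 \<or> j mod 4 = 1 \<or> j mod 4 = 2 \<or> j mod 4 = 3" by presburger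
      then show ?thesis using that unfolding T_def by auto
    qed
    show "x \<in> insert r (T 0 \<union> T 1 \<union> T 2 \<union> T 3)"
    proof (cases "x = xs ! i")
      case False
      then have "x \<in> Nb i" using i by (simp add: Nb_def)
      then show ?thesis using inT i by blast
    next
      case True
      show ?thesis
      proof (cases "Suc i < ?n")
        case True
        then have "x \<in> Nb (Suc i)" using i \<open>x = xs ! i\<close> n(3)[OF True] distinct[OF True] by (simp add: Nb_def)
        then show ?thesis using inT True by blast
      next
        case False
        then have "i = ?n - 1" using i by simp
        then have "x = r" using xs \<open>x = xs ! i\<close> by (simp add: last_conv_nth[OF xsne])
        then show ?thesis by simp
      qed
    qed
  qed
  moreover have finT: "finite (T q)" for q
    by (rule finite_subset[OF _ finS]) (auto simp: T_def Nb_def)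
  ultimately have "card {x \<in> S. \<exists>y\<in>set xs. crossing x y} \<le> card (insert r (T 0 \<union> T 1 \<union> T 2 \<union> T 3))"
    by (intro card_mono) auto
  also have "\<dots> \<le> Suc (card (T 0 \<union> T 1 \<union> T 2 \<union> T 3))" by (simp add: card_insert_if finT)
  also have "\<dots> \<le> Suc (card (T 0) + card (T 1) + card (T 2) + card (T 3))"
    by (intro iffD2[OF Suc_le_mono] order_trans[OF card_Un_le] add_mono order_refl)
  also have "\<dots> \<le> 4 * F + 1" using Tc[of 0] Tc[of 1] Tc[of 2] Tc[of 3] by simp
  finally have "card {x \<in> S. \<exists>y\<in>set xs. crossing x y} \<le> 4 * F + 1" .
  moreover have "r_connected crossing (set xs)"
  proof -
    let ?R = "{(u, v). u \<in> set xs \<and> v \<in> set xs \<and> crossing u v}"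
    have up: "(xs ! i, xs ! (i + d)) \<in> ?R\<^sup>* \<and> (xs ! (i + d), xs ! i) \<in> ?R\<^sup>*" if "i + d < ?n" for i d
      using that
    proof (induction d)
      case 0
      show ?case by simp
    next
      case (Suc d)
      have "i + d < ?n" using Suc.prems by simp
      moreover have "(xs ! (i + d), xs ! (i + Suc d)) \<in> ?R" "(xs ! (i + Suc d), xs ! (i + d)) \<in> ?R"
        using n(3)[of "i + d"] Suc.prems crossing_sym[of "xs ! (i + d)" "xs ! (i + Suc d)"] by auto
      ultimately show ?case
        using Suc.IH rtrancl.rtrancl_into_rtrancl[of "xs ! i" "xs ! (i + d)" ?R "xs ! (i + Suc d)"]
          converse_rtrancl_into_rtrancl[of "xs ! (i + Suc d)" "xs ! (i + d)" ?R "xs ! i"] by blast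
    qed
    have "(x, y) \<in> ?R\<^sup>*" if xy: "x \<in> set xs" "y \<in> set xs" for x y
    proof -
      obtain i where i: "i < ?n" "xs ! i = x" using xy(1) unfolding in_set_conv_nth by blast
      obtain j where j: "j < ?n" "xs ! j = y" using xy(2) unfolding in_set_conv_nth by blast
      show ?thesis using up[of i "j - i"] up[of j "i - j"] i j by (cases "i \<le> j") auto
    qed
    then show ?thesis using n(1) by (auto simp: r_connected_def)
  qed
  moreover have "c \<in> set xs" "r \<in> set xs" using xs hd_in_set[OF xsne] last_in_set[OF xsne] by auto
  ultimately show ?thesis using n(2) by (intro exI[of _ "set xs"]) auto
qed

lemma insert_interior_arc_connected:
  assumes "c \<in> E" "z \<in> img c"
  shows "path_connected (insert z (interior_arc c))"
proof (cases "z \<in> V")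
  case True
  then have "z \<in> c" using edgeD(5)[OF assms(1)] assms(2) by blast
  then show ?thesis using interior_arc(3)[OF assms(1)] by blast
next
  case False
  then have "insert z (interior_arc c) = interior_arc c" using assms(2) by (auto simp: interior_arc_def)
  then show ?thesis using interior_arc(1)[OF assms(1)] by simp
qed

lemma pieces_connected:
  assumes "P \<subseteq> E" "r_connected crossing P"
  shows "path_connected (\<Union>e\<in>P. interior_arc e)" "path_connected (\<Union>e\<in>P. img e)"
proof -
  have meet: "interior_arc e \<inter> interior_arc f \<noteq> {}" if "e \<in> P" "f \<in> P" "crossing e f" for e f
    using that assms(1) crossing_iff[of e f] by (auto simp: interior_arc_def)
  have sub: "interior_arc e \<subseteq> img e" for e by (auto simp: interior_arc_def)
  have "path_connected ((\<Union>e\<in>P. interior_arc e) \<union> (\<Union>e\<in>P. \<Union>f\<in>{f\<in>P. crossing e f}. {}))"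
  proof (rule path_connected_r_connected[OF assms(2)])
    show "path_connected (interior_arc e) \<and> interior_arc e \<noteq> {}" if "e \<in> P" for e using interior_arc assms(1) that by blast
    show "path_connected (interior_arc e \<union> {} \<union> interior_arc f)" if "e \<in> P" "f \<in> P" "crossing e f" for e f
      using path_connected_Un[OF _ _ meet[OF that]] interior_arc(1) that assms(1) by auto
  qed
  then show "path_connected (\<Union>e\<in>P. interior_arc e)" by simp
  have pi: "path_connected (img e)" if "e \<in> P" for e
    using edgeD(3)[of e] that assms(1) by (auto intro!: path_connected_path_image simp: arc_def)
  have "path_connected ((\<Union>e\<in>P. img e) \<union> (\<Union>e\<in>P. \<Union>f\<in>{f\<in>P. crossing e f}. {}))"
  proof (rule path_connected_r_connected[OF assms(2)])
    show "path_connected (img e) \<and> img e \<noteq> {}" if "e \<in> P" for e using pi[OF that] by simp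
    show "path_connected (img e \<union> {} \<union> img f)" if "e \<in> P" "f \<in> P" "crossing e f" for e f
    proof -
      have "img e \<inter> img f \<noteq> {}" using meet[OF that] sub[of e] sub[of f] by blast
      then show ?thesis using path_connected_Un[OF pi[OF that(1)] pi[OF that(2)]] by simp
    qed
  qed
  then show "path_connected (\<Union>e\<in>P. img e)" by simp
qed

text \<open>A straight segment from \<open>g\<close> to the nearest point \<open>q\<close> of the
  drawing meets the drawing at most in \<open>q\<close>; from there to \<rho> the barrier follows a
  geodesic chain along interior arcs, so an edge met on the way crosses a member of the chain. Edges
  through \<open>q\<close>, through \<rho> and near \<open>g\<close> each number at most as many as
  can pass through one point.\<close>

lemma barrier:
  assumes S: "S \<subseteq> E" "r_connected crossing S" and k: "2 \<le> k" "no_clique k S"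
    and F: "\<And>T. \<lbrakk>T \<subseteq> S; no_clique (k - 1) T\<rbrakk> \<Longrightarrow> card T \<le> F"
    and r: "r \<in> S" "\<rho> \<in> img r"
    and eps: "\<And>z F. \<lbrakk>F \<subseteq> S; F \<noteq> {}; \<forall>e\<in>F. img e \<inter> cball z \<epsilon> \<noteq> {}\<rbrakk> \<Longrightarrow> \<exists>x. \<forall>e\<in>F. x \<in> img e"
  shows "\<exists>B. path_connected B \<and> g \<in> B \<and> \<rho> \<in> B
     \<and> card {e \<in> S. img e \<inter> (B \<union> cball g \<epsilon>) \<noteq> {}} \<le> 4 * F + 1 + 3 * (card V + k)"
proof -
  have finS: "finite S" using S finite_E finite_subset by blast
  let ?Un = "\<Union>e\<in>S. img e"
  have cl: "closed ?Un" using finS S edgeD(3) by (intro closed_UN ballI closed_path_image) (auto simp: arc_def)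
  have "\<rho> \<in> ?Un" using r by blast
  then obtain q where q: "q \<in> ?Un" "\<And>z. z \<in> ?Un \<Longrightarrow> dist g q \<le> dist g z"
    using distance_attains_inf[OF cl, of g] by blast
  then obtain c where c: "c \<in> S" "q \<in> img c" by blast
  obtain Bc where Bc: "Bc \<subseteq> S" "c \<in> Bc" "r \<in> Bc" "r_connected crossing Bc" "card {x \<in> S. \<exists>y\<in>Bc. crossing x y} \<le> 4 * F + 1"
  proof -
    have "\<exists>B\<subseteq>S. c \<in> B \<and> r \<in> B \<and> r_connected crossing B \<and> card {x \<in> S. \<exists>y\<in>B. crossing x y} \<le> 4 * F + 1"
      by (rule geodesic_chain[OF S c(1) r(1) k]) (rule F)
    then show thesis using that by (elim exE conjE) blast
  qed
  let ?I = "\<Union>e\<in>Bc. interior_arc e"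
  have BcE: "Bc \<subseteq> E" using Bc S by blast
  have pI: "path_connected ?I" using pieces_connected(1)[OF BcE Bc(4)] .
  have cE: "c \<in> E" "r \<in> E" using c r S by blast+
  have p1: "path_connected (insert q (interior_arc c) \<union> ?I)"
    using insert_interior_arc_connected[OF cE(1) c(2)] pI Bc(2) interior_arc(2)[OF cE(1)] by (intro path_connected_Un) auto
  have p2: "path_connected (insert \<rho> (interior_arc r) \<union> (insert q (interior_arc c) \<union> ?I))"
    using insert_interior_arc_connected[OF cE(2) r(2)] p1 Bc(3) interior_arc(2)[OF cE(2)]
    by (intro path_connected_Un[of "insert \<rho> (interior_arc r)" "insert q (interior_arc c) \<union> ?I"]) auto
  define B where "B = closed_segment g q \<union> (insert \<rho> (interior_arc r) \<union> (insert q (interior_arc c) \<union> ?I))"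
  have "path_connected B"
    unfolding B_def using p2 by (intro path_connected_Un[of "closed_segment g q"]) (auto simp: convex_imp_path_connected)
  moreover have "g \<in> B" "\<rho> \<in> B" by (auto simp: B_def)
  moreover have "card {e \<in> S. img e \<inter> (B \<union> cball g \<epsilon>) \<noteq> {}} \<le> 4 * F + 1 + 3 * (card V + k)"
  proof -
    let ?N = "{x \<in> S. \<exists>y\<in>Bc. crossing x y}" and ?Q = "{e \<in> S. q \<in> img e}" and ?P = "{e \<in> S. \<rho> \<in> img e}"
      and ?Y = "{e \<in> S. img e \<inter> cball g \<epsilon> \<noteq> {}}"
    have seg: "z = q" if z: "z \<in> closed_segment g q" "z \<in> ?Un" for z
    proof -
      obtain u where u: "0 \<le> u" "u \<le> 1" "z = (1 - u) *\<^sub>R g + u *\<^sub>R q" using z(1) by (auto simp: in_segment)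
      have "g - z = u *\<^sub>R (g - q)" using u(3) by (simp add: algebra_simps)
      then have "dist g z = u * dist g q" using u(1) by (simp add: dist_norm)
      then have "dist g q \<le> u * dist g q" using q(2)[OF z(2)] by simp
      then have "0 \<le> (u - 1) * dist g q" by (simp add: algebra_simps)
      then have "u = 1 \<or> dist g q = 0" using u(2) zero_le_dist[of g q] by (auto simp: zero_le_mult_iff)
      then show ?thesis using u(3) by auto
    qed
    have "{e \<in> S. img e \<inter> (B \<union> cball g \<epsilon>) \<noteq> {}} \<subseteq> ?N \<union> ?Q \<union> ?P \<union> ?Y"
    proof
      fix e assume "e \<in> {e \<in> S. img e \<inter> (B \<union> cball g \<epsilon>) \<noteq> {}}"
      then obtain z where e: "e \<in> S" and z: "z \<in> img e" "z \<in> B \<union> cball g \<epsilon>" by blast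
      have eE: "e \<in> E" using e S by blast
      have cross: "e \<in> ?N" if "z \<in> interior_arc y" "y \<in> Bc" for y
        using that e z(1) crossing_iff[OF eE, of y] BcE by (auto simp: interior_arc_def)
      show "e \<in> ?N \<union> ?Q \<union> ?P \<union> ?Y"
        using z(2) e seg[of z] z(1) cross Bc(2,3) unfolding B_def by blast
    qed
    then have "card {e \<in> S. img e \<inter> (B \<union> cball g \<epsilon>) \<noteq> {}} \<le> card (?N \<union> ?Q \<union> ?P \<union> ?Y)"
      using finS by (intro card_mono) auto
    also have "\<dots> \<le> card ?N + card ?Q + card ?P + card ?Y" by (intro order_trans[OF card_Un_le] add_mono order_refl)
    finally have 1: "card {e \<in> S. img e \<inter> (B \<union> cball g \<epsilon>) \<noteq> {}} \<le> card ?N + card ?Q + card ?P + card ?Y" .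
    have "card ?Y \<le> card V + k"
    proof (cases "?Y = {}")
      case True
      then show ?thesis by (metis card.empty zero_le)
    next
      case False
      then obtain x where "\<forall>e\<in>?Y. x \<in> img e" using eps[of ?Y g] by blast
      then have "?Y \<subseteq> {e \<in> S. x \<in> img e}" by blast
      then have "card ?Y \<le> card {e \<in> S. x \<in> img e}" using finS by (intro card_mono) auto
      then show ?thesis using card_through_point[OF S(1) k(2), of x] by linarith
    qed
    moreover have "a \<le> 4 * F + 1 + 3 * v" if "y \<le> v" "a \<le> n' + x + p + y" "n' \<le> 4 * F + 1" "x \<le> v" "p \<le> v"
      for a n' x p y v :: nat using that by simp
    ultimately show ?thesis
      using 1 Bc(5) card_through_point[OF S(1) k(2), of q] card_through_point[OF S(1) k(2), of \<rho>] by blast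
  qed
  ultimately show ?thesis by blast
qed

text \<open>Otherwise deleting the edges met by any four barriers leaves a connected set with more
  than half of \<open>S\<close>. Two such sets share an edge, so their drawings meet pairwise, and
  with barriers from all points of a fine grid to one root this is the configuration excluded by
  \<open>no_grid_haven\<close>. The factor 4 counts the corners of a cell.\<close>

theorem crossing_separator:
  assumes S: "S \<subseteq> E" "r_connected crossing S" and k: "2 \<le> k" "no_clique k S"
    and F: "\<And>T. \<lbrakk>T \<subseteq> S; no_clique (k - 1) T\<rbrakk> \<Longrightarrow> card T \<le> F"
  shows "\<exists>T\<subseteq>S. card T \<le> 4 * (4 * F + 1 + 3 * (card V + k)) \<and> (\<forall>C\<subseteq>S - T. r_connected crossing C \<longrightarrow> 2 * card C \<le> card S)"
proof (rule ccontr)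
  define \<beta> where "\<beta> = 4 * F + 1 + 3 * (card V + k)"
  assume contra: "\<not> ?thesis"
  have haven: "\<exists>C\<subseteq>S - T. r_connected crossing C \<and> card S < 2 * card C" if "T \<subseteq> S" "card T \<le> 4 * \<beta>" for T
  proof -
    have "\<not> (\<forall>C\<subseteq>S - T. r_connected crossing C \<longrightarrow> 2 * card C \<le> card S)" using contra that unfolding \<beta>_def by blast
    then show ?thesis by (meson not_le)
  qed
  have finS: "finite S" using S finite_E finite_subset by blast
  have neS: "S \<noteq> {}" using S by (auto simp: r_connected_def)
  define UU where "UU = (\<Union>e\<in>S. img e)"
  have cpt: "compact UU" unfolding UU_def using finS S edgeD(3) by (intro compact_UN compact_path_image) (auto simp: arc_def)
  have neU: "UU \<noteq> {}" using neS by (auto simp: UU_def)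
  \<comment> \<open>The root is extreme in the diagonal direction, so the segment to it from the
    lower left corner of the frame touches the drawing only at \<rho>.\<close>
  obtain \<rho> where \<rho>: "\<rho> \<in> UU" "\<And>z. z \<in> UU \<Longrightarrow> Re \<rho> + Im \<rho> \<le> Re z + Im z"
  proof -
    have "continuous_on UU (\<lambda>z. Re z + Im z)" by (intro continuous_intros)
    then show thesis using continuous_attains_inf[OF cpt neU] that by blast
  qed
  obtain r where r: "r \<in> S" "\<rho> \<in> img r" using \<rho>(1) by (auto simp: UU_def)
  obtain M where M: "M > 0" "\<And>z. z \<in> UU \<Longrightarrow> norm z \<le> M" using compact_imp_bounded[OF cpt] bounded_pos by metis
  have "\<exists>\<epsilon>>0. \<forall>z. \<forall>F\<subseteq>S. F \<noteq> {} \<longrightarrow> (\<forall>e\<in>F. img e \<inter> cball z \<epsilon> \<noteq> {}) \<longrightarrow> (\<exists>x. \<forall>e\<in>F. x \<in> img e)"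
    using finS S edgeD(3) by (intro compact_common_point_scale compact_path_image) (auto simp: arc_def)
  then obtain \<epsilon> where \<epsilon>: "\<epsilon> > 0" and eps: "\<And>z F. \<lbrakk>F \<subseteq> S; F \<noteq> {}; \<forall>e\<in>F. img e \<inter> cball z \<epsilon> \<noteq> {}\<rbrakk> \<Longrightarrow> \<exists>x. \<forall>e\<in>F. x \<in> img e"
    by metis
  \<comment> \<open>Half the side of the square frame, which is centred at \<rho>; with this value
    the drawing stays more than \<epsilon> away from the frame.\<close>
  define t where "t = 2 * M + \<epsilon> + 1"
  have t: "t > 0" using M(1) \<epsilon> by (simp add: t_def)
  define z0 where "z0 = \<rho> - of_real t * (1 + \<i>)"
  \<comment> \<open>Makes the mesh \<open>h = 2 * t / N\<close> satisfy
    \<open>2 * h \<le> \<epsilon>\<close>.\<close>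
  define N where "N = Suc (nat \<lceil>4 * t / \<epsilon>\<rceil>)"
  define h where "h = 2 * t / real N"
  have N: "N > 0" by (simp add: N_def)
  have h: "h > 0" using t N by (simp add: h_def)
  have "4 * t / \<epsilon> \<le> real N" unfolding N_def by linarith
  then have h2: "2 * h \<le> \<epsilon>" using N \<epsilon> by (simp add: h_def field_simps)
  have Nh: "real N * h = 2 * t" using N by (simp add: h_def)
  define G where "G i j = z0 + of_nat i * of_real h + of_nat j * (\<i> * of_real h)" for i j
  have ReG: "Re (G i j) = Re \<rho> - t + real i * h" "Im (G i j) = Im \<rho> - t + real j * h" for i j
    by (simp_all add: G_def z0_def)
  have \<rho>M: "\<bar>Re \<rho>\<bar> \<le> M" "\<bar>Im \<rho>\<bar> \<le> M" using M(2)[OF \<rho>(1)] abs_Re_le_cmod[of \<rho>] abs_Im_le_cmod[of \<rho>] by linarith+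
  have far: "Re \<rho> - t + \<epsilon> < Re z" "Im \<rho> - t + \<epsilon> < Im z" "Re z < Re \<rho> + t - \<epsilon>" "Im z < Im \<rho> + t - \<epsilon>" if "z \<in> UU" for z
    using M(2)[OF that] abs_Re_le_cmod[of z] abs_Im_le_cmod[of z] \<rho>M unfolding t_def by linarith+
  have G00: "G 0 0 = z0" by (simp add: G_def)
  have box: "z \<in> box z0 (G N N)" if "z \<in> UU" for z
    using far[OF that] \<epsilon> ReG[of N N] ReG[of 0 0] Nh by (auto simp: in_box_complex_iff G00)
  define bd where "bd i j \<longleftrightarrow> i = 0 \<or> i = N \<or> j = 0 \<or> j = N" for i j
  \<comment> \<open>The common barrier of all grid points on the frame. Only edges through \<rho>
    meet it, so one large connected set avoids the barriers of the whole frame at once.\<close>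
  define Rb where "Rb = path_image (rectpath z0 (G N N)) \<union> closed_segment z0 \<rho>"
  have le: "Re z0 \<le> Re (G N N)" "Im z0 \<le> Im (G N N)" using ReG[of N N] ReG[of 0 0] Nh t by (auto simp: G00)
  have ring: "path_image (rectpath z0 (G N N)) = cbox z0 (G N N) - box z0 (G N N)"
    using path_image_rectpath_cbox_minus_box le by blast
  have pcR: "path_connected Rb"
    unfolding Rb_def
  proof (rule path_connected_Un)
    show "path_connected (path_image (rectpath z0 (G N N)))" by (intro path_connected_path_image path_rectpath)
    show "path_connected (closed_segment z0 \<rho>)" by (simp add: convex_imp_path_connected)
    have "z0 \<in> path_image (rectpath z0 (G N N))" by (metis pathstart_in_path_image pathstart_rectpath)
    then show "path_image (rectpath z0 (G N N)) \<inter> closed_segment z0 \<rho> \<noteq> {}" by auto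
  qed
  have \<rho>R: "\<rho> \<in> Rb" by (auto simp: Rb_def)
  have UR: "z = \<rho>" if z: "z \<in> UU" "z \<in> Rb" for z
  proof -
    have "z \<in> closed_segment z0 \<rho>" using z box ring unfolding Rb_def by blast
    then obtain u where u: "0 \<le> u" "u \<le> 1" "z = (1 - u) *\<^sub>R z0 + u *\<^sub>R \<rho>" by (auto simp: in_segment)
    have "z = \<rho> - of_real ((1 - u) * t) * (1 + \<i>)" unfolding u(3) z0_def by (simp add: scaleR_conv_of_real algebra_simps)
    then have "Re z + Im z = Re \<rho> + Im \<rho> - 2 * ((1 - u) * t)" by simp
    then have "(1 - u) * t \<le> 0" using \<rho>(2)[OF z(1)] by linarith
    then have "u = 1" using t u(2) by (simp add: mult_le_0_iff)
    then show ?thesis using u(3) by simp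
  qed
  have bdG: "G i j \<in> Rb" "cball (G i j) \<epsilon> \<inter> UU = {}" if ij: "i \<le> N" "j \<le> N" "bd i j" for i j
  proof -
    have i: "real i * h \<le> 2 * t" "real j * h \<le> 2 * t" "0 \<le> real i * h" "0 \<le> real j * h"
      using ij h Nh by (metis less_eq_real_def mult_right_mono of_nat_le_iff, metis less_eq_real_def mult_right_mono of_nat_le_iff, simp, simp)
    have side: "Re (G i j) = Re \<rho> - t \<or> Re (G i j) = Re \<rho> + t \<or> Im (G i j) = Im \<rho> - t \<or> Im (G i j) = Im \<rho> + t"
      using ij(3) Nh unfolding bd_def ReG by auto
    have "G i j \<in> cbox z0 (G N N)" using i ReG[of i j] ReG[of N N] ReG[of 0 0] Nh by (auto simp: in_cbox_complex_iff G00)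
    moreover have "G i j \<notin> box z0 (G N N)" using side ReG[of N N] ReG[of 0 0] Nh by (auto simp: in_box_complex_iff G00)
    ultimately show "G i j \<in> Rb" unfolding Rb_def ring by blast
    show "cball (G i j) \<epsilon> \<inter> UU = {}"
    proof (rule ccontr)
      assume "cball (G i j) \<epsilon> \<inter> UU \<noteq> {}"
      then obtain z where z: "z \<in> UU" "dist (G i j) z \<le> \<epsilon>" by auto
      have "\<bar>Re (G i j) - Re z\<bar> \<le> \<epsilon>" "\<bar>Im (G i j) - Im z\<bar> \<le> \<epsilon>"
        using z(2) abs_Re_le_cmod[of "G i j - z"] abs_Im_le_cmod[of "G i j - z"] by (auto simp: dist_norm)
      then show False using side far[OF z(1)] by linarith
    qed
  qed
  have ex: "\<exists>B. path_connected B \<and> g \<in> B \<and> \<rho> \<in> B \<and> card {e \<in> S. img e \<inter> (B \<union> cball g \<epsilon>) \<noteq> {}} \<le> \<beta>" for g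
    unfolding \<beta>_def by (rule barrier[OF S k _ r]) (use F eps in blast)+
  define B where "B i j = (if bd i j then Rb else (SOME B. path_connected B \<and> G i j \<in> B \<and> \<rho> \<in> B
      \<and> card {e \<in> S. img e \<inter> (B \<union> cball (G i j) \<epsilon>) \<noteq> {}} \<le> \<beta>))" for i j
  define T where "T i j = {e \<in> S. img e \<inter> (B i j \<union> cball (G i j) \<epsilon>) \<noteq> {}}" for i j
  define T0 where "T0 = {e \<in> S. \<rho> \<in> img e}"
  have T0: "card T0 \<le> \<beta>" using card_through_point[OF S(1) k(2), of \<rho>] by (simp add: T0_def \<beta>_def)
  have bdT: "T i j \<subseteq> T0" if ij: "i \<le> N" "j \<le> N" "bd i j" for i j
  proof
    fix e assume "e \<in> T i j"
    then have "e \<in> S \<and> img e \<inter> (Rb \<union> cball (G i j) \<epsilon>) \<noteq> {}" using ij(3) by (simp add: T_def B_def)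
    then obtain z where z: "e \<in> S" "z \<in> img e" "z \<in> Rb \<union> cball (G i j) \<epsilon>" by blast
    have "z \<in> UU" using z by (auto simp: UU_def)
    then have "z \<in> Rb" using z(3) bdG(2)[OF ij] by blast
    then have "z = \<rho>" using UR \<open>z \<in> UU\<close> by blast
    then show "e \<in> T0" using z by (simp add: T0_def)
  qed
  have Bprop: "path_connected (B i j) \<and> G i j \<in> B i j \<and> \<rho> \<in> B i j \<and> card (T i j) \<le> \<beta>" if "i \<le> N" "j \<le> N" for i j
  proof (cases "bd i j")
    case True
    have "card (T i j) \<le> card T0" using bdT[OF that True] finS by (intro card_mono) (auto simp: T0_def)
    then show ?thesis using True pcR \<rho>R bdG(1)[OF that True] T0 by (simp add: B_def)
  next
    case False
    have "path_connected (B i j) \<and> G i j \<in> B i j \<and> \<rho> \<in> B i j \<and> card {e \<in> S. img e \<inter> (B i j \<union> cball (G i j) \<epsilon>) \<noteq> {}} \<le> \<beta>"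
      unfolding B_def if_not_P[OF False] by (rule someI_ex[OF ex])
    then show ?thesis by (simp add: T_def)
  qed
  define p where "p i j = (SOME q. path q \<and> path_image q \<subseteq> B i j \<and> pathstart q = G i j \<and> pathfinish q = \<rho>)" for i j
  have p: "path (p i j) \<and> path_image (p i j) \<subseteq> B i j \<and> pathstart (p i j) = G i j \<and> pathfinish (p i j) = \<rho>" if "i \<le> N" "j \<le> N" for i j
  proof -
    have "\<exists>q. path q \<and> path_image q \<subseteq> B i j \<and> pathstart q = G i j \<and> pathfinish q = \<rho>"
      using Bprop[OF that] by (auto simp: path_connected_def)
    then show ?thesis unfolding p_def by (rule someI_ex)
  qed
  define \<F> where "\<F> = {(\<Union>e\<in>C. img e) | C. C \<subseteq> S \<and> r_connected crossing C \<and> card S < 2 * card C}"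
  have avoid: "(\<Union>e\<in>C. img e) \<inter> (path_image (p i j) \<union> cball (G i j) \<epsilon>) = {}" if "C \<subseteq> S" "C \<inter> T i j = {}" "i \<le> N" "j \<le> N" for C i j
  proof -
    have "img e \<inter> (B i j \<union> cball (G i j) \<epsilon>) = {}" if "e \<in> C" for e
      using that \<open>C \<subseteq> S\<close> \<open>C \<inter> T i j = {}\<close> unfolding T_def by blast
    moreover have "path_image (p i j) \<subseteq> B i j" using p that by blast
    ultimately show ?thesis by blast
  qed
  show False
  proof (rule no_grid_haven[where p = p and \<F> = \<F> and ?z0.0 = z0 and \<rho> = \<rho> and h = h and \<epsilon> = \<epsilon> and N = N, folded G_def])
    show "0 < h" "2 * h \<le> \<epsilon>" "0 < N" by fact+
    show "path (p i j) \<and> pathstart (p i j) = G i j \<and> pathfinish (p i j) = \<rho>" if "i \<le> N" "j \<le> N" for i j using p[OF that] by simp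
    show "connected Y" if Y: "Y \<in> \<F>" for Y
    proof -
      obtain C where C: "Y = (\<Union>e\<in>C. img e)" "C \<subseteq> S" "r_connected crossing C" using Y by (auto simp: \<F>_def)
      have "C \<subseteq> E" using C(2) S(1) by blast
      then show ?thesis using pieces_connected(2) C path_connected_imp_connected by metis
    qed
    show "Y \<inter> Y' \<noteq> {}" if YY: "Y \<in> \<F>" "Y' \<in> \<F>" for Y Y'
    proof -
      obtain C C' where C: "Y = (\<Union>e\<in>C. img e)" "C \<subseteq> S" "card S < 2 * card C" "Y' = (\<Union>e\<in>C'. img e)" "C' \<subseteq> S" "card S < 2 * card C'"
        using YY by (auto simp: \<F>_def)
      have "C \<inter> C' \<noteq> {}"
      proof
        assume "C \<inter> C' = {}"
        then have "card (C \<union> C') = card C + card C'" using C finS by (intro card_Un_disjoint) (auto intro: finite_subset)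
        moreover have "card (C \<union> C') \<le> card S" using C finS by (intro card_mono) auto
        ultimately show False using C by simp
      qed
      then obtain e where "e \<in> C" "e \<in> C'" by blast
      then have "img e \<subseteq> Y" "img e \<subseteq> Y'" using C by auto
      then show ?thesis using path_image_nonempty[of "curve e"] by blast
    qed
    show "\<exists>Y\<in>\<F>. Y \<inter> (path_image (p i j) \<union> cball (G i j) \<epsilon> \<union> (path_image (p (Suc i) j) \<union> cball (G (Suc i) j) \<epsilon>)
       \<union> (path_image (p i (Suc j)) \<union> cball (G i (Suc j)) \<epsilon>) \<union> (path_image (p (Suc i) (Suc j)) \<union> cball (G (Suc i) (Suc j)) \<epsilon>)) = {}"
      if ij: "i < N" "j < N" for i j
    proof -
      let ?T = "T i j \<union> T (Suc i) j \<union> T i (Suc j) \<union> T (Suc i) (Suc j)"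
      have "card ?T \<le> card (T i j) + card (T (Suc i) j) + card (T i (Suc j)) + card (T (Suc i) (Suc j))"
        by (intro order_trans[OF card_Un_le] add_mono order_refl)
      also have "\<dots> \<le> 4 * \<beta>"
        using Bprop[of i j] Bprop[of "Suc i" j] Bprop[of i "Suc j"] Bprop[of "Suc i" "Suc j"] ij by simp
      finally obtain C where C: "C \<subseteq> S - ?T" "r_connected crossing C" "card S < 2 * card C"
        using haven[of ?T] by (auto simp: T_def)
      have CS: "C \<subseteq> S" and dT: "C \<inter> T i j = {}" "C \<inter> T (Suc i) j = {}" "C \<inter> T i (Suc j) = {}" "C \<inter> T (Suc i) (Suc j) = {}"
        using C(1) by blast+
      show ?thesis
      proof (rule bexI[of _ "\<Union>e\<in>C. img e"])
        show "(\<Union>e\<in>C. img e) \<in> \<F>" using CS C by (auto simp: \<F>_def)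
        show "(\<Union>e\<in>C. img e) \<inter> (path_image (p i j) \<union> cball (G i j) \<epsilon> \<union> (path_image (p (Suc i) j) \<union> cball (G (Suc i) j) \<epsilon>)
           \<union> (path_image (p i (Suc j)) \<union> cball (G i (Suc j)) \<epsilon>) \<union> (path_image (p (Suc i) (Suc j)) \<union> cball (G (Suc i) (Suc j)) \<epsilon>)) = {}"
          using avoid[OF CS dT(1)] avoid[OF CS dT(2)] avoid[OF CS dT(3)] avoid[OF CS dT(4)] ij
          by (simp only: Int_Un_distrib Un_empty_right less_imp_le Suc_leI)
      qed
    qed
    show "\<exists>Y\<in>\<F>. \<exists>y\<in>Y. y \<in> box z0 (G N N) \<and> (\<forall>i\<le>N. \<forall>j\<le>N. i = 0 \<or> i = N \<or> j = 0 \<or> j = N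
        \<longrightarrow> Y \<inter> (path_image (p i j) \<union> cball (G i j) \<epsilon>) = {})"
    proof -
      have "card T0 \<le> 4 * \<beta>" "T0 \<subseteq> S" using T0 by (auto simp: T0_def)
      then obtain C where C: "C \<subseteq> S - T0" "r_connected crossing C" "card S < 2 * card C" using haven by blast
      have CS: "C \<subseteq> S" using C(1) by blast
      obtain e where e: "e \<in> C" using C(2) by (auto simp: r_connected_def)
      have "pathstart (curve e) \<in> UU" using e CS by (auto simp: UU_def)
      then have "pathstart (curve e) \<in> box z0 (G N N)" by (rule box)
      moreover have "pathstart (curve e) \<in> (\<Union>e\<in>C. img e)" using e by auto
      moreover have "(\<Union>e\<in>C. img e) \<inter> (path_image (p i j) \<union> cball (G i j) \<epsilon>) = {}" if "i \<le> N" "j \<le> N" "bd i j" for i j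
        using avoid[OF CS _ that(1,2)] bdT[OF that] C(1) by blast
      moreover have "(\<Union>e\<in>C. img e) \<in> \<F>" using CS C by (auto simp: \<F>_def)
      ultimately show ?thesis unfolding bd_def by blast
    qed
  qed
qed

end

section \<open>Edges without crossing cliques\<close>

definition r_component :: "('a \<Rightarrow> 'a \<Rightarrow> bool) \<Rightarrow> 'a set \<Rightarrow> 'a \<Rightarrow> 'a set" where
  "r_component r W x = {y. (x, y) \<in> {(u, v). u \<in> W \<and> v \<in> W \<and> r u v}\<^sup>*}"

lemma r_component_props:
  assumes sym: "\<And>x y. r x y \<Longrightarrow> r y x"
  shows "x \<in> r_component r W x"
    and "x \<in> W \<Longrightarrow> r_component r W x \<subseteq> W"
    and "y \<in> r_component r W x \<Longrightarrow> r_component r W y = r_component r W x"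
    and "x \<in> W \<Longrightarrow> r_connected r (r_component r W x)"
    and "\<lbrakk>y \<in> r_component r W x; y \<in> W; z \<in> W; r y z\<rbrakk> \<Longrightarrow> z \<in> r_component r W x"
    and "\<lbrakk>C \<subseteq> W; r_connected r C; x \<in> C\<rbrakk> \<Longrightarrow> C \<subseteq> r_component r W x"
proof -
  let ?R = "\<lambda>W. {(u, v). u \<in> W \<and> v \<in> W \<and> r u v}"
  have symR: "sym ((?R W)\<^sup>*)" by (rule sym_rtrancl) (auto simp: sym_def intro: sym)
  show 1: "x \<in> r_component r W x" by (simp add: r_component_def)
  show 2: "r_component r W x \<subseteq> W" if "x \<in> W"
  proof
    fix y assume "y \<in> r_component r W x"
    then have "(x, y) \<in> (?R W)\<^sup>*" by (simp add: r_component_def)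
    then show "y \<in> W" using that by (induction rule: rtrancl_induct) auto
  qed
  show 3: "r_component r W y = r_component r W x" if "y \<in> r_component r W x"
  proof -
    have a: "(x, y) \<in> (?R W)\<^sup>*" using that by (simp add: r_component_def)
    then have b: "(y, x) \<in> (?R W)\<^sup>*" using symR by (meson symE)
    show ?thesis unfolding r_component_def using a b by (auto intro: rtrancl_trans)
  qed
  have 5: "z \<in> r_component r W x" if "y \<in> r_component r W x" "y \<in> W" "z \<in> W" "r y z" for y z
    using that by (auto simp: r_component_def intro: rtrancl_into_rtrancl)
  then show "z \<in> r_component r W x" if "y \<in> r_component r W x" "y \<in> W" "z \<in> W" "r y z"
    using that by blast
  show "r_connected r (r_component r W x)" if x: "x \<in> W"
  proof -
    let ?K = "r_component r W x"
    have fromx: "(x, y) \<in> (?R ?K)\<^sup>*" if "y \<in> ?K" for y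
    proof -
      have "(x, y) \<in> (?R W)\<^sup>*" using that by (simp add: r_component_def)
      then show ?thesis
      proof (induction rule: rtrancl_induct)
        case base then show ?case by simp
      next
        case (step y z)
        have "y \<in> ?K" using step(1) by (simp add: r_component_def)
        then have "(y, z) \<in> ?R ?K" using step(2) 5[of y z] by auto
        then show ?case using step(3) by (meson rtrancl.rtrancl_into_rtrancl)
      qed
    qed
    have "sym ((?R ?K)\<^sup>*)" by (rule sym_rtrancl) (auto simp: sym_def intro: sym)
    then have "(y, z) \<in> (?R ?K)\<^sup>*" if "y \<in> ?K" "z \<in> ?K" for y z
      using fromx[OF that(1)] fromx[OF that(2)] by (meson symE rtrancl_trans)
    then show ?thesis using 1 unfolding r_connected_def by blast
  qed
  show "C \<subseteq> r_component r W x" if "C \<subseteq> W" "r_connected r C" "x \<in> C"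
  proof
    fix y assume "y \<in> C"
    then have "(x, y) \<in> (?R C)\<^sup>*" using that by (simp add: r_connected_def)
    moreover have "?R C \<subseteq> ?R W" using that(1) by blast
    ultimately show "y \<in> r_component r W x" using rtrancl_mono by (auto simp: r_component_def)
  qed
qed

section \<open>Repeated halving of the crossing graph\<close>

context simple_tg
begin

lemma card_E_le_square: "card E \<le> (card V)\<^sup>2"
proof -
  have "E \<subseteq> {e. e \<subseteq> V \<and> card e = 2}" using edgeD(1,2) by auto
  then have "card E \<le> card {e. e \<subseteq> V \<and> card e = 2}" using finite_V by (intro card_mono) auto
  also have "\<dots> = card V choose 2" by (rule n_subsets[OF finite_V])
  also have "\<dots> \<le> card V ^ 2" by (cases "2 \<le> card V") (auto simp: binomial_le_pow binomial_eq_0)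
  finally show ?thesis .
qed

text \<open>The separator is taken in the graph spanned by \<open>P\<close>, so that its size is
  measured by \<open>card (\<Union>P)\<close> and can be summed over the pieces. The constant arises
  from \<open>4 * (4 * F + 1 + 3 * (N + k))\<close> with 1 and \<open>k\<close> absorbed into
  multiples of \<open>N\<close>, the number of spanned vertices.\<close>

lemma component_separator:
  fixes c :: real
  assumes k: "2 \<le> k" "no_clique k E" and c: "0 \<le> c"
    and F: "\<And>T. \<lbrakk>T \<subseteq> E; no_clique (k - 1) T\<rbrakk> \<Longrightarrow> real (card T) \<le> c * card (\<Union>T)"
    and P: "P \<subseteq> E" "r_connected crossing P"
  shows "\<exists>T\<subseteq>P. real (card T) \<le> (16 * c + 16 + 12 * real k) * card (\<Union>P) \<and> (\<forall>C\<subseteq>P - T. r_connected crossing C \<longrightarrow> 2 * card C \<le> card P)"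
proof -
  interpret P: simple_tg "\<Union>P" P curve by (rule subgraph[OF P(1)])
  define N where "N = card (\<Union>P)"
  have "P \<noteq> {}" using P(2) by (simp add: r_connected_def)
  then obtain e where e: "e \<in> P" by blast
  have "card e \<le> N" unfolding N_def using e P.finite_V by (intro card_mono) auto
  then have N: "1 \<le> N" using P.edgeD(2)[OF e] by simp
  have noc: "no_clique k P" using k(2) P(1) unfolding no_clique_def by blast
  have "card T \<le> nat \<lfloor>c * N\<rfloor>" if T: "T \<subseteq> P" "no_clique (k - 1) T" for T
  proof -
    have "card (\<Union>T) \<le> N" unfolding N_def using T(1) P.finite_V by (intro card_mono) auto
    then have "c * card (\<Union>T) \<le> c * N" using c by (intro mult_left_mono) auto
    moreover have "real (card T) \<le> c * card (\<Union>T)" using T P by (intro F) auto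
    ultimately have "real (card T) \<le> c * N" by linarith
    then show ?thesis by (simp add: le_nat_floor)
  qed
  then obtain T where T: "T \<subseteq> P" "card T \<le> 4 * (4 * nat \<lfloor>c * N\<rfloor> + 1 + 3 * (N + k))"
      "\<forall>C\<subseteq>P - T. r_connected crossing C \<longrightarrow> 2 * card C \<le> card P"
    using P.crossing_separator[OF order_refl P(2) k(1) noc, of "nat \<lfloor>c * N\<rfloor>"] unfolding N_def by blast
  have fl: "real (nat \<lfloor>c * N\<rfloor>) \<le> c * N" using c by (simp add: of_nat_floor)
  have "real (card T) \<le> real (4 * (4 * nat \<lfloor>c * N\<rfloor> + 1 + 3 * (N + k)))" using T(2) of_nat_le_iff by blast
  also have "\<dots> = 16 * real (nat \<lfloor>c * N\<rfloor>) + 4 + 12 * real N + 12 * real k" by simp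
  also have "\<dots> \<le> 16 * (c * N) + 4 * real N + 12 * real N + 12 * (real k * real N)"
    using fl N mult_left_mono[of 1 "real N" "real k"] by simp
  also have "\<dots> = (16 * c + 16 + 12 * real k) * N" by (simp add: algebra_simps)
  finally show ?thesis using T(1,3) unfolding N_def by blast
qed

text \<open>Each of the \<open>j\<close> rounds removes a separator from every connected piece. The
  vertex counts of the pieces add up to at most \<open>272 * card V\<close>, so a round costs a
  fixed multiple of \<open>card V\<close> and halves the bound on the size of the pieces; pieces of
  size 1 are pairwise noncrossing edges.\<close>

lemma halving_bound:
  fixes c :: real
  assumes k: "2 \<le> k" "no_clique k E" and c: "0 \<le> c"
    and F: "\<And>T. \<lbrakk>T \<subseteq> E; no_clique (k - 1) T\<rbrakk> \<Longrightarrow> real (card T) \<le> c * card (\<Union>T)"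
  shows "W \<subseteq> E \<Longrightarrow> (\<And>C. \<lbrakk>C \<subseteq> W; r_connected crossing C\<rbrakk> \<Longrightarrow> card C \<le> 2 ^ j) \<Longrightarrow>
    real (card W) \<le> (16 + 272 * (16 * c + 16 + 12 * real k) * j) * card V"
proof (induction j arbitrary: W)
  case 0
  have "card W \<le> 16 * card V"
  proof (rule noncrossing_card_le[OF 0(1)])
    fix e f assume ef: "e \<in> W" "f \<in> W" "e \<noteq> f"
    show "\<not> crossing e f"
    proof
      assume cr: "crossing e f"
      have one: "r_connected crossing {x}" for x by (simp add: r_connected_def)
      have "r_connected crossing ({e} \<union> {f})"
        using cr crossing_sym[of e f] by (intro r_connected_Un one) (auto simp: touching_def)
      then show False using 0(2)[of "{e} \<union> {f}"] ef by auto
    qed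
  qed
  then show ?case by simp
next
  case (Suc j)
  define K where "K = 16 * c + 16 + 12 * real k"
  have K: "K \<ge> 0" using c by (simp add: K_def)
  have sym: "crossing y x" if "crossing x y" for x y using that crossing_sym by blast
  note cp = r_component_props[of crossing, OF sym]
  define \<P> where "\<P> = r_component crossing W ` W"
  have finW: "finite W" using Suc.prems(1) finite_E finite_subset by blast
  have fin: "finite \<P>" using finW by (simp add: \<P>_def)
  have sub: "P \<subseteq> W" if "P \<in> \<P>" for P using that cp(2) by (auto simp: \<P>_def)
  have con: "r_connected crossing P" if "P \<in> \<P>" for P using that cp(4) by (auto simp: \<P>_def)
  have nc: "\<not> crossing e f" if PQ: "P \<in> \<P>" "Q \<in> \<P>" "P \<noteq> Q" "e \<in> P" "f \<in> Q" for P Q e f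
  proof
    assume "crossing e f"
    obtain x y where xy: "P = r_component crossing W x" "Q = r_component crossing W y" using PQ(1,2) by (auto simp: \<P>_def)
    have "e \<in> W" "f \<in> W" using sub that by blast+
    then have "f \<in> P" using cp(5)[of e W x f] xy that \<open>crossing e f\<close> by blast
    then have "r_component crossing W f = P" using cp(3) xy by blast
    moreover have "r_component crossing W f = Q" using cp(3) xy that by blast
    ultimately show False using that by blast
  qed
  have sum: "(\<Sum>P\<in>\<P>. card (\<Union>P)) \<le> 272 * card V"
    by (rule pieces_vertex_sum[OF fin]) (use sub Suc.prems(1) con nc in blast)+
  have "\<forall>P\<in>\<P>. \<exists>T\<subseteq>P. real (card T) \<le> K * card (\<Union>P) \<and> (\<forall>C\<subseteq>P - T. r_connected crossing C \<longrightarrow> 2 * card C \<le> card P)"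
    unfolding K_def using sub con Suc.prems(1) by (intro ballI component_separator[OF k c F]) auto
  then obtain T where T: "\<And>P. P \<in> \<P> \<Longrightarrow> T P \<subseteq> P" "\<And>P. P \<in> \<P> \<Longrightarrow> real (card (T P)) \<le> K * card (\<Union>P)"
      "\<And>P C. \<lbrakk>P \<in> \<P>; C \<subseteq> P - T P; r_connected crossing C\<rbrakk> \<Longrightarrow> 2 * card C \<le> card P"
    by metis
  define W' where "W' = W - (\<Union>P\<in>\<P>. T P)"
  have "real (card W') \<le> (16 + 272 * K * j) * card V"
    unfolding K_def
  proof (rule Suc.IH)
    show "W' \<subseteq> E" using Suc.prems(1) by (auto simp: W'_def)
    fix C assume C: "C \<subseteq> W'" "r_connected crossing C"
    then obtain x where x: "x \<in> C" by (auto simp: r_connected_def)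
    let ?P = "r_component crossing W x"
    have P: "?P \<in> \<P>" using x C by (auto simp: \<P>_def W'_def)
    have "C \<subseteq> ?P" using C x by (intro cp(6)) (auto simp: W'_def)
    then have "C \<subseteq> ?P - T ?P" using C P by (auto simp: W'_def)
    then have "2 * card C \<le> card ?P" using T(3)[OF P] C by blast
    also have "\<dots> \<le> 2 ^ Suc j" using P sub con by (intro Suc.prems(2)) auto
    finally show "card C \<le> 2 ^ j" by simp
  qed
  moreover have "card W \<le> card W' + (\<Sum>P\<in>\<P>. card (T P))"
  proof -
    have "(\<Union>P\<in>\<P>. T P) \<subseteq> W" using T(1) sub by blast
    then have "card W \<le> card (W' \<union> (\<Union>P\<in>\<P>. T P))"
      using finW finite_subset[OF _ finW] by (intro card_mono) (auto simp: W'_def)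
    also have "\<dots> \<le> card W' + card (\<Union>P\<in>\<P>. T P)" by (rule card_Un_le)
    also have "card (\<Union>P\<in>\<P>. T P) \<le> (\<Sum>P\<in>\<P>. card (T P))" by (rule card_UN_le[OF fin])
    finally show ?thesis by simp
  qed
  moreover have "real (\<Sum>P\<in>\<P>. card (T P)) \<le> K * 272 * card V"
  proof -
    have "real (\<Sum>P\<in>\<P>. card (T P)) \<le> (\<Sum>P\<in>\<P>. K * card (\<Union>P))" using T(2) by (simp add: sum_mono)
    also have "\<dots> = K * real (\<Sum>P\<in>\<P>. card (\<Union>P))" by (simp add: sum_distrib_left)
    also have "\<dots> \<le> K * real (272 * card V)" by (intro mult_left_mono K iffD2[OF of_nat_le_iff sum])
    finally show ?thesis by simp
  qed
  moreover have "(16 + 272 * K * Suc j) * card V = (16 + 272 * K * j) * card V + K * 272 * card V" by (simp add: algebra_simps)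
  ultimately show ?case unfolding K_def[symmetric] by linarith
qed

lemma clique_induction_step:
  fixes c :: real
  assumes k: "2 \<le> k" "no_clique k E" and c: "0 \<le> c" and V: "V \<noteq> {}"
    and F: "\<And>T. \<lbrakk>T \<subseteq> E; no_clique (k - 1) T\<rbrakk> \<Longrightarrow> real (card T) \<le> c * card (\<Union>T)"
  shows "real (card E) \<le> (16 + 816 * (16 * c + 16 + 12 * real k) * (1 + ln (card V))) * card V"
proof -
  define n where "n = card V"
  have n: "n \<ge> 1" using V finite_V by (simp add: n_def Suc_le_eq card_gt_0_iff)
  \<comment> \<open>There are at most \<open>n\<^sup>2\<close> edges, so this many rounds bring
    every piece down to one edge. By \<open>log 2 n \<le> 3 / 2 * ln n\<close> the number of rounds
    is at most \<open>3 * (1 + ln n)\<close>, and 816 is 3 times 272.\<close>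
  define j where "j = nat \<lceil>2 * log 2 n\<rceil>"
  have l0: "0 \<le> log 2 n" using n by simp
  have j: "2 * log 2 n \<le> j" "j \<le> 2 * log 2 n + 1" unfolding j_def using l0 by linarith+
  have "real (n ^ 2) = 2 powr (2 * log 2 n)" using n powr_powr[of 2 "log 2 n" 2] by (simp add: mult.commute)
  also have "\<dots> \<le> 2 powr j" using j by (intro powr_mono) auto
  also have "\<dots> = real (2 ^ j)" by (simp add: powr_realpow)
  finally have "n\<^sup>2 \<le> 2 ^ j" using of_nat_le_iff by blast
  then have size: "card C \<le> 2 ^ j" if "C \<subseteq> E" for C
    using card_mono[OF finite_E that] card_E_le_square unfolding n_def by linarith
  have ln2: "(2::real) / 3 \<le> ln 2" using ln2_ge_two_thirds .
  have "log 2 n \<le> 3 / 2 * ln n"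
  proof -
    have "ln n * (2 / 3) \<le> ln n * ln 2" using ln2 n by (intro mult_left_mono) auto
    then show ?thesis using ln2 by (simp add: log_def field_simps)
  qed
  then have j3: "real j \<le> 3 * (1 + ln n)" using j by simp
  have "real (card E) \<le> (16 + 272 * (16 * c + 16 + 12 * real k) * j) * card V"
    using size by (intro halving_bound[OF k c F]) auto
  also have "\<dots> \<le> (16 + 272 * (16 * c + 16 + 12 * real k) * (3 * (1 + ln n))) * card V"
    using j3 c by (intro mult_right_mono add_left_mono mult_left_mono) auto
  finally show ?thesis by (simp add: n_def algebra_simps)
qed

end

text \<open>Each increase of \<open>k\<close> costs one logarithm, the number of halving rounds;
  pairwise noncrossing edges start the induction without any. The constant is uniform over all
  graphs because the step applies the hypothesis to the subgraphs spanned by sets of edges.\<close>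

theorem few_edges_without_crossing_clique:
  assumes "2 \<le> k"
  shows "\<exists>C\<ge>1. \<forall>V E curve. simple_tg V E curve \<longrightarrow> simple_tg.no_clique curve k E \<longrightarrow>
    real (card E) \<le> C * (1 + ln (card V)) ^ (k - 2) * card V"
  using assms
proof (induction k rule: nat_induct_at_least)
  case base
  have "real (card E) \<le> 16 * (1 + ln (card V)) ^ (2 - 2) * card V"
    if "simple_tg V E curve" and nc: "simple_tg.no_clique curve 2 E" for V E curve
  proof -
    interpret simple_tg V E curve by fact
    have "card E \<le> 16 * card V"
    proof (rule noncrossing_card_le[OF order_refl])
      fix e f assume ef: "e \<in> E" "f \<in> E" "e \<noteq> f"
      show "\<not> crossing e f"
      proof
        assume "crossing e f"
        then have "\<forall>x\<in>{e, f}. \<forall>y\<in>{e, f}. x \<noteq> y \<longrightarrow> crossing x y" using crossing_sym[of e f] by auto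
        moreover have "card {e, f} = 2" "{e, f} \<subseteq> E" using ef by auto
        ultimately show False using nc unfolding no_clique_def by blast
      qed
    qed
    then have "real (card E) \<le> real (16 * card V)" using of_nat_le_iff by blast
    then show ?thesis by simp
  qed
  then show ?case by (intro exI[of _ 16]) simp
next
  case (Suc k)
  then obtain C where C: "C \<ge> 1" "\<And>V E curve. simple_tg V E curve \<Longrightarrow> simple_tg.no_clique curve k E \<Longrightarrow>
    real (card E) \<le> C * (1 + ln (card V)) ^ (k - 2) * card V" by blast
  \<comment> \<open>For \<open>c \<ge> 1\<close> the bracket
    \<open>16 * c + 16 + 12 * (k + 1)\<close> is at most \<open>(44 + 12 * k) * c\<close>.\<close>
  define C' where "C' = C * (16 + 816 * (44 + 12 * real k))"
  have C': "C' \<ge> 1" unfolding C'_def using C(1) mult_mono[of 1 C 1 "16 + 816 * (44 + 12 * real k)"] by simp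
  have "real (card E) \<le> C' * (1 + ln (card V)) ^ (Suc k - 2) * card V"
    if st: "simple_tg V E curve" and nc: "simple_tg.no_clique curve (Suc k) E" for V E curve
  proof (cases "V = {}")
    case True
    then have "card E = 0" using simple_tg.card_E_le_square[OF st] by simp
    then show ?thesis using True by simp
  next
    case False
    interpret simple_tg V E curve by fact
    define L where "L = 1 + ln (real (card V))"
    have V1: "card V \<ge> 1" using False finite_V by (simp add: Suc_le_eq card_gt_0_iff)
    then have L: "L \<ge> 1" by (simp add: L_def)
    define c where "c = C * L ^ (k - 2)"
    have c1: "c \<ge> 1" unfolding c_def using C(1) L mult_mono[of 1 C 1 "L ^ (k - 2)"] one_le_power[of L "k - 2"] by simp
    have F: "real (card T) \<le> c * card (\<Union>T)" if T: "T \<subseteq> E" "no_clique (Suc k - 1) T" for T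
    proof (cases "T = {}")
      case True
      then show ?thesis by simp
    next
      case False
      have sg: "simple_tg (\<Union>T) T curve" by (rule subgraph[OF T(1)])
      have UT: "\<Union>T \<subseteq> V" using T edgeD(1) by blast
      obtain e where "e \<in> T" using False by blast
      moreover have "e \<noteq> {}" using \<open>e \<in> T\<close> T edgeD(2)[of e] by fastforce
      ultimately have "\<Union>T \<noteq> {}" by blast
      then have T1: "1 \<le> card (\<Union>T)" using finite_subset[OF UT finite_V] by (simp add: Suc_le_eq card_gt_0_iff)
      have "card (\<Union>T) \<le> card V" using card_mono[OF finite_V UT] .
      then have "ln (card (\<Union>T)) \<le> ln (card V)" "0 \<le> ln (real (card (\<Union>T)))" using T1 by auto
      then have "(1 + ln (card (\<Union>T))) ^ (k - 2) \<le> L ^ (k - 2)" unfolding L_def by (intro power_mono) auto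
      then have "C * (1 + ln (card (\<Union>T))) ^ (k - 2) * card (\<Union>T) \<le> c * card (\<Union>T)"
        unfolding c_def using C(1) by (intro mult_right_mono mult_left_mono) auto
      moreover have "real (card T) \<le> C * (1 + ln (card (\<Union>T))) ^ (k - 2) * card (\<Union>T)"
        using C(2)[OF sg] T(2) by simp
      ultimately show ?thesis by linarith
    qed
    have "real (card E) \<le> (16 + 816 * (16 * c + 16 + 12 * real (Suc k)) * L) * card V"
      unfolding L_def using Suc.hyps nc c1 False F by (intro clique_induction_step) auto
    also have "\<dots> \<le> (16 * (c * L) + 816 * ((44 + 12 * real k) * c) * L) * card V"
    proof (intro mult_right_mono add_mono mult_left_mono)
      show "(16::real) \<le> 16 * (c * L)" using c1 L mult_mono[of 1 c 1 L] by simp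
      have "12 * real k \<le> 12 * real k * c" using mult_left_mono[OF c1, of "12 * real k"] by simp
      then show "16 * c + 16 + 12 * real (Suc k) \<le> (44 + 12 * real k) * c" using c1 by (simp add: algebra_simps)
    qed (use L in auto)
    also have "\<dots> = C' * (L ^ (k - 2) * L) * card V" unfolding c_def C'_def by (simp add: algebra_simps)
    also have "L ^ (k - 2) * L = L ^ (Suc k - 2)" using Suc.hyps power_Suc2[of L "k - 2"] Suc_diff_le[of 2 k] by simp
    finally show ?thesis unfolding L_def .
  qed
  then show ?case using C' by blast
qed

section \<open>Mixing of lazy walks\<close>

lemma weighted_Cauchy_Schwarz:
  fixes w a b :: "'i \<Rightarrow> real"
  assumes "\<And>i. i \<in> I \<Longrightarrow> 0 \<le> w i"
  shows "(\<Sum>i\<in>I. w i * (a i * b i))\<^sup>2 \<le> (\<Sum>i\<in>I. w i * (a i)\<^sup>2) * (\<Sum>i\<in>I. w i * (b i)\<^sup>2)"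
proof -
  have "(\<Sum>i\<in>I. w i * (a i * b i)) = (\<Sum>i\<in>I. (sqrt (w i) * a i) * (sqrt (w i) * b i))"
  proof (rule sum.cong[OF refl])
    fix i assume "i \<in> I"
    then have "w i = sqrt (w i) * sqrt (w i)" using assms by simp
    then have "w i * (a i * b i) = (sqrt (w i) * sqrt (w i)) * (a i * b i)" by simp
    then show "w i * (a i * b i) = (sqrt (w i) * a i) * (sqrt (w i) * b i)" by (simp only: mult_ac)
  qed
  then have "(\<Sum>i\<in>I. w i * (a i * b i))\<^sup>2 \<le> (\<Sum>i\<in>I. (sqrt (w i) * a i)\<^sup>2) * (\<Sum>i\<in>I. (sqrt (w i) * b i)\<^sup>2)"
    using Cauchy_Schwarz_ineq_sum[of "\<lambda>i. sqrt (w i) * a i" "\<lambda>i. sqrt (w i) * b i" I] by simp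
  moreover have "(\<Sum>i\<in>I. (sqrt (w i) * c i)\<^sup>2) = (\<Sum>i\<in>I. w i * (c i)\<^sup>2)" for c
    using assms by (intro sum.cong) (auto simp: power_mult_distrib)
  ultimately show ?thesis by simp
qed

text \<open>The weights are normalised to total mass 1, so that the row sums are the stationary distribution.\<close>

locale network =
  fixes V :: "'a set" and w :: "'a \<Rightarrow> 'a \<Rightarrow> real"
  assumes finV: "finite V" and w_sym: "w u v = w v u" and w_nonneg: "0 \<le> w u v"
    and w_total: "(\<Sum>v\<in>V. \<Sum>u\<in>V. w v u) = 1" and w_pos: "v \<in> V \<Longrightarrow> 0 < (\<Sum>u\<in>V. w v u)"
begin

definition sta :: "'a \<Rightarrow> real" where "sta v = (\<Sum>u\<in>V. w v u)"
definition mean :: "('a \<Rightarrow> real) \<Rightarrow> real" where "mean f = (\<Sum>v\<in>V. sta v * f v)"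
text \<open>Runs over ordered pairs, which makes it twice the usual Dirichlet form.\<close>

definition energy :: "('a \<Rightarrow> real) \<Rightarrow> real" where "energy f = (\<Sum>v\<in>V. \<Sum>u\<in>V. w v u * (f v - f u)\<^sup>2)"
definition lazy :: "('a \<Rightarrow> real) \<Rightarrow> 'a \<Rightarrow> real" where "lazy f v = (f v + (\<Sum>u\<in>V. w v u * f u) / sta v) / 2"
definition flow_out :: "'a set \<Rightarrow> real" where "flow_out U = (\<Sum>v\<in>U. \<Sum>u\<in>V - U. w v u)"

lemma sta_pos: "v \<in> V \<Longrightarrow> 0 < sta v"
  using w_pos by (simp add: sta_def)

lemma sta_nonneg: "0 \<le> sta v"
  unfolding sta_def by (intro sum_nonneg w_nonneg)

lemma sum_sta: "sum sta V = 1"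
  using w_total by (simp add: sta_def)

lemma sum_w_fst: "(\<Sum>v\<in>V. \<Sum>u\<in>V. w v u * g v) = mean g"
  by (simp add: mean_def sta_def sum_distrib_right)

lemma sum_w_snd: "(\<Sum>v\<in>V. \<Sum>u\<in>V. w v u * g u) = mean g"
proof -
  have "(\<Sum>v\<in>V. \<Sum>u\<in>V. w v u * g u) = (\<Sum>u\<in>V. \<Sum>v\<in>V. w v u * g u)" by (rule sum.swap)
  also have "\<dots> = (\<Sum>u\<in>V. \<Sum>v\<in>V. w u v * g u)" by (simp only: w_sym)
  finally show ?thesis by (simp add: sum_w_fst)
qed

lemma mean_mono: "(\<And>v. v \<in> V \<Longrightarrow> f v \<le> g v) \<Longrightarrow> mean f \<le> mean g"
  unfolding mean_def by (intro sum_mono mult_left_mono sta_nonneg)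

lemma mean_add: "mean (\<lambda>v. f v + g v) = mean f + mean g"
  by (simp add: mean_def algebra_simps sum.distrib)

lemma mean_diff: "mean (\<lambda>v. f v - g v) = mean f - mean g"
  by (simp add: mean_def algebra_simps sum_subtractf)

lemma mean_scale: "mean (\<lambda>v. c * f v) = c * mean f"
  by (simp add: mean_def sum_distrib_left mult_ac)

lemma mean_const: "mean (\<lambda>v. c) = c"
  using sum_sta by (simp add: mean_def flip: sum_distrib_right)

lemma mean_nonneg: "(\<And>v. v \<in> V \<Longrightarrow> 0 \<le> f v) \<Longrightarrow> 0 \<le> mean f"
  unfolding mean_def by (intro sum_nonneg mult_nonneg_nonneg sta_nonneg)

lemma sta_lazy: "v \<in> V \<Longrightarrow> sta v * lazy f v = (\<Sum>u\<in>V. w v u * ((f v + f u) / 2))"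
proof -
  assume v: "v \<in> V"
  have "sta v * lazy f v = (sta v * f v + (\<Sum>u\<in>V. w v u * f u)) / 2" using sta_pos[OF v] by (simp add: lazy_def field_simps)
  also have "sta v * f v = (\<Sum>u\<in>V. w v u * f v)" by (simp add: sta_def sum_distrib_right)
  finally show ?thesis by (simp add: sum.distrib[symmetric] sum_divide_distrib distrib_left)
qed

lemma mean_lazy: "mean (lazy f) = mean f"
proof -
  have "mean (lazy f) = (\<Sum>v\<in>V. \<Sum>u\<in>V. w v u * ((f v + f u) / 2))" unfolding mean_def by (intro sum.cong refl sta_lazy)
  also have "\<dots> = ((\<Sum>v\<in>V. \<Sum>u\<in>V. w v u * f v) + (\<Sum>v\<in>V. \<Sum>u\<in>V. w v u * f u)) / 2"
    by (simp add: sum_divide_distrib sum.distrib[symmetric] distrib_left)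
  finally show ?thesis by (simp add: sum_w_fst sum_w_snd)
qed

lemma lazy_self_adjoint: "mean (\<lambda>v. f v * lazy g v) = mean (\<lambda>v. lazy f v * g v)"
proof -
  have e: "mean (\<lambda>v. f v * lazy g v) = (mean (\<lambda>v. f v * g v) + (\<Sum>v\<in>V. \<Sum>u\<in>V. w v u * (f v * g u))) / 2" for f g
  proof -
    have "mean (\<lambda>v. f v * lazy g v) = (\<Sum>v\<in>V. f v * (sta v * lazy g v))" by (simp add: mean_def mult_ac)
    also have "\<dots> = (\<Sum>v\<in>V. f v * (\<Sum>u\<in>V. w v u * ((g v + g u) / 2)))" by (intro sum.cong refl arg_cong2[where f="(*)"] sta_lazy)
    also have "\<dots> = ((\<Sum>v\<in>V. \<Sum>u\<in>V. w v u * (f v * g v)) + (\<Sum>v\<in>V. \<Sum>u\<in>V. w v u * (f v * g u))) / 2"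
      by (simp add: sum_divide_distrib sum.distrib[symmetric] distrib_left sum_distrib_left mult_ac add_divide_distrib)
    finally show ?thesis by (simp add: sum_w_fst)
  qed
  have "(\<Sum>v\<in>V. \<Sum>u\<in>V. w v u * (f v * g u)) = (\<Sum>u\<in>V. \<Sum>v\<in>V. w v u * (f v * g u))" by (rule sum.swap)
  also have "\<dots> = (\<Sum>v\<in>V. \<Sum>u\<in>V. w v u * (g v * f u))"
  proof (intro sum.cong refl)
    fix x y show "w x y * (f x * g y) = w y x * (g y * f x)" using w_sym[of x y] by (simp add: mult_ac)
  qed
  finally have "(\<Sum>v\<in>V. \<Sum>u\<in>V. w v u * (f v * g u)) = (\<Sum>v\<in>V. \<Sum>u\<in>V. w v u * (g v * f u))" .
  then have "mean (\<lambda>v. f v * lazy g v) = mean (\<lambda>v. g v * lazy f v)" unfolding e by (simp add: mult_ac)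
  then show ?thesis by (simp add: mult_ac)
qed

lemma lazy_pow_self_adjoint: "mean (\<lambda>v. f v * (lazy ^^ t) g v) = mean (\<lambda>v. (lazy ^^ t) f v * g v)"
proof (induction t arbitrary: f)
  case (Suc t)
  have "mean (\<lambda>v. f v * (lazy ^^ Suc t) g v) = mean (\<lambda>v. lazy f v * (lazy ^^ t) g v)"
    using lazy_self_adjoint[of f "(lazy ^^ t) g"] by simp
  also have "\<dots> = mean (\<lambda>v. (lazy ^^ t) (lazy f) v * g v)" by (rule Suc)
  also have "(lazy ^^ t) (lazy f) = (lazy ^^ Suc t) f" by (simp add: funpow_swap1)
  finally show ?case .
qed simp

lemma lazy_scale: "lazy (\<lambda>v. c * f v) = (\<lambda>v. c * lazy f v)"
  by (auto simp: lazy_def sum_distrib_left mult_ac add_divide_distrib distrib_left intro!: ext)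

lemma lazy_pow_scale: "(lazy ^^ t) (\<lambda>v. c * f v) = (\<lambda>v. c * (lazy ^^ t) f v)"
  by (induction t) (simp_all add: lazy_scale)

lemma lazy_nonneg: "(\<And>v. 0 \<le> f v) \<Longrightarrow> 0 \<le> lazy f v"
  unfolding lazy_def by (intro divide_nonneg_nonneg add_nonneg_nonneg sum_nonneg mult_nonneg_nonneg w_nonneg sta_nonneg) auto

lemma lazy_pow_nonneg: "(\<And>v. 0 \<le> f v) \<Longrightarrow> 0 \<le> (lazy ^^ t) f v"
  by (induction t arbitrary: v) (simp_all add: lazy_nonneg)

lemma mean_lazy_pow: "mean ((lazy ^^ t) f) = mean f"
  by (induction t) (simp_all add: mean_lazy)

lemma energy_nonneg: "0 \<le> energy f"
  unfolding energy_def by (intro sum_nonneg mult_nonneg_nonneg w_nonneg) simp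

text \<open>Cauchy-Schwarz for the average of \<open>(f v + f u) / 2\<close> over the neighbours,
  followed by \<open>((a + b) / 2)\<^sup>2 = a\<^sup>2 / 2 + b\<^sup>2 / 2 - (a - b)\<^sup>2 /
  4\<close>. It is laziness that puts the mean of two values here, so that the loss is governed by
  the energy.\<close>

lemma lazy_contraction: "mean (\<lambda>v. (lazy f v)\<^sup>2) \<le> mean (\<lambda>v. (f v)\<^sup>2) - energy f / 4"
proof -
  have "sta v * (lazy f v)\<^sup>2 \<le> (\<Sum>u\<in>V. w v u * ((f v + f u) / 2)\<^sup>2)" if v: "v \<in> V" for v
  proof -
    have "(sta v * lazy f v)\<^sup>2 \<le> sta v * (\<Sum>u\<in>V. w v u * ((f v + f u) / 2)\<^sup>2)"
      using weighted_Cauchy_Schwarz[of V "w v" "\<lambda>u. 1" "\<lambda>u. (f v + f u) / 2"] w_nonneg sta_lazy[OF v, of f]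
      by (simp add: sta_def)
    then have "sta v * (sta v * (lazy f v)\<^sup>2) \<le> sta v * (\<Sum>u\<in>V. w v u * ((f v + f u) / 2)\<^sup>2)" by (simp add: power2_eq_square mult_ac)
    then show ?thesis using sta_pos[OF v] by simp
  qed
  then have "mean (\<lambda>v. (lazy f v)\<^sup>2) \<le> (\<Sum>v\<in>V. \<Sum>u\<in>V. w v u * ((f v + f u) / 2)\<^sup>2)"
    unfolding mean_def by (rule sum_mono)
  also have "\<dots> = (\<Sum>v\<in>V. \<Sum>u\<in>V. (w v u * (f v)\<^sup>2) / 2 + (w v u * (f u)\<^sup>2) / 2 - (w v u * (f v - f u)\<^sup>2) / 4)"
    by (intro sum.cong refl) (simp add: power2_eq_square field_simps)
  also have "\<dots> = (\<Sum>v\<in>V. \<Sum>u\<in>V. w v u * (f v)\<^sup>2) / 2 + (\<Sum>v\<in>V. \<Sum>u\<in>V. w v u * (f u)\<^sup>2) / 2 - energy f / 4"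
    by (simp add: energy_def sum.distrib sum_subtractf sum_divide_distrib)
  also have "\<dots> = mean (\<lambda>v. (f v)\<^sup>2) - energy f / 4" by (simp add: sum_w_fst[of "\<lambda>v. (f v)\<^sup>2"] sum_w_snd[of "\<lambda>v. (f v)\<^sup>2"])
  finally show ?thesis .
qed

text \<open>Peels off the superlevel sets of \<open>F\<close> one at a time, starting with the support.\<close>

lemma coarea:
  assumes "\<And>v. v \<in> V \<Longrightarrow> 0 \<le> F v" and "\<And>U. \<lbrakk>U \<subseteq> {v\<in>V. 0 < F v}; U \<noteq> {}\<rbrakk> \<Longrightarrow> \<psi> * sum sta U \<le> flow_out U"
  shows "2 * \<psi> * mean F \<le> (\<Sum>v\<in>V. \<Sum>u\<in>V. w v u * \<bar>F v - F u\<bar>)"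
  using assms
proof (induction "card {v\<in>V. 0 < F v}" arbitrary: F rule: less_induct)
  case less
  let ?U = "{v\<in>V. 0 < F v}"
  show ?case
  proof (cases "?U = {}")
    case True
    then have "F v = 0" if "v \<in> V" for v using that less.prems(1)[OF that] by (metis (mono_tags, lifting) empty_iff less_eq_real_def mem_Collect_eq)
    then show ?thesis by (simp add: mean_def)
  next
    case False
    have finU: "finite ?U" using finV by simp
    define \<mu> where "\<mu> = Min (F ` ?U)"
    have "\<mu> \<in> F ` ?U" unfolding \<mu>_def using finU False by (intro Min_in) auto
    then obtain z where z: "z \<in> ?U" "F z = \<mu>" by auto
    have \<mu>0: "\<mu> > 0" using z by auto
    have \<mu>le: "\<mu> \<le> F v" if "v \<in> ?U" for v unfolding \<mu>_def using finU that by (intro Min_le) auto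
    \<comment> \<open>Lowers \<open>F\<close> by its least positive value on the whole support: the
      support shrinks strictly, and exactly the differences across its boundary drop, each by that
      value.\<close>
    define F' where "F' v = F v - \<mu> * of_bool (v \<in> ?U)" for v
    have out: "F v = 0" if "v \<in> V" "v \<notin> ?U" for v using that less.prems(1)[of v] by auto
    have sub: "{v\<in>V. 0 < F' v} \<subseteq> ?U - {z}"
    proof
      fix v assume v: "v \<in> {v\<in>V. 0 < F' v}"
      have "v \<in> ?U" using v out[of v] \<mu>0 by (cases "v \<in> ?U") (auto simp: F'_def)
      moreover have "v \<noteq> z" using v z by (auto simp: F'_def)
      ultimately show "v \<in> ?U - {z}" by blast
    qed
    have "card {v\<in>V. 0 < F' v} < card ?U" using sub z finU by (intro psubset_card_mono) auto
    then have IH: "2 * \<psi> * mean F' \<le> (\<Sum>v\<in>V. \<Sum>u\<in>V. w v u * \<bar>F' v - F' u\<bar>)"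
    proof (rule less.hyps)
      show "0 \<le> F' v" if "v \<in> V" for v using \<mu>le[of v] out[OF that] by (cases "v \<in> ?U") (auto simp: F'_def)
      show "\<psi> * sum sta U \<le> flow_out U" if "U \<subseteq> {v\<in>V. 0 < F' v}" "U \<noteq> {}" for U using that sub by (intro less.prems(2)) auto
    qed
    have abs: "\<bar>F v - F u\<bar> = \<bar>F' v - F' u\<bar> + \<mu> * (of_bool (v \<in> ?U \<and> u \<notin> ?U) + of_bool (u \<in> ?U \<and> v \<notin> ?U))" if "v \<in> V" "u \<in> V" for u v
      using \<mu>le[of v] \<mu>le[of u] out[OF that(1)] out[OF that(2)] \<mu>0 by (cases "v \<in> ?U"; cases "u \<in> ?U") (auto simp: F'_def)
    have fo: "(\<Sum>v\<in>V. \<Sum>u\<in>V. w v u * of_bool (v \<in> ?U \<and> u \<notin> ?U)) = flow_out ?U"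
    proof -
      have "(\<Sum>v\<in>V. \<Sum>u\<in>V. w v u * of_bool (v \<in> ?U \<and> u \<notin> ?U)) = (\<Sum>v\<in>V. if v \<in> ?U then (\<Sum>u\<in>V - ?U. w v u) else 0)"
      proof (intro sum.cong refl)
        fix v assume "v \<in> V"
        show "(\<Sum>u\<in>V. w v u * of_bool (v \<in> ?U \<and> u \<notin> ?U)) = (if v \<in> ?U then (\<Sum>u\<in>V - ?U. w v u) else 0)"
          using finV by (cases "v \<in> ?U") (auto intro!: sum.mono_neutral_cong_right)
      qed
      also have "\<dots> = (\<Sum>v\<in>?U. \<Sum>u\<in>V - ?U. w v u)" using finV by (intro sum.mono_neutral_cong_right) auto
      finally show ?thesis by (simp add: flow_out_def)
    qed
    have fo': "(\<Sum>v\<in>V. \<Sum>u\<in>V. w v u * of_bool (u \<in> ?U \<and> v \<notin> ?U)) = flow_out ?U"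
    proof -
      have "(\<Sum>v\<in>V. \<Sum>u\<in>V. w v u * of_bool (u \<in> ?U \<and> v \<notin> ?U)) = (\<Sum>u\<in>V. \<Sum>v\<in>V. w u v * of_bool (u \<in> ?U \<and> v \<notin> ?U))"
        by (subst sum.swap) (simp only: w_sym)
      then show ?thesis using fo by simp
    qed
    have "(\<Sum>v\<in>V. \<Sum>u\<in>V. w v u * \<bar>F v - F u\<bar>) =
      (\<Sum>v\<in>V. \<Sum>u\<in>V. w v u * \<bar>F' v - F' u\<bar> + \<mu> * (w v u * of_bool (v \<in> ?U \<and> u \<notin> ?U)) + \<mu> * (w v u * of_bool (u \<in> ?U \<and> v \<notin> ?U)))"
      by (intro sum.cong refl) (simp only: abs, simp add: algebra_simps)
    also have "\<dots> = (\<Sum>v\<in>V. \<Sum>u\<in>V. w v u * \<bar>F' v - F' u\<bar>) + \<mu> * flow_out ?U + \<mu> * flow_out ?U"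
      by (simp only: sum.distrib sum_distrib_left[symmetric] fo fo')
    finally have tot: "(\<Sum>v\<in>V. \<Sum>u\<in>V. w v u * \<bar>F v - F u\<bar>) = (\<Sum>v\<in>V. \<Sum>u\<in>V. w v u * \<bar>F' v - F' u\<bar>) + 2 * \<mu> * flow_out ?U" by simp
    have mF: "mean F = mean F' + \<mu> * sum sta ?U"
    proof -
      have "mean F = (\<Sum>v\<in>V. sta v * F' v + (if v \<in> ?U then \<mu> * sta v else 0))"
        unfolding mean_def by (intro sum.cong refl) (simp add: F'_def algebra_simps)
      also have "\<dots> = mean F' + (\<Sum>v\<in>V. if v \<in> ?U then \<mu> * sta v else 0)" by (simp only: sum.distrib mean_def)
      also have "(\<Sum>v\<in>V. if v \<in> ?U then \<mu> * sta v else 0) = (\<Sum>v\<in>?U. \<mu> * sta v)"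
        using finV by (intro sum.mono_neutral_cong_right) auto
      finally show ?thesis by (simp only: sum_distrib_left)
    qed
    have "\<mu> * (\<psi> * sum sta ?U) \<le> \<mu> * flow_out ?U" using less.prems(2)[OF order_refl False] \<mu>0 by simp
    then show ?thesis using IH unfolding tot mF by (simp add: algebra_simps)
  qed
qed

text \<open>The coarea inequality for the square of \<open>g\<close>, with the difference
  \<open>g v - g u\<close> split off from the difference of squares by Cauchy-Schwarz. Expansion is
  asked only of sets inside the support of \<open>g\<close>, so truncated functions profit from the
  better expansion of small sets.\<close>

lemma Cheeger:
  assumes g: "\<And>v. v \<in> V \<Longrightarrow> 0 \<le> g v" and \<psi>: "0 \<le> \<psi>"
    and U: "\<And>U. \<lbrakk>U \<subseteq> {v\<in>V. 0 < g v}; U \<noteq> {}\<rbrakk> \<Longrightarrow> \<psi> * sum sta U \<le> flow_out U"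
  shows "\<psi>\<^sup>2 * mean (\<lambda>v. (g v)\<^sup>2) \<le> energy g"
proof -
  define N where "N = mean (\<lambda>v. (g v)\<^sup>2)"
  have N0: "N \<ge> 0" unfolding N_def by (intro mean_nonneg) simp
  have "2 * \<psi> * N \<le> (\<Sum>v\<in>V. \<Sum>u\<in>V. w v u * \<bar>(g v)\<^sup>2 - (g u)\<^sup>2\<bar>)"
    unfolding N_def using U by (intro coarea) (auto simp: zero_less_power2 less_le g dest: g)
  also have "\<dots> = (\<Sum>v\<in>V. \<Sum>u\<in>V. w v u * (\<bar>g v - g u\<bar> * (g v + g u)))"
  proof (intro sum.cong refl)
    fix v u assume "v \<in> V" "u \<in> V"
    then have "\<bar>g v + g u\<bar> = g v + g u" using g[of v] g[of u] by simp
    moreover have "(g v)\<^sup>2 - (g u)\<^sup>2 = (g v - g u) * (g v + g u)" by (simp add: power2_eq_square algebra_simps)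
    ultimately show "w v u * \<bar>(g v)\<^sup>2 - (g u)\<^sup>2\<bar> = w v u * (\<bar>g v - g u\<bar> * (g v + g u))" by (simp add: abs_mult)
  qed
  also have "\<dots> = (\<Sum>(v, u)\<in>V \<times> V. w v u * (\<bar>g v - g u\<bar> * (g v + g u)))" by (rule sum.cartesian_product)
  finally have "2 * \<psi> * N \<le> (\<Sum>p\<in>V \<times> V. w (fst p) (snd p) * (\<bar>g (fst p) - g (snd p)\<bar> * (g (fst p) + g (snd p))))"
    by (simp add: case_prod_beta)
  then have "(2 * \<psi> * N)\<^sup>2 \<le> (\<Sum>p\<in>V \<times> V. w (fst p) (snd p) * (\<bar>g (fst p) - g (snd p)\<bar> * (g (fst p) + g (snd p))))\<^sup>2"
    using \<psi> N0 by (intro power_mono) auto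
  also have "\<dots> \<le> (\<Sum>p\<in>V \<times> V. w (fst p) (snd p) * \<bar>g (fst p) - g (snd p)\<bar>\<^sup>2) * (\<Sum>p\<in>V \<times> V. w (fst p) (snd p) * (g (fst p) + g (snd p))\<^sup>2)"
    by (rule weighted_Cauchy_Schwarz) (rule w_nonneg)
  also have "(\<Sum>p\<in>V \<times> V. w (fst p) (snd p) * \<bar>g (fst p) - g (snd p)\<bar>\<^sup>2) = energy g"
    unfolding energy_def sum.cartesian_product by (simp add: case_prod_beta)
  also have "(\<Sum>p\<in>V \<times> V. w (fst p) (snd p) * (g (fst p) + g (snd p))\<^sup>2) = (\<Sum>v\<in>V. \<Sum>u\<in>V. w v u * (g v + g u)\<^sup>2)"
    unfolding sum.cartesian_product by (simp add: case_prod_beta)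
  also have "energy g * \<dots> \<le> energy g * (4 * N)"
  proof (intro mult_left_mono energy_nonneg)
    have "(\<Sum>v\<in>V. \<Sum>u\<in>V. w v u * (g v + g u)\<^sup>2) \<le> (\<Sum>v\<in>V. \<Sum>u\<in>V. w v u * (2 * (g v)\<^sup>2) + w v u * (2 * (g u)\<^sup>2))"
    proof (intro sum_mono)
      fix v u
      have "(g v + g u)\<^sup>2 \<le> 2 * (g v)\<^sup>2 + 2 * (g u)\<^sup>2" using zero_le_power2[of "g v - g u"] by (simp add: power2_eq_square algebra_simps)
      then show "w v u * (g v + g u)\<^sup>2 \<le> w v u * (2 * (g v)\<^sup>2) + w v u * (2 * (g u)\<^sup>2)"
        unfolding distrib_left[symmetric] by (intro mult_left_mono w_nonneg)
    qed
    also have "\<dots> = mean (\<lambda>v. 2 * (g v)\<^sup>2) + mean (\<lambda>v. 2 * (g v)\<^sup>2)"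
      by (simp only: sum.distrib sum_w_fst[of "\<lambda>v. 2 * (g v)\<^sup>2"] sum_w_snd[of "\<lambda>v. 2 * (g v)\<^sup>2"])
    also have "\<dots> = 4 * N" by (simp add: mean_scale N_def)
    finally show "(\<Sum>v\<in>V. \<Sum>u\<in>V. w v u * (g v + g u)\<^sup>2) \<le> 4 * N" .
  qed
  finally have "N * (\<psi>\<^sup>2 * N) \<le> N * energy g" by (simp add: power2_eq_square mult_ac)
  then show ?thesis using N0 energy_nonneg[of g] unfolding N_def[symmetric] by (cases "N = 0") auto
qed

lemma energy_mono:
  assumes "\<And>v u. \<lbrakk>v \<in> V; u \<in> V\<rbrakk> \<Longrightarrow> (g v - g u)\<^sup>2 + (h v - h u)\<^sup>2 \<le> (f v - f u)\<^sup>2"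
  shows "energy g + energy h \<le> energy f"
  unfolding energy_def sum.distrib[symmetric] distrib_left[symmetric]
  using assms by (intro sum_mono mult_left_mono w_nonneg)

lemma Markov_level:
  assumes "\<And>v. v \<in> V \<Longrightarrow> 0 \<le> f v" "mean f = 1" "0 < c"
  shows "sum sta {v\<in>V. c < f v} \<le> 1 / c"
proof -
  have "c * sum sta {v\<in>V. c < f v} = (\<Sum>v\<in>{v\<in>V. c < f v}. sta v * c)" by (simp add: sum_distrib_left mult.commute)
  also have "\<dots> \<le> (\<Sum>v\<in>{v\<in>V. c < f v}. sta v * f v)" by (intro sum_mono mult_left_mono sta_nonneg) auto
  also have "\<dots> \<le> mean f" unfolding mean_def using finV assms(1) sta_nonneg by (intro sum_mono2) auto
  finally show ?thesis using assms by (simp add: field_simps)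
qed

lemma median_exists:
  fixes f :: "'a \<Rightarrow> real"
  shows "\<exists>c. sum sta {v\<in>V. c < f v} \<le> 1 / 2 \<and> sum sta {v\<in>V. f v < c} \<le> 1 / 2"
proof -
  have neV: "V \<noteq> {}" using sum_sta by auto
  define X where "X = {x \<in> f ` V. sum sta {v\<in>V. x < f v} \<le> 1 / 2}"
  have finX: "finite X" using finV by (simp add: X_def)
  have "Max (f ` V) \<in> X"
  proof -
    have "{v\<in>V. Max (f ` V) < f v} = {}" using finV by (auto simp: not_less)
    then have "sum sta {v\<in>V. Max (f ` V) < f v} = 0" by (simp only: sum.empty)
    moreover have "Max (f ` V) \<in> f ` V" using finV neV by (intro Max_in) auto
    ultimately show ?thesis unfolding X_def by (intro CollectI conjI) linarith+
  qed
  then have neX: "X \<noteq> {}" by blast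
  \<comment> \<open>The least value with at most half of the mass above it; for the next smaller
    value more than half lies above, so at most half lies strictly below \<open>c\<close>.\<close>
  define c where "c = Min X"
  have c: "c \<in> X" unfolding c_def using finX neX by (rule Min_in)
  have "sum sta {v\<in>V. f v < c} \<le> 1 / 2"
  proof (cases "{v\<in>V. f v < c} = {}")
    case True
    then show ?thesis by (simp only: sum.empty)
  next
    case False
    define y where "y = Max (f ` {v\<in>V. f v < c})"
    have "y \<in> f ` {v\<in>V. f v < c}" unfolding y_def using finV False by (intro Max_in) auto
    then obtain z where z: "z \<in> V" "f z < c" "y = f z" by auto
    then have "y \<notin> X" using Min_le[OF finX, of y] unfolding c_def by linarith
    then have "1 / 2 < sum sta {v\<in>V. y < f v}" using z by (auto simp: X_def)
    moreover have "{v\<in>V. f v < c} = V - {v\<in>V. y < f v}"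
    proof (intro set_eqI iffI)
      fix v assume v: "v \<in> {v\<in>V. f v < c}"
      then have "f v \<le> y" unfolding y_def using finV by (intro Max_ge) auto
      then show "v \<in> V - {v\<in>V. y < f v}" using v by auto
    next
      fix v assume "v \<in> V - {v\<in>V. y < f v}"
      then show "v \<in> {v\<in>V. f v < c}" using z by auto
    qed
    then have "sum sta {v\<in>V. f v < c} = sum sta V - sum sta {v\<in>V. y < f v}" using finV by (simp add: sum_diff)
    ultimately show ?thesis using sum_sta by simp
  qed
  then show ?thesis using c by (auto simp: X_def)
qed

end

section \<open>Decay of the second moment under logarithmic expansion\<close>

locale expanding_network = network +
  fixes \<kappa> :: real
  assumes \<kappa>_pos: "0 < \<kappa>"
    and expansion: "\<lbrakk>U \<subseteq> V; U \<noteq> {}; sum sta U \<le> 1 / 2\<rbrakk> \<Longrightarrow> \<kappa> * (1 + ln (1 / sum sta U)) * sum sta U \<le> flow_out U"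
begin

lemma profile:
  assumes "U \<subseteq> V" "U \<noteq> {}" "sum sta U \<le> p" "p \<le> 1 / 2"
  shows "\<kappa> * (1 + ln (1 / p)) * sum sta U \<le> flow_out U"
proof -
  have fU: "finite U" using assms(1) finV finite_subset by blast
  have p: "0 < sum sta U" using assms sta_pos fU by (intro sum_pos) auto
  then have "ln (1 / p) \<le> ln (1 / sum sta U)" using assms by (simp add: ln_div)
  then have "\<kappa> * (1 + ln (1 / p)) * sum sta U \<le> \<kappa> * (1 + ln (1 / sum sta U)) * sum sta U"
    using \<kappa>_pos p by (intro mult_right_mono mult_left_mono) auto
  also have "\<dots> \<le> flow_out U" using assms by (intro expansion) auto
  finally show ?thesis .
qed

text \<open>Truncating at a quarter of the second moment leaves at least half of it on a set of measure at most
  \<open>4 / mean f\<^sup>2\<close>, where the expansion is better the larger the second moment is.\<close>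

lemma early_decay:
  assumes f: "\<And>v. 0 \<le> f v" "mean f = 1" and Q: "8 \<le> mean (\<lambda>v. (f v)\<^sup>2)"
  shows "mean (\<lambda>v. (lazy f v)\<^sup>2) \<le> mean (\<lambda>v. (f v)\<^sup>2) * (1 - (\<kappa> * (1 + ln (mean (\<lambda>v. (f v)\<^sup>2) / 4)))\<^sup>2 / 8)"
proof -
  define Q where "Q = mean (\<lambda>v. (f v)\<^sup>2)"
  define c where "c = Q / 4"
  have c2: "c \<ge> 2" using Q by (simp add: c_def Q_def)
  define g where "g v = max 0 (f v - c)" for v
  define \<psi> where "\<psi> = \<kappa> * (1 + ln c)"
  have \<psi>0: "0 \<le> \<psi>" using \<kappa>_pos c2 by (simp add: \<psi>_def)
  have "\<psi>\<^sup>2 * mean (\<lambda>v. (g v)\<^sup>2) \<le> energy g"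
  proof (rule Cheeger[OF _ \<psi>0])
    fix U assume U: "U \<subseteq> {v\<in>V. 0 < g v}" "U \<noteq> {}"
    then have Us: "U \<subseteq> {v\<in>V. c < f v}" by (auto simp: g_def split: if_splits)
    have "sum sta U \<le> sum sta {v\<in>V. c < f v}" using Us finV sta_nonneg by (intro sum_mono2) auto
    also have "\<dots> \<le> 1 / c" using f c2 by (intro Markov_level) auto
    finally have "sum sta U \<le> 1 / c" .
    then have "\<kappa> * (1 + ln (1 / (1 / c))) * sum sta U \<le> flow_out U" using Us U c2 by (intro profile) (auto simp: field_simps)
    then show "\<psi> * sum sta U \<le> flow_out U" by (simp add: \<psi>_def)
  qed (simp add: g_def)
  moreover have "energy g + energy (\<lambda>v. 0) \<le> energy f"
  proof (rule energy_mono)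
    fix v u
    have "\<bar>g v - g u\<bar> \<le> \<bar>f v - f u\<bar>" unfolding g_def by auto
    then have "(g v - g u)\<^sup>2 \<le> (f v - f u)\<^sup>2" using abs_le_square_iff by blast
    then show "(g v - g u)\<^sup>2 + (0 - 0)\<^sup>2 \<le> (f v - f u)\<^sup>2" by simp
  qed
  moreover have "energy (\<lambda>v. 0) = 0" by (simp add: energy_def)
  moreover have "Q / 2 \<le> mean (\<lambda>v. (g v)\<^sup>2)"
  proof -
    have "(f v)\<^sup>2 - 2 * c * f v \<le> (g v)\<^sup>2" for v
    proof (cases "c \<le> f v")
      case True
      then show ?thesis by (simp add: g_def power2_eq_square algebra_simps)
    next
      case False
      then have "f v * (f v - 2 * c) \<le> 0" using f(1)[of v] c2 by (intro mult_nonneg_nonpos) auto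
      then have "(f v)\<^sup>2 - 2 * c * f v \<le> 0" by (simp add: power2_eq_square algebra_simps)
      then show ?thesis using zero_le_power2[of "g v"] by linarith
    qed
    then have "mean (\<lambda>v. (f v)\<^sup>2 - 2 * c * f v) \<le> mean (\<lambda>v. (g v)\<^sup>2)" by (rule mean_mono)
    moreover have "mean (\<lambda>v. (f v)\<^sup>2 - 2 * c * f v) = Q - 2 * c * 1" by (simp only: mean_diff mean_scale f(2) Q_def)
    ultimately show ?thesis by (simp add: c_def)
  qed
  ultimately have "\<psi>\<^sup>2 * (Q / 2) \<le> energy f" using mult_left_mono[of "Q / 2" "mean (\<lambda>v. (g v)\<^sup>2)" "\<psi>\<^sup>2"] by simp
  then have "mean (\<lambda>v. (lazy f v)\<^sup>2) \<le> Q - \<psi>\<^sup>2 * (Q / 2) / 4" using lazy_contraction[of f] unfolding Q_def[symmetric] by linarith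
  also have "\<dots> = Q * (1 - \<psi>\<^sup>2 / 8)" by (simp add: algebra_simps)
  finally show ?thesis unfolding \<psi>_def c_def Q_def .
qed

lemma variance: "mean f = 1 \<Longrightarrow> mean (\<lambda>v. (f v - c)\<^sup>2) = mean (\<lambda>v. (f v)\<^sup>2) - 1 + (1 - c)\<^sup>2"
proof -
  assume f: "mean f = 1"
  have "mean (\<lambda>v. (f v - c)\<^sup>2) = mean (\<lambda>v. ((f v)\<^sup>2 + c\<^sup>2) - 2 * c * f v)" by (simp add: power2_eq_square algebra_simps)
  also have "\<dots> = mean (\<lambda>v. (f v)\<^sup>2) + c\<^sup>2 - 2 * c * 1" by (simp only: mean_diff mean_add mean_scale mean_const f)
  finally show ?thesis by (simp add: power2_eq_square algebra_simps)
qed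

text \<open>A Poincare inequality: for a median \<open>c\<close> the positive and the negative part
  of \<open>f - c\<close> live on sets of measure at most \<open>1 / 2\<close>, so Cheeger's
  inequality applies to both, and their energies add up to at most that of \<open>f\<close>. The
  variance is at most the second moment about \<open>c\<close>.\<close>

lemma late_decay:
  assumes f: "mean f = 1"
  shows "mean (\<lambda>v. (lazy f v)\<^sup>2) - 1 \<le> (mean (\<lambda>v. (f v)\<^sup>2) - 1) * (1 - \<kappa>\<^sup>2 / 4)"
proof -
  obtain c where c: "sum sta {v\<in>V. c < f v} \<le> 1 / 2" "sum sta {v\<in>V. f v < c} \<le> 1 / 2" using median_exists by blast
  define g where "g v = max 0 (f v - c)" for v
  define h where "h v = max 0 (c - f v)" for v
  have k0: "0 \<le> \<kappa>" using \<kappa>_pos by simp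
  have prof: "\<kappa> * sum sta U \<le> flow_out U" if "U \<subseteq> W" "U \<noteq> {}" "W \<subseteq> V" "sum sta W \<le> 1 / 2" for U W
  proof -
    have "sum sta U \<le> sum sta W" using that finV finite_subset sta_nonneg by (intro sum_mono2) auto
    then have "\<kappa> * (1 + ln (1 / (1 / 2))) * sum sta U \<le> flow_out U" using that by (intro profile) auto
    moreover have "\<kappa> * sum sta U \<le> \<kappa> * (1 + ln (1 / (1 / 2))) * sum sta U"
      using k0 mult_left_mono[of 1 "1 + ln 2" \<kappa>] by (intro mult_right_mono sum_nonneg sta_nonneg) auto
    ultimately show ?thesis by linarith
  qed
  have "\<kappa>\<^sup>2 * mean (\<lambda>v. (g v)\<^sup>2) \<le> energy g"
    by (rule Cheeger[OF _ k0], simp add: g_def, rule prof[OF _ _ _ c(1)]) (auto simp: g_def split: if_splits)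
  moreover have "\<kappa>\<^sup>2 * mean (\<lambda>v. (h v)\<^sup>2) \<le> energy h"
    by (rule Cheeger[OF _ k0], simp add: h_def, rule prof[OF _ _ _ c(2)]) (auto simp: h_def split: if_splits)
  moreover have "energy g + energy h \<le> energy f"
  proof (rule energy_mono)
    fix v u
    define x y where "x = f v - c" and "y = f u - c"
    have "(max 0 x - max 0 y)\<^sup>2 + (max 0 (- x) - max 0 (- y))\<^sup>2 \<le> (x - y)\<^sup>2"
    proof (cases "0 \<le> x"; cases "0 \<le> y")
      assume "0 \<le> x" "\<not> 0 \<le> y"
      then have "x * y \<le> 0" by (simp add: mult_nonneg_nonpos)
      then show ?thesis using \<open>0 \<le> x\<close> \<open>\<not> 0 \<le> y\<close> by (simp add: power2_eq_square algebra_simps max_def)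
    next
      assume "\<not> 0 \<le> x" "0 \<le> y"
      then have "x * y \<le> 0" by (simp add: mult_nonpos_nonneg)
      then show ?thesis using \<open>\<not> 0 \<le> x\<close> \<open>0 \<le> y\<close> by (simp add: power2_eq_square algebra_simps max_def)
    qed (auto simp: max_def power2_eq_square algebra_simps)
    then show "(g v - g u)\<^sup>2 + (h v - h u)\<^sup>2 \<le> (f v - f u)\<^sup>2" by (simp add: g_def h_def x_def y_def)
  qed
  moreover have "mean (\<lambda>v. (g v)\<^sup>2) + mean (\<lambda>v. (h v)\<^sup>2) = mean (\<lambda>v. (f v - c)\<^sup>2)"
    unfolding mean_add[symmetric]
    by (rule arg_cong[where f=mean], rule ext) (auto simp: g_def h_def max_def power2_eq_square algebra_simps)
  then have "\<kappa>\<^sup>2 * mean (\<lambda>v. (f v - c)\<^sup>2) = \<kappa>\<^sup>2 * mean (\<lambda>v. (g v)\<^sup>2) + \<kappa>\<^sup>2 * mean (\<lambda>v. (h v)\<^sup>2)" by (simp only: distrib_left[symmetric])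
  ultimately have "\<kappa>\<^sup>2 * mean (\<lambda>v. (f v - c)\<^sup>2) \<le> energy f" by linarith
  moreover have "\<kappa>\<^sup>2 * (mean (\<lambda>v. (f v)\<^sup>2) - 1) \<le> \<kappa>\<^sup>2 * mean (\<lambda>v. (f v - c)\<^sup>2)"
    unfolding variance[OF f] by (intro mult_left_mono) auto
  ultimately have "\<kappa>\<^sup>2 * (mean (\<lambda>v. (f v)\<^sup>2) - 1) \<le> energy f" by linarith
  then show ?thesis using lazy_contraction[of f] by (simp add: algebra_simps)
qed

text \<open>The first summand brings the second moment of any density below 8, regardless of its
  initial size; over the second one its excess over 1 shrinks by a factor
  \<open>exp (- 4)\<close>.\<close>

definition mixing_steps :: nat where "mixing_steps = nat \<lceil>8 / \<kappa>\<^sup>2\<rceil> + nat \<lceil>16 / \<kappa>\<^sup>2\<rceil>"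

lemma density_mixes:
  assumes f: "\<And>v. 0 \<le> f v" "mean f = 1"
  shows "mean (\<lambda>v. ((lazy ^^ mixing_steps) f v)\<^sup>2) - 1 \<le> 1 / 4"
proof -
  define Q where "Q t = mean (\<lambda>v. ((lazy ^^ t) f v)\<^sup>2)" for t
  have ft: "0 \<le> (lazy ^^ t) f v" "mean ((lazy ^^ t) f) = 1" for t v using f lazy_pow_nonneg mean_lazy_pow by simp_all
  have Qs: "Q (Suc t) \<le> Q t" for t
    using lazy_contraction[of "(lazy ^^ t) f"] energy_nonneg[of "(lazy ^^ t) f"] by (simp add: Q_def)
  then have dec: "Q t \<le> Q s" if "s \<le> t" for s t using that lift_Suc_antimono_le[of Q] by (simp add: antimono_def)
  have Q1: "1 \<le> Q t" for t
  proof -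
    have "0 \<le> mean (\<lambda>v. ((lazy ^^ t) f v - 1)\<^sup>2)" by (intro mean_nonneg) simp
    then show ?thesis unfolding variance[OF ft(2)] Q_def by simp
  qed
  define t1 where "t1 = nat \<lceil>8 / \<kappa>\<^sup>2\<rceil>"
  define t2 where "t2 = nat \<lceil>16 / \<kappa>\<^sup>2\<rceil>"
  have k2: "\<kappa>\<^sup>2 > 0" using \<kappa>_pos by simp
  have t12: "8 \<le> real t1 * \<kappa>\<^sup>2" "16 \<le> real t2 * \<kappa>\<^sup>2"
    using k2 real_nat_ceiling_ge[of "8 / \<kappa>\<^sup>2"] real_nat_ceiling_ge[of "16 / \<kappa>\<^sup>2"]
    unfolding t1_def[symmetric] t2_def[symmetric] by (simp_all add: pos_divide_le_eq)
  have Q8: "Q t1 < 8"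
  proof (rule ccontr)
    assume "\<not> Q t1 < 8"
    then have ge: "8 \<le> Q s" if "s \<le> t1" for s using dec[OF that] by linarith
    \<comment> \<open>Early decay reads
      \<open>y (Suc s) \<le> y s - \<kappa>\<^sup>2 / 8 * (y s)\<^sup>2\<close>, so
      \<open>1 / y\<close> grows by at least \<open>\<kappa>\<^sup>2 / 8\<close> per step and would
      reach 1 after \<open>t1\<close> steps although \<open>y > 1\<close>. The starting value does
      not enter, which saves a logarithm.\<close>
    define y where "y s = 1 + ln (Q s / 4)" for s
    have y1: "1 + ln 2 \<le> y s" if "s \<le> t1" for s using ge[OF that] unfolding y_def by simp
    have "s \<le> t1 \<Longrightarrow> real s * \<kappa>\<^sup>2 / 8 \<le> 1 / y s" for s
    proof (induction s)
      case 0
      have "0 < ln (2::real)" by simp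
      then have "0 \<le> y 0" using y1[of 0] by linarith
      then show ?case by simp
    next
      case (Suc s)
      have l2: "0 < ln (2::real)" by simp
      have ys: "0 < y s" "0 < y (Suc s)" using y1[of s] y1[of "Suc s"] Suc.prems l2 by linarith+
      have Q0: "0 < Q s" "0 < Q (Suc s)" using Q1[of s] Q1[of "Suc s"] by linarith+
      have "Q (Suc s) \<le> Q s * (1 - (\<kappa> * y s)\<^sup>2 / 8)"
        using early_decay[OF ft] ge[of s] Suc.prems unfolding Q_def y_def by simp
      then have "Q (Suc s) / Q s - 1 \<le> - ((\<kappa> * y s)\<^sup>2 / 8)" using Q0 by (simp add: field_simps)
      moreover have "ln (Q (Suc s) / Q s) \<le> Q (Suc s) / Q s - 1" using Q0 by (intro ln_le_minus_one) simp
      moreover have "y (Suc s) = y s + ln (Q (Suc s) / Q s)" using Q0 by (simp add: y_def ln_div)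
      ultimately have step: "y (Suc s) \<le> y s - \<kappa>\<^sup>2 / 8 * (y s)\<^sup>2" by (simp add: power_mult_distrib)
      define \<delta> where "\<delta> = \<kappa>\<^sup>2 / 8"
      have \<delta>: "0 < \<delta>" using k2 by (simp add: \<delta>_def)
      have "(1 / y s + \<delta>) * y (Suc s) \<le> (1 / y s + \<delta>) * (y s - \<delta> * (y s)\<^sup>2)"
        using step ys \<delta> unfolding \<delta>_def[symmetric] by (intro mult_left_mono) auto
      also have "\<dots> = 1 - (\<delta> * y s)\<^sup>2" using ys by (simp add: field_simps power2_eq_square)
      finally have "(1 / y s + \<delta>) * y (Suc s) \<le> 1" using zero_le_power2[of "\<delta> * y s"] by linarith
      then have "1 / y s + \<delta> \<le> 1 / y (Suc s)" using ys by (simp add: pos_le_divide_eq)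
      then show ?case using Suc by (simp add: \<delta>_def algebra_simps add_divide_distrib)
    qed
    then have "real t1 * \<kappa>\<^sup>2 / 8 \<le> 1 / y t1" by simp
    then have "1 \<le> 1 / y t1" using t12(1) by linarith
    moreover have "1 < y t1" using y1[of t1] ln_gt_zero[of "2::real"] by linarith
    ultimately show False by simp
  qed
  have late: "Q (t1 + s) - 1 \<le> 7 * exp (- (real s * \<kappa>\<^sup>2 / 4))" for s
  proof (induction s)
    case 0
    then show ?case using Q8 by simp
  next
    case (Suc s)
    have "Q (t1 + Suc s) - 1 \<le> (Q (t1 + s) - 1) * (1 - \<kappa>\<^sup>2 / 4)" using late_decay[OF ft(2)] by (simp add: Q_def)
    also have "\<dots> \<le> (Q (t1 + s) - 1) * exp (- (\<kappa>\<^sup>2 / 4))"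
      using Q1[of "t1 + s"] exp_ge_add_one_self[of "- (\<kappa>\<^sup>2 / 4)"] by (intro mult_left_mono) auto
    also have "\<dots> \<le> 7 * exp (- (real s * \<kappa>\<^sup>2 / 4)) * exp (- (\<kappa>\<^sup>2 / 4))" using Suc by (intro mult_right_mono) auto
    also have "\<dots> = 7 * exp (- (real (Suc s) * \<kappa>\<^sup>2 / 4))" by (simp add: mult_exp_exp algebra_simps add_divide_distrib)
    finally show ?case .
  qed
  have "exp (- (real t2 * \<kappa>\<^sup>2 / 4)) \<le> exp (- 4)" using t12(2) by simp
  also have "exp (- 4 :: real) \<le> 1 / 28"
  proof -
    have "(2.5::real) \<le> exp 1" using exp_ge_one_plus_x_over_n_power_n[of 2 1] exp_lower_Taylor_quadratic[of 1] by simp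
    then have "(2.5::real) ^ 4 \<le> exp 1 ^ 4" by (intro power_mono) auto
    also have "exp 1 ^ 4 = exp (4::real)" by (simp flip: exp_of_nat_mult)
    finally have "28 \<le> exp (4::real)" by (simp add: power_divide)
    then show ?thesis by (simp add: exp_minus field_simps)
  qed
  finally have "7 * exp (- (real t2 * \<kappa>\<^sup>2 / 4)) \<le> 1 / 4" by simp
  then have "Q (t1 + t2) - 1 \<le> 1 / 4" using late[of t2] by linarith
  then show ?thesis unfolding Q_def mixing_steps_def t1_def t2_def .
qed

text \<open>Self-adjointness splits the walk into two halves: the transition density from
  \<open>a\<close> to \<open>b\<close> is the inner product of the densities started at
  \<open>a\<close> and at \<open>b\<close> after \<open>mixing_steps\<close> steps. Both deviate
  from the constant 1 by at most \<open>1 / 4\<close> in mean square, so the inner product is at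
  least \<open>3 / 4\<close>; mean-square mixing thus becomes a pointwise bound.\<close>

theorem transition_lower_bound:
  assumes "a \<in> V" "b \<in> V"
  shows "3 / 4 * sta b \<le> (lazy ^^ (2 * mixing_steps)) (\<lambda>v. of_bool (v = b)) a"
proof -
  define \<delta> where "\<delta> c v = (1 / sta c) * of_bool (v = c)" for c v
  have \<delta>m: "mean (\<lambda>v. \<delta> c v * g v) = g c" if "c \<in> V" for c g
  proof -
    have "mean (\<lambda>v. \<delta> c v * g v) = (\<Sum>v\<in>V. if v = c then g c else 0)"
      unfolding mean_def using sta_pos[OF that] by (intro sum.cong refl) (auto simp: \<delta>_def)
    then show ?thesis using finV that by simp
  qed
  have \<delta>1: "mean (\<delta> c) = 1" if "c \<in> V" for c using \<delta>m[OF that, of "\<lambda>v. 1"] by simp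
  have \<delta>0: "0 \<le> \<delta> c v" for c v using sta_nonneg by (simp add: \<delta>_def)
  define f where "f c = (lazy ^^ mixing_steps) (\<delta> c)" for c
  have f1: "mean (f c) = 1" if "c \<in> V" for c unfolding f_def mean_lazy_pow by (rule \<delta>1[OF that])
  have small: "mean (\<lambda>v. (f c v - 1)\<^sup>2) \<le> 1 / 4" if "c \<in> V" for c
    using density_mixes[OF \<delta>0 \<delta>1[OF that]] unfolding variance[OF f1[OF that]] by (simp add: f_def)
  have half: "(lazy ^^ (2 * mixing_steps)) (\<delta> b) = (lazy ^^ mixing_steps) (f b)" unfolding f_def by (simp add: mult_2 funpow_add)
  have "(lazy ^^ (2 * mixing_steps)) (\<delta> b) a = mean (\<lambda>v. \<delta> a v * (lazy ^^ mixing_steps) (f b) v)" using \<delta>m assms half by simp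
  also have "\<dots> = mean (\<lambda>v. f a v * f b v)" unfolding lazy_pow_self_adjoint by (simp add: f_def)
  also have "\<dots> = mean (\<lambda>v. (f a v + f b v - 1) + (f a v - 1) * (f b v - 1))" by (simp add: algebra_simps)
  also have "\<dots> = 1 + mean (\<lambda>v. (f a v - 1) * (f b v - 1))"
    by (simp only: mean_add mean_diff mean_const f1[OF assms(1)] f1[OF assms(2)])
  finally have eq: "(lazy ^^ (2 * mixing_steps)) (\<delta> b) a = 1 + mean (\<lambda>v. (f a v - 1) * (f b v - 1))" .
  have "0 \<le> ((f a v - 1)\<^sup>2 + (f b v - 1)\<^sup>2) + 2 * ((f a v - 1) * (f b v - 1))" for v
    using zero_le_power2[of "(f a v - 1) + (f b v - 1)"] by (simp add: power2_eq_square algebra_simps)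
  then have "0 \<le> mean (\<lambda>v. ((f a v - 1)\<^sup>2 + (f b v - 1)\<^sup>2) + 2 * ((f a v - 1) * (f b v - 1)))" by (intro mean_nonneg)
  then have "0 \<le> (mean (\<lambda>v. (f a v - 1)\<^sup>2) + mean (\<lambda>v. (f b v - 1)\<^sup>2)) + 2 * mean (\<lambda>v. (f a v - 1) * (f b v - 1))"
    by (simp only: mean_scale mean_add)
  moreover have "3 / 4 \<le> z" if "0 \<le> (x + y) + 2 * t" "z = 1 + t" "x \<le> 1 / 4" "y \<le> 1 / 4" for x y z t :: real
    using that by linarith
  ultimately have "3 / 4 \<le> (lazy ^^ (2 * mixing_steps)) (\<delta> b) a" using eq small[OF assms(1)] small[OF assms(2)] by blast
  moreover have "(lazy ^^ (2 * mixing_steps)) (\<delta> b) a = (1 / sta b) * (lazy ^^ (2 * mixing_steps)) (\<lambda>v. of_bool (v = b)) a"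
    unfolding \<delta>_def lazy_pow_scale ..
  moreover have "3 / 4 * c \<le> y" if "3 / 4 \<le> x" "x = (1 / c) * y" "0 < c" for x y c :: real
    using that by (simp add: pos_le_divide_eq)
  ultimately show ?thesis using sta_pos[OF assms(2)] by blast
qed

end

section \<open>Systems of random bridges\<close>

lemma card_2_doubleton: "card e = 2 \<Longrightarrow> v \<in> e \<Longrightarrow> u \<in> e \<Longrightarrow> v \<noteq> u \<Longrightarrow> e = {v, u}"
proof -
  assume e: "card e = 2" "v \<in> e" "u \<in> e" "v \<noteq> u"
  then have "finite e" by (intro card_ge_0_finite) simp
  then have "{v, u} = e" using e by (intro card_subset_eq) auto
  then show ?thesis by simp
qed

lemma prob_le_of_pmf_le:
  assumes "finite (set_pmf M)" "\<And>x. pmf M x \<le> c * pmf N x" "0 \<le> c"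
  shows "measure_pmf.prob M X \<le> c * measure_pmf.prob N X"
proof -
  have fin: "finite (X \<inter> set_pmf M)" using assms(1) by simp
  have "measure_pmf.prob M X = measure_pmf.prob M (X \<inter> set_pmf M)" by (simp only: measure_Int_set_pmf)
  also have "\<dots> = sum (pmf M) (X \<inter> set_pmf M)" by (rule measure_measure_pmf_finite[OF fin])
  also have "\<dots> \<le> (\<Sum>x\<in>X \<inter> set_pmf M. c * pmf N x)" by (intro sum_mono assms)
  also have "\<dots> = c * measure_pmf.prob N (X \<inter> set_pmf M)" by (simp only: sum_distrib_left[symmetric] measure_measure_pmf_finite[OF fin])
  also have "\<dots> \<le> c * measure_pmf.prob N X" by (intro mult_left_mono assms measure_pmf.finite_measure_mono) auto
  finally show ?thesis .
qed

lemma prob_less_1_witness: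
  assumes "measure_pmf.prob M X < 1"
  obtains z where "z \<in> set_pmf M" "z \<notin> X"
proof -
  have "\<not> set_pmf M \<subseteq> X"
  proof
    assume "set_pmf M \<subseteq> X"
    then have "AE x in M. x \<in> X" by (auto simp: AE_measure_pmf_iff)
    then show False using assms measure_pmf.prob_eq_1[of X M] by simp
  qed
  then show thesis using that by blast
qed

lemma Pi_pmf_two_components:
  assumes "finite I" "x \<in> I" "y \<in> I" "x \<noteq> y"
  shows "map_pmf (\<lambda>f. (f x, f y)) (Pi_pmf I d p) = pair_pmf (p x) (p y)"
proof -
  have I: "I = insert x (I - {x})" using assms by auto
  have "map_pmf (\<lambda>f. (f x, f y)) (Pi_pmf I d p) =
      map_pmf (\<lambda>f. (f x, f y)) (map_pmf (\<lambda>(u, f). f(x := u)) (pair_pmf (p x) (Pi_pmf (I - {x}) d p)))"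
    by (subst I, subst Pi_pmf_insert) (use assms in auto)
  also have "\<dots> = map_pmf (apsnd (\<lambda>f. f y)) (pair_pmf (p x) (Pi_pmf (I - {x}) d p))"
    unfolding map_pmf_comp using assms(4) by (intro map_pmf_cong) (auto simp: apsnd_def)
  also have "\<dots> = pair_pmf (p x) (p y)" unfolding pair_map_pmf2[symmetric] using assms by (simp add: Pi_pmf_component)
  finally show ?thesis .
qed

text \<open>Fubini for discrete laws: drawing both first ends, then both second ends, then both
  walks amounts to drawing two complete walks independently.\<close>

lemma pair_pmf_bind_product:
  defines "n q r B \<equiv> bind_pmf q (\<lambda>x. bind_pmf r (\<lambda>y. B x y))"
  shows "bind_pmf (pair_pmf (pair_pmf q q) (pair_pmf r r)) (\<lambda>((x, x'), (y, y')). pair_pmf (B x y) (B x' y')) = pair_pmf (n q r B) (n q r B)"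
proof -
  have "bind_pmf (pair_pmf (pair_pmf q q) (pair_pmf r r)) (\<lambda>((x, x'), (y, y')). pair_pmf (B x y) (B x' y')) =
    bind_pmf q (\<lambda>x. bind_pmf q (\<lambda>x'. bind_pmf r (\<lambda>y. bind_pmf r (\<lambda>y'. bind_pmf (B x y) (\<lambda>u. bind_pmf (B x' y') (\<lambda>u'. return_pmf (u, u')))))))"
    by (simp add: pair_pmf_def bind_assoc_pmf bind_return_pmf)
  also have "\<dots> = bind_pmf q (\<lambda>x. bind_pmf r (\<lambda>y. bind_pmf q (\<lambda>x'. bind_pmf r (\<lambda>y'. bind_pmf (B x y) (\<lambda>u. bind_pmf (B x' y') (\<lambda>u'. return_pmf (u, u')))))))"
    by (subst bind_commute_pmf[of q r]) (rule refl)
  also have "\<dots> = bind_pmf q (\<lambda>x. bind_pmf r (\<lambda>y. bind_pmf q (\<lambda>x'. bind_pmf (B x y) (\<lambda>u. bind_pmf r (\<lambda>y'. bind_pmf (B x' y') (\<lambda>u'. return_pmf (u, u')))))))"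
    by (intro bind_pmf_cong refl bind_commute_pmf)
  also have "\<dots> = bind_pmf q (\<lambda>x. bind_pmf r (\<lambda>y. bind_pmf (B x y) (\<lambda>u. bind_pmf q (\<lambda>x'. bind_pmf r (\<lambda>y'. bind_pmf (B x' y') (\<lambda>u'. return_pmf (u, u')))))))"
    by (intro bind_pmf_cong refl bind_commute_pmf)
  also have "\<dots> = pair_pmf (n q r B) (n q r B)" by (simp add: n_def pair_pmf_def bind_assoc_pmf)
  finally show ?thesis .
qed

section \<open>The lazy random walk on a finite graph\<close>

locale edge_graph =
  fixes V :: "'a set" and E :: "'a set set"
  assumes fin_V: "finite V" and edge: "e \<in> E \<Longrightarrow> e \<subseteq> V \<and> card e = 2" and ne_E: "E \<noteq> {}"
    and cover: "v \<in> V \<Longrightarrow> \<exists>e\<in>E. v \<in> e"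
begin

definition inc :: "'a \<Rightarrow> 'a set set" where "inc v = {e \<in> E. v \<in> e}"
definition wt :: "'a \<Rightarrow> 'a \<Rightarrow> real" where "wt v u = of_bool ({v, u} \<in> E) / (2 * card E)"

lemma fin_E: "finite E"
  by (rule finite_subset[of _ "Pow V"]) (use edge fin_V in auto)

lemma card_E_pos: "0 < card E"
  using fin_E ne_E by (simp add: card_gt_0_iff)

lemma fin_inc: "finite (inc v)"
  using fin_E by (simp add: inc_def)

lemma inc_ne: "v \<in> V \<Longrightarrow> inc v \<noteq> {}"
  using cover by (auto simp: inc_def)

lemma fin_edge: "e \<in> E \<Longrightarrow> finite e \<and> e \<noteq> {}"
  using edge[of e] card.infinite[of e] card.empty by fastforce

lemma card_nbrs: "card {u \<in> V. {v, u} \<in> E} = card (inc v)"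
proof (rule bij_betw_same_card[of "\<lambda>u. {v, u}"], rule bij_betw_imageI)
  show "inj_on (\<lambda>u. {v, u}) {u \<in> V. {v, u} \<in> E}" by (auto simp: inj_on_def doubleton_eq_iff)
  show "(\<lambda>u. {v, u}) ` {u \<in> V. {v, u} \<in> E} = inc v"
  proof
    show "(\<lambda>u. {v, u}) ` {u \<in> V. {v, u} \<in> E} \<subseteq> inc v" by (auto simp: inc_def)
    show "inc v \<subseteq> (\<lambda>u. {v, u}) ` {u \<in> V. {v, u} \<in> E}"
    proof
      fix e assume "e \<in> inc v"
      then have e: "e \<in> E" "v \<in> e" by (auto simp: inc_def)
      then obtain u where "e = {v, u}" using edge[OF e(1)] unfolding card_2_iff by auto
      then show "e \<in> (\<lambda>u. {v, u}) ` {u \<in> V. {v, u} \<in> E}" using e edge[OF e(1)] by auto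
    qed
  qed
qed

lemma sum_wt: "(\<Sum>u\<in>V. wt v u) = card (inc v) / (2 * card E)"
proof -
  have "(\<Sum>u\<in>V. wt v u) = (\<Sum>u\<in>V. of_bool ({v, u} \<in> E)) / (2 * card E)" by (simp add: wt_def sum_divide_distrib)
  also have "(\<Sum>u\<in>V. of_bool ({v, u} \<in> E)) = real (card {u \<in> V. {v, u} \<in> E})" using fin_V by (simp add: Int_def)
  finally show ?thesis by (simp only: card_nbrs)
qed

lemma sum_inc: "U \<subseteq> V \<Longrightarrow> (\<Sum>v\<in>U. card (inc v)) = (\<Sum>e\<in>E. card (e \<inter> U))"
proof -
  assume U: "U \<subseteq> V"
  have fU: "finite U" using U fin_V finite_subset by blast
  have "(\<Sum>v\<in>U. card (inc v)) = (\<Sum>v\<in>U. \<Sum>e\<in>E. of_bool (v \<in> e))" using fin_E by (simp add: inc_def Int_def)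
  also have "\<dots> = (\<Sum>e\<in>E. \<Sum>v\<in>U. of_bool (v \<in> e))" by (rule sum.swap)
  also have "\<dots> = (\<Sum>e\<in>E. card (e \<inter> U))" using fU by (simp add: Int_def conj_commute)
  finally show ?thesis .
qed

lemma handshake: "(\<Sum>v\<in>V. card (inc v)) = 2 * card E"
proof -
  have "(\<Sum>e\<in>E. card (e \<inter> V)) = (\<Sum>e\<in>E. 2)" using edge by (intro sum.cong refl) (simp add: Int_absorb2)
  then show ?thesis using sum_inc[of V] by simp
qed

sublocale network V wt
proof
  show "finite V" by (rule fin_V)
  show "wt u v = wt v u" for u v by (simp add: wt_def insert_commute)
  show "0 \<le> wt u v" for u v by (simp add: wt_def)
  have "(\<Sum>v\<in>V. \<Sum>u\<in>V. wt v u) = real (\<Sum>v\<in>V. card (inc v)) / (2 * card E)" by (simp add: sum_wt sum_divide_distrib)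
  then show "(\<Sum>v\<in>V. \<Sum>u\<in>V. wt v u) = 1" unfolding handshake using card_E_pos by simp
  show "0 < (\<Sum>u\<in>V. wt v u)" if "v \<in> V" for v
    using inc_ne[OF that] fin_inc[of v] card_E_pos by (simp add: sum_wt card_gt_0_iff)
qed

lemma sta_eq: "sta v = card (inc v) / (2 * card E)"
  by (simp add: sta_def sum_wt)

text \<open>A random edge at \<open>v\<close>, then a random end of it: the walker stays with
  probability \<open>1 / 2\<close>, in agreement with \<open>lazy\<close>. Likewise
  \<open>start\<close>, a random end of a random edge, is proportional to the degree.\<close>

definition step :: "'a \<Rightarrow> 'a pmf" where "step v = bind_pmf (pmf_of_set (inc v)) pmf_of_set"
definition start :: "'a pmf" where "start = bind_pmf (pmf_of_set E) pmf_of_set"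

lemma pmf_edge: "e \<in> E \<Longrightarrow> pmf (pmf_of_set e) x = of_bool (x \<in> e) / 2"
  using fin_edge[of e] edge[of e] by (simp add: indicator_def)

lemma pmf_start: "pmf start v = sta v"
proof -
  have "pmf start v = (\<Sum>e\<in>E. of_bool (v \<in> e) / 2) / card E"
    unfolding start_def pmf_bind_pmf_of_set[OF ne_E fin_E] by (simp add: pmf_edge)
  also have "(\<Sum>e\<in>E. of_bool (v \<in> e) / 2) = real (card (inc v)) / 2"
    using fin_E by (simp add: inc_def Int_def flip: sum_divide_distrib)
  finally show ?thesis by (simp add: sta_eq)
qed

lemma pmf_step:
  assumes v: "v \<in> V"
  shows "pmf (step v) u = (of_bool (u = v) + wt v u / sta v) / 2"
proof -
  have c: "0 < card (inc v)" using inc_ne[OF v] fin_inc by (simp add: card_gt_0_iff)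
  have "pmf (step v) u = (\<Sum>e\<in>inc v. of_bool (u \<in> e) / 2) / card (inc v)"
    unfolding step_def pmf_bind_pmf_of_set[OF inc_ne[OF v] fin_inc] by (simp add: pmf_edge inc_def)
  also have "(\<Sum>e\<in>inc v. of_bool (u \<in> e) / 2) = real (card {e \<in> inc v. u \<in> e}) / 2"
    using fin_inc by (simp add: Int_def flip: sum_divide_distrib)
  also have "card {e \<in> inc v. u \<in> e} = (if u = v then card (inc v) else of_bool ({v, u} \<in> E))"
  proof (cases "u = v")
    case True
    then have "{e \<in> inc v. u \<in> e} = inc v" by (auto simp: inc_def)
    then show ?thesis using True by simp
  next
    case False
    have "{e \<in> inc v. u \<in> e} = (if {v, u} \<in> E then {{v, u}} else {})"
    proof -
      have 1: "e = {v, u}" if "e \<in> E" "v \<in> e" "u \<in> e" for e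
      proof (rule card_2_doubleton)
        show "card e = 2" using edge[OF that(1)] by simp
      qed (use that False in auto)
      have 2: "{e \<in> inc v. u \<in> e} = {e \<in> E. v \<in> e \<and> u \<in> e}" by (auto simp: inc_def)
      show ?thesis
      proof (cases "{v, u} \<in> E")
        case True
        have "{e \<in> E. v \<in> e \<and> u \<in> e} = {{v, u}}"
        proof (intro equalityI subsetI)
          fix e assume "e \<in> {e \<in> E. v \<in> e \<and> u \<in> e}"
          then have "e \<in> E" "v \<in> e" "u \<in> e" by simp_all
          then have "e = {v, u}" by (rule 1)
          then show "e \<in> {{v, u}}" by (rule iffD2[OF singleton_iff])
        qed (use True in auto)
        then show ?thesis using 2 True by simp
      next
        case False
        have "\<not> (e \<in> E \<and> v \<in> e \<and> u \<in> e)" for e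
        proof
          assume e: "e \<in> E \<and> v \<in> e \<and> u \<in> e"
          then have "e = {v, u}" by (elim conjE) (rule 1)
          then show False using e False by (elim conjE) (rule notE, assumption, erule subst)
        qed
        then have "{e \<in> E. v \<in> e \<and> u \<in> e} = {}" by simp
        then show ?thesis using 2 False by simp
      qed
    qed
    then show ?thesis using False by simp
  qed
  also have "wt v v = 0" using edge[of "{v, v}"] by (auto simp: wt_def)
  then have "real (if u = v then card (inc v) else of_bool ({v, u} \<in> E)) / 2 / real (card (inc v)) = (of_bool (u = v) + wt v u / sta v) / 2"
    using c card_E_pos by (auto simp: sta_eq wt_def)
  finally show ?thesis .
qed

lemma set_start: "set_pmf start = V"
proof -
  have "set_pmf start = (\<Union>e\<in>E. set_pmf (pmf_of_set e))" by (simp add: start_def set_bind_pmf ne_E fin_E)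
  also have "\<dots> = (\<Union>e\<in>E. e)" using fin_edge by (intro SUP_cong refl set_pmf_of_set) auto
  also have "\<dots> = V" using edge cover by blast
  finally show ?thesis .
qed

lemma set_step: "v \<in> V \<Longrightarrow> u \<in> set_pmf (step v) \<longleftrightarrow> (\<exists>e\<in>E. v \<in> e \<and> u \<in> e)"
proof -
  assume v: "v \<in> V"
  have "set_pmf (step v) = (\<Union>e\<in>inc v. set_pmf (pmf_of_set e))" by (simp add: step_def set_bind_pmf inc_ne[OF v] fin_inc)
  also have "\<dots> = (\<Union>e\<in>inc v. e)" using fin_edge by (intro SUP_cong refl set_pmf_of_set) (auto simp: inc_def)
  finally show ?thesis by (auto simp: inc_def)
qed

lemma step_cases: "v \<in> V \<Longrightarrow> u \<in> set_pmf (step v) \<Longrightarrow> u \<in> V \<and> (u = v \<or> {v, u} \<in> E)"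
proof -
  assume "v \<in> V" "u \<in> set_pmf (step v)"
  then obtain e where e: "e \<in> E" "v \<in> e" "u \<in> e" using set_step by blast
  moreover have "u \<noteq> v \<Longrightarrow> e = {v, u}" using card_2_doubleton[of e v u] edge[OF e(1)] e by blast
  ultimately show ?thesis using edge[OF e(1)] by blast
qed

lemma start_stationary: "bind_pmf start step = start"
proof (rule pmf_eqI)
  fix u
  show "pmf (bind_pmf start step) u = pmf start u"
  proof (cases "u \<in> V")
    case True
    have "pmf (bind_pmf start step) u = (\<Sum>v\<in>V. pmf (step v) u * sta v)"
      unfolding pmf_bind using fin_V set_start by (subst integral_measure_pmf_real[of V]) (auto simp: pmf_start)
    also have "\<dots> = (\<Sum>v\<in>V. (of_bool (u = v) * sta v + wt u v) / 2)"
    proof (intro sum.cong refl)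
      fix v assume "v \<in> V"
      then show "pmf (step v) u * sta v = (of_bool (u = v) * sta v + wt u v) / 2"
        using sta_pos[of v] w_sym[of u v] by (simp add: pmf_step field_simps)
    qed
    also have "\<dots> = ((\<Sum>v\<in>V. of_bool (u = v) * sta v) + (\<Sum>v\<in>V. wt u v)) / 2"
      by (simp only: sum_divide_distrib[symmetric] sum.distrib)
    also have "\<dots> = ((\<Sum>v\<in>V. if v = u then sta u else 0) + sta u) / 2"
      unfolding sta_def[of u, symmetric] by (intro arg_cong2[where f="(/)"] arg_cong2[where f="(+)"] refl sum.cong) auto
    also have "\<dots> = sta u" using True fin_V by simp
    finally show ?thesis by (simp add: pmf_start)
  next
    case False
    then have "u \<notin> set_pmf start" "u \<notin> set_pmf (bind_pmf start step)" using set_start step_cases by (auto simp: set_bind_pmf)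
    then show ?thesis by (metis pmf_eq_0_set_pmf)
  qed
qed

primrec walk :: "nat \<Rightarrow> 'a \<Rightarrow> 'a list pmf" where
  "walk 0 v = return_pmf [v]"
| "walk (Suc T) v = bind_pmf (step v) (\<lambda>u. map_pmf ((#) v) (walk T u))"

lemma walk_support:
  "v \<in> V \<Longrightarrow> xs \<in> set_pmf (walk T v) \<Longrightarrow> length xs = Suc T \<and> hd xs = v \<and> set xs \<subseteq> V \<and>
     (\<forall>s<T. xs ! s = xs ! Suc s \<or> {xs ! s, xs ! Suc s} \<in> E)"
proof (induction T arbitrary: v xs)
  case (Suc T)
  then obtain u ys where u: "u \<in> set_pmf (step v)" "ys \<in> set_pmf (walk T u)" "xs = v # ys" by (auto simp: set_bind_pmf)
  have uV: "u \<in> V" "u = v \<or> {v, u} \<in> E" using step_cases[OF Suc.prems(1) u(1)] by auto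
  note IH = Suc.IH[OF uV(1) u(2)]
  have "ys \<noteq> []" using IH by auto
  then have "ys ! 0 = u" using IH by (simp add: hd_conv_nth)
  then have "xs ! s = xs ! Suc s \<or> {xs ! s, xs ! Suc s} \<in> E" if "s < Suc T" for s
    using that uV(2) IH u(3) by (cases s) auto
  then show ?case using IH u(3) Suc.prems(1) by auto
qed simp

lemma finite_walk_support: "v \<in> V \<Longrightarrow> finite (set_pmf (walk T v))"
  by (rule finite_subset[OF _ finite_lists_length_eq[OF fin_V, of "Suc T"]]) (use walk_support in blast)

text \<open>Links the walk with the operator \<open>lazy\<close>, so that the lower bound for
  transitions becomes one for reaching a prescribed end.\<close>

lemma walk_last: "v \<in> V \<Longrightarrow> pmf (map_pmf last (walk T v)) b = (lazy ^^ T) (\<lambda>x. of_bool (x = b)) v"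
proof (induction T arbitrary: v)
  case 0
  then show ?case by (simp add: indicator_def)
next
  case (Suc T)
  have "map_pmf last (walk (Suc T) v) = bind_pmf (step v) (\<lambda>u. map_pmf last (walk T u))"
    unfolding walk.simps map_bind_pmf
  proof (intro bind_pmf_cong refl)
    fix u assume "u \<in> set_pmf (step v)"
    then have "u \<in> V" using step_cases[OF Suc.prems] by blast
    then have "xs \<noteq> []" if "xs \<in> set_pmf (walk T u)" for xs using walk_support[OF _ that] by auto
    then show "map_pmf last (map_pmf ((#) v) (walk T u)) = map_pmf last (walk T u)"
      unfolding map_pmf_comp by (intro map_pmf_cong) auto
  qed
  then have "pmf (map_pmf last (walk (Suc T) v)) b = (\<integral>u. pmf (map_pmf last (walk T u)) b \<partial>measure_pmf (step v))"
    by (simp only: pmf_bind)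
  also have "\<dots> = (\<Sum>u\<in>V. pmf (map_pmf last (walk T u)) b * pmf (step v) u)"
    using fin_V step_cases[OF Suc.prems] by (intro integral_measure_pmf_real) auto
  also have "\<dots> = (\<Sum>u\<in>V. (if u = v then (lazy ^^ T) (\<lambda>x. of_bool (x = b)) v / 2 else 0) + (wt v u * (lazy ^^ T) (\<lambda>x. of_bool (x = b)) u) / sta v / 2)"
    using Suc by (intro sum.cong refl) (auto simp: pmf_step algebra_simps add_divide_distrib)
  also have "\<dots> = lazy ((lazy ^^ T) (\<lambda>x. of_bool (x = b))) v"
    using fin_V Suc.prems by (simp add: sum.distrib lazy_def sum_divide_distrib[symmetric] add_divide_distrib)
  finally show ?case by simp
qed

definition stat_walk :: "nat \<Rightarrow> 'a list pmf" where "stat_walk T = bind_pmf start (walk T)"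

text \<open>Seen from its second vertex on, a stationary walk is again a stationary walk. Hence
  collisions of two such walks can be estimated for each pair of times separately.\<close>

lemma stat_walk_nth: "s \<le> T \<Longrightarrow> map_pmf (\<lambda>xs. xs ! s) (stat_walk T) = start"
proof (induction s arbitrary: T)
  case 0
  have "map_pmf (\<lambda>xs. xs ! 0) (walk T v) = return_pmf v" if v: "v \<in> V" for v
  proof -
    have "map_pmf (\<lambda>xs. xs ! 0) (walk T v) = map_pmf (\<lambda>xs. v) (walk T v)"
    proof (intro map_pmf_cong refl)
      fix xs assume "xs \<in> set_pmf (walk T v)"
      then have "length xs = Suc T" "hd xs = v" using walk_support[OF v] by blast+
      then show "xs ! 0 = v" by (cases xs) auto
    qed
    then show ?thesis by simp
  qed
  then have "map_pmf (\<lambda>xs. xs ! 0) (stat_walk T) = bind_pmf start return_pmf"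
    unfolding stat_walk_def map_bind_pmf using set_start by (intro bind_pmf_cong refl) auto
  then show ?case by (simp add: bind_return_pmf')
next
  case (Suc s)
  then obtain T' where T': "T = Suc T'" "s \<le> T'" by (cases T) auto
  have "map_pmf (\<lambda>xs. xs ! Suc s) (stat_walk T) = bind_pmf (bind_pmf start step) (\<lambda>u. map_pmf (\<lambda>xs. xs ! s) (walk T' u))"
    by (simp add: T' stat_walk_def map_bind_pmf map_pmf_comp bind_assoc_pmf)
  also have "\<dots> = map_pmf (\<lambda>xs. xs ! s) (stat_walk T')" by (simp add: start_stationary stat_walk_def map_bind_pmf)
  also have "\<dots> = start" by (rule Suc.IH[OF T'(2)])
  finally show ?case .
qed

lemma stat_walk_edge: "s < T \<Longrightarrow> map_pmf (\<lambda>xs. {xs ! s, xs ! Suc s}) (stat_walk T) = bind_pmf start (\<lambda>v. map_pmf (\<lambda>u. {v, u}) (step v))"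
proof (induction s arbitrary: T)
  case 0
  then obtain T' where T': "T = Suc T'" by (cases T) auto
  have "map_pmf (\<lambda>xs. {v, xs ! 0}) (walk T' u) = return_pmf {v, u}" if u: "u \<in> V" for u v
  proof -
    have "map_pmf (\<lambda>xs. {v, xs ! 0}) (walk T' u) = map_pmf (\<lambda>xs. {v, u}) (walk T' u)"
    proof (intro map_pmf_cong refl)
      fix xs assume "xs \<in> set_pmf (walk T' u)"
      then have "length xs = Suc T'" "hd xs = u" using walk_support[OF u] by blast+
      then show "{v, xs ! 0} = {v, u}" by (cases xs) auto
    qed
    then show ?thesis by simp
  qed
  then have "map_pmf (\<lambda>xs. {xs ! 0, xs ! Suc 0}) (walk T v) = map_pmf (\<lambda>u. {v, u}) (step v)" if "v \<in> V" for v
    unfolding T' walk.simps map_bind_pmf map_pmf_comp map_pmf_def[of "\<lambda>u. {v, u}"] using step_cases[OF that]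
    by (intro bind_pmf_cong refl) auto
  then show ?case unfolding stat_walk_def map_bind_pmf using set_start by (intro bind_pmf_cong refl) auto
next
  case (Suc s)
  then obtain T' where T': "T = Suc T'" "s < T'" by (cases T) auto
  have "map_pmf (\<lambda>xs. {xs ! Suc s, xs ! Suc (Suc s)}) (stat_walk T) = bind_pmf (bind_pmf start step) (\<lambda>u. map_pmf (\<lambda>xs. {xs ! s, xs ! Suc s}) (walk T' u))"
    by (simp add: T' stat_walk_def map_bind_pmf map_pmf_comp bind_assoc_pmf)
  also have "\<dots> = map_pmf (\<lambda>xs. {xs ! s, xs ! Suc s}) (stat_walk T')" by (simp add: start_stationary stat_walk_def map_bind_pmf)
  finally show ?case using Suc.IH[OF T'(2)] by simp
qed

text \<open>The factor 2 is due to laziness: with probability \<open>1 / 2\<close> the set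
  \<open>{v, u}\<close> is a singleton, and otherwise all edges are equally likely.\<close>

lemma pmf_step_edge:
  assumes e: "e \<in> E"
  shows "pmf (bind_pmf start (\<lambda>v. map_pmf (\<lambda>u. {v, u}) (step v))) e = 1 / (2 * card E)"
proof -
  obtain x y where xy: "e = {x, y}" "x \<noteq> y" using edge[OF e] unfolding card_2_iff by auto
  have V: "x \<in> V" "y \<in> V" using edge[OF e] xy by auto
  have val: "pmf (map_pmf (\<lambda>u. {v, u}) (step v)) e * sta v = (if v = x \<or> v = y then 1 / (4 * card E) else 0)" if v: "v \<in> V" for v
  proof -
    have "(\<lambda>u. {v, u}) -` {e} = (if v = x then {y} else if v = y then {x} else {})"
      using xy by (auto simp: doubleton_eq_iff)
    then have "pmf (map_pmf (\<lambda>u. {v, u}) (step v)) e = (if v = x then pmf (step v) y else if v = y then pmf (step v) x else 0)"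
      unfolding pmf_map by (auto simp: measure_pmf_single)
    moreover have "pmf (step x) y * sta x = 1 / (4 * card E)" "pmf (step y) x * sta y = 1 / (4 * card E)"
      using V xy e sta_pos[OF V(1)] sta_pos[OF V(2)] by (auto simp: pmf_step wt_def insert_commute)
    ultimately show ?thesis by auto
  qed
  have "pmf (bind_pmf start (\<lambda>v. map_pmf (\<lambda>u. {v, u}) (step v))) e = (\<Sum>v\<in>V. pmf (map_pmf (\<lambda>u. {v, u}) (step v)) e * sta v)"
    unfolding pmf_bind using fin_V set_start by (subst integral_measure_pmf_real[of V]) (auto simp: pmf_start)
  also have "\<dots> = (\<Sum>v\<in>V. if v = x \<or> v = y then 1 / (4 * card E) else 0)" by (intro sum.cong refl val)
  also have "\<dots> = (\<Sum>v\<in>{x, y}. 1 / (4 * card E))" using V fin_V by (intro sum.mono_neutral_cong_right) auto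
  also have "\<dots> = 1 / (2 * card E)" using xy by simp
  finally show ?thesis .
qed

end

text \<open>Deleting immediate repetitions turns a lazy walk into one that moves along an edge in
  every step, and each of its edges is already a step of the lazy walk.\<close>

lemma walk_edges_remdups_adj:
  "e \<in> set (walk_edges (remdups_adj xs)) \<Longrightarrow> \<exists>s. Suc s < length xs \<and> xs ! s \<noteq> xs ! Suc s \<and> e = {xs ! s, xs ! Suc s}"
proof (induction xs rule: remdups_adj.induct)
  case (3 x y xs)
  show ?case
  proof (cases "x = y")
    case True
    then have "remdups_adj (x # y # xs) = remdups_adj (x # xs)" by simp
    then obtain s where "Suc s < length (x # xs)" "(x # xs) ! s \<noteq> (x # xs) ! Suc s" "e = {(x # xs) ! s, (x # xs) ! Suc s}"
      using 3 True by auto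
    then show ?thesis using True by (intro exI[of _ "Suc s"]) simp
  next
    case False
    obtain zs where zs: "remdups_adj (y # xs) = y # zs" by (metis remdups_adj_Cons_alt)
    then have "walk_edges (remdups_adj (x # y # xs)) = {x, y} # walk_edges (remdups_adj (y # xs))" using False by simp
    then consider "e = {x, y}" | "e \<in> set (walk_edges (remdups_adj (y # xs)))" using 3(3) by auto
    then show ?thesis
    proof cases
      case 1
      then show ?thesis using False by (intro exI[of _ 0]) simp
    next
      case 2
      then obtain s where "Suc s < length (y # xs)" "(y # xs) ! s \<noteq> (y # xs) ! Suc s" "e = {(y # xs) ! s, (y # xs) ! Suc s}"
        using 3(2) False by auto
      then show ?thesis by (intro exI[of _ "Suc s"]) simp
    qed
  qed
qed auto

lemma bipartite_walk_parity:
  assumes "\<And>e. e \<in> set (walk_edges xs) \<Longrightarrow> card e = 2 \<and> card (e \<inter> A) = 1" "xs \<noteq> []"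
  shows "even (length xs) \<longleftrightarrow> (hd xs \<in> A) \<noteq> (last xs \<in> A)"
  using assms
proof (induction xs rule: walk_edges.induct)
  case (1 x y xs)
  have c: "card {x, y} = 2" "card ({x, y} \<inter> A) = 1" using 1(2)[of "{x, y}"] by auto
  then have "x \<noteq> y" by auto
  then have "(x \<in> A) \<noteq> (y \<in> A)" using c(2) by (cases "x \<in> A"; cases "y \<in> A") auto
  moreover have "even (length (y # xs)) \<longleftrightarrow> (hd (y # xs) \<in> A) \<noteq> (last (y # xs) \<in> A)" using 1 by auto
  ultimately show ?case by auto
qed auto

section \<open>Random bridges between the two sides\<close>

locale bipartite_expander = edge_graph V E + expanding_network V "edge_graph.wt E" \<kappa>
  for V :: "'a set" and E and \<kappa> +
  fixes A :: "'a set"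
  assumes bip: "e \<in> E \<Longrightarrow> card (e \<inter> A) = 1"
begin

abbreviation steps :: nat where "steps \<equiv> 2 * mixing_steps"
definition bridge :: "'a \<Rightarrow> 'a \<Rightarrow> 'a list pmf" where "bridge a b = cond_pmf (walk steps a) {xs. last xs = b}"
text \<open>The end is drawn by way of a random edge, so its law is at most twice the stationary
  distribution, whatever the sizes of the two sides.\<close>

definition endpoint :: "'a set \<Rightarrow> 'a pmf" where "endpoint S = map_pmf (\<lambda>e. SOME v. v \<in> e \<inter> S) (pmf_of_set E)"
definition bridge_law :: "'a list pmf" where "bridge_law = bind_pmf (endpoint A) (\<lambda>a. bind_pmf (endpoint (- A)) (bridge a))"

lemma endpoint:
  assumes S: "\<And>e. e \<in> E \<Longrightarrow> e \<inter> S \<noteq> {}"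
  shows "pmf (endpoint S) v \<le> 2 * sta v" and "v \<in> set_pmf (endpoint S) \<Longrightarrow> v \<in> V \<inter> S"
proof -
  let ?f = "\<lambda>e. SOME v. v \<in> e \<inter> S"
  have f: "?f e \<in> e \<inter> S" if e: "e \<in> E" for e
  proof -
    obtain x where "x \<in> e \<inter> S" using S[OF e] by blast
    then show ?thesis by (rule someI)
  qed
  have "pmf (endpoint S) v = card (E \<inter> ?f -` {v}) / card E"
    unfolding endpoint_def pmf_map by (simp add: measure_pmf_of_set[OF ne_E fin_E])
  moreover have "card (E \<inter> ?f -` {v}) \<le> card (inc v)" using f by (intro card_mono fin_inc) (auto simp: inc_def)
  ultimately show "pmf (endpoint S) v \<le> 2 * sta v" by (simp add: sta_eq divide_right_mono)
  show "v \<in> V \<inter> S" if v: "v \<in> set_pmf (endpoint S)"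
  proof -
    have "v \<in> ?f ` E" using v by (simp only: endpoint_def set_map_pmf set_pmf_of_set[OF ne_E fin_E])
    then obtain e where e: "e \<in> E" "v = ?f e" by (elim imageE)
    show ?thesis using f[OF e(1)] e(2) edge[OF e(1)] by auto
  qed
qed

lemma meets: "e \<in> E \<Longrightarrow> e \<inter> A \<noteq> {}" "e \<in> E \<Longrightarrow> e \<inter> - A \<noteq> {}"
proof -
  assume e: "e \<in> E"
  show "e \<inter> A \<noteq> {}" using bip[OF e] by auto
  show "e \<inter> - A \<noteq> {}"
  proof
    assume "e \<inter> - A = {}"
    then have "e \<inter> A = e" by auto
    then show False using bip[OF e] edge[OF e] by simp
  qed
qed

lemma prob_last:
  assumes "a \<in> V" "b \<in> V"
  shows "3 / 4 * sta b \<le> measure_pmf.prob (walk steps a) {xs. last xs = b}"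
proof -
  have "last -` {b} = {xs. last xs = b}" by auto
  then show ?thesis using walk_last[OF assms(1), of steps b] transition_lower_bound[OF assms] by (simp add: pmf_map)
qed

lemma bridge_possible:
  assumes "a \<in> V" "b \<in> V"
  shows "set_pmf (walk steps a) \<inter> {xs. last xs = b} \<noteq> {}"
proof
  assume "set_pmf (walk steps a) \<inter> {xs. last xs = b} = {}"
  then have "measure_pmf.prob (walk steps a) {xs. last xs = b} = 0" by (subst measure_pmf_zero_iff) auto
  then show False using prob_last[OF assms] sta_pos[OF assms(2)] by simp
qed

lemma set_bridge: "a \<in> V \<Longrightarrow> b \<in> V \<Longrightarrow> set_pmf (bridge a b) = set_pmf (walk steps a) \<inter> {xs. last xs = b}"
  unfolding bridge_def by (rule set_cond_pmf[OF bridge_possible])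

text \<open>Conditioning divides by the probability of ending in \<open>b\<close>, which after
  mixing is at least \<open>3 / 4 * sta b\<close>.\<close>

lemma pmf_bridge_le:
  assumes "a \<in> V" "b \<in> V"
  shows "pmf (bridge a b) xs * sta b \<le> 4 / 3 * (of_bool (last xs = b) * pmf (walk steps a) xs)"
proof -
  define p where "p = measure_pmf.prob (walk steps a) {xs. last xs = b}"
  have p: "3 / 4 * sta b \<le> p" "0 < sta b" using prob_last[OF assms] sta_pos[OF assms(2)] by (auto simp: p_def)
  then have p0: "0 < p" by linarith
  have "sta b / p \<le> 4 / 3" using p p0 by (simp add: pos_divide_le_eq)
  then have "of_bool (last xs = b) * pmf (walk steps a) xs * (sta b / p) \<le> of_bool (last xs = b) * pmf (walk steps a) xs * (4 / 3)"
    by (intro mult_left_mono) auto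
  then show ?thesis unfolding bridge_def pmf_cond[OF bridge_possible[OF assms]] p_def[symmetric] by (auto simp: mult_ac)
qed

text \<open>Each of the two ends costs a factor 2 against the stationary distribution and the
  conditioning a factor \<open>4 / 3\<close>; the product \<open>16 / 3\<close> is rounded up to 6.
  Bad events for bridges are thereby reduced to bad events for stationary walks.\<close>

lemma bridge_law_le: "pmf bridge_law xs \<le> 6 * pmf (stat_walk steps) xs"
proof -
  note eA = endpoint[OF meets(1)] and eB = endpoint[OF meets(2)]
  have in1: "pmf (bind_pmf (endpoint (- A)) (bridge a)) xs \<le> 8 / 3 * pmf (walk steps a) xs" if a: "a \<in> V" for a
  proof -
    have "pmf (bind_pmf (endpoint (- A)) (bridge a)) xs = (\<Sum>b\<in>V. pmf (bridge a b) xs * pmf (endpoint (- A)) b)"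
      unfolding pmf_bind using fin_V eB(2) by (intro integral_measure_pmf_real) auto
    also have "\<dots> \<le> (\<Sum>b\<in>V. pmf (bridge a b) xs * (2 * sta b))" by (intro sum_mono mult_left_mono eB(1)) auto
    also have "\<dots> \<le> (\<Sum>b\<in>V. if b = last xs then 8 / 3 * pmf (walk steps a) xs else 0)"
    proof (intro sum_mono)
      fix b assume "b \<in> V"
      then show "pmf (bridge a b) xs * (2 * sta b) \<le> (if b = last xs then 8 / 3 * pmf (walk steps a) xs else 0)"
        using pmf_bridge_le[OF a, of b xs] by (auto simp: mult_ac split: if_splits)
    qed
    also have "\<dots> \<le> 8 / 3 * pmf (walk steps a) xs" using fin_V by simp
    finally show ?thesis .
  qed
  have "pmf bridge_law xs = (\<Sum>a\<in>V. pmf (bind_pmf (endpoint (- A)) (bridge a)) xs * pmf (endpoint A) a)"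
    unfolding bridge_law_def pmf_bind[of "endpoint A"] using fin_V eA(2) by (intro integral_measure_pmf_real) auto
  also have "\<dots> \<le> (\<Sum>a\<in>V. (8 / 3 * pmf (walk steps a) xs) * (2 * sta a))"
    using sta_nonneg by (intro sum_mono mult_mono in1 eA(1)) auto
  also have "\<dots> \<le> (\<Sum>a\<in>V. 6 * (pmf (walk steps a) xs * sta a))"
    using sta_nonneg by (intro sum_mono) (simp add: mult_nonneg_nonneg)
  also have "\<dots> = 6 * pmf (stat_walk steps) xs"
    unfolding stat_walk_def pmf_bind sum_distrib_left[symmetric]
    using fin_V set_start by (subst integral_measure_pmf_real[of V]) (auto simp: pmf_start)
  finally show ?thesis .
qed

lemma finite_bridge_law: "finite (set_pmf bridge_law)"
proof (rule finite_subset)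
  show "set_pmf bridge_law \<subseteq> (\<Union>a\<in>V. set_pmf (walk steps a))"
    using endpoint(2)[OF meets(1)] endpoint(2)[OF meets(2)] set_bridge by (fastforce simp: bridge_law_def set_bind_pmf)
  show "finite (\<Union>a\<in>V. set_pmf (walk steps a))" using fin_V finite_walk_support by blast
qed

lemma bridge_pair_prob_le: "measure_pmf.prob (pair_pmf bridge_law bridge_law) X \<le> 36 * measure_pmf.prob (pair_pmf (stat_walk steps) (stat_walk steps)) X"
proof (rule prob_le_of_pmf_le)
  fix z :: "'a list \<times> 'a list"
  have "pmf bridge_law (fst z) * pmf bridge_law (snd z) \<le> (6 * pmf (stat_walk steps) (fst z)) * (6 * pmf (stat_walk steps) (snd z))"
    by (intro mult_mono bridge_law_le) auto
  then show "pmf (pair_pmf bridge_law bridge_law) z \<le> 36 * pmf (pair_pmf (stat_walk steps) (stat_walk steps)) z"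
    using pmf_pair[of _ _ "fst z" "snd z"] by simp
qed (use finite_bridge_law in auto)

text \<open>Two independent stationary positions agree with probability
  \<open>\<Sum>v\<in>V. (sta v)\<^sup>2\<close>, which is at most the largest value of
  \<open>sta\<close>, and no degree exceeds \<open>card V\<close>.\<close>

lemma prob_same_vertex:
  assumes "s \<le> T" "t \<le> T"
  shows "measure_pmf.prob (pair_pmf (stat_walk T) (stat_walk T)) {(x, y). x ! s = y ! t} \<le> card V / (2 * card E)"
proof -
  let ?D = "(\<lambda>v. (v, v)) ` V"
  have "measure_pmf.prob (pair_pmf (stat_walk T) (stat_walk T)) {(x, y). x ! s = y ! t} =
      measure_pmf.prob (map_pmf (\<lambda>(x, y). (x ! s, y ! t)) (pair_pmf (stat_walk T) (stat_walk T))) {(u, v). u = v}"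
    unfolding measure_map_pmf by (intro arg_cong2[where f=measure] refl) auto
  also have "\<dots> = measure_pmf.prob (pair_pmf start start) {(u, v). u = v}"
    by (simp only: map_pair stat_walk_nth[OF assms(1)] stat_walk_nth[OF assms(2)])
  also have "\<dots> = measure_pmf.prob (pair_pmf start start) ?D"
    by (subst (1 2) measure_Int_set_pmf[symmetric]) (auto simp: set_start intro!: arg_cong2[where f=measure])
  also have "\<dots> = (\<Sum>v\<in>V. (sta v)\<^sup>2)"
    using fin_V by (subst measure_measure_pmf_finite) (auto simp: sum.reindex inj_on_def pmf_pair pmf_start power2_eq_square)
  also have "\<dots> \<le> (\<Sum>v\<in>V. card V / (2 * card E) * sta v)"
  proof (intro sum_mono)
    fix v assume "v \<in> V"
    have "card (inc v) \<le> card V" unfolding card_nbrs[symmetric] using fin_V by (intro card_mono) auto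
    then have "sta v \<le> card V / (2 * card E)" by (simp add: sta_eq divide_right_mono)
    then show "(sta v)\<^sup>2 \<le> card V / (2 * card E) * sta v" unfolding power2_eq_square by (intro mult_right_mono sta_nonneg)
  qed
  also have "\<dots> = card V / (2 * card E)" by (simp only: sum_distrib_left[symmetric] sum_sta mult_1_right)
  finally show ?thesis .
qed

text \<open>There are at most \<open>\<zeta> * card E\<close> related ordered pairs of edges, and
  the walks traverse a given pair at the given times with probability
  \<open>(1 / (2 * card E))\<^sup>2\<close>.\<close>

lemma prob_related_edges:
  fixes \<zeta> :: real
  assumes "s < T" "t < T" and R: "\<And>e. e \<in> E \<Longrightarrow> card {f \<in> E. R e f} \<le> \<zeta>"
  shows "measure_pmf.prob (pair_pmf (stat_walk T) (stat_walk T))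
    {(x, y). {x ! s, x ! Suc s} \<in> E \<and> {y ! t, y ! Suc t} \<in> E \<and> R {x ! s, x ! Suc s} {y ! t, y ! Suc t}} \<le> \<zeta> / (4 * card E)"
proof -
  let ?J = "bind_pmf start (\<lambda>v. map_pmf (\<lambda>u. {v, u}) (step v))"
  let ?X = "SIGMA e:E. {f \<in> E. R e f}"
  have "measure_pmf.prob (pair_pmf (stat_walk T) (stat_walk T))
      {(x, y). {x ! s, x ! Suc s} \<in> E \<and> {y ! t, y ! Suc t} \<in> E \<and> R {x ! s, x ! Suc s} {y ! t, y ! Suc t}} =
      measure_pmf.prob (map_pmf (\<lambda>(x, y). ({x ! s, x ! Suc s}, {y ! t, y ! Suc t})) (pair_pmf (stat_walk T) (stat_walk T))) ?X"
    unfolding measure_map_pmf by (intro arg_cong2[where f=measure] refl) auto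
  also have "\<dots> = measure_pmf.prob (pair_pmf ?J ?J) ?X"
    using map_pair[of "\<lambda>x. {x ! s, x ! Suc s}" "\<lambda>y. {y ! t, y ! Suc t}" "stat_walk T" "stat_walk T"]
    by (simp only: stat_walk_edge[OF assms(1)] stat_walk_edge[OF assms(2)])
  also have "\<dots> = (\<Sum>z\<in>?X. pmf (pair_pmf ?J ?J) z)" using fin_E by (intro measure_measure_pmf_finite) auto
  also have "\<dots> = (\<Sum>z\<in>?X. 1 / (2 * card E) * (1 / (2 * card E)))"
    by (intro sum.cong refl) (auto simp only: mem_Sigma_iff mem_Collect_eq pmf_pair pmf_step_edge split: prod.splits)
  also have "\<dots> = real (card ?X) * (1 / (2 * card E) * (1 / (2 * card E)))" by simp
  also have "real (card ?X) = (\<Sum>e\<in>E. real (card {f \<in> E. R e f}))" using fin_E by simp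
  also have "\<dots> * (1 / (2 * card E) * (1 / (2 * card E))) \<le> (\<Sum>e\<in>E. \<zeta>) * (1 / (2 * card E) * (1 / (2 * card E)))"
    using R by (intro mult_right_mono sum_mono) auto
  also have "\<dots> = \<zeta> / (4 * card E)" using card_E_pos by simp
  finally show ?thesis .
qed

text \<open>All pairs of times are included, since the walks may meet at different times; steps at
  which a walk rests are excluded by membership in \<open>E\<close>.\<close>

definition bad :: "('a set \<Rightarrow> 'a set \<Rightarrow> bool) \<Rightarrow> ('a list \<times> 'a list) set" where
  "bad R = (\<Union>s\<in>{..steps}. \<Union>t\<in>{..steps}. {(x, y). x ! s = y ! t}) \<union>
     (\<Union>s\<in>{..<steps}. \<Union>t\<in>{..<steps}. {(x, y). {x ! s, x ! Suc s} \<in> E \<and> {y ! t, y ! Suc t} \<in> E \<and> R {x ! s, x ! Suc s} {y ! t, y ! Suc t}})"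

lemma prob_bad:
  fixes \<zeta> :: real
  assumes R: "\<And>e. e \<in> E \<Longrightarrow> card {f \<in> E. R e f} \<le> \<zeta>"
  shows "measure_pmf.prob (pair_pmf bridge_law bridge_law) (bad R) \<le> 36 * ((steps + 1)\<^sup>2 * (card V / (2 * card E)) + steps\<^sup>2 * (\<zeta> / (4 * card E)))"
proof -
  let ?P = "measure_pmf.prob (pair_pmf (stat_walk steps) (stat_walk steps))"
  let ?X = "\<lambda>s t. {(x, y). x ! s = y ! t} :: ('a list \<times> 'a list) set"
  let ?Y = "\<lambda>s t. {(x, y). {x ! s, x ! Suc s} \<in> E \<and> {y ! t, y ! Suc t} \<in> E \<and> R {x ! s, x ! Suc s} {y ! t, y ! Suc t}}"
  have dsum: "(\<Sum>s\<in>{..N}. \<Sum>t\<in>{..N}. c) = real ((N + 1)\<^sup>2) * c" for N :: nat and c :: real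
    by (simp add: power2_eq_square algebra_simps)
  have "?P (bad R) \<le> ?P (\<Union>s\<in>{..steps}. \<Union>t\<in>{..steps}. ?X s t) + ?P (\<Union>s\<in>{..<steps}. \<Union>t\<in>{..<steps}. ?Y s t)"
    unfolding bad_def by (intro measure_Un_le) auto
  also have "?P (\<Union>s\<in>{..steps}. \<Union>t\<in>{..steps}. ?X s t) \<le> (\<Sum>s\<in>{..steps}. \<Sum>t\<in>{..steps}. ?P (?X s t))"
    by (intro order_trans[OF measure_UNION_le] sum_mono measure_UNION_le) auto
  also have "\<dots> \<le> (\<Sum>s\<in>{..steps}. \<Sum>t\<in>{..steps}. card V / (2 * card E))" by (intro sum_mono prob_same_vertex) auto
  also have "\<dots> = (steps + 1)\<^sup>2 * (card V / (2 * card E))" by (rule dsum)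
  also have "?P (\<Union>s\<in>{..<steps}. \<Union>t\<in>{..<steps}. ?Y s t) \<le> (\<Sum>s\<in>{..<steps}. \<Sum>t\<in>{..<steps}. ?P (?Y s t))"
    by (intro order_trans[OF measure_UNION_le] sum_mono measure_UNION_le) auto
  also have "\<dots> \<le> (\<Sum>s\<in>{..<steps}. \<Sum>t\<in>{..<steps}. \<zeta> / (4 * card E))" using R by (intro sum_mono prob_related_edges) auto
  also have "\<dots> = steps\<^sup>2 * (\<zeta> / (4 * card E))" by (simp add: power2_eq_square)
  finally have "?P (bad R) \<le> (steps + 1)\<^sup>2 * (card V / (2 * card E)) + steps\<^sup>2 * (\<zeta> / (4 * card E))" by simp
  then show ?thesis by (intro order_trans[OF bridge_pair_prob_le] mult_left_mono) auto
qed

text \<open>Three ends on either side, then nine bridges that are independent once the ends are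
  given: a random model of \<open>K\<^sub>3\<^sub>,\<^sub>3\<close> with walks as edges.\<close>

definition bridge_system :: "((nat \<Rightarrow> 'a) \<times> (nat \<Rightarrow> 'a) \<times> (nat \<times> nat \<Rightarrow> 'a list)) pmf" where
  "bridge_system = bind_pmf (pair_pmf (Pi_pmf {..<3} undefined (\<lambda>_. endpoint A)) (Pi_pmf {..<3} undefined (\<lambda>_. endpoint (- A))))
     (\<lambda>(a, b). map_pmf (\<lambda>w. (a, b, w)) (Pi_pmf ({..<3} \<times> {..<3}) [] (\<lambda>(i, j). bridge (a i) (b j))))"

text \<open>Walks without a common index share no random end, so they are two independent copies of
  \<open>bridge_law\<close>.\<close>

lemma bridge_system_pair:
  assumes "i < 3" "j < 3" "k < 3" "l < 3" "i \<noteq> k" "j \<noteq> l"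
  shows "map_pmf (\<lambda>(a, b, w). (w (i, j), w (k, l))) bridge_system = pair_pmf bridge_law bridge_law"
proof -
  let ?q = "endpoint A" and ?r = "endpoint (- A)"
  let ?PA = "Pi_pmf {..<3::nat} undefined (\<lambda>_. ?q)" and ?PB = "Pi_pmf {..<3::nat} undefined (\<lambda>_. ?r)"
  have "map_pmf (\<lambda>(a, b, w). (w (i, j), w (k, l))) bridge_system =
     bind_pmf (pair_pmf ?PA ?PB) (\<lambda>(a, b). map_pmf (\<lambda>w. (w (i, j), w (k, l))) (Pi_pmf ({..<3} \<times> {..<3}) [] (\<lambda>(i, j). bridge (a i) (b j))))"
    unfolding bridge_system_def map_bind_pmf by (intro bind_pmf_cong refl) (auto simp: map_pmf_comp)
  also have "\<dots> = bind_pmf (pair_pmf ?PA ?PB) (\<lambda>(a, b). pair_pmf (bridge (a i) (b j)) (bridge (a k) (b l)))"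
    using assms by (intro bind_pmf_cong refl) (auto simp: Pi_pmf_two_components)
  also have "\<dots> = bind_pmf (map_pmf (\<lambda>(a, b). ((a i, a k), (b j, b l))) (pair_pmf ?PA ?PB))
      (\<lambda>((x, x'), (y, y')). pair_pmf (bridge x y) (bridge x' y'))"
    unfolding bind_map_pmf by (intro bind_pmf_cong refl) auto
  also have "map_pmf (\<lambda>(a, b). ((a i, a k), (b j, b l))) (pair_pmf ?PA ?PB) = pair_pmf (pair_pmf ?q ?q) (pair_pmf ?r ?r)"
    using map_pair[of "\<lambda>a. (a i, a k)" "\<lambda>b. (b j, b l)" ?PA ?PB] assms by (simp add: Pi_pmf_two_components)
  also have "bind_pmf (pair_pmf (pair_pmf ?q ?q) (pair_pmf ?r ?r)) (\<lambda>((x, x'), (y, y')). pair_pmf (bridge x y) (bridge x' y')) = pair_pmf bridge_law bridge_law"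
    unfolding bridge_law_def by (rule pair_pmf_bind_product)
  finally show ?thesis .
qed

text \<open>A union bound: at most 36 ordered pairs of nonadjacent walks, each with the factor 36
  for passing to two stationary walks, give 1296. Once the rests are deleted, a walk from
  \<open>A\<close> to its complement alternates between the sides, so its number of vertices is
  even.\<close>

theorem walk_system_exists:
  fixes \<zeta> :: real
  assumes R: "\<And>e. e \<in> E \<Longrightarrow> card {f \<in> E. R e f} \<le> \<zeta>" and \<zeta>: "0 \<le> \<zeta>"
    and m: "1296 * ((steps + 1)\<^sup>2 * card V + steps\<^sup>2 * \<zeta>) \<le> card E"
  shows "\<exists>(a :: nat \<Rightarrow> 'a) (b :: nat \<Rightarrow> 'a) w. (\<forall>i<3. \<forall>j<3. w i j \<noteq> [] \<and> hd (w i j) = a i \<and> last (w i j) = b j \<and> even (length (w i j)) \<and> set (walk_edges (w i j)) \<subseteq> E)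
    \<and> (\<forall>i<3. \<forall>j<3. \<forall>k<3. \<forall>l<3. i \<noteq> k \<longrightarrow> j \<noteq> l \<longrightarrow> set (w i j) \<inter> set (w k l) = {} \<and>
        (\<forall>e\<in>set (walk_edges (w i j)). \<forall>f\<in>set (walk_edges (w k l)). \<not> R e f))"
proof -
  define Q where "Q = {(i, j, k, l). i < (3::nat) \<and> j < (3::nat) \<and> k < (3::nat) \<and> l < (3::nat) \<and> i \<noteq> k \<and> j \<noteq> l}"
  have Qeq: "Q = (\<lambda>((i, k), (j, l)). (i, j, k, l)) ` ({(i, k). i < 3 \<and> k < 3 \<and> i \<noteq> k} \<times> {(j, l). j < 3 \<and> l < 3 \<and> j \<noteq> l})"
    unfolding Q_def by force
  have six: "{(i, k). i < (3::nat) \<and> k < (3::nat) \<and> i \<noteq> k} = {(0,1),(0,2),(1,0),(1,2),(2,0),(2,1)}"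
    by (auto simp: numeral_3_eq_3 less_Suc_eq)
  have cardQ: "finite Q" "card Q \<le> 36"
    unfolding Qeq by (simp add: six, rule order_trans[OF card_image_le], simp add: six, simp only: card_cartesian_product six, simp)
  let ?B = "\<lambda>(i, j, k, l). {(a :: nat \<Rightarrow> 'a, b :: nat \<Rightarrow> 'a, w). (w (i, j), w (k, l)) \<in> bad R}"
  let ?\<Omega> = "bridge_system"
  define \<beta> where "\<beta> = 36 * ((steps + 1)\<^sup>2 * (card V / (2 * card E)) + steps\<^sup>2 * (\<zeta> / (4 * card E)))"
  have pB: "measure_pmf.prob ?\<Omega> (?B q) \<le> \<beta>" if q: "q \<in> Q" for q
  proof -
    obtain i j k l where q4: "q = (i, j, k, l)" by (metis prod_cases4)
    have "measure_pmf.prob ?\<Omega> (?B q) = measure_pmf.prob (map_pmf (\<lambda>(a, b, w). (w (i, j), w (k, l))) ?\<Omega>) (bad R)"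
      unfolding measure_map_pmf q4 by (intro arg_cong2[where f=measure] refl) auto
    also have "\<dots> = measure_pmf.prob (pair_pmf bridge_law bridge_law) (bad R)"
      using q unfolding q4 Q_def by (subst bridge_system_pair) auto
    also have "\<dots> \<le> \<beta>" unfolding \<beta>_def by (rule prob_bad[OF R])
    finally show ?thesis .
  qed
  have "measure_pmf.prob ?\<Omega> (\<Union>q\<in>Q. ?B q) \<le> (\<Sum>q\<in>Q. measure_pmf.prob ?\<Omega> (?B q))" using cardQ(1) by (intro measure_UNION_le) auto
  also have "\<dots> \<le> (\<Sum>q\<in>Q. \<beta>)" by (intro sum_mono pB)
  also have "\<dots> = card Q * \<beta>" by simp
  also have "\<dots> \<le> 36 * \<beta>" using cardQ(2) \<zeta> by (intro mult_right_mono) (auto simp: \<beta>_def)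
  also have "\<dots> < 1"
  proof -
    define M x y where "M = real (card E)" and "x = real ((steps + 1)\<^sup>2) * card V" and "y = real (steps\<^sup>2) * \<zeta>"
    have M0: "M > 0" using card_E_pos by (simp add: M_def)
    have xy: "0 \<le> x" "0 \<le> y" using \<zeta> by (auto simp: x_def y_def)
    have "1296 * (x + y) \<le> M" using m by (simp add: M_def x_def y_def)
    then have "1296 * (x / 2 + y / 4) < M" using xy M0 by (simp add: field_simps)
    moreover have "36 * \<beta> = 1296 * (x / 2 + y / 4) / M" using M0 by (simp add: \<beta>_def M_def x_def y_def field_simps)
    ultimately show ?thesis using M0 by simp
  qed
  finally have "measure_pmf.prob ?\<Omega> (\<Union>q\<in>Q. ?B q) < 1" .
  then obtain z where z: "z \<in> set_pmf ?\<Omega>" "z \<notin> (\<Union>q\<in>Q. ?B q)" by (rule prob_less_1_witness)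
  obtain a b w where zabw: "z = (a, b, w)" by (rule prod_cases3)
  note abw = z[unfolded zabw]
  have ab: "a i \<in> V \<inter> A" "b i \<in> V \<inter> - A" if "i < 3" for i
    using abw(1) that endpoint(2)[OF meets(1)] endpoint(2)[OF meets(2)]
    by (auto simp: bridge_system_def set_bind_pmf set_Pi_pmf PiE_dflt_def)
  have w: "w (i, j) \<in> set_pmf (walk steps (a i)) \<and> last (w (i, j)) = b j" if ij: "i < 3" "j < 3" for i j
  proof -
    have "w (i, j) \<in> set_pmf (bridge (a i) (b j))" using abw(1) ij
      by (auto simp: bridge_system_def set_bind_pmf set_Pi_pmf PiE_dflt_def)
    then show ?thesis using set_bridge[of "a i" "b j"] ab[OF ij(1)] ab[OF ij(2)] by auto
  qed
  have ws: "length (w (i, j)) = Suc steps \<and> hd (w (i, j)) = a i \<and> set (w (i, j)) \<subseteq> V \<and>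
     (\<forall>s<steps. w (i, j) ! s = w (i, j) ! Suc s \<or> {w (i, j) ! s, w (i, j) ! Suc s} \<in> E)" if ij: "i < 3" "j < 3" for i j
    using walk_support[of "a i" "w (i, j)" steps] w[OF ij] ab[OF ij(1)] by blast
  have edges: "\<exists>s<steps. e = {w (i, j) ! s, w (i, j) ! Suc s} \<and> e \<in> E" if ij: "i < 3" "j < 3" and e: "e \<in> set (walk_edges (remdups_adj (w (i, j))))" for i j e
  proof -
    obtain s where "Suc s < length (w (i, j))" "w (i, j) ! s \<noteq> w (i, j) ! Suc s" "e = {w (i, j) ! s, w (i, j) ! Suc s}"
      using walk_edges_remdups_adj[OF e] by blast
    then show ?thesis using ws[OF ij] by (intro exI[of _ s]) auto
  qed
  have nb: "(w (i, j), w (k, l)) \<notin> bad R" if "i < 3" "j < 3" "k < 3" "l < 3" "i \<noteq> k" "j \<noteq> l" for i j k l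
    using abw(2) that unfolding Q_def by fastforce
  define W where "W i j = remdups_adj (w (i, j))" for i j
  have "W i j \<noteq> [] \<and> hd (W i j) = a i \<and> last (W i j) = b j \<and> even (length (W i j)) \<and> set (walk_edges (W i j)) \<subseteq> E" if ij: "i < 3" "j < 3" for i j
  proof -
    have ne: "w (i, j) \<noteq> []" using ws[OF ij] by auto
    then have 1: "W i j \<noteq> []" "hd (W i j) = a i" "last (W i j) = b j" using ws[OF ij] w[OF ij] by (auto simp: W_def)
    have 2: "set (walk_edges (W i j)) \<subseteq> E" using edges[OF ij] unfolding W_def by blast
    have "card e = 2 \<and> card (e \<inter> A) = 1" if "e \<in> set (walk_edges (W i j))" for e using 2 that edge bip by blast
    then have "even (length (W i j)) \<longleftrightarrow> (hd (W i j) \<in> A) \<noteq> (last (W i j) \<in> A)" using 1(1) by (rule bipartite_walk_parity)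
    then show ?thesis using 1 2 ab[OF ij(1)] ab[OF ij(2)] by auto
  qed
  moreover have "set (W i j) \<inter> set (W k l) = {} \<and> (\<forall>e\<in>set (walk_edges (W i j)). \<forall>f\<in>set (walk_edges (W k l)). \<not> R e f)"
    if q: "i < 3" "j < 3" "k < 3" "l < 3" "i \<noteq> k" "j \<noteq> l" for i j k l
  proof (intro conjI ballI notI)
    show "set (W i j) \<inter> set (W k l) = {}"
    proof (rule ccontr)
      assume "set (W i j) \<inter> set (W k l) \<noteq> {}"
      then obtain v where "v \<in> set (w (i, j))" "v \<in> set (w (k, l))" by (auto simp: W_def)
      then obtain s t where "s < Suc steps" "t < Suc steps" "w (i, j) ! s = w (k, l) ! t"
        using ws[OF q(1,2)] ws[OF q(3,4)] by (metis in_set_conv_nth)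
      then have "(w (i, j), w (k, l)) \<in> bad R" unfolding bad_def by auto
      then show False using nb[OF q] by blast
    qed
    fix e f assume ef: "e \<in> set (walk_edges (W i j))" "f \<in> set (walk_edges (W k l))" "R e f"
    obtain s t where "s < steps" "e = {w (i, j) ! s, w (i, j) ! Suc s}" "e \<in> E" "t < steps" "f = {w (k, l) ! t, w (k, l) ! Suc t}" "f \<in> E"
      using edges[OF q(1,2), of e] edges[OF q(3,4), of f] ef unfolding W_def by blast
    then have "(w (i, j), w (k, l)) \<in> bad R" unfolding bad_def using ef(3) by blast
    then show False using nb[OF q] by blast
  qed
  ultimately show ?thesis by blast
qed

end

section \<open>Dense cores\<close>

text \<open>A new vertex \<open>x\<close> goes to the side that separates more of its edges; each
  edge at \<open>x\<close> is separated by one of the two choices.\<close>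

lemma bipartite_half:
  assumes "finite V" "finite E" "\<And>e. e \<in> E \<Longrightarrow> e \<subseteq> V \<and> card e = 2"
  shows "\<exists>A. card E \<le> 2 * card {e \<in> E. card (e \<inter> A) = 1}"
  using assms
proof (induction V arbitrary: E rule: finite_induct)
  case empty
  then have "E = {}" by fastforce
  then show ?case by simp
next
  case (insert x V)
  define E' where "E' = {e \<in> E. x \<notin> e}"
  define X where "X = {e \<in> E. x \<in> e}"
  have fin: "finite E'" "finite X" using insert.prems(1) by (auto simp: E'_def X_def)
  have "\<exists>A. card E' \<le> 2 * card {e \<in> E'. card (e \<inter> A) = 1}"
    using insert.prems fin by (intro insert.IH) (auto simp: E'_def)
  then obtain A where A: "card E' \<le> 2 * card {e \<in> E'. card (e \<inter> A) = 1}" by blast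
  define good where "good B = {e \<in> X. card (e \<inter> B) = 1}" for B
  have split: "card {e \<in> E. card (e \<inter> B) = 1} = card {e \<in> E'. card (e \<inter> A) = 1} + card (good B)"
    if B: "B - {x} = A - {x}" for B
  proof -
    have same: "e \<inter> B = e \<inter> A" if "e \<in> E'" for e using that B by (auto simp: E'_def)
    have "{e \<in> E. card (e \<inter> B) = 1} = {e \<in> E'. card (e \<inter> B) = 1} \<union> good B" by (auto simp: E'_def X_def good_def)
    also have "{e \<in> E'. card (e \<inter> B) = 1} = {e \<in> E'. card (e \<inter> A) = 1}" by (intro Collect_cong conj_cong refl) (simp only: same)
    finally have "{e \<in> E. card (e \<inter> B) = 1} = {e \<in> E'. card (e \<inter> A) = 1} \<union> good B" .
    moreover have "{e \<in> E'. card (e \<inter> A) = 1} \<inter> good B = {}" by (auto simp: good_def X_def E'_def)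
    moreover have "finite {e \<in> E'. card (e \<inter> A) = 1}" "finite (good B)" using fin by (auto simp: good_def)
    ultimately show ?thesis by (simp only: card_Un_disjoint)
  qed
  have "X \<subseteq> good (A - {x}) \<union> good (insert x A)"
  proof
    fix e assume e: "e \<in> X"
    then have c: "card e = 2" "x \<in> e" using insert.prems(2) by (auto simp: X_def)
    then have "card (e - {x}) = 1" by simp
    then obtain u where u: "e - {x} = {u}" by (auto simp: card_1_singleton_iff)
    have ux: "u \<noteq> x" "e = {x, u}" using u c by auto
    show "e \<in> good (A - {x}) \<union> good (insert x A)"
    proof (cases "u \<in> A")
      case True
      then have "e \<inter> (A - {x}) = {u}" using ux by auto
      then show ?thesis using e by (simp add: good_def)
    next
      case False
      then have "e \<inter> insert x A = {x}" using ux by auto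
      then show ?thesis using e by (simp add: good_def)
    qed
  qed
  then have "card X \<le> card (good (A - {x}) \<union> good (insert x A))" using fin by (intro card_mono) (auto simp: good_def)
  also have "\<dots> \<le> card (good (A - {x})) + card (good (insert x A))" by (rule card_Un_le)
  finally have X2: "card X \<le> card (good (A - {x})) + card (good (insert x A))" .
  have "E = E' \<union> X" by (auto simp: E'_def X_def)
  then have EX: "card E \<le> card E' + card X" using card_Un_le by metis
  show ?case
  proof (cases "card (good (insert x A)) \<le> card (good (A - {x}))")
    case True
    then show ?thesis using split[of "A - {x}"] A X2 EX by (intro exI[of _ "A - {x}"]) simp
  next
    case False
    then show ?thesis using split[of "insert x A"] A X2 EX by (intro exI[of _ "insert x A"]) simp
  qed
qed

definition inner_edges :: "'a set set \<Rightarrow> 'a set \<Rightarrow> 'a set set" where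
  "inner_edges E U = {e \<in> E. e \<subseteq> U}"

lemma densest_core:
  fixes \<Phi> :: "nat \<Rightarrow> real"
  assumes V: "finite V" "V \<noteq> {}" and pos: "\<And>n. 1 \<le> n \<Longrightarrow> 0 < \<Phi> n"
  obtains W where "W \<subseteq> V" "W \<noteq> {}"
    "\<And>U. \<lbrakk>U \<subseteq> V; U \<noteq> {}\<rbrakk> \<Longrightarrow> card (inner_edges E U) * \<Phi> (card W) \<le> card (inner_edges E W) * \<Phi> (card U)"
proof -
  define \<S> where "\<S> = {U. U \<subseteq> V \<and> U \<noteq> {}}"
  define \<phi> where "\<phi> U = card (inner_edges E U) / \<Phi> (card U)" for U
  have fin: "finite (\<phi> ` \<S>)" and ne: "\<phi> ` \<S> \<noteq> {}" using V by (auto simp: \<S>_def)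
  have "Max (\<phi> ` \<S>) \<in> \<phi> ` \<S>" by (rule Max_in[OF fin ne])
  then obtain W where W: "W \<in> \<S>" "\<phi> W = Max (\<phi> ` \<S>)" by auto
  have p: "0 < \<Phi> (card U)" if "U \<in> \<S>" for U
  proof -
    have "finite U" "U \<noteq> {}" using that V(1) finite_subset by (auto simp: \<S>_def)
    then show ?thesis by (intro pos) (simp add: Suc_le_eq card_gt_0_iff)
  qed
  show thesis
  proof (rule that[of W])
    show "W \<subseteq> V" "W \<noteq> {}" using W by (auto simp: \<S>_def)
    fix U assume "U \<subseteq> V" "U \<noteq> {}"
    then have U: "U \<in> \<S>" by (simp add: \<S>_def)
    then have "\<phi> U \<le> \<phi> W" using Max_ge[OF fin, of "\<phi> U"] W(2) by simp
    then show "card (inner_edges E U) * \<Phi> (card W) \<le> card (inner_edges E W) * \<Phi> (card U)"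
      using p[OF U] p[OF W(1)] by (simp add: \<phi>_def field_simps)
  qed
qed

text \<open>Of the maximality of the core only the first power of the ratio of logarithms is kept.
  It makes small sets so sparse inside that they have a large boundary, with constants that do not
  involve \<open>k\<close>.\<close>

locale dense_core =
  fixes V :: "'a set" and E :: "'a set set"
  assumes fin_core: "finite V" and edge_core: "e \<in> E \<Longrightarrow> e \<subseteq> V \<and> card e = 2" and ne_core: "E \<noteq> {}"
    and dense: "\<lbrakk>U \<subseteq> V; U \<noteq> {}\<rbrakk> \<Longrightarrow> card (inner_edges E U) / card E
      \<le> card U / card V * ((1 + ln (card U)) / (1 + ln (card V)))"
begin

lemma fin_E_core: "finite E"
  by (rule finite_subset[of _ "Pow V"]) (use edge_core fin_core in auto)

lemma m_pos: "0 < card E"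
  using fin_E_core ne_core by (simp add: card_gt_0_iff)

lemma n_ge_2: "2 \<le> card V"
proof -
  obtain e where e: "e \<in> E" using ne_core by blast
  then show ?thesis using edge_core[OF e] card_mono[OF fin_core, of e] by simp
qed

definition \<Lambda> :: real where "\<Lambda> = 1 + ln (card V)"

lemma \<Lambda>_ge_1: "1 \<le> \<Lambda>"
  using n_ge_2 by (simp add: \<Lambda>_def)

lemma ratio_le_1:
  assumes "U \<subseteq> V" "U \<noteq> {}"
  shows "(1 + ln (card U)) / \<Lambda> = 1 - ln (card V / card U) / \<Lambda>" "0 \<le> ln (card V / card U)" "ln (card V / card U) \<le> \<Lambda>" "0 < card U" "card U \<le> card V"
proof -
  have f: "finite U" using assms fin_core finite_subset by blast
  show c: "0 < card U" using f assms by (simp add: card_gt_0_iff)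
  show le: "card U \<le> card V" using card_mono[OF fin_core assms(1)] .
  have l: "ln (card V / card U) = ln (card V) - ln (card U)" using c le by (simp add: ln_div)
  have "0 \<le> ln (card U)" "ln (card U) \<le> ln (card V)" using c le by auto
  then show "0 \<le> ln (card V / card U)" "ln (card V / card U) \<le> \<Lambda>" using l by (auto simp: \<Lambda>_def)
  have "1 + ln (card U) = \<Lambda> - ln (card V / card U)" using l by (simp add: \<Lambda>_def)
  then show "(1 + ln (card U)) / \<Lambda> = 1 - ln (card V / card U) / \<Lambda>" using \<Lambda>_ge_1 by (simp add: diff_divide_distrib)
qed

lemma dense': "\<lbrakk>U \<subseteq> V; U \<noteq> {}\<rbrakk> \<Longrightarrow> card (inner_edges E U) / card E \<le> card U / card V * (1 - ln (card V / card U) / \<Lambda>)"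
proof -
  assume U: "U \<subseteq> V" "U \<noteq> {}"
  show ?thesis using dense[OF U] unfolding \<Lambda>_def[symmetric] ratio_le_1(1)[OF U] .
qed

text \<open>Deleting a vertex of degree below \<open>card E / card V\<close> would raise the density
  of the core.\<close>

lemma degree_ge:
  assumes v: "v \<in> V"
  shows "card E \<le> card {e \<in> E. v \<in> e} * card V"
proof -
  let ?U = "V - {v}"
  have cU: "card ?U = card V - 1" using v by simp
  have ne: "?U \<noteq> {}"
  proof
    assume "?U = {}"
    then have "card ?U = 0" by (simp only: card.empty)
    then show False using cU n_ge_2 by linarith
  qed
  have "inner_edges E ?U = E - {e \<in> E. v \<in> e}" using edge_core by (auto simp: inner_edges_def)
  then have c: "real (card (inner_edges E ?U)) = real (card E) - real (card {e \<in> E. v \<in> e})"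
    using fin_E_core card_mono[OF fin_E_core, of "{e \<in> E. v \<in> e}"] by (simp add: card_Diff_subset of_nat_diff)
  have l: "0 \<le> ln (card V / card ?U) / \<Lambda>" using ratio_le_1(2)[of ?U] ne \<Lambda>_ge_1 by (intro divide_nonneg_nonneg) auto
  have "card (inner_edges E ?U) / card E \<le> card ?U / card V * (1 - ln (card V / card ?U) / \<Lambda>)" using ne by (intro dense') auto
  also have "\<dots> \<le> card ?U / card V * 1" using l by (intro mult_left_mono) auto
  also have "\<dots> = 1 - 1 / card V" using cU n_ge_2 by (simp add: of_nat_diff diff_divide_distrib)
  finally have 1: "card (inner_edges E ?U) / card E \<le> 1 - 1 / card V" .
  have "1 / real (card V) \<le> card {e \<in> E. v \<in> e} / card E"
  proof -
    have "real (card (inner_edges E ?U)) / card E = 1 - card {e \<in> E. v \<in> e} / card E" using c m_pos by (simp add: diff_divide_distrib)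
    then show ?thesis using 1 by linarith
  qed
  then have "real (card E) \<le> real (card {e \<in> E. v \<in> e} * card V)" using m_pos n_ge_2 by (simp add: field_simps)
  then show ?thesis using of_nat_le_iff by blast
qed

sublocale edge_graph V E
proof
  show "\<exists>e\<in>E. v \<in> e" if "v \<in> V" for v
  proof (rule ccontr)
    assume "\<not> ?thesis"
    then have "{e \<in> E. v \<in> e} = {}" by blast
    then have "card {e \<in> E. v \<in> e} = 0" by (simp only: card.empty)
    then show False using degree_ge[OF that] m_pos by simp
  qed
qed (use fin_core edge_core ne_core in auto)

lemma sta_ge: "v \<in> V \<Longrightarrow> 1 / (2 * card V) \<le> sta v"
proof -
  assume v: "v \<in> V"
  have "real (card E) \<le> real (card (inc v) * card V)" using degree_ge[OF v] unfolding inc_def of_nat_le_iff .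
  then show ?thesis using m_pos n_ge_2 by (simp add: sta_eq field_simps)
qed

lemma sum_sta_ge: "U \<subseteq> V \<Longrightarrow> card U / (2 * card V) \<le> sum sta U"
proof -
  assume U: "U \<subseteq> V"
  have "(\<Sum>v\<in>U. 1 / (2 * card V)) \<le> sum sta U" using U sta_ge by (intro sum_mono) auto
  then show ?thesis by simp
qed

lemma sum_inner:
  assumes U: "U \<subseteq> V"
  shows "(\<Sum>v\<in>U. \<Sum>u\<in>U. wt v u) = card (inner_edges E U) / card E"
proof -
  have fU: "finite U" using U fin_core finite_subset by blast
  have "(\<Sum>v\<in>U. \<Sum>u\<in>U. wt v u) = (\<Sum>v\<in>U. real (card {e \<in> inner_edges E U. v \<in> e}) / (2 * card E))"
  proof (intro sum.cong refl)
    fix v assume v: "v \<in> U"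
    have "card {u \<in> U. {v, u} \<in> E} = card {e \<in> inner_edges E U. v \<in> e}"
    proof (rule bij_betw_same_card[of "\<lambda>u. {v, u}"], rule bij_betw_imageI)
      show "inj_on (\<lambda>u. {v, u}) {u \<in> U. {v, u} \<in> E}" by (auto simp: inj_on_def doubleton_eq_iff)
      show "(\<lambda>u. {v, u}) ` {u \<in> U. {v, u} \<in> E} = {e \<in> inner_edges E U. v \<in> e}"
      proof
        show "(\<lambda>u. {v, u}) ` {u \<in> U. {v, u} \<in> E} \<subseteq> {e \<in> inner_edges E U. v \<in> e}" using v by (auto simp: inner_edges_def)
        show "{e \<in> inner_edges E U. v \<in> e} \<subseteq> (\<lambda>u. {v, u}) ` {u \<in> U. {v, u} \<in> E}"
        proof
          fix e assume "e \<in> {e \<in> inner_edges E U. v \<in> e}"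
          then have e: "e \<in> E" "e \<subseteq> U" "v \<in> e" by (auto simp: inner_edges_def)
          have "card (e - {v}) = 1" using edge_core[OF e(1)] e(3) by simp
          then obtain u where "e - {v} = {u}" by (auto simp: card_1_singleton_iff)
          then have "e = {v, u}" using e(3) by auto
          then show "e \<in> (\<lambda>u. {v, u}) ` {u \<in> U. {v, u} \<in> E}" using e by auto
        qed
      qed
    qed
    moreover have "(\<Sum>u\<in>U. wt v u) = real (card {u \<in> U. {v, u} \<in> E}) / (2 * card E)"
      using fU by (simp add: wt_def Int_def flip: sum_divide_distrib)
    ultimately show "(\<Sum>u\<in>U. wt v u) = real (card {e \<in> inner_edges E U. v \<in> e}) / (2 * card E)" by simp
  qed
  also have "\<dots> = real (\<Sum>v\<in>U. card {e \<in> inner_edges E U. v \<in> e}) / (2 * card E)" by (simp add: sum_divide_distrib)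
  also have "(\<Sum>v\<in>U. card {e \<in> inner_edges E U. v \<in> e}) = (\<Sum>v\<in>U. \<Sum>e\<in>inner_edges E U. of_bool (v \<in> e))"
    using fin_E_core by (simp add: inner_edges_def Int_def)
  also have "\<dots> = (\<Sum>e\<in>inner_edges E U. \<Sum>v\<in>U. of_bool (v \<in> e))" by (rule sum.swap)
  also have "\<dots> = (\<Sum>e\<in>inner_edges E U. 2)"
  proof (intro sum.cong refl)
    fix e assume "e \<in> inner_edges E U"
    then have "{v \<in> U. v \<in> e} = e" "card e = 2" using edge_core by (auto simp: inner_edges_def)
    then show "(\<Sum>v\<in>U. of_bool (v \<in> e)) = (2::nat)" using fU by (simp add: Int_def)
  qed
  finally show ?thesis using m_pos by simp
qed

lemma sta_split:
  assumes U: "U \<subseteq> V"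
  shows "sum sta U = card (inner_edges E U) / card E + flow_out U"
proof -
  have "sum sta U = (\<Sum>v\<in>U. (\<Sum>u\<in>U. wt v u) + (\<Sum>u\<in>V - U. wt v u))"
    unfolding sta_def using U fin_core by (intro sum.cong refl) (simp add: sum.subset_diff)
  then show ?thesis by (simp add: sum.distrib sum_inner[OF U] flow_out_def)
qed

lemma flow_out_compl: "U \<subseteq> V \<Longrightarrow> flow_out (V - U) = flow_out U"
proof -
  assume U: "U \<subseteq> V"
  have "flow_out (V - U) = (\<Sum>v\<in>V - U. \<Sum>u\<in>U. wt v u)" using U by (simp add: flow_out_def double_diff)
  also have "\<dots> = (\<Sum>u\<in>U. \<Sum>v\<in>V - U. wt v u)" by (rule sum.swap)
  also have "\<dots> = flow_out U" unfolding flow_out_def by (intro sum.cong refl w_sym)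
  finally show ?thesis .
qed

text \<open>The density bounds for \<open>U\<close> and for its complement leave at least the share
  \<open>x * l / \<Lambda>\<close> of the total mass 1 for the edges between them, and this mass is
  twice the flow. The stationary measure of \<open>U\<close> may exceed its share \<open>x\<close>
  of the vertices, but at most by the flow, and \<open>l \<le> \<Lambda>\<close> pays for this
  excess.\<close>

lemma flow_out_ge:
  assumes U: "U \<subseteq> V" "U \<noteq> {}" "U \<noteq> V"
  shows "sum sta U * ln (card V / card U) \<le> 3 * \<Lambda> * flow_out U"
proof -
  let ?W = "V - U"
  have W: "?W \<subseteq> V" "?W \<noteq> {}" using U by auto
  define x l where "x = card U / card V" and "l = ln (card V / card U)"
  define y r where "y = card ?W / card V" and "r = ln (card V / card ?W)"
  have fU: "finite U" using U fin_core finite_subset by blast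
  have "card ?W + card U = card V" using U fU card_mono[OF fin_core U(1)] by (simp add: card_Diff_subset)
  then have xy: "x + y = 1" using n_ge_2 unfolding x_def y_def by (simp flip: add_divide_distrib of_nat_add)
  have \<Lambda>0: "0 < \<Lambda>" using \<Lambda>_ge_1 by simp
  have nn: "0 \<le> x" "0 \<le> y" "0 \<le> l" "0 \<le> r" "l \<le> \<Lambda>"
    using ratio_le_1(2,3)[OF U(1,2)] ratio_le_1(2)[OF W] by (auto simp: x_def y_def l_def r_def)
  define i o' where "i = card (inner_edges E U) / card E" and "o' = flow_out U"
  define j where "j = card (inner_edges E ?W) / card E"
  have 1: "i \<le> x * (1 - l / \<Lambda>)" unfolding i_def x_def l_def by (rule dense'[OF U(1,2)])
  have 2: "j \<le> y * (1 - r / \<Lambda>)" unfolding j_def y_def r_def by (rule dense'[OF W])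
  have "sum sta V = sum sta U + sum sta ?W" using U fin_core by (simp add: sum.subset_diff add.commute)
  then have "1 = (i + o') + (j + o')"
    using sta_split[OF U(1)] sta_split[OF W(1)] flow_out_compl[OF U(1)] sum_sta by (simp add: i_def j_def o'_def)
  moreover have "y * (1 - r / \<Lambda>) \<le> y" using nn \<Lambda>0 by (simp add: mult_left_le)
  moreover have e: "x * (1 - l / \<Lambda>) = x - x * l / \<Lambda>" by (simp add: algebra_simps)
  ultimately have out: "x * l / \<Lambda> \<le> 2 * o'" using 1 2 xy by linarith
  then have 3: "x * l \<le> 2 * \<Lambda> * o'" using \<Lambda>0 by (simp add: pos_divide_le_eq mult_ac)
  have "0 \<le> x * l / \<Lambda>" using nn \<Lambda>0 by simp
  then have ix: "i \<le> x" and o0: "0 \<le> o'" using 1 e out by linarith+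
  have "sum sta U * l = i * l + o' * l" using sta_split[OF U(1)] by (simp add: i_def o'_def distrib_right)
  also have "\<dots> \<le> x * l + o' * \<Lambda>" using ix o0 nn by (intro add_mono mult_right_mono mult_left_mono) auto
  also have "\<dots> \<le> 3 * \<Lambda> * o'" using 3 by (simp add: algebra_simps)
  finally show ?thesis by (simp add: l_def o'_def)
qed

text \<open>\<open>flow_out_ge\<close> involves the vertex share of \<open>U\<close>, the claim its
  stationary measure \<open>p\<close>; the minimum degree gives
  \<open>1 / p \<le> 2 * (card V / card U)\<close>. If \<open>U\<close> has at most two thirds of
  the vertices, \<open>ln (card V / card U)\<close> is at least \<open>1 / 3\<close> and absorbs the
  constants. A larger \<open>U\<close> is handled through its complement, which has less than a
  third of the vertices but at least the measure of \<open>U\<close>.\<close>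

lemma core_expansion:
  assumes U: "U \<subseteq> V" "U \<noteq> {}" "sum sta U \<le> 1 / 2"
  shows "1 / (40 * \<Lambda>) * (1 + ln (1 / sum sta U)) * sum sta U \<le> flow_out U"
proof -
  have UV: "U \<noteq> V" using U(3) sum_sta by auto
  have \<Lambda>0: "0 < \<Lambda>" using \<Lambda>_ge_1 by simp
  define p where "p = sum sta U"
  define L where "L = ln (1 / p)"
  note r = ratio_le_1[OF U(1,2)]
  have n0: "0 < real (card V)" "0 < real (card U)" using n_ge_2 r(4) by auto
  have px: "card U / (2 * card V) \<le> p" unfolding p_def by (rule sum_sta_ge[OF U(1)])
  have "0 < card U / (2 * card V)" using n0 by simp
  then have p0: "0 < p" using px by linarith
  have "(1 + L) * p \<le> 40 * \<Lambda> * flow_out U"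
  proof (cases "3 * card U \<le> 2 * card V")
    case True
    define l where "l = ln (card V / card U)"
    have l1: "1 / 3 \<le> l"
    proof -
      have "3 / 2 \<le> card V / card U" using True n0 by (simp add: field_simps flip: of_nat_mult)
      then have "ln (3 / 2) \<le> l" unfolding l_def by (intro ln_mono) (use n0 in auto)
      moreover have "ln (2 / 3 :: real) \<le> 2 / 3 - 1" by (intro ln_le_minus_one) simp
      moreover have "ln (3 / 2 :: real) = - ln (2 / 3)" by (simp add: ln_div)
      ultimately show ?thesis by linarith
    qed
    have l2: "L - 1 \<le> l"
    proof -
      have "1 / p \<le> 2 * (card V / card U)" using px p0 n0 by (simp add: field_simps)
      then have "L \<le> ln (2 * (card V / card U))" unfolding L_def using p0 by (intro ln_mono) auto
      also have "\<dots> = ln 2 + l" unfolding l_def using n0 by (intro ln_mult_pos) auto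
      also have "ln (2::real) \<le> 1" using ln_le_minus_one[of "2::real"] by simp
      finally show ?thesis by simp
    qed
    have "1 + L \<le> 40 / 3 * l" using l1 l2 by linarith
    then have "(1 + L) * p \<le> 40 / 3 * l * p" using p0 by (intro mult_right_mono) auto
    also have "\<dots> = 40 / 3 * (p * l)" by simp
    also have "\<dots> \<le> 40 / 3 * (3 * \<Lambda> * flow_out U)"
      using flow_out_ge[OF U(1,2) UV] unfolding p_def l_def by (intro mult_left_mono) auto
    finally show ?thesis by simp
  next
    case False
    let ?W = "V - U"
    have W: "?W \<subseteq> V" "?W \<noteq> {}" "?W \<noteq> V" using U UV by auto
    have fU: "finite U" using U fin_core finite_subset by blast
    have cW: "card ?W + card U = card V" using U fU card_mono[OF fin_core U(1)] by (simp add: card_Diff_subset)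
    have W0: "0 < card ?W" using ratio_le_1(4)[OF W(1,2)] .
    have "3 * real (card ?W) \<le> card V" using cW False by linarith
    then have "3 \<le> card V / card ?W" using W0 by (simp add: field_simps)
    then have "ln 3 \<le> ln (card V / card ?W)" by (intro ln_mono) (use n0 W0 in auto)
    moreover have "1 \<le> ln (3::real)" using ln_ge_iff[of 3 1] exp_le by simp
    ultimately have l1: "1 \<le> ln (card V / card ?W)" by linarith
    have "sum sta V = p + sum sta ?W" unfolding p_def using U fin_core by (simp add: sum.subset_diff add.commute)
    then have pW: "p \<le> sum sta ?W" using sum_sta U(3) by (simp add: p_def)
    have "p \<le> sum sta ?W * ln (card V / card ?W)" using pW p0 mult_left_mono[OF l1, of "sum sta ?W"] by linarith
    also have "\<dots> \<le> 3 * \<Lambda> * flow_out U" using flow_out_ge[OF W] flow_out_compl[OF U(1)] by simp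
    finally have out: "p \<le> 3 * \<Lambda> * flow_out U" .
    have "2 * real (card V) < 3 * real (card U)" using False by linarith
    then have "1 / 3 \<le> card U / (2 * card V)" using n0 by (simp add: field_simps)
    then have "1 / p \<le> 3" using px p0 by (simp add: field_simps)
    moreover have "L \<le> 1 / p - 1" unfolding L_def using p0 by (intro ln_le_minus_one) simp
    ultimately have "1 + L \<le> 3" by linarith
    then have "(1 + L) * p \<le> 3 * p" using p0 by (intro mult_right_mono) auto
    also have "\<dots> \<le> 40 * \<Lambda> * flow_out U" using out p0 by linarith
    finally show ?thesis .
  qed
  then show ?thesis unfolding p_def L_def using \<Lambda>0 by (simp add: field_simps)
qed

lemma core_network: "expanding_network V wt (1 / (40 * \<Lambda>))"
  using core_expansion \<Lambda>_ge_1 by unfold_locales auto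

text \<open>\<open>8 / \<kappa>\<^sup>2 + 16 / \<kappa>\<^sup>2\<close> is
  \<open>38400 * \<Lambda>\<^sup>2\<close> for \<open>\<kappa> = 1 / (40 * \<Lambda>)\<close>. After
  doubling, the two ceilings and the final 1 add 5, absorbed by
  \<open>1 \<le> \<Lambda>\<^sup>2\<close>.\<close>

lemma steps_bound: "real (2 * expanding_network.mixing_steps (1 / (40 * \<Lambda>))) + 1 \<le> 76805 * \<Lambda>\<^sup>2"
proof -
  have ceil: "real (nat \<lceil>x\<rceil>) \<le> x + 1" if "0 \<le> x" for x using that by linarith
  have "real (expanding_network.mixing_steps (1 / (40 * \<Lambda>))) \<le> (8 / (1 / (40 * \<Lambda>))\<^sup>2 + 1) + (16 / (1 / (40 * \<Lambda>))\<^sup>2 + 1)"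
    unfolding expanding_network.mixing_steps_def[OF core_network] of_nat_add
    by (intro add_mono ceil) auto
  also have "\<dots> = 38400 * \<Lambda>\<^sup>2 + 2" by (simp add: power2_eq_square)
  finally have "real (expanding_network.mixing_steps (1 / (40 * \<Lambda>))) \<le> 38400 * \<Lambda>\<^sup>2 + 2" .
  moreover have "1 \<le> \<Lambda>\<^sup>2" using \<Lambda>_ge_1 by (simp add: one_le_power)
  ultimately show ?thesis by simp
qed

end

section \<open>From a dense core back to the given graph\<close>

context simple_tg
begin

text \<open>In contrast to the subgraph spanned by its edges, this one keeps the whole vertex set
  \<open>W\<close>, so that edge bounds in terms of \<open>card W\<close> apply directly.\<close>

lemma subgraph_within: "F \<subseteq> E \<Longrightarrow> W \<subseteq> V \<Longrightarrow> (\<And>e. e \<in> F \<Longrightarrow> e \<subseteq> W) \<Longrightarrow> simple_tg W F curve"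
proof
  assume F: "F \<subseteq> E" and W: "W \<subseteq> V" and FW: "\<And>e. e \<in> F \<Longrightarrow> e \<subseteq> W"
  have "img e \<inter> W = e" if "e \<in> F" for e
  proof -
    have "img e \<inter> V = e" using edgeD(5)[of e] that F by blast
    then show ?thesis using W FW[OF that] by blast
  qed
  moreover have "finite W" using W finite_V finite_subset by blast
  moreover have "\<forall>e\<in>F. e \<subseteq> W" using FW by blast
  moreover have S: "simple_topological_graph (\<Union>F) F curve" by (rule simple_tg.stg[OF subgraph[OF F]])
  have "\<forall>e\<in>F. card e = 2 \<and> arc (curve e) \<and> {pathstart (curve e), pathfinish (curve e)} = e"
    "\<forall>e\<in>F. \<forall>f\<in>F. e \<noteq> f \<longrightarrow> (\<forall>p\<in>edge_interior curve e \<inter> edge_interior curve f. proper_crossing_at (img e) (img f) p)"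
    "\<forall>e\<in>F. \<forall>f\<in>F. e \<noteq> f \<longrightarrow> (\<forall>x y. x \<in> img e \<inter> img f \<longrightarrow> y \<in> img e \<inter> img f \<longrightarrow> x = y)"
    using S by (simp_all add: simple_topological_graph_def topological_graph_def)
  ultimately show "simple_topological_graph W F curve"
    unfolding simple_topological_graph_def topological_graph_def by simp
qed

text \<open>With more edges, \<open>walk_system_exists\<close> with disjointness as the relation
  \<open>R\<close> would yield nine walks without disjoint edges in nonadjacent ones, against the
  parity obstruction. The fourth power of the logarithm is the square of the number of
  steps.\<close>

lemma dense_bipartite_core_edges:
  fixes \<zeta> :: real
  assumes core: "dense_core V E" and bip: "\<And>e. e \<in> E \<Longrightarrow> card (e \<inter> A) = 1"
    and \<zeta>: "\<And>e. e \<in> E \<Longrightarrow> card {f \<in> E. edges_disjoint curve e f} \<le> \<zeta>"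
  shows "card E \<le> 1296 * 76805\<^sup>2 * (1 + ln (card V)) ^ 4 * (card V + \<zeta>)"
proof (rule ccontr)
  assume contra: "\<not> ?thesis"
  interpret dense_core V E by (rule core)
  interpret bipartite_expander V E "1 / (40 * \<Lambda>)" A
    by (intro bipartite_expander.intro core_network bipartite_expander_axioms.intro edge_graph_axioms bip)
  obtain e where e: "e \<in> E" using ne_core by blast
  have \<zeta>0: "0 \<le> \<zeta>" using \<zeta>[OF e] by linarith
  have st: "real steps + 1 \<le> 76805 * \<Lambda>\<^sup>2" using steps_bound by simp
  have s1: "real ((steps + 1)\<^sup>2) \<le> 76805\<^sup>2 * \<Lambda> ^ 4"
  proof -
    have "(real steps + 1)\<^sup>2 \<le> (76805 * \<Lambda>\<^sup>2)\<^sup>2" using st by (intro power_mono) auto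
    also have "\<dots> = 76805\<^sup>2 * \<Lambda> ^ 4" by (simp add: power_mult_distrib flip: power_mult)
    finally show ?thesis by (simp add: add.commute)
  qed
  have "real (steps\<^sup>2) \<le> real ((steps + 1)\<^sup>2)" unfolding of_nat_le_iff by (intro power_mono) auto
  then have s2: "real (steps\<^sup>2) \<le> 76805\<^sup>2 * \<Lambda> ^ 4" using s1 by linarith
  have "1296 * (real ((steps + 1)\<^sup>2) * card V + real (steps\<^sup>2) * \<zeta>) \<le> 1296 * (76805\<^sup>2 * \<Lambda> ^ 4 * card V + 76805\<^sup>2 * \<Lambda> ^ 4 * \<zeta>)"
    using s1 s2 \<zeta>0 by (intro mult_left_mono add_mono mult_right_mono) auto
  also have "\<dots> = 1296 * 76805\<^sup>2 * \<Lambda> ^ 4 * (card V + \<zeta>)" by (simp add: algebra_simps)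
  also have "\<dots> \<le> card E" using contra unfolding \<Lambda>_def by linarith
  finally have m: "1296 * (real ((steps + 1)\<^sup>2 * card V) + real (steps\<^sup>2) * \<zeta>) \<le> card E" by (simp only: of_nat_mult)
  obtain a b w where w: "\<And>i j. \<lbrakk>i < 3; j < 3\<rbrakk> \<Longrightarrow> w i j \<noteq> [] \<and> hd (w i j) = a i \<and> last (w i j) = b j \<and> even (length (w i j)) \<and> set (walk_edges (w i j)) \<subseteq> E"
    and d: "\<And>i j k l. \<lbrakk>i < (3::nat); j < (3::nat); k < 3; l < 3; i \<noteq> k; j \<noteq> l\<rbrakk> \<Longrightarrow> set (w i j) \<inter> set (w k l) = {} \<and>
        (\<forall>e\<in>set (walk_edges (w i j)). \<forall>f\<in>set (walk_edges (w k l)). \<not> edges_disjoint curve e f)"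
  proof -
    have "\<exists>(a :: nat \<Rightarrow> complex) (b :: nat \<Rightarrow> complex) w. (\<forall>i<3. \<forall>j<3. w i j \<noteq> [] \<and> hd (w i j) = a i \<and> last (w i j) = b j \<and> even (length (w i j)) \<and> set (walk_edges (w i j)) \<subseteq> E)
      \<and> (\<forall>i<3. \<forall>j<3. \<forall>k<3. \<forall>l<3. i \<noteq> k \<longrightarrow> j \<noteq> l \<longrightarrow> set (w i j) \<inter> set (w k l) = {} \<and>
        (\<forall>e\<in>set (walk_edges (w i j)). \<forall>f\<in>set (walk_edges (w k l)). \<not> edges_disjoint curve e f))"
      by (rule walk_system_exists[OF _ \<zeta>0 m]) (rule \<zeta>)
    then show thesis
    proof (elim exE conjE, goal_cases)
      case (1 a b w)
      show thesis by (rule that[of w a b]) (use 1 in simp_all)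
    qed
  qed
  have "\<exists>i j k l e f. i < 3 \<and> j < 3 \<and> k < 3 \<and> l < 3 \<and> i \<noteq> k \<and> j \<noteq> l \<and> e \<in> set (walk_edges (w i j))
       \<and> f \<in> set (walk_edges (w k l)) \<and> edges_disjoint curve e f"
    using w d by (intro K33_walks_disjoint_pair) auto
  then show False using d by blast
qed

end

theorem few_edges_without_k1_family:
  assumes k: "2 \<le> k"
  shows "\<exists>C::real. 0 \<le> C \<and> (\<forall>V E curve. simple_topological_graph V E curve \<longrightarrow> V \<noteq> {} \<longrightarrow> \<not> has_k1_crossing_family k E curve \<longrightarrow>
    real (card E) \<le> C * card V * (1 + ln (card V)) ^ (k + 2))"
proof -
  obtain C where C: "C \<ge> 1" and clique: "\<And>V E curve. simple_tg V E curve \<Longrightarrow> simple_tg.no_clique curve k E \<Longrightarrow>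
    real (card E) \<le> C * (1 + ln (card V)) ^ (k - 2) * card V"
    using few_edges_without_crossing_clique[OF k] by blast
  define K where "K = 1296 * 76805\<^sup>2 * (1 + C)"
  have K0: "0 \<le> K" using C by (simp add: K_def)
  have "real (card E) \<le> 2 * K * card V * (1 + ln (card V)) ^ (k + 2)"
    if st: "simple_topological_graph V E curve" and neV: "V \<noteq> {}" and no: "\<not> has_k1_crossing_family k E curve" for V E curve
  proof -
    interpret G: simple_tg V E curve by unfold_locales (rule st)
    obtain A where A: "card E \<le> 2 * card {e \<in> E. card (e \<inter> A) = 1}"
      using bipartite_half[OF G.finite_V G.finite_E] G.edgeD(1,2) by blast
    define E2 where "E2 = {e \<in> E. card (e \<inter> A) = 1}"
    define lam where "lam n = 1 + ln (real n)" for n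
    \<comment> \<open>With this weight the core satisfies \<open>card F \<le> K * \<Phi> n\<close>,
      and maximality carries the same ratio over to all of \<open>E2\<close>.\<close>
    define \<Phi> where "\<Phi> n = real n * lam n ^ (k + 2)" for n
    have lam1: "1 \<le> lam n" if "1 \<le> n" for n using that by (simp add: lam_def)
    have \<Phi>0: "0 < \<Phi> n" if "1 \<le> n" for n using that lam1[OF that] by (simp add: \<Phi>_def)
    have cV: "1 \<le> card V" using neV G.finite_V by (simp add: Suc_le_eq card_gt_0_iff)
    have inV: "inner_edges E2 V = E2" using G.edgeD(1) by (auto simp: inner_edges_def E2_def)
    have "real (card E2) \<le> K * \<Phi> (card V)"
    proof (cases "E2 = {}")
      case True
      then show ?thesis using K0 \<Phi>0[OF cV] by simp
    next
      case False
      obtain W where W: "W \<subseteq> V" "W \<noteq> {}" and max: "\<And>U. \<lbrakk>U \<subseteq> V; U \<noteq> {}\<rbrakk> \<Longrightarrow>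
          card (inner_edges E2 U) * \<Phi> (card W) \<le> card (inner_edges E2 W) * \<Phi> (card U)"
        by (rule densest_core[OF G.finite_V neV, where E = E2 and \<Phi> = \<Phi>]) (erule \<Phi>0, rule that)
      define F where "F = inner_edges E2 W"
      define n where "n = card W"
      have finW: "finite W" using W(1) G.finite_V finite_subset by blast
      have n1: "1 \<le> n" using W(2) finW by (simp add: n_def Suc_le_eq card_gt_0_iff)
      have finE2: "finite E2" using G.finite_E by (simp add: E2_def)
      have VW: "card E2 * \<Phi> n \<le> card F * \<Phi> (card V)" using max[OF order_refl neV] unfolding inV F_def n_def .
      have "0 < real (card E2) * \<Phi> n" using False finE2 \<Phi>0[OF n1] by (simp add: card_gt_0_iff)
      then have "0 < real (card F) * \<Phi> (card V)" using VW by linarith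
      then have F0: "0 < card F" using \<Phi>0[OF cV] by (simp add: zero_less_mult_iff)
      have FE: "F \<subseteq> E" "\<And>e. e \<in> F \<Longrightarrow> e \<subseteq> W" by (auto simp: F_def inner_edges_def E2_def)
      interpret H: simple_tg W F curve by (rule G.subgraph_within[OF FE(1) W(1) FE(2)])
      have core: "dense_core W F"
      proof
        show "finite W" by (rule finW)
        show "e \<subseteq> W \<and> card e = 2" if "e \<in> F" for e using FE that G.edgeD(2) by blast
        show "F \<noteq> {}" using F0 by auto
        fix U assume U: "U \<subseteq> W" "U \<noteq> {}"
        have fU: "finite U" using U finW finite_subset by blast
        have c1: "1 \<le> card U" using U fU by (simp add: Suc_le_eq card_gt_0_iff)
        have cn: "card U \<le> n" unfolding n_def using card_mono[OF finW U(1)] .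
        have "inner_edges F U = inner_edges E2 U" using U by (auto simp: F_def inner_edges_def)
        moreover have "card (inner_edges E2 U) * \<Phi> n \<le> card F * \<Phi> (card U)" using max[of U] U W unfolding n_def F_def by blast
        ultimately have "card (inner_edges F U) * \<Phi> n \<le> card F * \<Phi> (card U)" by simp
        then have 1: "card (inner_edges F U) / card F \<le> \<Phi> (card U) / \<Phi> n" using F0 \<Phi>0[OF n1] by (simp add: field_simps)
        have r: "0 \<le> lam (card U) / lam n" "lam (card U) / lam n \<le> 1"
        proof -
          have "lam (card U) \<le> lam n" using c1 cn by (simp add: lam_def)
          then show "lam (card U) / lam n \<le> 1" "0 \<le> lam (card U) / lam n" using lam1[OF c1] lam1[OF n1] by auto
        qed
        have "\<Phi> (card U) / \<Phi> n = card U / n * (lam (card U) / lam n) ^ (k + 2)" by (simp add: \<Phi>_def power_divide)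
        \<comment> \<open>The ratio of logarithms is at most 1, so its power \<open>k + 2\<close> is
          below the first power that a dense core asks for.\<close>
        also have "\<dots> \<le> card U / n * (lam (card U) / lam n) ^ 1" using r by (intro mult_left_mono power_decreasing) auto
        finally show "card (inner_edges F U) / card F \<le> card U / card W * ((1 + ln (card U)) / (1 + ln (card W)))"
          using 1 by (simp add: lam_def n_def)
      qed
      \<comment> \<open>Among the edges disjoint from \<open>e\<close>, any \<open>k\<close>
        pairwise crossing ones would form a \<open>(k,1)\<close>-crossing family together with
        \<open>e\<close>.\<close>
      have \<zeta>: "card {f \<in> F. edges_disjoint curve e f} \<le> C * lam n ^ (k - 2) * n" if e: "e \<in> F" for e
      proof -
        let ?D = "{f \<in> F. edges_disjoint curve e f}"
        have "simple_tg W ?D curve" using H.subgraph_within[of ?D W] FE(2) by auto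
        moreover have "simple_tg.no_clique curve k ?D"
          unfolding G.no_clique_def
        proof (rule notI, elim exE conjE)
          fix X assume X: "X \<subseteq> ?D" "card X = k" "\<forall>e\<in>X. \<forall>f\<in>X. e \<noteq> f \<longrightarrow> edges_cross curve e f"
          have "\<forall>f\<in>X. edges_disjoint curve f e" using X(1) by (auto simp: edges_disjoint_def)
          then have "has_k1_crossing_family k E curve"
            unfolding has_k1_crossing_family_def using X FE(1) e by (intro exI[of _ X] exI[of _ e]) auto
          then show False using no by blast
        qed
        ultimately show ?thesis unfolding lam_def n_def by (rule clique)
      qed
      have "card F \<le> 1296 * 76805\<^sup>2 * (1 + ln (card W)) ^ 4 * (card W + C * lam n ^ (k - 2) * n)"
        using \<zeta> by (intro H.dense_bipartite_core_edges[OF core, of A]) (auto simp: F_def inner_edges_def E2_def)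
      also have "\<dots> = 1296 * 76805\<^sup>2 * lam n ^ 4 * (n + C * lam n ^ (k - 2) * n)" by (simp add: lam_def n_def)
      also have "\<dots> \<le> 1296 * 76805\<^sup>2 * lam n ^ 4 * (lam n ^ (k - 2) * n + C * lam n ^ (k - 2) * n)"
        using lam1[OF n1] mult_right_mono[OF one_le_power[OF lam1[OF n1], of "k - 2"], of "real n"] by (intro mult_left_mono add_right_mono) auto
      also have "\<dots> = K * (n * (lam n ^ 4 * lam n ^ (k - 2)))" by (simp add: K_def algebra_simps)
      also have "lam n ^ 4 * lam n ^ (k - 2) = lam n ^ (k + 2)" using k by (simp flip: power_add)
      finally have "card F \<le> K * \<Phi> n" by (simp add: \<Phi>_def)
      then have "card F * \<Phi> (card V) \<le> K * \<Phi> n * \<Phi> (card V)" using \<Phi>0[OF cV] by (intro mult_right_mono) auto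
      then have "card E2 * \<Phi> n \<le> (K * \<Phi> (card V)) * \<Phi> n" using VW by (simp add: mult_ac)
      then show ?thesis using \<Phi>0[OF n1] by simp
    qed
    moreover have "real (card E) \<le> 2 * real (card E2)" using A unfolding E2_def by linarith
    ultimately show ?thesis by (simp add: \<Phi>_def lam_def mult_ac)
  qed
  then show ?thesis using K0 by (intro exI[of _ "2 * K"]) auto
qed

lemma one_plus_ln_le: "2 \<le> n \<Longrightarrow> 1 + ln (real n) \<le> 3 * ln (real n)"
proof -
  assume n: "2 \<le> n"
  have "2 / 3 \<le> ln (2::real)" by (rule ln2_ge_two_thirds)
  also have "ln 2 \<le> ln (real n)" using n by simp
  finally show ?thesis by simp
qed

text \<open>Replaces \<open>1 + ln n\<close> by \<open>3 * ln n\<close>, valid from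
  \<open>n = 2\<close> on, and allows a larger exponent \<open>q\<close>: \<open>k + 2\<close> is at
  most 6 for \<open>k \<le> 4\<close> and at most \<open>2 * k + 2\<close> throughout.\<close>

lemma polylog_bound:
  assumes k: "2 \<le> k" and q: "k + 2 \<le> q"
  shows "\<exists>C::real. \<forall>V E curve. simple_topological_graph V E curve \<and> card V \<ge> 2 \<and> \<not> has_k1_crossing_family k E curve
    \<longrightarrow> real (card E) \<le> C * real (card V) * ln (real (card V)) ^ q"
proof -
  obtain C :: real where C: "C \<ge> 0" "\<And>V E curve. simple_topological_graph V E curve \<Longrightarrow> V \<noteq> {} \<Longrightarrow> \<not> has_k1_crossing_family k E curve \<Longrightarrow>
    real (card E) \<le> C * card V * (1 + ln (card V)) ^ (k + 2)"
    using few_edges_without_k1_family[OF k] by blast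
  have "real (card E) \<le> C * 3 ^ q * real (card V) * ln (real (card V)) ^ q"
    if "simple_topological_graph V E curve" "card V \<ge> 2" "\<not> has_k1_crossing_family k E curve" for V E curve
  proof -
    have "V \<noteq> {}" using that(2) by auto
    then have "real (card E) \<le> C * card V * (1 + ln (card V)) ^ (k + 2)" using C(2) that by blast
    also have "\<dots> \<le> C * card V * (1 + ln (card V)) ^ q" using that(2) q C(1) by (intro mult_left_mono power_increasing) auto
    also have "\<dots> \<le> C * card V * (3 * ln (card V)) ^ q" using that(2) C(1) one_plus_ln_le by (intro mult_left_mono power_mono) auto
    finally show ?thesis by (simp add: power_mult_distrib mult_ac)
  qed
  then show ?thesis by blast
qed

theorem theorem12:
  shows "(\<forall>k::nat. k > 4 \<longrightarrow> (\<exists>C::real. \<forall>V E curve.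
            simple_topological_graph V E curve \<and> card V \<ge> 2 \<and> \<not> has_k1_crossing_family k E curve
            \<longrightarrow> real (card E) \<le> C * real (card V) * ln (real (card V)) ^ (2 * k + 2)))
       \<and> (\<forall>k::nat. k \<in> {2, 3, 4} \<longrightarrow> (\<exists>C::real. \<forall>V E curve.
            simple_topological_graph V E curve \<and> card V \<ge> 2 \<and> \<not> has_k1_crossing_family k E curve
            \<longrightarrow> real (card E) \<le> C * real (card V) * ln (real (card V)) ^ 6))"
  by (intro conjI allI impI polylog_bound) auto

end
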